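(* Let $n\ge5$ and let $X\in\mathfrak{so}(n,\mathbb C)$ be a non-zero nilpotent element with associated partition $\mathbf d$ of $n$. Let $\eta_1<\dots<\eta_\alpha$ be the even parts and $\theta_1<\dots<\theta_\beta$ the odd parts of $\mathbf d$, with multiplicities $t_{\eta_i}$, $t_{\theta_j}$. Let $\{X,H,Y\}$ be an $\mathfrak{sl}_2(\mathbb R)$-triple in $\mathfrak{so}(n,\mathbb C)$, and let $K$ be the maximal compact subgroup of $\mathcal Z_{\mathrm{SO}(n,\mathbb C)}(X,H,Y)$ defined in the context. Then $\Lambda_{\mathcal H}(K)\subset\mathrm{SO}_n$ is given by $$\Lambda_{\mathcal H}(K)=\Big\{\mathbf D_{\mathrm{SO}(n,\mathbb C)}(g)\ \Big|\ g\in\prod_{i=1}^\alpha\mathrm{Sp}(t_{\eta_i}/2)\times S\Big(\prod_{j=1}^\beta\mathrm O(t_{\theta_j})\Big)\Big\}.$$ The nilpotent orbit $\mathcal O_X$ in $\mathfrak{so}(n,\mathbb C)$ is homotopy equivalent to $\mathrm{SO}_n/\Lambda_{\mathcal H}(K)$.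
   Context: $\langle x,y\rangle=x^ty$ on $V=\mathbb C^n$; $\mathrm{SO}(n,\mathbb C)=\{g\in\mathrm{SL}_n(\mathbb C):g^tg=\mathrm I_n\}$, with Lie algebra $\mathfrak{so}(n,\mathbb C)$; $\mathrm{SO}_n$, $\mathrm O(t)=\mathrm O_t$ are the compact real (special) orthogonal groups; $\mathrm{Sp}(m)=\{g\in\mathrm{GL}_m(\mathbb H):\bar g^tg=\mathrm I_m\}$, where $\mathbb H$ is the real quaternions with units $\mathbf i,\mathbf j,\mathbf k$ (and $\sqrt{-1}\in\mathbb C$ is identified with $\mathbf i$). $S(\prod_j\mathrm O(t_{\theta_j}))$ is the subgroup of tuples $(h_j)$ with $\prod_j\det h_j=1$. $\mathcal O_X$ is the $\mathrm{SO}(n,\mathbb C)$-adjoint orbit of $X$, and $\mathcal Z_G(X,H,Y)$ is the subgroup of $G$ fixing $X,H,Y$ under the adjoint action. An $\mathfrak{sl}_2(\mathbb R)$-triple satisfies $X\ne0$, $[H,X]=2X$, $[H,Y]=-2Y$, $[X,Y]=H$. For $d\ge1$, $M(d-1)\subset V$ is the sum of all irreducible $\mathrm{Span}_{\mathbb R}\{X,H,Y\}$-submodules of real dimension $d$, $L(d-1)=M(d-1)\cap\ker Y$ (a $\mathbb C$-subspace), $t_d=\dim_{\mathbb C}L(d-1)$. The parts of $\mathbf d$ are the $d$ with $t_d>0$, with multiplicity $t_d$; $\mathbb E_{\mathbf d}$, $\mathbb O_{\mathbf d}$ are the sets of even and odd parts. The form $(v,u)_d=\langle v,X^{d-1}u\rangle$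 on $L(d-1)$ is symmetric for $d$ odd and symplectic for $d$ even. Fix ordered bases $(v^d_1,\dots,v^d_{t_d})$ of $L(d-1)$ such that: for $\theta\in\mathbb O_{\mathbf d}$ it is orthonormal for $(\cdot,\cdot)_\theta$; for $\eta\in\mathbb E_{\mathbf d}$ it is symplectic: $(v^\eta_j,v^\eta_{t_\eta/2+j})_\eta=1$ for $1\le j\le t_\eta/2$ and $(v^\eta_i,v^\eta_j)_\eta=0$ if $|i-j|\ne t_\eta/2$. For $\theta\in\mathbb O_{\mathbf d}$, $0\le l\le\theta-1$, $1\le j\le t_\theta$, put, for $l$ even, $w^\theta_{jl}=(X^lv^\theta_j+X^{\theta-1-l}v^\theta_j)/\sqrt2$ if $l<(\theta-1)/2$; $w^\theta_{jl}=X^lv^\theta_j$ if $l=(\theta-1)/2$; $w^\theta_{jl}=\sqrt{-1}(X^{\theta-1-l}v^\theta_j-X^lv^\theta_j)/\sqrt2$ if $l>(\theta-1)/2$; and for $l$ odd, $w^\theta_{jl}=\sqrt{-1}(X^lv^\theta_j+X^{\theta-1-l}v^\theta_j)/\sqrt2$, $\sqrt{-1}X^lv^\theta_j$, $(X^{\theta-1-l}v^\theta_j-X^lv^\theta_j)/\sqrt2$ in the same three ranges. Let $\mathcal C^l(\theta)=(w^\theta_{1l},\dots,w^\theta_{t_\theta l})$ and $V^l(\theta)=\mathrm{Span}_{\mathbb C}\,\mathcal C^l(\theta)$. For $\eta\in\mathbb E_{\mathbf d}$, $0\le l\le\eta/2-1$, put $W^l(\eta)=X^lL(\eta-1)+X^{\eta-1-l}L(\eta-1)$,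 $t=t_\eta$, $\epsilon=(-1)^l$, and $w^\eta_{jl}=(X^lv^\eta_j+\epsilon X^{\eta-1-l}v^\eta_{t/2+j})/\sqrt2$ for $0<j\le t/2$; $w^\eta_{jl}=(X^lv^\eta_j-\epsilon X^{\eta-1-l}v^\eta_{j-t/2})/\sqrt2$ for $t/2<j\le t$; $w^\eta_{jl}=\sqrt{-1}(X^lv^\eta_{j-t}-\epsilon X^{\eta-1-l}v^\eta_{j-t/2})/\sqrt2$ for $t<j\le3t/2$; $w^\eta_{jl}=\sqrt{-1}(X^lv^\eta_{j-t}+\epsilon X^{\eta-1-l}v^\eta_{j-3t/2})/\sqrt2$ for $3t/2<j\le2t$. Let $\mathcal D^l(\eta)=(w^\eta_{1l},\dots,w^\eta_{2t_\eta\,l})$, an orthonormal ordered basis of $W^l(\eta)$. $K$ is the subgroup of all $g\in\mathcal Z_{\mathrm{SO}(n,\mathbb C)}(X,H,Y)$ such that: (1) $g(V^l(\theta))\subset V^l(\theta)$ for all $\theta\in\mathbb O_{\mathbf d}$, $0\le l\le\theta-1$; (2) for each $\theta\in\mathbb O_{\mathbf d}$ there is $A(\theta)\in\mathrm O_{t_\theta}$ with $[g|_{V^l(\theta)}]_{\mathcal C^l(\theta)}=A(\theta)$ for all $l$; (3) $g(W^l(\eta))\subset W^l(\eta)$ for all $\eta\in\mathbb E_{\mathbf d}$, $0\le l\le\eta/2-1$; (4) for each $\eta\in\mathbb E_{\mathbf d}$ there are real $t_\eta/2\times t_\eta/2$ matrices $A_1,A_2,B_1,B_2$ with $(A_1+\mathbf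 iA_2)+\mathbf j(B_1+\mathbf iB_2)\in\mathrm{Sp}(t_\eta/2)$ and, for all $0\le l\le\eta/2-1$, $$[g|_{W^l(\eta)}]_{\mathcal D^l(\eta)}=\begin{pmatrix} A_1 & -B_1 & -A_2 & -B_2 \\ B_1 & A_1 & -B_2 & A_2 \\ A_2 & B_2 & A_1 & -B_1 \\ B_2 & -A_2 & B_1 & A_1 \end{pmatrix}.$$ $K$ is a maximal compact subgroup of $\mathcal Z_{\mathrm{SO}(n,\mathbb C)}(X,H,Y)$. Let $\mathcal D(\eta)$ be the concatenation of $\mathcal D^0(\eta),\dots,\mathcal D^{\eta/2-1}(\eta)$, $\mathcal C(\theta)$ that of $\mathcal C^0(\theta),\dots,\mathcal C^{\theta-1}(\theta)$, and $\mathcal H$ that of $\mathcal D(\eta_1),\dots,\mathcal D(\eta_\alpha),\mathcal C(\theta_1),\dots,\mathcal C(\theta_\beta)$; $\mathcal H$ is an orthonormal ordered basis of $V$. $\Lambda_{\mathcal H}(T)$ is the matrix of $T\in\mathrm{End}_{\mathbb C}(V)$ in $\mathcal H$. Define $\wp_{m,\mathbb C}:\mathrm M_m(\mathbb C)\to\mathrm M_{2m}(\mathbb R)$, $S+\sqrt{-1}T\mapsto\begin{pmatrix} S & -T \\ T & S \end{pmatrix}$ ($S,T$ real), and $\wp_{m,\mathbb H}:\mathrm M_m(\mathbb H)\to\mathrm M_{2m}(\mathbb C)$, $P+\mathbf jQ\mapsto\begin{pmatrix} P & -\overline Q \\ Q & \overline P \end{pmatrix}$ ($P,Q$ complex). For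 a square matrix $B$, $B_\blacktriangle^s=B\oplus\cdots\oplus B$ ($s$ diagonal blocks). Then $\mathbf D_{\mathrm{SO}(n,\mathbb C)}:\prod_{i=1}^\alpha\mathrm M_{t_{\eta_i}/2}(\mathbb H)\times\prod_{k=1}^\beta\mathrm M_{t_{\theta_k}}(\mathbb R)\to\mathrm M_n(\mathbb R)$ is $$(A_{\eta_1},\dots,A_{\eta_\alpha};C_{\theta_1},\dots,C_{\theta_\beta})\mapsto\bigoplus_{i=1}^\alpha\big(\wp_{t_{\eta_i},\mathbb C}(\wp_{t_{\eta_i}/2,\mathbb H}(A_{\eta_i}))\big)_\blacktriangle^{\eta_i/2}\oplus\bigoplus_{k=1}^\beta(C_{\theta_k})_\blacktriangle^{\theta_k}.$$ *)

theory Defs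
  imports "HOL-Analysis.Analysis" "Jordan_Normal_Form.Determinant"
begin

text \<open>
  The space \<open>V\<close> is \<^typ>\<open>complex^'n\<close>, and elements of \<open>SO(n,\<complex>)\<close>, of its Lie algebra and of
  \<open>End(V)\<close> are HOL-Analysis matrices. Matrices of variable size (block matrices, coordinate
  matrices with respect to ordered bases, and in particular \<open>SO\<^sub>n\<close>) are those of
  \<^theory>\<open>Jordan_Normal_Form.Matrix\<close>.
\<close>

no_notation vec_index (infixl \<open>$\<close> 100)


section \<open>Quaternions\<close>

text \<open>\<open>Quat a b c d\<close> stands for \<open>a + b i + c j + d k\<close>.\<close>

datatype quat = Quat (qRe: real) (qIm1: real) (qIm2: real) (qIm3: real)

instantiation quat :: real_algebra_1
begin

definition "0 = Quat 0 0 0 0"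

definition "1 = Quat 1 0 0 0"

definition "p + q = Quat (qRe p + qRe q) (qIm1 p + qIm1 q) (qIm2 p + qIm2 q) (qIm3 p + qIm3 q)"

definition "- q = Quat (- qRe q) (- qIm1 q) (- qIm2 q) (- qIm3 q)"

definition "p - q = Quat (qRe p - qRe q) (qIm1 p - qIm1 q) (qIm2 p - qIm2 q) (qIm3 p - qIm3 q)"

definition "scaleR r q = Quat (r * qRe q) (r * qIm1 q) (r * qIm2 q) (r * qIm3 q)"

definition "p * q = Quat
  (qRe p * qRe q - qIm1 p * qIm1 q - qIm2 p * qIm2 q - qIm3 p * qIm3 q)
  (qRe p * qIm1 q + qIm1 p * qRe q + qIm2 p * qIm3 q - qIm3 p * qIm2 q)
  (qRe p * qIm2 q - qIm1 p * qIm3 q + qIm2 p * qRe q + qIm3 p * qIm1 q)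
  (qRe p * qIm3 q + qIm1 p * qIm2 q - qIm2 p * qIm1 q + qIm3 p * qRe q)"

instance
  by standard
    (simp_all add: zero_quat_def one_quat_def plus_quat_def uminus_quat_def minus_quat_def
      scaleR_quat_def times_quat_def algebra_simps)

end

definition qi :: quat where "qi = Quat 0 1 0 0"
definition qj :: quat where "qj = Quat 0 0 1 0"
definition qk :: quat where "qk = Quat 0 0 0 1"

lemma quat_units:
  "qi * qi = - 1" "qj * qj = - 1" "qk * qk = - 1" "qi * qj = qk" "qj * qk = qi" "qk * qi = qj"
  by (simp_all add: qi_def qj_def qk_def times_quat_def one_quat_def uminus_quat_def)

definition qcnj :: "quat \<Rightarrow> quat" where
  "qcnj q = Quat (qRe q) (- qIm1 q) (- qIm2 q) (- qIm3 q)"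

definition quat_of_complex :: "complex \<Rightarrow> quat" where
  "quat_of_complex z = of_real (Re z) + qi * of_real (Im z)"

text \<open>The complex coordinates \<open>P\<close>, \<open>Q\<close> of a quaternion \<open>P + j Q\<close>; note the sign coming from \<open>j i = - k\<close>.\<close>

definition qP :: "quat \<Rightarrow> complex" where "qP q = Complex (qRe q) (qIm1 q)"
definition qQ :: "quat \<Rightarrow> complex" where "qQ q = Complex (qIm2 q) (- qIm3 q)"

lemma quat_decomp: "q = quat_of_complex P + qj * quat_of_complex Q \<longleftrightarrow> P = qP q \<and> Q = qQ q"
  by (cases q; cases P; cases Q)
    (auto simp: quat_of_complex_def qP_def qQ_def qi_def qj_def of_real_def one_quat_def
      scaleR_quat_def times_quat_def plus_quat_def)


section \<open>Compact groups and block matrices\<close>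

definition Sp :: "nat \<Rightarrow> quat mat set" where
  "Sp m = {g \<in> carrier_mat m m. invertible_mat g \<and> transpose_mat (map_mat qcnj g) * g = 1\<^sub>m m}"

definition Orth :: "nat \<Rightarrow> real mat set" where
  "Orth t = {g \<in> carrier_mat t t. transpose_mat g * g = 1\<^sub>m t}"

text \<open>\<open>SO\<^sub>n\<close>, regarded inside the complex \<open>n \<times> n\<close> matrices.\<close>

definition SOn :: "nat \<Rightarrow> complex mat set" where
  "SOn n = map_mat complex_of_real ` {g \<in> Orth n. Determinant.det g = 1}"

definition wp_C :: "complex mat \<Rightarrow> real mat" where
  "wp_C M = four_block_mat (map_mat Re M) (- map_mat Im M) (map_mat Im M) (map_mat Re M)"

definition wp_H :: "quat mat \<Rightarrow> complex mat" where
  "wp_H M = four_block_mat (map_mat qP M) (- map_mat cnj (map_mat qQ M))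
                           (map_mat qQ M) (map_mat cnj (map_mat qP M))"


section \<open>The complex orthogonal group and its Lie algebra\<close>

definition bil :: "complex^'n \<Rightarrow> complex^'n \<Rightarrow> complex" where
  "bil x y = (\<Sum>i\<in>UNIV. x $ i * y $ i)"

definition SO_C :: "(complex^'n^'n) set" where
  "SO_C = {g. Determinants.det g = 1 \<and>
              Finite_Cartesian_Product.transpose g ** g = Finite_Cartesian_Product.mat 1}"

definition so_C :: "(complex^'n^'n) set" where
  "so_C = {A. Finite_Cartesian_Product.transpose A + A = 0}"

definition Ad :: "complex^'n^'n \<Rightarrow> complex^'n^'n \<Rightarrow> complex^'n^'n" where
  "Ad g A = g ** A ** matrix_inv g"

definition adjoint_orbit :: "complex^'n^'n \<Rightarrow> (complex^'n^'n) set" where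
  "adjoint_orbit X = (\<lambda>g. Ad g X) ` SO_C"

definition centralizer :: "complex^'n^'n \<Rightarrow> complex^'n^'n \<Rightarrow> complex^'n^'n \<Rightarrow> (complex^'n^'n) set" where
  "centralizer X H Y = {g \<in> SO_C. Ad g X = X \<and> Ad g H = H \<and> Ad g Y = Y}"

definition lie_bracket :: "complex^'n^'n \<Rightarrow> complex^'n^'n \<Rightarrow> complex^'n^'n" where
  "lie_bracket A B = A ** B - B ** A"

text \<open>The type class power on \<^typ>\<open>complex^'n^'n\<close> is componentwise, so powers are iterated
  applications.\<close>

definition mpow :: "complex^'n^'n \<Rightarrow> nat \<Rightarrow> complex^'n \<Rightarrow> complex^'n" where
  "mpow A k = ((*v) A) ^^ k"

definition nilpotent_mat :: "complex^'n^'n \<Rightarrow> bool" where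
  "nilpotent_mat A \<longleftrightarrow> (\<exists>k. \<forall>u. mpow A k u = 0)"

definition sl2_triple :: "complex^'n^'n \<Rightarrow> complex^'n^'n \<Rightarrow> complex^'n^'n \<Rightarrow> bool" where
  "sl2_triple X H Y \<longleftrightarrow> X \<noteq> 0 \<and> lie_bracket H X = 2 *\<^sub>R X \<and> lie_bracket H Y = (- 2) *\<^sub>R Y \<and>
     lie_bracket X Y = H"


section \<open>The decomposition of \<open>V\<close> and the associated partition\<close>

text \<open>\<^const>\<open>subspace\<close>, \<^const>\<open>span\<close> and \<^const>\<open>dim\<close> are real, their \<open>vec.\<close> versions complex.\<close>

definition submodule :: "complex^'n^'n \<Rightarrow> complex^'n^'n \<Rightarrow> complex^'n^'n \<Rightarrow> (complex^'n) set \<Rightarrow> bool" where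
  "submodule X H Y U \<longleftrightarrow> subspace U \<and> (\<forall>Z \<in> span {X, H, Y}. \<forall>u\<in>U. Z *v u \<in> U)"

definition irreducible_submodule ::
    "complex^'n^'n \<Rightarrow> complex^'n^'n \<Rightarrow> complex^'n^'n \<Rightarrow> (complex^'n) set \<Rightarrow> bool" where
  "irreducible_submodule X H Y U \<longleftrightarrow> submodule X H Y U \<and> U \<noteq> {0} \<and>
     (\<forall>U'\<subseteq>U. submodule X H Y U' \<longrightarrow> U' = {0} \<or> U' = U)"

definition M_space :: "complex^'n^'n \<Rightarrow> complex^'n^'n \<Rightarrow> complex^'n^'n \<Rightarrow> nat \<Rightarrow> (complex^'n) set" where
  "M_space X H Y k = span (\<Union>{U. irreducible_submodule X H Y U \<and> dim U = Suc k})"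

definition L_space :: "complex^'n^'n \<Rightarrow> complex^'n^'n \<Rightarrow> complex^'n^'n \<Rightarrow> nat \<Rightarrow> (complex^'n) set" where
  "L_space X H Y k = M_space X H Y k \<inter> {u. Y *v u = 0}"

definition mult :: "complex^'n^'n \<Rightarrow> complex^'n^'n \<Rightarrow> complex^'n^'n \<Rightarrow> nat \<Rightarrow> nat" where
  "mult X H Y d = vec.dim (L_space X H Y (d - 1))"

definition parts :: "complex^'n^'n \<Rightarrow> complex^'n^'n \<Rightarrow> complex^'n^'n \<Rightarrow> nat set" where
  "parts X H Y = {d. d \<ge> 1 \<and> mult X H Y d > 0}"

definition even_parts :: "complex^'n^'n \<Rightarrow> complex^'n^'n \<Rightarrow> complex^'n^'n \<Rightarrow> nat set" where
  "even_parts X H Y = {d \<in> parts X H Y. even d}"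

definition odd_parts :: "complex^'n^'n \<Rightarrow> complex^'n^'n \<Rightarrow> complex^'n^'n \<Rightarrow> nat set" where
  "odd_parts X H Y = {d \<in> parts X H Y. odd d}"

definition form :: "complex^'n^'n \<Rightarrow> nat \<Rightarrow> complex^'n \<Rightarrow> complex^'n \<Rightarrow> complex" where
  "form X d x y = bil x (mpow X (d - 1) y)"

text \<open>\<open>v d j\<close> is the vector \<open>v\<^sup>d\<^sub>j\<close>, meaningful for \<open>d\<close> a part and \<open>1 \<le> j \<le> t\<^sub>d\<close>.\<close>

definition adapted_bases ::
    "complex^'n^'n \<Rightarrow> complex^'n^'n \<Rightarrow> complex^'n^'n \<Rightarrow> (nat \<Rightarrow> nat \<Rightarrow> complex^'n) \<Rightarrow> bool" where
  "adapted_bases X H Y v \<longleftrightarrow>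
     (\<forall>d \<in> parts X H Y. let J = {1..mult X H Y d} in
        inj_on (v d) J \<and> vec.independent (v d ` J) \<and> vec.span (v d ` J) = L_space X H Y (d - 1)) \<and>
     (\<forall>\<theta> \<in> odd_parts X H Y. \<forall>i \<in> {1..mult X H Y \<theta>}. \<forall>j \<in> {1..mult X H Y \<theta>}.
        form X \<theta> (v \<theta> i) (v \<theta> j) = (if i = j then 1 else 0)) \<and>
     (\<forall>\<eta> \<in> even_parts X H Y.
        (\<forall>j \<in> {1..mult X H Y \<eta> div 2}. form X \<eta> (v \<eta> j) (v \<eta> (mult X H Y \<eta> div 2 + j)) = 1) \<and>
        (\<forall>i \<in> {1..mult X H Y \<eta>}. \<forall>j \<in> {1..mult X H Y \<eta>}.
           \<bar>int i - int j\<bar> \<noteq> int (mult X H Y \<eta> div 2) \<longrightarrow> form X \<eta> (v \<eta> i) (v \<eta> j) = 0))"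


section \<open>The ordered bases \<open>\<C>\<^sup>l(\<theta>)\<close>, \<open>\<D>\<^sup>l(\<eta>)\<close> and \<open>\<H>\<close>\<close>

definition w_odd ::
    "complex^'n^'n \<Rightarrow> (nat \<Rightarrow> nat \<Rightarrow> complex^'n) \<Rightarrow> nat \<Rightarrow> nat \<Rightarrow> nat \<Rightarrow> complex^'n" where
  "w_odd X v \<theta> l j =
     (let a = mpow X l (v \<theta> j); b = mpow X (\<theta> - 1 - l) (v \<theta> j) in
      if even l then
        (if l < (\<theta> - 1) div 2 then (1 / sqrt 2) *\<^sub>R (a + b)
         else if l = (\<theta> - 1) div 2 then a
         else \<i> *s ((1 / sqrt 2) *\<^sub>R (b - a)))
      else
        (if l < (\<theta> - 1) div 2 then \<i> *s ((1 / sqrt 2) *\<^sub>R (a + b))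
         else if l = (\<theta> - 1) div 2 then \<i> *s a
         else (1 / sqrt 2) *\<^sub>R (b - a)))"

definition C_basis ::
    "complex^'n^'n \<Rightarrow> complex^'n^'n \<Rightarrow> complex^'n^'n \<Rightarrow> (nat \<Rightarrow> nat \<Rightarrow> complex^'n) \<Rightarrow>
     nat \<Rightarrow> nat \<Rightarrow> (complex^'n) list" where
  "C_basis X H Y v \<theta> l = map (w_odd X v \<theta> l) [1..<Suc (mult X H Y \<theta>)]"

definition V_space ::
    "complex^'n^'n \<Rightarrow> complex^'n^'n \<Rightarrow> complex^'n^'n \<Rightarrow> (nat \<Rightarrow> nat \<Rightarrow> complex^'n) \<Rightarrow>
     nat \<Rightarrow> nat \<Rightarrow> (complex^'n) set" where
  "V_space X H Y v \<theta> l = vec.span (set (C_basis X H Y v \<theta> l))"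

definition W_space ::
    "complex^'n^'n \<Rightarrow> complex^'n^'n \<Rightarrow> complex^'n^'n \<Rightarrow> nat \<Rightarrow> nat \<Rightarrow> (complex^'n) set" where
  "W_space X H Y \<eta> l =
     {mpow X l x + mpow X (\<eta> - 1 - l) y | x y. x \<in> L_space X H Y (\<eta> - 1) \<and> y \<in> L_space X H Y (\<eta> - 1)}"

definition w_even ::
    "complex^'n^'n \<Rightarrow> nat \<Rightarrow> (nat \<Rightarrow> nat \<Rightarrow> complex^'n) \<Rightarrow> nat \<Rightarrow> nat \<Rightarrow> nat \<Rightarrow> complex^'n" where
  "w_even X t v \<eta> l j =
     (let h = t div 2; \<epsilon> = (- 1) ^ l :: real;
          a = (\<lambda>i. mpow X l (v \<eta> i)); b = (\<lambda>i. mpow X (\<eta> - 1 - l) (v \<eta> i)) in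
      if j \<le> h then (1 / sqrt 2) *\<^sub>R (a j + \<epsilon> *\<^sub>R b (h + j))
      else if j \<le> t then (1 / sqrt 2) *\<^sub>R (a j - \<epsilon> *\<^sub>R b (j - h))
      else if j \<le> 3 * h then \<i> *s ((1 / sqrt 2) *\<^sub>R (a (j - t) - \<epsilon> *\<^sub>R b (j - h)))
      else \<i> *s ((1 / sqrt 2) *\<^sub>R (a (j - t) + \<epsilon> *\<^sub>R b (j - 3 * h))))"

definition D_basis ::
    "complex^'n^'n \<Rightarrow> complex^'n^'n \<Rightarrow> complex^'n^'n \<Rightarrow> (nat \<Rightarrow> nat \<Rightarrow> complex^'n) \<Rightarrow>
     nat \<Rightarrow> nat \<Rightarrow> (complex^'n) list" where
  "D_basis X H Y v \<eta> l = map (w_even X (mult X H Y \<eta>) v \<eta> l) [1..<Suc (2 * mult X H Y \<eta>)]"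

definition H_basis ::
    "complex^'n^'n \<Rightarrow> complex^'n^'n \<Rightarrow> complex^'n^'n \<Rightarrow> (nat \<Rightarrow> nat \<Rightarrow> complex^'n) \<Rightarrow>
     (complex^'n) list" where
  "H_basis X H Y v =
     concat (map (\<lambda>\<eta>. concat (map (D_basis X H Y v \<eta>) [0..<\<eta> div 2]))
                 (sorted_list_of_set (even_parts X H Y))) @
     concat (map (\<lambda>\<theta>. concat (map (C_basis X H Y v \<theta>) [0..<\<theta>]))
                 (sorted_list_of_set (odd_parts X H Y)))"

text \<open>Column \<open>j\<close> holds the coordinates of \<open>T (bs ! j)\<close>. Meaningful if \<open>bs\<close> is an ordered basis of a
  \<open>T\<close>-invariant subspace.\<close>

definition matrix_wrt :: "(complex^'n) list \<Rightarrow> (complex^'n \<Rightarrow> complex^'n) \<Rightarrow> complex mat" where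
  "matrix_wrt bs T = Matrix.mat (length bs) (length bs)
     (\<lambda>(i, j). vec.representation (set bs) (T (bs ! j)) (bs ! i))"

definition Lambda_H ::
    "complex^'n^'n \<Rightarrow> complex^'n^'n \<Rightarrow> complex^'n^'n \<Rightarrow> (nat \<Rightarrow> nat \<Rightarrow> complex^'n) \<Rightarrow>
     complex^'n^'n \<Rightarrow> complex mat" where
  "Lambda_H X H Y v g = matrix_wrt (H_basis X H Y v) ((*v) g)"


section \<open>The maximal compact subgroup \<open>K\<close> and the map \<open>D\<close>\<close>

definition quat_block :: "real mat \<Rightarrow> real mat \<Rightarrow> real mat \<Rightarrow> real mat \<Rightarrow> real mat" where
  "quat_block A1 A2 B1 B2 =
     four_block_mat
       (four_block_mat A1 (- B1) B1 A1) (four_block_mat (- A2) (- B2) (- B2) A2)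
       (four_block_mat A2 B2 B2 (- A2)) (four_block_mat A1 (- B1) B1 A1)"

definition K_group ::
    "complex^'n^'n \<Rightarrow> complex^'n^'n \<Rightarrow> complex^'n^'n \<Rightarrow> (nat \<Rightarrow> nat \<Rightarrow> complex^'n) \<Rightarrow>
     (complex^'n^'n) set" where
  "K_group X H Y v = {g \<in> centralizer X H Y.
     (\<forall>\<theta> \<in> odd_parts X H Y. \<forall>l \<in> {0..\<theta> - 1}. (*v) g ` V_space X H Y v \<theta> l \<subseteq> V_space X H Y v \<theta> l) \<and>
     (\<forall>\<theta> \<in> odd_parts X H Y. \<exists>A \<in> Orth (mult X H Y \<theta>). \<forall>l \<in> {0..\<theta> - 1}.
        matrix_wrt (C_basis X H Y v \<theta> l) ((*v) g) = map_mat complex_of_real A) \<and>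
     (\<forall>\<eta> \<in> even_parts X H Y. \<forall>l \<in> {0..\<eta> div 2 - 1}. (*v) g ` W_space X H Y \<eta> l \<subseteq> W_space X H Y \<eta> l) \<and>
     (\<forall>\<eta> \<in> even_parts X H Y. let m = mult X H Y \<eta> div 2; q = map_mat (of_real :: real \<Rightarrow> quat) in
        \<exists>A1 \<in> carrier_mat m m. \<exists>A2 \<in> carrier_mat m m. \<exists>B1 \<in> carrier_mat m m. \<exists>B2 \<in> carrier_mat m m.
          (q A1 + qi \<cdot>\<^sub>m q A2) + qj \<cdot>\<^sub>m (q B1 + qi \<cdot>\<^sub>m q B2) \<in> Sp m \<and>
          (\<forall>l \<in> {0..\<eta> div 2 - 1}.
             matrix_wrt (D_basis X H Y v \<eta> l) ((*v) g) =
               map_mat complex_of_real (quat_block A1 A2 B1 B2)))}"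

text \<open>Tuples indexed by the parts are extensional functions.\<close>

definition D_domain ::
    "complex^'n^'n \<Rightarrow> complex^'n^'n \<Rightarrow> complex^'n^'n \<Rightarrow> ((nat \<Rightarrow> quat mat) \<times> (nat \<Rightarrow> real mat)) set" where
  "D_domain X H Y =
     (\<Pi>\<^sub>E \<eta> \<in> even_parts X H Y. Sp (mult X H Y \<eta> div 2)) \<times>
     {C \<in> (\<Pi>\<^sub>E \<theta> \<in> odd_parts X H Y. Orth (mult X H Y \<theta>)).
        (\<Prod>\<theta> \<in> odd_parts X H Y. Determinant.det (C \<theta>)) = 1}"

definition D_SO ::
    "complex^'n^'n \<Rightarrow> complex^'n^'n \<Rightarrow> complex^'n^'n \<Rightarrow> (nat \<Rightarrow> quat mat) \<times> (nat \<Rightarrow> real mat) \<Rightarrow> real mat" where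
  "D_SO X H Y = (\<lambda>(A, C). diag_block_mat
     (concat (map (\<lambda>\<eta>. replicate (\<eta> div 2) (wp_C (wp_H (A \<eta>)))) (sorted_list_of_set (even_parts X H Y))) @
      concat (map (\<lambda>\<theta>. replicate \<theta> (C \<theta>)) (sorted_list_of_set (odd_parts X H Y)))))"


section \<open>Homogeneous spaces of matrix groups\<close>

text \<open>The usual topology of \<open>M\<^sub>n(\<complex>) = \<complex>\<^bsup>n \<times> n\<^esup>\<close>.\<close>

definition mat_topology :: "nat \<Rightarrow> complex mat topology" where
  "mat_topology n = pullback_topology (carrier_mat n n)
     (\<lambda>A. \<lambda>ij \<in> {..<n} \<times> {..<n}. A $$ ij)
     (product_topology (\<lambda>_. euclidean) ({..<n} \<times> {..<n}))"

lemma topspace_mat_topology: "topspace (mat_topology n) = carrier_mat n n"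
  by (auto simp: mat_topology_def topspace_pullback_topology)

definition quotient_topology :: "'a topology \<Rightarrow> ('a \<Rightarrow> 'b) \<Rightarrow> 'b topology" where
  "quotient_topology T f =
     topology (\<lambda>U. U \<subseteq> f ` topspace T \<and> openin T {x \<in> topspace T. f x \<in> U})"

lemma openin_quotient_topology:
  "openin (quotient_topology T f) U \<longleftrightarrow> U \<subseteq> f ` topspace T \<and> openin T {x \<in> topspace T. f x \<in> U}"
proof -
  have "istopology (\<lambda>U. U \<subseteq> f ` topspace T \<and> openin T {x \<in> topspace T. f x \<in> U})"
    unfolding istopology_def
  proof (intro conjI allI impI; (elim conjE)?)
    fix S U assume "openin T {x \<in> topspace T. f x \<in> S}" "openin T {x \<in> topspace T. f x \<in> U}"
    moreover have "{x \<in> topspace T. f x \<in> S \<inter> U} =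
        {x \<in> topspace T. f x \<in> S} \<inter> {x \<in> topspace T. f x \<in> U}" by auto
    ultimately show "openin T {x \<in> topspace T. f x \<in> S \<inter> U}" by auto
  next
    fix \<K> assume *: "\<forall>K\<in>\<K>. K \<subseteq> f ` topspace T \<and> openin T {x \<in> topspace T. f x \<in> K}"
    have "{x \<in> topspace T. f x \<in> \<Union>\<K>} = (\<Union>K\<in>\<K>. {x \<in> topspace T. f x \<in> K})" by auto
    then show "openin T {x \<in> topspace T. f x \<in> \<Union>\<K>}" using * by auto
    show "\<Union>\<K> \<subseteq> f ` topspace T" using * by auto
  qed auto
  then show ?thesis
    by (simp add: quotient_topology_def topology_inverse')
qed

lemma quotient_map_quotient_topology: "quotient_map T (quotient_topology T f) f"
proof -
  have "{x \<in> topspace T. f x \<in> f ` topspace T} = topspace T" by auto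
  then have "openin (quotient_topology T f) (f ` topspace T)"
    by (simp add: openin_quotient_topology)
  then have "topspace (quotient_topology T f) = f ` topspace T"
    using openin_quotient_topology by (metis openin_subset openin_topspace subset_antisym)
  then show ?thesis
    by (auto simp: quotient_map_def openin_quotient_topology)
qed

text \<open>The space \<open>G / L\<close> of left cosets, for a subgroup \<open>L\<close> of a group \<open>G\<close> of \<open>n \<times> n\<close> matrices.\<close>

definition coset_space :: "nat \<Rightarrow> complex mat set \<Rightarrow> complex mat set \<Rightarrow> complex mat set topology" where
  "coset_space n G L = quotient_topology (subtopology (mat_topology n) G) (\<lambda>g. (\<lambda>k. g * k) ` L)"

end

theory Submission imports Defs begin

text \<open>
  In coordinates with respect to the orthonormal basis \<open>\<H>\<close> the vectors \<open>X\<^sup>l v\<^sup>d\<^sub>j\<close> form a unitary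
  basis which complex conjugation permutes up to signs. Hence in these coordinates \<open>K\<close> is the
  centralizer of \<open>X\<close> in the compact group \<open>SO\<^sub>n\<close>: a real unitary matrix commuting with \<open>X\<close> also
  commutes with its adjoint, so it preserves the weights and the bottoms of the strings, where it acts
  by orthogonal matrices (odd parts) and quaternionic unitary matrices (even parts).

  It remains to deform the orbit of \<open>X\<close> under \<open>G = SO(n,\<complex>)\<close> onto its orbit under \<open>SO\<^sub>n\<close>. The centralizer
  of \<open>X\<close> preserves the filtration by weights, so that a point \<open>g X g\<^sup>-\<^sup>1\<close> determines a filtration of \<open>V\<close>
  and, by orthogonalization, an orthogonal grading. First, the components of \<open>g X g\<^sup>-\<^sup>1\<close> of degree
  greater than 2 are scaled to 0; this replaces \<open>g\<close> by an element mapping the grading of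
  \<open>X\<close> to the new one. Secondly, averaging over the strings gives a positive matrix depending only on
  the point; its geometric mean with its inverse transpose lies in \<open>G\<close>, and the square root of this
  mean moves the point to the compact orbit. The orbit map being open, continuity can be
  checked on \<open>G\<close>.
\<close>

text \<open>A point of the orbit determines g only up to a right factor z centralizing X, so each
  deformation must be built from data that z leaves unchanged; this is what forces the two stages.
  Such a z preserves the weight filtration but not the grading, hence the filtration is regraded by
  Hermitian orthogonality first. Two regraded representatives of a point differ by a factor
  commuting with the grading as well, and such a factor commutes with the string operators
  \<open>N k\<close>, so only then is the average well defined. The average is positive but in
  general not complex orthogonal. Taking a positive h to its inverse transpose is an involution
  whose fixed points are the positive orthogonal matrices; the geometric mean is the midpoint of h
  and its image, hence fixed. Its square root is orthogonal for the same reason, and it moves the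
  point to where a unitary matrix would, because averaging has made the mean, pulled back to X,
  commute with X. On the compact orbit both stages are constant, so the final map retracts onto
  it.\<close>

no_notation scalar_prod (infix "\<bullet>" 70)

section \<open>The normed algebra of complex matrices\<close>

text \<open>A copy of \<^typ>\<open>complex^'n^'n\<close>, whose class multiplication is componentwise.\<close>

typedef ('n::finite) cmat = "UNIV :: (complex^'n^'n) set" morphisms mat_of Cmat ..

setup_lifting type_definition_cmat

instantiation cmat :: (finite) real_normed_algebra_1
begin

lift_definition zero_cmat :: "'a cmat" is 0 .
lift_definition one_cmat :: "'a cmat" is "Finite_Cartesian_Product.mat 1" .
lift_definition plus_cmat :: "'a cmat \<Rightarrow> 'a cmat \<Rightarrow> 'a cmat" is "(+)" .
lift_definition minus_cmat :: "'a cmat \<Rightarrow> 'a cmat \<Rightarrow> 'a cmat" is "(-)" .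
lift_definition uminus_cmat :: "'a cmat \<Rightarrow> 'a cmat" is uminus .
lift_definition times_cmat :: "'a cmat \<Rightarrow> 'a cmat \<Rightarrow> 'a cmat" is "(**)" .
lift_definition scaleR_cmat :: "real \<Rightarrow> 'a cmat \<Rightarrow> 'a cmat" is "(*\<^sub>R)" .
lift_definition norm_cmat :: "'a cmat \<Rightarrow> real" is "\<lambda>A. onorm ((*v) A)" .
definition "sgn A = inverse (norm A) *\<^sub>R (A :: 'a cmat)"
definition "dist A B = norm (A - B :: 'a cmat)"
definition "(uniformity :: ('a cmat \<times> 'a cmat) filter) = (INF e\<in>{0 <..}. principal {(x, y). dist x y < e})"
definition "open (U :: 'a cmat set) \<longleftrightarrow> (\<forall>x\<in>U. \<forall>\<^sub>F (x', y) in uniformity. x' = x \<longrightarrow> y \<in> U)"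

instance
proof
  fix a b c :: "'a cmat" and r s :: real
  show "a + b + c = a + (b + c)" by transfer (rule add.assoc)
  show "a + b = b + a" by transfer (rule add.commute)
  show "0 + a = a" by transfer simp
  show "- a + a = 0" by transfer simp
  show "a - b = a + - b" by transfer simp
  show "r *\<^sub>R (a + b) = r *\<^sub>R a + r *\<^sub>R b" by transfer (rule scaleR_add_right)
  show "(r + s) *\<^sub>R a = r *\<^sub>R a + s *\<^sub>R a" by transfer (rule scaleR_add_left)
  show "r *\<^sub>R s *\<^sub>R a = (r * s) *\<^sub>R a" by transfer simp
  show "1 *\<^sub>R a = a" by transfer simp
  show "a * b * c = a * (b * c)" by transfer (simp add: matrix_mul_assoc)
  show "(a + b) * c = a * c + b * c"
    by transfer (vector matrix_matrix_mult_def sum.distrib distrib_right)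
  show "a * (b + c) = a * b + a * c" by transfer (simp add: matrix_add_ldistrib)
  show "1 * a = a" by transfer simp
  show "a * 1 = a" by transfer simp
  show "r *\<^sub>R a * b = r *\<^sub>R (a * b)"
    by transfer (vector matrix_matrix_mult_def scaleR_sum_right)
  show "a * r *\<^sub>R b = r *\<^sub>R (a * b)"
    by transfer (vector matrix_matrix_mult_def scaleR_sum_right)
  show "(0::'a cmat) \<noteq> 1" 
  proof transfer
    have "(0 :: complex^'a) \<noteq> Finite_Cartesian_Product.mat 1 *v 1" by simp
    then show "(0 :: complex^'a^'a) \<noteq> Finite_Cartesian_Product.mat 1" by (metis matrix_vector_mult_0)
  qed
  show "dist a b = norm (a - b)" "sgn a = inverse (norm a) *\<^sub>R a"
    "(uniformity :: ('a cmat \<times> 'a cmat) filter) = (INF e\<in>{0 <..}. principal {(x, y). dist x y < e})"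
    by (simp_all add: dist_cmat_def sgn_cmat_def uniformity_cmat_def)
  show "open U \<longleftrightarrow> (\<forall>x\<in>U. \<forall>\<^sub>F (x', y) in uniformity. x' = x \<longrightarrow> y \<in> U)" for U :: "'a cmat set"
    by (simp add: open_cmat_def)
  show "norm a = 0 \<longleftrightarrow> a = 0"
  proof transfer
    fix a :: "complex^'a^'a"
    have "onorm ((*v) a) = 0 \<longleftrightarrow> (\<forall>x. a *v x = 0)"
      by (rule onorm_eq_0) simp
    also have "\<dots> \<longleftrightarrow> a = 0"
      using matrix_eq[of a 0] by simp
    finally show "onorm ((*v) a) = 0 \<longleftrightarrow> a = 0" .
  qed
  show "norm (a + b) \<le> norm a + norm b"
  proof transfer
    fix a b :: "complex^'a^'a"
    have "(*v) (a + b) = (\<lambda>x. a *v x + b *v x)"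
      by (simp add: fun_eq_iff matrix_vector_mult_add_rdistrib)
    then show "onorm ((*v) (a + b)) \<le> onorm ((*v) a) + onorm ((*v) b)"
      by (simp add: onorm_triangle)
  qed
  show "norm (r *\<^sub>R a) = \<bar>r\<bar> * norm a"
  proof transfer
    fix r and a :: "complex^'a^'a"
    have "(*v) (r *\<^sub>R a) = (\<lambda>x. r *\<^sub>R (a *v x))"
      by (intro ext) (vector matrix_vector_mult_def scaleR_sum_right)
    then show "onorm ((*v) (r *\<^sub>R a)) = \<bar>r\<bar> * onorm ((*v) a)"
      by (simp add: onorm_scaleR)
  qed
  show "norm (a * b) \<le> norm a * norm b"
  proof transfer
    fix a b :: "complex^'a^'a"
    have "(*v) (a ** b) = (*v) a \<circ> (*v) b"
      by (simp add: fun_eq_iff matrix_vector_mul_assoc)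
    then show "onorm ((*v) (a ** b)) \<le> onorm ((*v) a) * onorm ((*v) b)"
      by (simp add: onorm_compose)
  qed
  show "norm (1::'a cmat) = 1"
  proof transfer
    have "(*v) (Finite_Cartesian_Product.mat 1 :: complex^'a^'a) = (\<lambda>x. x)" by (simp add: fun_eq_iff)
    then show "onorm ((*v) (Finite_Cartesian_Product.mat 1 :: complex^'a^'a)) = 1"
      by (simp add: onorm_id)
  qed
qed

end

lift_definition app :: "'n::finite cmat \<Rightarrow> complex^'n \<Rightarrow> complex^'n" (infixr "\<rhd>" 75) is "(*v)" .
lift_definition adj :: "'n::finite cmat \<Rightarrow> 'n cmat" is "\<lambda>A. \<chi> i j. cnj (A $ j $ i)" .
lift_definition tr :: "'n::finite cmat \<Rightarrow> 'n cmat" is Finite_Cartesian_Product.transpose .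

lemma norm_app: "norm (A \<rhd> x) \<le> norm A * norm x"
  by transfer (simp add: onorm)

lemma app_simps [simp]: "(A * B) \<rhd> x = A \<rhd> B \<rhd> x" "(1::'n::finite cmat) \<rhd> x = x" "(0::'n cmat) \<rhd> x = 0"
  "A \<rhd> (0::complex^'n) = 0"
proof -
  show "(A * B) \<rhd> x = A \<rhd> B \<rhd> x" by transfer (rule matrix_vector_mul_assoc[symmetric])
  show "(1::'n cmat) \<rhd> x = x" by transfer (rule matrix_vector_mul_lid)
  show "(0::'n cmat) \<rhd> x = 0" by transfer (rule matrix_vector_mult_0)
  show "A \<rhd> (0::complex^'n) = 0" by transfer (rule matrix_vector_mult_0_right)
qed

lemma app_linear: "(A + B) \<rhd> x = A \<rhd> x + B \<rhd> x" "(A - B) \<rhd> x = A \<rhd> x - B \<rhd> x"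
  "(- A) \<rhd> x = - (A \<rhd> x)" "(r *\<^sub>R A) \<rhd> x = r *\<^sub>R (A \<rhd> x)"
  "A \<rhd> (x + y) = A \<rhd> x + A \<rhd> y" "A \<rhd> (x - y) = A \<rhd> x - A \<rhd> y" "A \<rhd> (- x) = - (A \<rhd> x)"
  "A \<rhd> (r *\<^sub>R x) = r *\<^sub>R (A \<rhd> x)" "A \<rhd> (c *s x) = c *s (A \<rhd> x)"
proof -
  show add: "(A + B) \<rhd> x = A \<rhd> x + B \<rhd> x" for A B by transfer (rule matrix_vector_mult_add_rdistrib)
  show diff: "(A - B) \<rhd> x = A \<rhd> x - B \<rhd> x" for A B by transfer (rule matrix_vector_mult_diff_rdistrib)
  show "(- A) \<rhd> x = - (A \<rhd> x)" using diff[of 0 A] by simp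
  show "(r *\<^sub>R A) \<rhd> x = r *\<^sub>R (A \<rhd> x)" by transfer (vector matrix_vector_mult_def scaleR_sum_right)
  show "A \<rhd> (x + y) = A \<rhd> x + A \<rhd> y" by transfer (rule matrix_vector_right_distrib)
  show diff': "A \<rhd> (x - y) = A \<rhd> x - A \<rhd> y" for x y by transfer (rule matrix_vector_mult_diff_distrib)
  show "A \<rhd> (- x) = - (A \<rhd> x)" using diff'[of 0 x] by simp
  show "A \<rhd> (r *\<^sub>R x) = r *\<^sub>R (A \<rhd> x)" by transfer (vector matrix_vector_mult_def scaleR_sum_right)
  show "A \<rhd> (c *s x) = c *s (A \<rhd> x)" by transfer (rule vector_scalar_commute)
qed

lemma cmat_eqI: "(\<And>x. A \<rhd> x = B \<rhd> x) \<Longrightarrow> A = B"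
  by transfer (blast intro: matrix_eq[THEN iffD2])

lemma app_sum_right: "A \<rhd> (\<Sum>i\<in>I. f i) = (\<Sum>i\<in>I. A \<rhd> f i)"
  by (induct I rule: infinite_finite_induct) (simp_all add: app_linear)
lemma app_sum_left: "(\<Sum>i\<in>I. F i) \<rhd> x = (\<Sum>i\<in>I. F i \<rhd> x)"
  by (induct I rule: infinite_finite_induct) (simp_all add: app_linear)

lemma adj_simps [simp]: "adj (A * B) = adj B * adj A" "adj (A + B) = adj A + adj B" "adj (A - B) = adj A - adj B"
  "adj (- A) = - adj A" "adj (r *\<^sub>R A) = r *\<^sub>R adj A" "adj (adj A) = A" "adj 1 = (1 :: 'n::finite cmat)" "adj 0 = (0 :: 'n cmat)"
proof -
  show "adj (A * B) = adj B * adj A"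
    by transfer (simp add: matrix_matrix_mult_def vec_eq_iff mult.commute)
  show "adj (A + B) = adj A + adj B" "adj (A - B) = adj A - adj B" "adj (- A) = - adj A"
    "adj (r *\<^sub>R A) = r *\<^sub>R adj A" "adj (adj A) = A" "adj 0 = (0 :: 'n cmat)"
    by (transfer, vector)+
  show "adj 1 = (1 :: 'n cmat)"
    by transfer (vector Finite_Cartesian_Product.mat_def)
qed

lemma tr_simps [simp]: "tr (A * B) = tr B * tr A" "tr (A + B) = tr A + tr B" "tr (A - B) = tr A - tr B"
  "tr (- A) = - tr A" "tr (r *\<^sub>R A) = r *\<^sub>R tr A" "tr (tr A) = A" "tr 1 = (1 :: 'n::finite cmat)" "tr 0 = (0 :: 'n cmat)"
proof -
  show "tr (A * B) = tr B * tr A"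
    by transfer (rule matrix_transpose_mul)
  show "tr (A + B) = tr A + tr B" "tr (A - B) = tr A - tr B" "tr (- A) = - tr A"
    "tr (r *\<^sub>R A) = r *\<^sub>R tr A" "tr (tr A) = A" "tr 0 = (0 :: 'n cmat)"
    by (transfer, vector Finite_Cartesian_Product.transpose_def)+
  show "tr 1 = (1 :: 'n cmat)"
    by transfer (rule transpose_mat)
qed

lemma tr_adj: "tr (adj A) = adj (tr A)"
  by transfer (simp add: vec_eq_iff Finite_Cartesian_Product.transpose_def)

lemma adj_sum [simp]: "adj (\<Sum>i\<in>I. f i) = (\<Sum>i\<in>I. adj (f i))"
  by (induct I rule: infinite_finite_induct) simp_all
lemma tr_sum [simp]: "tr (\<Sum>i\<in>I. f i) = (\<Sum>i\<in>I. tr (f i))"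
  by (induct I rule: infinite_finite_induct) simp_all

text \<open>The class inner product of complex vectors is the real part of the Hermitian form, so
  its adjoint of a complex matrix is still the conjugate transpose.\<close>

lemma inner_adj: "x \<bullet> (A \<rhd> y) = (adj A \<rhd> x) \<bullet> y"
proof transfer
  fix A :: "complex^'a^'a" and x y :: "complex^'a"
  have "x \<bullet> (A *v y) = (\<Sum>i\<in>UNIV. \<Sum>j\<in>UNIV. x $ i \<bullet> (A $ i $ j * y $ j))"
    by (simp add: inner_vec_def matrix_vector_mult_def inner_sum_right)
  also have "\<dots> = (\<Sum>j\<in>UNIV. \<Sum>i\<in>UNIV. x $ i \<bullet> (A $ i $ j * y $ j))"
    by (rule sum.swap)
  also have "\<dots> = (\<Sum>j\<in>UNIV. \<Sum>i\<in>UNIV. (cnj (A $ i $ j) * x $ i) \<bullet> y $ j)"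
    by (simp add: inner_complex_def algebra_simps)
  also have "\<dots> = ((\<chi> i j. cnj (A $ j $ i)) *v x) \<bullet> y"
    by (simp add: inner_vec_def matrix_vector_mult_def inner_sum_left)
  finally show "x \<bullet> (A *v y) = ((\<chi> i j. cnj (A $ j $ i)) *v x) \<bullet> y" .
qed

lemma bounded_linear_Cmat: "bounded_linear (Cmat :: complex^'n^'n \<Rightarrow> 'n::finite cmat)"
proof -
  have "linear (Cmat :: complex^'n^'n \<Rightarrow> 'n cmat)"
    by (rule linearI) (simp_all add: plus_cmat_def scaleR_cmat_def Cmat_inverse)
  then show ?thesis by (simp add: linear_conv_bounded_linear)
qed

lemma bounded_linear_app_left: "bounded_linear (\<lambda>A. A \<rhd> (x::complex^'n::finite))"
proof (rule bounded_linear_intro)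
  show "norm (A \<rhd> x) \<le> norm A * norm x" for A :: "'n cmat" by (rule norm_app)
qed (simp_all add: app_linear)

lemma entry_app: "mat_of A $ i $ j = (A \<rhd> axis j 1) $ i"
  by transfer (simp add: matrix_vector_mult_def axis_def if_distrib cong: if_cong)

lemma norm_entry_le: "norm (mat_of A $ i $ j) \<le> norm A"
proof -
  have "norm ((A \<rhd> axis j 1) $ i) \<le> norm (A \<rhd> axis j 1)" by (rule Finite_Cartesian_Product.norm_nth_le)
  also have "\<dots> \<le> norm A * norm (axis j 1 :: complex^'a)" by (rule norm_app)
  finally show ?thesis by (simp add: entry_app)
qed

text \<open>Each entry is bounded by the operator norm; summing over all entries gives the square of
  the dimension as a constant. Together with \<open>bounded_linear_Cmat\<close> the two norms are
  equivalent, so topological facts may be moved between the two types.\<close>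

lemma bounded_linear_mat_of: "bounded_linear (mat_of :: 'n::finite cmat \<Rightarrow> complex^'n^'n)"
proof (rule bounded_linear_intro)
  fix A :: "'n cmat"
  have "norm (mat_of A) \<le> (\<Sum>i\<in>UNIV. norm (mat_of A $ i))"
    by (simp add: norm_vec_def L2_set_le_sum)
  also have "\<dots> \<le> (\<Sum>i\<in>UNIV. \<Sum>j\<in>UNIV. norm (mat_of A $ i $ j))"
    by (intro sum_mono) (simp add: norm_vec_def L2_set_le_sum)
  also have "\<dots> \<le> (\<Sum>i\<in>(UNIV::'n set). \<Sum>j\<in>(UNIV::'n set). norm A)"
    by (intro sum_mono norm_entry_le)
  finally show "norm (mat_of A) \<le> norm A * (real CARD('n) * real CARD('n))"
    by (simp add: algebra_simps)
qed (simp_all add: plus_cmat.rep_eq scaleR_cmat.rep_eq)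

lemma bounded_linear_of_cmat_matrix:
  fixes f :: "complex^'n^'n \<Rightarrow> complex^'n^'n" and F :: "'n::finite cmat \<Rightarrow> 'n cmat"
  assumes "linear f" "\<And>A. mat_of (F A) = f (mat_of A)"
  shows "bounded_linear F"
proof -
  have "F = (\<lambda>A. Cmat (f (mat_of A)))"
    using assms(2) by (metis mat_of_inverse)
  moreover have "bounded_linear f" using assms(1) by (simp add: linear_conv_bounded_linear)
  ultimately show ?thesis
    using bounded_linear_compose[OF bounded_linear_Cmat bounded_linear_compose[OF _ bounded_linear_mat_of]] by auto
qed

lemma bounded_linear_adj: "bounded_linear (adj :: 'n::finite cmat \<Rightarrow> 'n cmat)"
  by (rule bounded_linear_of_cmat_matrix[of "\<lambda>A. \<chi> i j. cnj (A $ j $ i)"])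
    (rule linearI, vector, vector, rule adj.rep_eq)

lemma bounded_linear_tr: "bounded_linear (tr :: 'n::finite cmat \<Rightarrow> 'n cmat)"
  by (rule bounded_linear_of_cmat_matrix[of Finite_Cartesian_Product.transpose])
    (rule linearI, vector Finite_Cartesian_Product.transpose_def,
      vector Finite_Cartesian_Product.transpose_def, rule tr.rep_eq)

lemmas tendsto_adj [tendsto_intros] = bounded_linear.tendsto[OF bounded_linear_adj]
lemmas tendsto_tr [tendsto_intros] = bounded_linear.tendsto[OF bounded_linear_tr]
lemmas tendsto_app [tendsto_intros] = bounded_linear.tendsto[OF bounded_linear_app_left]
lemmas continuous_on_adj [continuous_intros] = bounded_linear.continuous_on[OF bounded_linear_adj]
lemmas continuous_on_tr [continuous_intros] = bounded_linear.continuous_on[OF bounded_linear_tr]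
lemmas continuous_on_mat_of [continuous_intros] = bounded_linear.continuous_on[OF bounded_linear_mat_of]
lemmas continuous_on_Cmat [continuous_intros] = bounded_linear.continuous_on[OF bounded_linear_Cmat]

instance cmat :: (finite) heine_borel
proof
  fix f :: "nat \<Rightarrow> 'a cmat"
  assume "bounded (range f)"
  then have "bounded (range (\<lambda>k. mat_of (f k)))"
    using bounded_linear_image[OF _ bounded_linear_mat_of, of "range f"] by (simp add: image_image)
  then obtain l r where r: "strict_mono r" "((\<lambda>k. mat_of (f k)) \<circ> r) \<longlonglongrightarrow> l"
    using bounded_imp_convergent_subsequence by blast
  then have "(\<lambda>k. Cmat (mat_of (f (r k)))) \<longlonglongrightarrow> Cmat l"
    using bounded_linear.tendsto[OF bounded_linear_Cmat] by (auto simp: o_def)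
  then show "\<exists>l r. strict_mono r \<and> (f \<circ> r) \<longlonglongrightarrow> l"
    using r(1) by (auto simp: mat_of_inverse o_def)
qed

instance cmat :: (finite) banach ..

section \<open>Inverses, and square roots near the identity\<close>

lemma norm_cmat_le: "(\<And>x. norm (A \<rhd> x) \<le> b * norm x) \<Longrightarrow> norm A \<le> b"
  by transfer (rule onorm_le)

lemma cmat_left_inverse: "A * B = 1 \<longleftrightarrow> B * A = (1 :: 'n::finite cmat)"
  by transfer (rule matrix_left_right_inverse)

lemma cmat_injective_invertible:
  fixes A :: "'n::finite cmat"
  assumes "\<And>x. A \<rhd> x = 0 \<Longrightarrow> x = 0"
  shows "\<exists>B. A * B = 1 \<and> B * A = 1"
proof -
  have "\<exists>B. B * A = 1"
    using assms
  proof transfer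
    fix A :: "complex^'n^'n"
    assume "\<And>x. A *v x = 0 \<Longrightarrow> x = 0"
    then show "\<exists>B. B ** A = Finite_Cartesian_Product.mat 1"
      using matrix_left_invertible_ker by blast
  qed
  then show ?thesis using cmat_left_inverse by blast
qed

definition cinv :: "'n::finite cmat \<Rightarrow> 'n cmat" where
  "cinv A = (SOME B. A * B = 1)"

lemma cinv_eq: "A * B = 1 \<Longrightarrow> cinv A = B"
proof -
  assume AB: "A * B = 1"
  have "C = B" if "A * C = 1" for C
  proof -
    have "B = B * (A * C)" using that by simp
    also have "\<dots> = C" using AB cmat_left_inverse by (metis mult.assoc mult_1)
    finally show ?thesis ..
  qed
  then show ?thesis unfolding cinv_def using AB by (intro some_equality)
qed

text \<open>No bound on the inverses \<open>g x\<close> is given. The identity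
  \<open>g x - B = g x * (A - f x) * B\<close> bounds the error by a small multiple of itself plus a
  term tending to 0, and the former is absorbed once \<open>norm (A - f x)\<close> is below
  \<open>1 / (2 * norm B)\<close>.\<close>

lemma tendsto_inverse_cmat:
  fixes f g :: "'b \<Rightarrow> 'n::finite cmat"
  assumes f: "(f \<longlongrightarrow> A) F" and fg: "\<forall>\<^sub>F x in F. f x * g x = 1" and AB: "A * B = 1"
  shows "(g \<longlongrightarrow> B) F"
proof -
  have BA: "B * A = 1" using AB cmat_left_inverse by blast
  define b where "b = norm B"
  have b0: "b > 0" unfolding b_def using AB by auto
  have "((\<lambda>x. A - f x) \<longlongrightarrow> A - A) F" by (intro tendsto_intros f)
  then have z: "((\<lambda>x. norm (A - f x)) \<longlongrightarrow> 0) F" using tendsto_norm_zero by fastforce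
  have small: "\<forall>\<^sub>F x in F. norm (A - f x) < 1 / (2 * b)"
    by (rule order_tendstoD[OF z]) (use b0 in simp)
  have bound: "\<forall>\<^sub>F x in F. norm (g x - B) \<le> norm (A - f x) * (2 * b * b)"
    using fg small
  proof eventually_elim
    case (elim x)
    let ?d = "norm (g x - B)" and ?e = "norm (A - f x)"
    have "g x * f x = 1" using elim(1) cmat_left_inverse by blast
    then have "g x - B = g x * (A - f x) * B"
      by (simp add: algebra_simps AB mult.assoc[symmetric])
    also have "norm \<dots> \<le> norm (g x) * ?e * b"
      unfolding b_def by (rule order_trans[OF norm_mult_ineq mult_right_mono[OF norm_mult_ineq norm_ge_zero]])
    also have "\<dots> \<le> (?d + b) * ?e * b"
      unfolding b_def using norm_triangle_sub[of "g x" B] by (intro mult_right_mono norm_ge_zero) linarith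
    finally have 1: "?d \<le> ?d * (?e * b) + ?e * (b * b)" by (simp add: algebra_simps)
    have "?e * b \<le> 1 / 2" using elim(2) b0 by (simp add: field_simps)
    then have "?d * (?e * b) \<le> ?d * (1 / 2)" by (intro mult_left_mono norm_ge_zero)
    with 1 show ?case by (simp add: algebra_simps)
  qed
  have "((\<lambda>x. g x - B) \<longlongrightarrow> 0) F"
    by (rule Lim_null_comparison[OF bound]) (use tendsto_mult_left_zero[OF z] in simp)
  then show ?thesis by (simp add: LIM_zero_iff)
qed

text \<open>The equation for \<open>1 - y\<close> to be a square root of \<open>1 - e\<close> is the
  fixed point equation \<open>y = (1/2) *\<^sub>R (e + y * y)\<close>, solved by contraction. The
  closed set P records the properties the root has to inherit, such as being symmetric or commuting
  with given matrices.\<close>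

lemma sqrt_exists:
  fixes e :: "'a::{real_normed_algebra_1,banach}"
  assumes e: "norm e < 1" and P: "closed P" "0 \<in> P"
    and step: "\<And>y. y \<in> P \<Longrightarrow> (1/2) *\<^sub>R (e + y * y) \<in> P"
  obtains y where "y \<in> P" "norm y \<le> norm e" "(1 - y) * (1 - y) = 1 - e"
proof -
  define a where "a = norm e"
  \<comment> \<open>The smaller root of the scalar equation \<open>r = (a + r * r) / 2\<close>: the
    ball of radius r is therefore mapped into itself, and r < 1 is also the contraction
    factor.\<close>
  define r where "r = 1 - sqrt (1 - a)"
  have a: "0 \<le> a" "a < 1" using e by (auto simp: a_def)
  have r: "0 \<le> r" "r < 1" using a by (auto simp: r_def)
  have rr: "a + r * r = 2 * r"
    using a by (simp add: r_def algebra_simps)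
  have "1 - a \<le> sqrt (1 - a)"
    using a by (intro real_le_rsqrt) (simp add: power2_eq_square mult_left_le)
  then have ra: "r \<le> a" by (simp add: r_def)
  let ?f = "\<lambda>y. (1/2) *\<^sub>R (e + y * y)"
  let ?S = "{y \<in> P. norm y \<le> r}"
  have "\<exists>!y\<in>?S. ?f y = y"
  proof (rule Banach_fix[of _ r])
    have "?S = P \<inter> cball 0 r" by (auto simp: dist_norm)
    then show "complete ?S" using P by (simp add: closed_Int complete_eq_closed)
    show "?S \<noteq> {}" using P r by auto
    show "0 \<le> r" "r < 1" by fact+
    show "?f ` ?S \<subseteq> ?S"
    proof safe
      fix y assume y: "y \<in> P" "norm y \<le> r"
      show "?f y \<in> P" by (rule step) fact
      have "norm (e + y * y) \<le> a + norm y * norm y"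
        unfolding a_def by (rule order_trans[OF norm_triangle_ineq add_left_mono[OF norm_mult_ineq]])
      also have "\<dots> \<le> a + r * r" using y r by (intro add_left_mono mult_mono) auto
      finally show "norm (?f y) \<le> r" using rr by simp
    qed
    fix x y assume x: "x \<in> ?S" and y: "y \<in> ?S"
    have "x * x - y * y = x * (x - y) + (x - y) * y" by (simp add: algebra_simps)
    also have "norm \<dots> \<le> norm x * norm (x - y) + norm (x - y) * norm y"
      by (rule order_trans[OF norm_triangle_ineq add_mono[OF norm_mult_ineq norm_mult_ineq]])
    also have "\<dots> \<le> r * norm (x - y) + norm (x - y) * r"
      using x y by (intro add_mono mult_right_mono mult_left_mono) auto
    finally have *: "norm (x * x - y * y) \<le> 2 * r * norm (x - y)" by simp
    have "?f x - ?f y = (1/2) *\<^sub>R (x * x - y * y)" by (simp add: algebra_simps)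
    then have "norm (?f x - ?f y) = (1/2) * norm (x * x - y * y)" by simp
    with * show "dist (?f x) (?f y) \<le> r * dist x y" by (simp add: dist_norm)
  qed
  then obtain y where y: "y \<in> P" "norm y \<le> r" "?f y = y" by auto
  have "2 *\<^sub>R y = 2 *\<^sub>R ?f y" by (simp only: y(3))
  also have "\<dots> = e + y * y" by (simp add: algebra_simps)
  finally have "e + y * y = y + y" by (simp add: scaleR_2)
  then have "1 - e = 1 - (y + y) + y * y" by (simp add: algebra_simps)
  also have "\<dots> = (1 - y) * (1 - y)" by (simp add: algebra_simps)
  finally have "(1 - y) * (1 - y) = 1 - e" ..
  then show ?thesis using that y ra a_def by force
qed

text \<open>Otherwise a subsequence stays away from L, and by boundedness it has a convergent
  subsequence with another limit. This turns uniqueness of a root into its continuity.\<close>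

lemma bounded_unique_limit:
  fixes f :: "nat \<Rightarrow> 'a::heine_borel"
  assumes b: "bounded (range f)"
    and u: "\<And>l r. strict_mono r \<Longrightarrow> (f \<circ> r) \<longlonglongrightarrow> l \<Longrightarrow> l = L"
  shows "f \<longlonglongrightarrow> L"
proof (rule ccontr)
  assume "\<not> ?thesis"
  then obtain e where e: "e > 0" "\<And>N. \<exists>n\<ge>N. dist (f n) L \<ge> e"
    by (auto simp: lim_sequentially not_less)
  then have inf: "infinite {n. dist (f n) L \<ge> e}"
    by (auto simp: infinite_nat_iff_unbounded_le)
  define r where "r = enumerate {n. dist (f n) L \<ge> e}"
  have r: "strict_mono r" "\<And>k. dist (f (r k)) L \<ge> e"
    using inf enumerate_in_set[OF inf] by (auto simp: r_def strict_mono_enumerate)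
  have "bounded (range (f \<circ> r))" using b by (rule bounded_subset) auto
  then obtain l s where s: "strict_mono s" "((f \<circ> r) \<circ> s) \<longlonglongrightarrow> l"
    using bounded_imp_convergent_subsequence by blast
  have "l = L" using u[of "r \<circ> s"] s r by (simp add: strict_mono_o o_assoc)
  then have "\<forall>\<^sub>F k in sequentially. dist (f (r (s k))) L < e"
    using s(2) e(1) by (auto simp: tendsto_iff o_def)
  then show False using r(2) by (meson eventually_sequentially le_refl not_le)
qed

section \<open>Positive definite matrices and their square roots\<close>

definition pos :: "'n::finite cmat \<Rightarrow> bool" where
  "pos A \<longleftrightarrow> adj A = A \<and> (\<forall>x. x \<noteq> 0 \<longrightarrow> 0 < x \<bullet> (A \<rhd> x))"

lemma pos_adj: "pos A \<Longrightarrow> adj A = A" by (simp add: pos_def)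

lemma pos_one: "pos 1" by (simp add: pos_def)

lemma pos_add: "pos A \<Longrightarrow> pos B \<Longrightarrow> pos (A + B)"
  by (auto simp: pos_def app_linear inner_add_right add_pos_pos)

lemma pos_scaleR: "pos A \<Longrightarrow> 0 < r \<Longrightarrow> pos (r *\<^sub>R A)"
  by (auto simp: pos_def app_linear)

lemma pos_conj:
  assumes "pos A" "T * U = 1"
  shows "pos (adj T * A * T)"
proof -
  have "T \<rhd> x \<noteq> 0" if "x \<noteq> 0" for x
    using assms(2) that cmat_left_inverse by (metis app_simps(1,2,4))
  moreover have "x \<bullet> ((adj T * A * T) \<rhd> x) = (T \<rhd> x) \<bullet> (A \<rhd> T \<rhd> x)" for x
    using inner_adj[of x "adj T" "A \<rhd> T \<rhd> x"] by simp
  ultimately have "0 < x \<bullet> ((adj T * A * T) \<rhd> x)" if "x \<noteq> 0" for x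
    using that assms(1) by (simp add: pos_def)
  then show ?thesis using assms(1) by (simp add: pos_def mult.assoc)
qed

lemma pos_injective: "pos A \<Longrightarrow> A \<rhd> x = 0 \<Longrightarrow> x = 0"
  unfolding pos_def by (metis inner_zero_right less_irrefl)

lemma cinv_pos: assumes "pos A" shows "A * cinv A = 1" "cinv A * A = 1" "pos (cinv A)"
proof -
  obtain B where B: "A * B = 1" "B * A = 1"
    using cmat_injective_invertible[of A] pos_injective assms by blast
  then have c: "cinv A = B" by (simp add: cinv_eq)
  show "A * cinv A = 1" "cinv A * A = 1" using B c by auto
  have "B = adj B * A * B"
  proof -
    have "adj B * A = 1" using B(1) pos_adj[OF assms] by (metis adj_simps(1,7))
    then show ?thesis by simp
  qed
  then show "pos (cinv A)" using pos_conj[OF assms B(2)] c by simp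
qed

lemma pos_lower_bound:
  fixes A :: "'n::finite cmat"
  assumes "pos A"
  obtains m where "m > 0" "\<And>x. m * (norm x)\<^sup>2 \<le> x \<bullet> (A \<rhd> x)"
proof -
  have "continuous_on (sphere 0 1) (\<lambda>x::complex^'n. x \<bullet> (A \<rhd> x))"
    unfolding app.rep_eq by (intro continuous_intros)
  moreover have "sphere (0::complex^'n) 1 \<noteq> {}" by simp
  ultimately obtain z where "z \<in> sphere 0 1"
    "\<forall>x\<in>sphere 0 1. z \<bullet> (A \<rhd> z) \<le> x \<bullet> (A \<rhd> x)"
    using continuous_attains_inf[OF compact_sphere] by blast
  then have z: "norm z = 1" "\<And>x. norm x = 1 \<Longrightarrow> z \<bullet> (A \<rhd> z) \<le> x \<bullet> (A \<rhd> x)"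
    by auto
  show thesis
  proof
    have "z \<noteq> 0" using z(1) by auto
    then show "0 < z \<bullet> (A \<rhd> z)" using assms by (simp add: pos_def)
    fix x :: "complex^'n"
    show "z \<bullet> (A \<rhd> z) * (norm x)\<^sup>2 \<le> x \<bullet> (A \<rhd> x)"
    proof (cases "x = 0")
      case False
      let ?u = "inverse (norm x) *\<^sub>R x"
      have "(norm x)\<^sup>2 * (?u \<bullet> (A \<rhd> ?u)) = (norm x * inverse (norm x))\<^sup>2 * (x \<bullet> (A \<rhd> x))"
        by (simp only: app_linear inner_scaleR_left inner_scaleR_right power2_eq_square mult_ac)
      then have "x \<bullet> (A \<rhd> x) = (norm x)\<^sup>2 * (?u \<bullet> (A \<rhd> ?u))" using False by simp
      also have "(norm x)\<^sup>2 * (z \<bullet> (A \<rhd> z)) \<le> \<dots>" using False by (intro mult_left_mono z(2)) simp_all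
      finally show ?thesis by (simp only: mult.commute)
    qed simp
  qed
qed

lemma pos_one_minus:
  assumes "adj y = y" "norm y < 1"
  shows "pos (1 - y)"
  unfolding pos_def
proof (intro conjI allI impI)
  show "adj (1 - y) = 1 - y" using assms by simp
  fix x :: "complex^'a" assume "x \<noteq> 0"
  have "x \<bullet> (y \<rhd> x) \<le> norm x * (norm y * norm x)"
    by (rule order_trans[OF norm_cauchy_schwarz mult_left_mono[OF norm_app norm_ge_zero]])
  also have "\<dots> < x \<bullet> x"
    using \<open>x \<noteq> 0\<close> assms(2) by (simp add: dot_square_norm power2_eq_square)
  finally show "0 < x \<bullet> ((1 - y) \<rhd> x)" by (simp add: app_linear inner_diff_right)
qed

text \<open>\<open>sqrt_exists\<close> works only within distance 1 of the identity, so p is first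
  scaled to \<open>c *\<^sub>R p = 1 - e\<close>. The root is sought among the self-adjoint matrices
  commuting with everything that commutes with p; this clause later gives both uniqueness and all
  commutation statements.\<close>

lemma pos_sqrt_exists:
  fixes p :: "'n::finite cmat"
  assumes "pos p"
  shows "\<exists>q. pos q \<and> q * q = p \<and> (\<forall>z. z * p = p * z \<longrightarrow> z * q = q * z)"
proof -
  obtain m where m: "m > 0" "\<And>x. m * (norm x)\<^sup>2 \<le> x \<bullet> (p \<rhd> x)"
    using pos_lower_bound[OF assms] by blast
  define K where "K = norm p"
  have K: "m \<le> K" "K > 0"
  proof -
    obtain x :: "complex^'n" where x: "norm x = 1" using vector_choose_size[of 1] by auto
    have "m \<le> x \<bullet> (p \<rhd> x)" using m(2)[of x] x by simp
    also have "\<dots> \<le> norm x * norm (p \<rhd> x)" by (rule norm_cauchy_schwarz)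
    also have "\<dots> \<le> K" using norm_app[of p x] x by (simp add: K_def)
    finally show "m \<le> K" .
    then show "K > 0" using m(1) by simp
  qed
  \<comment> \<open>The minimizer of \<open>1 - 2 * c * m + c\<^sup>2 * K\<^sup>2\<close>, which
    bounds the square of the norm of \<open>1 - c *\<^sub>R p\<close>; the minimum is
    \<open>1 - c * m\<close>.\<close>
  define c where "c = m / K\<^sup>2"
  have c: "c > 0" using m K by (simp add: c_def)
  define e where "e = 1 - c *\<^sub>R p"
  define b where "b = 1 - c * m"
  have cm: "c * m \<le> 1" using m K by (simp add: c_def power2_eq_square field_simps mult_mono)
  have b: "0 \<le> b" "b < 1" using cm c m by (auto simp: b_def)
  have "norm (e \<rhd> x) \<le> sqrt b * norm x" for x
  proof -
    have "(norm (e \<rhd> x))\<^sup>2 = (norm x)\<^sup>2 - 2 * c * (x \<bullet> (p \<rhd> x)) + c\<^sup>2 * (norm (p \<rhd> x))\<^sup>2"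
      using dot_norm_neg[of x "c *\<^sub>R (p \<rhd> x)"] by (simp add: e_def app_linear power_mult_distrib)
    also have "\<dots> \<le> (norm x)\<^sup>2 - 2 * c * (m * (norm x)\<^sup>2) + c\<^sup>2 * (K * norm x)\<^sup>2"
      using m(2)[of x] norm_app[of p x] c
      by (intro add_mono diff_mono mult_left_mono power_mono) (auto simp: K_def)
    also have "\<dots> = b * (norm x)\<^sup>2"
      using K by (simp add: b_def c_def power2_eq_square field_simps)
    finally have "norm (e \<rhd> x) \<le> sqrt (b * (norm x)\<^sup>2)" by (rule real_le_rsqrt)
    then show ?thesis by (simp add: real_sqrt_mult)
  qed
  then have ne: "norm e < 1"
    using norm_cmat_le[of e "sqrt b"] b by (simp add: le_less_trans[of _ "sqrt b"])
  define P where "P = {y. adj y = y \<and> (\<forall>z. z * p = p * z \<longrightarrow> z * y = y * z)}"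
  have "P = {y. adj y = y} \<inter> (\<Inter>z \<in> {z. z * p = p * z}. {y. z * y = y * z})"
    by (auto simp: P_def)
  moreover have "closed {y :: 'n cmat. adj y = y}" "\<And>z. closed {y :: 'n cmat. z * y = y * z}"
    by (intro closed_Collect_eq continuous_intros)+
  ultimately have "closed P" by (simp add: closed_INT closed_Int)
  moreover have "0 \<in> P" by (simp add: P_def)
  moreover have "(1/2) *\<^sub>R (e + y * y) \<in> P" if "y \<in> P" for y
  proof -
    have "z * (y * y) = y * y * z" if "z * p = p * z" for z
    proof -
      have zy: "z * y = y * z" using \<open>y \<in> P\<close> that unfolding P_def by blast
      have "z * (y * y) = (z * y) * y" by (simp only: mult.assoc)
      also have "\<dots> = y * (z * y)" by (simp only: zy mult.assoc)
      also have "\<dots> = y * y * z" by (simp only: zy mult.assoc)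
      finally show ?thesis .
    qed
    moreover have "adj y = y" using that by (simp add: P_def)
    ultimately show ?thesis using pos_adj[OF assms] unfolding P_def
      by (auto simp: e_def right_diff_distrib left_diff_distrib distrib_left distrib_right)
  qed
  ultimately obtain y where y: "y \<in> P" "norm y \<le> norm e" "(1 - y) * (1 - y) = 1 - e"
    using sqrt_exists[OF ne] by metis
  define q where "q = (1 / sqrt c) *\<^sub>R (1 - y)"
  have "pos (1 - y)" using y ne by (intro pos_one_minus) (auto simp: P_def)
  then have "pos q" unfolding q_def using c by (intro pos_scaleR) auto
  moreover have "q * q = p"
    using y(3) c by (simp add: q_def e_def)
  moreover have "z * q = q * z" if "z * p = p * z" for z
  proof -
    have "z * y = y * z" using y(1) that unfolding P_def by blast
    then show ?thesis by (simp add: q_def right_diff_distrib left_diff_distrib)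
  qed
  ultimately show ?thesis by blast
qed

definition msqrt :: "'n::finite cmat \<Rightarrow> 'n cmat" where
  "msqrt p = (SOME q. pos q \<and> q * q = p \<and> (\<forall>z. z * p = p * z \<longrightarrow> z * q = q * z))"

lemma msqrt:
  assumes "pos p"
  shows "pos (msqrt p)" "msqrt p * msqrt p = p" "z * p = p * z \<Longrightarrow> z * msqrt p = msqrt p * z"
  using someI_ex[OF pos_sqrt_exists[OF assms]] unfolding msqrt_def[symmetric] by auto

text \<open>The two roots commute, hence \<open>(?s + q) * (?s - q) = 0\<close>, and the first
  factor is positive definite because \<open>msqrt p\<close> is. Only semidefiniteness of q is asked
  for, since q will arise as a limit of positive matrices.\<close>

lemma msqrt_unique:
  assumes "adj q = q" "\<And>x. 0 \<le> x \<bullet> (q \<rhd> x)" "q * q = p" "pos p"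
  shows "msqrt p = q"
proof -
  let ?s = "msqrt p"
  have "q * ?s = ?s * q" by (rule msqrt(3)[OF assms(4)]) (simp add: assms(3)[symmetric] mult.assoc)
  then have "(?s + q) * (?s - q) = 0"
    using assms(3) msqrt(2)[OF assms(4)] by (simp add: algebra_simps)
  moreover have "pos (?s + q)"
    using assms(1,2) msqrt(1)[OF assms(4)] unfolding pos_def
    by (auto simp: app_linear inner_add_right intro: add_pos_nonneg)
  ultimately have "(?s - q) \<rhd> x = 0" for x
    by (metis app_simps(1,3) pos_injective)
  then have "?s - q = 0" by (intro cmat_eqI) simp
  then show ?thesis by simp
qed

text \<open>The roots of a convergent sequence are bounded, and every cluster point of them is a
  semidefinite root of the limit, so \<open>msqrt_unique\<close> leaves one possibility.\<close>

lemma continuous_on_msqrt: "continuous_on {p. pos p} msqrt"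
  unfolding continuous_on_sequentially
proof (intro allI ballI impI, elim conjE)
  fix p :: "'n::finite cmat" and x :: "nat \<Rightarrow> 'n cmat"
  assume p: "p \<in> {p. pos p}" and "\<forall>n. x n \<in> {p. pos p}" and lim: "x \<longlonglongrightarrow> p"
  then have x: "\<And>n. pos (x n)" by auto
  show "(msqrt \<circ> x) \<longlonglongrightarrow> msqrt p"
  proof (rule bounded_unique_limit)
    obtain b where b: "\<And>n. norm (x n) \<le> b"
      using convergent_imp_Bseq[OF convergentI[OF lim]] unfolding Bseq_def by auto
    have b0: "0 \<le> b" using b[of 0] norm_ge_zero order_trans by blast
    have "norm (msqrt (x n)) \<le> sqrt b" for n
    proof (rule norm_cmat_le)
      fix v
      let ?q = "msqrt (x n)"
      have "(norm (?q \<rhd> v))\<^sup>2 = v \<bullet> (x n \<rhd> v)"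
        using msqrt(1,2)[OF x[of n]] inner_adj[of v "?q" "?q \<rhd> v"]
        by (metis app_simps(1) pos_adj power2_norm_eq_inner)
      also have "\<dots> \<le> norm v * norm (x n \<rhd> v)" by (rule norm_cauchy_schwarz)
      also have "\<dots> \<le> norm v * (b * norm v)"
        by (intro mult_left_mono order_trans[OF norm_app] mult_right_mono b norm_ge_zero)
      finally have "norm (?q \<rhd> v) \<le> sqrt (b * (norm v)\<^sup>2)"
        by (intro real_le_rsqrt) (simp add: power2_eq_square mult.commute mult.left_commute)
      then show "norm (?q \<rhd> v) \<le> sqrt b * norm v" by (simp add: real_sqrt_mult)
    qed
    then show "bounded (range (msqrt \<circ> x))" by (auto simp: bounded_iff)
    fix l r assume r: "strict_mono (r :: nat \<Rightarrow> nat)" and l: "((msqrt \<circ> x) \<circ> r) \<longlonglongrightarrow> l"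
    have lim': "(\<lambda>n. x (r n)) \<longlonglongrightarrow> p" using LIMSEQ_subseq_LIMSEQ[OF lim r] by (simp add: o_def)
    have l': "(\<lambda>n. msqrt (x (r n))) \<longlonglongrightarrow> l" using l by (simp add: o_def)
    have "msqrt p = l"
    proof (rule msqrt_unique)
      have "(\<lambda>n. adj (msqrt (x (r n)))) \<longlonglongrightarrow> adj l" by (intro tendsto_intros l')
      then show "adj l = l"
        using l' pos_adj[OF msqrt(1)[OF x]] LIMSEQ_unique by simp
      have "(\<lambda>n. msqrt (x (r n)) * msqrt (x (r n))) \<longlonglongrightarrow> l * l" by (intro tendsto_intros l')
      then show "l * l = p" using lim' msqrt(2)[OF x] LIMSEQ_unique by simp
      show "pos p" using p by simp
      fix v
      have "(\<lambda>n. v \<bullet> (msqrt (x (r n)) \<rhd> v)) \<longlonglongrightarrow> v \<bullet> (l \<rhd> v)" by (intro tendsto_intros l')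
      moreover have "0 \<le> v \<bullet> (msqrt (x (r n)) \<rhd> v)" for n
        using msqrt(1)[OF x[of "r n"]] unfolding pos_def by (cases "v = 0") (auto intro: less_imp_le)
      ultimately show "0 \<le> v \<bullet> (l \<rhd> v)" by (intro LIMSEQ_le_const) auto
    qed
    then show "l = msqrt p" by simp
  qed
qed

section \<open>Complex conjugation and the geometric mean with the inverse transpose\<close>

definition vcnj :: "complex^'n \<Rightarrow> complex^'n" where
  "vcnj x = (\<chi> i. cnj (x $ i))"

lemma vcnj_nth [simp]: "vcnj x $ i = cnj (x $ i)" by (simp add: vcnj_def)

lemma vcnj_vcnj [simp]: "vcnj (vcnj x) = x" by (vector vcnj_def)

lemma vcnj_eq_0 [simp]: "vcnj x = 0 \<longleftrightarrow> x = 0"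
proof -
  have "vcnj 0 = 0" by (vector vcnj_def)
  then show ?thesis by (metis vcnj_vcnj)
qed

lemma inner_vcnj: "vcnj x \<bullet> vcnj y = x \<bullet> y"
  by (simp add: inner_vec_def inner_complex_def)

text \<open>\<open>tr (adj A)\<close> is the entrywise complex conjugate of A.\<close>

lemma vcnj_app: "vcnj (A \<rhd> x) = tr (adj A) \<rhd> vcnj x"
  by transfer (simp add: vcnj_def matrix_vector_mult_def Finite_Cartesian_Product.transpose_def)

text \<open>For Hermitian A the transpose is the conjugate, so the quadratic form of
  \<open>tr A\<close> at x is that of A at the conjugate of x.\<close>

lemma pos_tr: assumes "pos A" shows "pos (tr A)"
proof -
  have "x \<bullet> (tr A \<rhd> x) = vcnj x \<bullet> (A \<rhd> vcnj x)" for x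
    using inner_vcnj[of "vcnj x" "A \<rhd> vcnj x"] vcnj_app[of A "vcnj x"] pos_adj[OF assms] by simp
  moreover have "adj (tr A) = tr A" using pos_adj[OF assms] tr_adj[of A] by simp
  ultimately show ?thesis using assms by (simp add: pos_def)
qed

text \<open>The geometric mean of \<open>h\<close> and the inverse of its transpose.\<close>

definition gmean :: "'n::finite cmat \<Rightarrow> 'n cmat" where
  "gmean h = msqrt h * msqrt (cinv (msqrt h) * tr (cinv h) * cinv (msqrt h)) * msqrt h"

lemma gmean_aux:
  assumes h: "pos h"
  defines "a \<equiv> msqrt h"
  defines "b \<equiv> cinv a"
  shows "pos a" "a * a = h" "a * b = 1" "b * a = 1" "pos b" "cinv h = b * b" "pos (b * tr (cinv h) * b)"
    "gmean h = a * msqrt (b * tr (cinv h) * b) * a"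
proof -
  show a: "pos a" "a * a = h" using msqrt(1,2)[OF h] by (auto simp: a_def)
  show b: "a * b = 1" "b * a = 1" "pos b" using cinv_pos[OF a(1)] by (auto simp: b_def)
  have "h * (b * b) = a * (a * b) * b" by (simp only: a(2)[symmetric] mult.assoc)
  then show "cinv h = b * b" using b by (intro cinv_eq) simp
  have "pos (adj b * tr (cinv h) * b)"
    using b by (intro pos_conj[of _ b a] pos_tr cinv_pos(3) h)
  then show "pos (b * tr (cinv h) * b)" using pos_adj[OF b(3)] by simp
  show "gmean h = a * msqrt (b * tr (cinv h) * b) * a" by (simp add: gmean_def a_def b_def)
qed

text \<open>The second equation is a Riccati equation, and with positivity it characterizes the mean
  (\<open>gmean_unique\<close>). Each symmetry of the mean below is obtained by exhibiting a second
  positive solution.\<close>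

lemma gmean:
  assumes h: "pos h"
  shows "pos (gmean h)" "gmean h * cinv h * gmean h = tr (cinv h)"
proof -
  note A = gmean_aux[OF h]
  define a where "a = msqrt h"
  define b where "b = cinv a"
  define k where "k = tr (cinv h)"
  define c where "c = msqrt (b * k * b)"
  note A = A[folded a_def, folded b_def, folded k_def, folded c_def]
  have c: "pos c" "c * c = b * k * b" using msqrt(1,2)[OF A(7)] by (auto simp: c_def)
  show "pos (gmean h)"
    using pos_conj[OF c(1) A(3)] pos_adj[OF A(1)] A(8) by simp
  have "gmean h * cinv h * gmean h = a * c * (a * b) * (b * a) * c * a"
    by (simp only: A(6,8) mult.assoc)
  also have "\<dots> = a * (c * c) * a" by (simp only: A(3,4) mult_1_right mult.assoc)
  also have "\<dots> = (a * b) * k * (b * a)" by (simp only: c mult.assoc)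
  finally show "gmean h * cinv h * gmean h = tr (cinv h)" by (simp add: A(3,4) k_def)
qed

text \<open>Congruence by the inverse of \<open>msqrt h\<close> turns the Riccati equation into the
  equation of an ordinary square root.\<close>

lemma gmean_unique:
  assumes h: "pos h" and m: "pos m" "m * cinv h * m = tr (cinv h)"
  shows "gmean h = m"
proof -
  note A = gmean_aux[OF h]
  define a where "a = msqrt h"
  define b where "b = cinv a"
  note A = A[folded a_def, folded b_def]
  have "pos (adj b * m * b)" by (rule pos_conj[OF m(1) A(4)])
  then have p: "pos (b * m * b)" using pos_adj[OF A(5)] by simp
  have "(b * m * b) * (b * m * b) = b * (m * (b * b) * m) * b" by (simp only: mult.assoc)
  then have "(b * m * b) * (b * m * b) = b * tr (cinv h) * b" using m(2) A(6) by simp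
  moreover have "0 \<le> x \<bullet> ((b * m * b) \<rhd> x)" for x
    using p unfolding pos_def by (cases "x = 0") (auto intro: less_imp_le)
  ultimately have "msqrt (b * tr (cinv h) * b) = b * m * b"
    using A(7) pos_adj[OF p] by (intro msqrt_unique)
  then have "gmean h = (a * b) * m * (b * a)" by (simp only: A(8) mult.assoc)
  then show ?thesis by (simp add: A)
qed

text \<open>Transposing the Riccati equation and cancelling \<open>tr m\<close> on both sides shows
  that the inverse transpose of the mean solves it as well.\<close>

lemma gmean_orthogonal:
  assumes h: "pos h"
  shows "tr (gmean h) * gmean h = 1"
proof -
  define m where "m = gmean h"
  have m: "pos m" "m * cinv h * m = tr (cinv h)" using gmean[OF h] by (auto simp: m_def)
  define n where "n = cinv (tr m)"
  have n: "tr m * n = 1" "n * tr m = 1" "pos n" using cinv_pos[OF pos_tr[OF m(1)]] by (auto simp: n_def)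
  have "cinv h = tr (m * cinv h * m)" by (simp add: m(2))
  also have "\<dots> = tr m * tr (cinv h) * tr m" by (simp add: mult.assoc)
  finally have "n * cinv h * n = n * (tr m * tr (cinv h) * tr m) * n" by (rule arg_cong)
  also have "\<dots> = (n * tr m) * tr (cinv h) * (tr m * n)" by (simp only: mult.assoc)
  finally have "n * cinv h * n = tr (cinv h)" by (simp add: n)
  then have "gmean h = n" by (rule gmean_unique[OF h n(3)])
  then show ?thesis using n(1) by (simp add: m_def)
qed

lemma gmean_fixed:
  assumes h: "pos h" and "tr h * h = 1"
  shows "gmean h = h"
proof -
  have "cinv h = tr h" using assms(2) cmat_left_inverse by (intro cinv_eq) blast
  moreover have "h * tr h = 1" using assms(2) cmat_left_inverse by blast
  ultimately show ?thesis by (intro gmean_unique h) simp_all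
qed

text \<open>For complex orthogonal g, the congruence taking h to \<open>adj g * h * g\<close>
  commutes with forming the inverse transpose, so it carries solutions of the Riccati equation to
  solutions.\<close>

lemma gmean_conj:
  assumes h: "pos h" and g: "tr g * g = 1"
  shows "gmean (adj g * h * g) = adj g * gmean h * g"
proof -
  have g': "g * tr g = 1" using g cmat_left_inverse by blast
  have ga: "tr (adj g) * adj g = 1" "adj g * tr (adj g) = 1"
    using arg_cong[OF g, of adj] arg_cong[OF g', of adj] by (simp_all add: tr_adj)
  have "(adj g * h * g) * (tr g * cinv h * tr (adj g)) = adj g * (h * ((g * tr g) * cinv h)) * tr (adj g)"
    by (simp only: mult.assoc)
  then have c: "cinv (adj g * h * g) = tr g * cinv h * tr (adj g)"
    by (intro cinv_eq) (simp add: g' ga cinv_pos[OF h])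
  show ?thesis
  proof (rule gmean_unique)
    show "pos (adj g * h * g)" by (rule pos_conj[OF h g'])
    show "pos (adj g * gmean h * g)" by (rule pos_conj[OF gmean(1)[OF h] g'])
    have "adj g * gmean h * g * cinv (adj g * h * g) * (adj g * gmean h * g)
      = adj g * (gmean h * ((g * tr g) * cinv h * ((tr (adj g) * adj g) * gmean h))) * g"
      unfolding c by (simp only: mult.assoc)
    also have "\<dots> = adj g * tr (cinv h) * g"
      using gmean(2)[OF h] by (simp add: g' ga mult.assoc)
    also have "\<dots> = tr (cinv (adj g * h * g))" unfolding c by (simp add: mult.assoc)
    finally show "adj g * gmean h * g * cinv (adj g * h * g) * (adj g * gmean h * g) = tr (cinv (adj g * h * g))" .
  qed
qed

lemma commute_cinv:
  fixes A B z :: "'n::finite cmat"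
  assumes "A * B = 1" "z * A = A * z"
  shows "z * B = B * z"
proof -
  have "B * A = 1" using assms(1) cmat_left_inverse by blast
  then have "z * B = B * (A * z) * B" by (simp add: mult.assoc[symmetric])
  also have "\<dots> = B * z * (A * B)" by (simp only: assms(2)[symmetric] mult.assoc)
  finally show ?thesis by (simp add: assms(1))
qed

text \<open>Skewness makes z commute with the inverse transpose too: transposing the relation
  between z and \<open>cinv h\<close> changes the sign on both sides. The square roots then inherit
  commutation from \<open>msqrt\<close>.\<close>

lemma gmean_commute:
  assumes h: "pos h" and z: "z * h = h * z" and skew: "tr z = - z"
  shows "z * gmean h = gmean h * z"
proof -
  note A = gmean_aux[OF h]
  define a where "a = msqrt h"
  define b where "b = cinv a"
  define k where "k = tr (cinv h)"
  define c where "c = msqrt (b * k * b)"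
  note A = A[folded a_def, folded b_def, folded k_def, folded c_def]
  have za: "z * a = a * z" unfolding a_def by (rule msqrt(3)[OF h z])
  have zb: "z * b = b * z" by (rule commute_cinv[OF A(3) za])
  have "z * cinv h = cinv h * z" by (rule commute_cinv[OF cinv_pos(1)[OF h] z])
  from arg_cong[OF this, of tr] have zk: "z * k = k * z" by (simp add: skew k_def)
  have "z * (b * k * b) = b * k * b * z"
  proof -
    have "z * (b * k * b) = (z * b) * k * b" by (simp only: mult.assoc)
    also have "\<dots> = b * (z * k) * b" by (simp only: zb mult.assoc)
    also have "\<dots> = b * k * (z * b)" by (simp only: zk mult.assoc)
    finally show ?thesis by (simp only: zb mult.assoc)
  qed
  then have zc: "z * c = c * z" unfolding c_def by (rule msqrt(3)[OF A(7)])
  have "z * (a * c * a) = (z * a) * c * a" by (simp only: mult.assoc)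
  also have "\<dots> = a * (z * c) * a" by (simp only: za mult.assoc)
  also have "\<dots> = a * c * (z * a)" by (simp only: zc mult.assoc)
  finally show ?thesis unfolding A(8) by (simp only: za mult.assoc)
qed

lemma continuous_on_cinv: "continuous_on {h. pos h} cinv"
  unfolding continuous_on_def
proof
  fix h :: "'n::finite cmat" assume "h \<in> {h. pos h}"
  then have h: "pos h" by simp
  show "(cinv \<longlongrightarrow> cinv h) (at h within {h. pos h})"
    by (rule tendsto_inverse_cmat[OF tendsto_ident_at _ cinv_pos(1)[OF h]])
      (simp add: eventually_at_filter cinv_pos(1))
qed

lemma continuous_on_gmean: "continuous_on {h :: 'n::finite cmat. pos h} gmean"
proof -
  have a: "continuous_on {h. pos h} (msqrt :: 'n::finite cmat \<Rightarrow> _)" by (rule continuous_on_msqrt)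
  have "continuous_on {h. pos h} (\<lambda>h :: 'n cmat. cinv (msqrt h))"
    by (rule continuous_on_compose2[OF continuous_on_cinv a]) (auto simp: msqrt(1))
  moreover have "continuous_on {h. pos h} (\<lambda>h :: 'n cmat. cinv (msqrt h) * tr (cinv h) * cinv (msqrt h))"
    by (intro continuous_intros calculation continuous_on_cinv)
  then have "continuous_on {h. pos h} (\<lambda>h :: 'n cmat. msqrt (cinv (msqrt h) * tr (cinv h) * cinv (msqrt h)))"
    by (rule continuous_on_compose2[OF continuous_on_msqrt]) (auto intro: gmean_aux(7))
  ultimately show ?thesis unfolding gmean_def by (intro continuous_intros a)
qed

text \<open>Makes an equation between products usable for rewriting inside a right-nested
  product.\<close>

lemma mult_assoc_rule: "a * b = c \<Longrightarrow> a * (b * z) = c * (z :: 'a::semigroup_mult)"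
  by (simp add: mult.assoc[symmetric])

section \<open>The complex special orthogonal group and its compact subgroup\<close>

definition SO :: "'n::finite cmat set" where
  "SO = {g. tr g * g = 1 \<and> Determinants.det (mat_of g) = 1}"

text \<open>Being orthogonal and unitary at once means being real: this is the compact group
  \<open>SOn\<close> (\<open>toJ_SOr\<close>).\<close>

definition SOr :: "'n::finite cmat set" where
  "SOr = {g \<in> SO. adj g * g = 1}"

lemma SO_D: "g \<in> SO \<Longrightarrow> tr g * g = 1" "g \<in> SO \<Longrightarrow> g * tr g = 1"
  using cmat_left_inverse by (auto simp: SO_def)

lemma SO_cancel: "g \<in> SO \<Longrightarrow> tr g * (g * z) = z" "g \<in> SO \<Longrightarrow> g * (tr g * z) = z"
  by (simp_all add: mult.assoc[symmetric] SO_D)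

lemma det_mat_of_mult: "Determinants.det (mat_of (A * B)) = Determinants.det (mat_of A) * Determinants.det (mat_of B)"
  by (simp add: times_cmat.rep_eq Determinants.det_mul)

lemma det_mat_of_tr: "Determinants.det (mat_of (tr A)) = Determinants.det (mat_of A)"
  by (simp add: tr.rep_eq Determinants.det_transpose)

lemma det_mat_of_one: "Determinants.det (mat_of 1) = 1"
  by (simp add: one_cmat.rep_eq)

lemma SO_one: "1 \<in> SO" by (simp add: SO_def det_mat_of_one)

lemma SO_mult: "g \<in> SO \<Longrightarrow> h \<in> SO \<Longrightarrow> g * h \<in> SO"
  by (simp add: SO_def det_mat_of_mult mult.assoc mult_assoc_rule[of "tr g" g])

lemma SO_tr: "g \<in> SO \<Longrightarrow> tr g \<in> SO"
  using SO_D(2)[of g] by (simp add: SO_def det_mat_of_tr)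

text \<open>The determinant of an orthogonal matrix squares to 1. Matrices with an orthogonal square
  root thus lie in \<open>SO\<close> without any computation of a determinant.\<close>

lemma SO_square:
  assumes "tr g * g = 1" shows "g * g \<in> SO"
proof -
  have "Determinants.det (mat_of (tr g * g)) = 1" by (simp add: assms det_mat_of_one)
  then have "Determinants.det (mat_of g) * Determinants.det (mat_of g) = 1"
    by (simp add: det_mat_of_mult det_mat_of_tr)
  then show ?thesis
    using assms by (simp add: SO_def det_mat_of_mult mult.assoc mult_assoc_rule[OF assms])
qed

text \<open>A positive orthogonal p equals its own inverse transpose, so the inverse transpose of
  its root is again a positive root of p.\<close>

lemma msqrt_orthogonal:
  assumes p: "pos p" "tr p * p = 1"
  shows "tr (msqrt p) * msqrt p = 1"
proof -
  define q where "q = msqrt p"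
  have q: "pos q" "q * q = p" using msqrt(1,2)[OF p(1)] by (auto simp: q_def)
  define r where "r = cinv (tr q)"
  have r: "tr q * r = 1" "r * tr q = 1" "pos r" using cinv_pos[OF pos_tr[OF q(1)]] by (auto simp: r_def)
  have "tr p * (r * r) = tr q * (tr q * r) * r" by (simp add: q(2)[symmetric] mult.assoc)
  then have "tr p * (r * r) = 1" using r by simp
  then have "p * (tr p * (r * r)) = p" by simp
  moreover have "p * tr p = 1" using p(2) cmat_left_inverse by blast
  ultimately have "r * r = p" by (simp add: mult_assoc_rule)
  moreover have "0 \<le> x \<bullet> (r \<rhd> x)" for x
    using r(3) unfolding pos_def by (cases "x = 0") (auto intro: less_imp_le)
  ultimately have "q = r" unfolding q_def using pos_adj[OF r(3)] p(1) by (intro msqrt_unique)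
  then show ?thesis using r(1) by (simp add: q_def)
qed

lemma pos_orthogonal_SO: "pos p \<Longrightarrow> tr p * p = 1 \<Longrightarrow> p \<in> SO"
  using SO_square[OF msqrt_orthogonal] msqrt(2) by metis

lemma continuous_det_mat_of: "continuous_on UNIV (\<lambda>A :: 'n::finite cmat. Determinants.det (mat_of A))"
proof -
  have "continuous_on UNIV (\<lambda>A :: 'n cmat. mat_of A $ i $ j)" for i j
    unfolding entry_app
    by (rule linear_continuous_on[OF bounded_linear_compose[OF bounded_linear_vec_nth bounded_linear_app_left]])
  then show ?thesis unfolding Determinants.det_def by (intro continuous_intros)
qed

lemma tendsto_det_mat_of:
  fixes f :: "'b \<Rightarrow> 'n::finite cmat"
  assumes "(f \<longlongrightarrow> A) F"
  shows "((\<lambda>x. Determinants.det (mat_of (f x))) \<longlongrightarrow> Determinants.det (mat_of A)) F"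
proof -
  have "isCont (\<lambda>A :: 'n cmat. Determinants.det (mat_of A)) A"
    using continuous_det_mat_of[where 'n='n] by (simp add: continuous_on_eq_continuous_at)
  from isCont_tendsto_compose[OF this assms] show ?thesis .
qed

text \<open>On orthogonal matrices the determinant only takes the values 1 and -1, and here it tends
  to 1.\<close>

lemma eventually_SO:
  fixes f :: "'b \<Rightarrow> 'n::finite cmat"
  assumes "(f \<longlongrightarrow> 1) F" "\<forall>\<^sub>F x in F. tr (f x) * f x = 1"
  shows "\<forall>\<^sub>F x in F. f x \<in> SO"
proof -
  have "((\<lambda>x. Determinants.det (mat_of (f x))) \<longlongrightarrow> 1) F"
    using tendsto_det_mat_of[OF assms(1)] by (simp add: det_mat_of_one)
  then have "\<forall>\<^sub>F x in F. dist (Determinants.det (mat_of (f x))) 1 < 1"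
    by (rule tendstoD) simp
  with assms(2) show ?thesis
  proof eventually_elim
    case (elim x)
    have "Determinants.det (mat_of (tr (f x) * f x)) = 1" by (simp add: elim det_mat_of_one)
    then have "(Determinants.det (mat_of (f x)))\<^sup>2 = 1"
      by (simp add: det_mat_of_mult det_mat_of_tr power2_eq_square)
    then have "Determinants.det (mat_of (f x)) = 1 \<or> Determinants.det (mat_of (f x)) = -1"
      by (simp add: power2_eq_1_iff)
    moreover have "dist (-1) (1::complex) = 2" by (simp add: dist_norm)
    ultimately show ?case using elim by (auto simp: SO_def)
  qed
qed

section \<open>Orthogonal gradings\<close>

text \<open>A complete system of idempotents; the condition on \<open>tr\<close> says that the
  components of degrees i and j are orthogonal for the bilinear form unless i + j = 0.\<close>

definition grading :: "int \<Rightarrow> (int \<Rightarrow> 'n::finite cmat) \<Rightarrow> bool" where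
  "grading m R \<longleftrightarrow> (\<forall>i j. R i * R j = (if i = j then R i else 0)) \<and> (\<Sum>i\<in>{-m..m}. R i) = 1 \<and>
     (\<forall>i. tr (R i) = R (- i))"

text \<open>The one-parameter torus of the grading. Since degrees i and -i are paired, its transpose
  is its inverse (\<open>tr_scal\<close>).\<close>

definition scal :: "int \<Rightarrow> (int \<Rightarrow> 'n::finite cmat) \<Rightarrow> real \<Rightarrow> 'n cmat" where
  "scal m R s = (\<Sum>i\<in>{-m..m}. (s powi i) *\<^sub>R R i)"

text \<open>For s > 0, and A without components of degree below d, this is conjugation by the torus
  up to a scalar (\<open>resc_pos\<close>). Unlike that conjugation it is polynomial in s and so
  makes sense at s = 0, where exactly the component of degree d remains.\<close>

definition resc :: "int \<Rightarrow> (int \<Rightarrow> 'n::finite cmat) \<Rightarrow> int \<Rightarrow> real \<Rightarrow> 'n cmat \<Rightarrow> 'n cmat" where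
  "resc m R d s A = (\<Sum>i\<in>{-m..m}. \<Sum>j\<in>{-m..m}. (if j < i + d then 0 else s ^ nat (j - i - d)) *\<^sub>R (R j * A * R i))"

context
  fixes m :: int and R :: "int \<Rightarrow> 'n::finite cmat"
  assumes grading: "grading m R"
begin

lemma R_mult: "R i * R j = (if i = j then R i else 0)" using grading by (simp add: grading_def)
lemma R_mult2: "R i * (R j * z) = (if i = j then R i * z else 0)" by (simp add: mult.assoc[symmetric] R_mult)
lemma R_sum: "(\<Sum>i\<in>{-m..m}. R i) = 1" using grading by (simp add: grading_def)
lemma R_tr: "tr (R i) = R (- i)" using grading by (simp add: grading_def)

lemma R_outside: "i \<notin> {-m..m} \<Longrightarrow> R i = 0"
proof -
  assume i: "i \<notin> {-m..m}"
  have "R i = R i * (\<Sum>j\<in>{-m..m}. R j)" by (simp add: R_sum)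
  also have "\<dots> = (\<Sum>j\<in>{-m..m}. 0)" unfolding sum_distrib_left
    by (intro sum.cong refl) (use i in \<open>auto simp: R_mult\<close>)
  finally show ?thesis by simp
qed

lemma sum_R_right: "(\<Sum>a\<in>{-m..m}. F a * R a) * R i = F i * R i"
proof -
  have "(\<Sum>a\<in>{-m..m}. F a * R a) * R i = (\<Sum>a\<in>{-m..m}. if a = i then F i * R i else 0)"
    unfolding sum_distrib_right by (intro sum.cong refl) (simp add: mult.assoc R_mult)
  then show ?thesis using R_outside[of i] by simp
qed

lemma sum_R_left: "R i * (\<Sum>a\<in>{-m..m}. R a * F a) = R i * F i"
proof -
  have "R i * (\<Sum>a\<in>{-m..m}. R a * F a) = (\<Sum>a\<in>{-m..m}. if a = i then R i * F i else 0)"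
    unfolding sum_distrib_left by (intro sum.cong refl) (simp add: mult.assoc[symmetric] R_mult)
  then show ?thesis using R_outside[of i] by simp
qed

lemma grading_ext_right: assumes "\<And>i. A * R i = B * R i" shows "A = B"
proof -
  have "A * (\<Sum>i\<in>{-m..m}. R i) = B * (\<Sum>i\<in>{-m..m}. R i)"
    unfolding sum_distrib_left using assms by simp
  then show ?thesis by (simp add: R_sum)
qed

lemma grading_ext_left: assumes "\<And>i. R i * A = R i * B" shows "A = B"
proof -
  have "(\<Sum>i\<in>{-m..m}. R i) * A = (\<Sum>i\<in>{-m..m}. R i) * B"
    unfolding sum_distrib_right using assms by simp
  then show ?thesis by (simp add: R_sum)
qed

lemma grading_ext: assumes "\<And>i j. R j * A * R i = R j * B * R i" shows "A = B"
  by (rule grading_ext_right, rule grading_ext_left) (use assms in \<open>simp add: mult.assoc\<close>)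

lemma scal_R: "scal m R s * R i = (s powi i) *\<^sub>R R i" "R i * scal m R s = (s powi i) *\<^sub>R R i"
  using sum_R_right[of "\<lambda>i. (s powi i) *\<^sub>R 1" i] sum_R_left[of i "\<lambda>i. (s powi i) *\<^sub>R 1"]
  by (simp_all add: scal_def)

lemma scal_mult: "scal m R s * scal m R t = scal m R (s * t)"
  by (rule grading_ext_right) (simp add: mult.assoc scal_R power_int_mult_distrib mult.commute)

lemma scal_one: "scal m R 1 = 1"
  by (rule grading_ext_right) (simp add: scal_R)

lemma tr_scal: "tr (scal m R s) = scal m R (1 / s)"
proof (rule grading_ext_right)
  fix i
  have "tr (scal m R s) * R i = tr (R (- i) * scal m R s)" by (simp add: R_tr)
  then show "tr (scal m R s) * R i = scal m R (1 / s) * R i"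
    by (simp add: scal_R R_tr power_int_minus power_int_inverse flip: inverse_eq_divide)
qed

lemma scal_SO: assumes "0 < s" shows "scal m R s \<in> SO"
proof -
  have "tr (scal m R (sqrt s)) * scal m R (sqrt s) = 1"
    unfolding tr_scal scal_mult using assms by (simp add: scal_one)
  from SO_square[OF this] show ?thesis using assms by (simp add: scal_mult)
qed

lemma resc_component: "R j * resc m R d s A * R i = (if j < i + d then 0 else s ^ nat (j - i - d)) *\<^sub>R (R j * A * R i)"
proof -
  define c where "c i j = (if j < i + d then 0 else s ^ nat (j - i - d))" for i j
  have "resc m R d s A = (\<Sum>a\<in>{-m..m}. (\<Sum>b\<in>{-m..m}. R b * (c a b *\<^sub>R A)) * R a)"
    unfolding resc_def c_def sum_distrib_right by (intro sum.cong refl) simp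
  then have "R j * resc m R d s A * R i = (R j * (\<Sum>b\<in>{-m..m}. R b * (c i b *\<^sub>R A))) * R i"
    by (simp only: mult.assoc sum_R_right)
  also have "\<dots> = R j * (c i j *\<^sub>R A) * R i" by (simp only: sum_R_left)
  finally show ?thesis by (simp add: c_def)
qed

lemma resc_pos:
  assumes s: "0 < s" and A: "\<And>i j. j < i + d \<Longrightarrow> R j * A * R i = 0"
  shows "resc m R d s A = (s powi (- d)) *\<^sub>R (scal m R s * A * scal m R (1 / s))"
proof (rule grading_ext)
  fix i j
  have "R j * ((s powi (- d)) *\<^sub>R (scal m R s * A * scal m R (1 / s))) * R i
      = (s powi (- d)) *\<^sub>R ((R j * scal m R s) * A * (scal m R (1 / s) * R i))"
    by (simp add: mult.assoc)
  also have "\<dots> = (s powi (- d) * (s powi j * (1 / s) powi i)) *\<^sub>R (R j * A * R i)"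
    by (simp add: scal_R)
  also have "s powi (- d) * (s powi j * (1 / s) powi i) = s powi (j - i - d)"
  proof -
    have e: "(1 / s) powi i = s powi (- i)"
      by (simp add: power_int_minus power_int_inverse flip: inverse_eq_divide)
    show ?thesis unfolding e using s power_int_add[of s "- d" "j + - i"] power_int_add[of s j "- i"] by simp
  qed
  also have "s powi (j - i - d) *\<^sub>R (R j * A * R i) = R j * resc m R d s A * R i"
    using A[of j i] by (auto simp: resc_component power_int_def)
  finally show "R j * resc m R d s A * R i = R j * ((s powi (- d)) *\<^sub>R (scal m R s * A * scal m R (1 / s))) * R i" ..
qed

lemma resc_one: "(\<And>i j. j < i + d \<Longrightarrow> R j * A * R i = 0) \<Longrightarrow> resc m R d 1 A = A"
  by (rule grading_ext) (simp add: resc_component)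

lemma resc_0_component: "R j * resc m R d 0 A * R i = (if j = i + d then R j * A * R i else 0)"
  by (simp add: resc_component)

text \<open>Conjugation by the torus does not change the determinant of u, and for s tending to 0 it
  moves u to its part of degree 0, the identity.\<close>

lemma unipotent_SO:
  assumes u: "tr u * u = 1" and A: "\<And>i j. j < i \<Longrightarrow> R j * u * R i = 0" and d: "\<And>i. R i * u * R i = R i"
  shows "u \<in> SO"
proof -
  have "resc m R 0 0 u = 1"
    by (rule grading_ext) (auto simp: resc_0_component d R_mult)
  moreover have "continuous_on UNIV (\<lambda>s::real. if j < i then 0 else s ^ n)" for i j :: int and n
    by (cases "j < i") (simp_all add: continuous_on_power continuous_on_id)
  then have "continuous_on UNIV (\<lambda>s. resc m R 0 s u)"
    unfolding resc_def by (intro continuous_intros)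
  then have "continuous (at 0 within {0<..}) (\<lambda>s. resc m R 0 s u)"
    by (meson UNIV_I continuous_on_eq_continuous_within continuous_within_subset subset_UNIV)
  then have "((\<lambda>s. resc m R 0 s u) \<longlongrightarrow> resc m R 0 0 u) (at_right 0)"
    by (simp add: continuous_within)
  ultimately have "((\<lambda>s. resc m R 0 s u) \<longlongrightarrow> 1) (at_right 0)" by simp
  from tendsto_det_mat_of[OF this]
  have "((\<lambda>s. Determinants.det (mat_of (resc m R 0 s u))) \<longlongrightarrow> 1) (at_right 0)"
    by (simp add: det_mat_of_one)
  moreover have "\<forall>\<^sub>F s in at_right 0. Determinants.det (mat_of (resc m R 0 s u)) = Determinants.det (mat_of u)"
    unfolding eventually_at_right_field
  proof (intro exI[of _ 1] conjI allI impI)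
    fix s :: real assume s: "0 < s" "s < 1"
    have "resc m R 0 s u = scal m R s * u * scal m R (1 / s)"
      using resc_pos[OF s(1), of 0 u] A by simp
    moreover have "scal m R s \<in> SO" "scal m R (1 / s) \<in> SO" using s by (auto intro: scal_SO)
    ultimately show "Determinants.det (mat_of (resc m R 0 s u)) = Determinants.det (mat_of u)"
      by (simp add: det_mat_of_mult SO_def)
  qed simp
  ultimately have "((\<lambda>s::real. Determinants.det (mat_of u)) \<longlongrightarrow> 1) (at_right 0)"
    by (rule Lim_transform_eventually)
  then have "Determinants.det (mat_of u) = 1" by (simp add: tendsto_const_iff)
  then show ?thesis using u by (simp add: SO_def)
qed

end

section \<open>Openness of the orbit map\<close>

text \<open>On \<open>SO\<close> this is the adjoint action. With \<open>tr g\<close> in place of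
  the inverse it is polynomial in g, hence visibly continuous.\<close>

definition conj_act :: "'n::finite cmat \<Rightarrow> 'n cmat \<Rightarrow> 'n cmat" where
  "conj_act g A = g * A * tr g"

lemma conj_act_mult: "conj_act (g * h) A = conj_act g (conj_act h A)"
  by (simp add: conj_act_def mult.assoc)

lemma conj_act_inverse: "g \<in> SO \<Longrightarrow> conj_act (tr g) (conj_act g A) = A"
  by (simp add: conj_act_def mult.assoc SO_cancel SO_D)

lemma conj_act_eq_iff:
  assumes "g \<in> SO" shows "conj_act g A = B \<longleftrightarrow> g * A = B * g"
proof
  assume "conj_act g A = B"
  then have "conj_act g A * g = B * g" by simp
  then show "g * A = B * g" by (simp add: conj_act_def mult.assoc SO_D assms)
next
  assume "g * A = B * g"
  then have "g * A * tr g = B * g * tr g" by simp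
  then show "conj_act g A = B" by (simp add: conj_act_def mult.assoc SO_D assms)
qed

text \<open>D is the orthogonal complement of the commutant of X; the commutator with X is injective
  there, hence bounded below. The last clause is the dimension formula in a form that survives an
  injective linear map, which will be left multiplication by an intertwiner.\<close>

lemma commutant_complement_bound:
  fixes X :: "'n::finite cmat"
  shows "\<exists>D c. subspace D \<and> c > 0 \<and>
    (\<forall>T\<in>D. c * norm (Cmat T) \<le> norm (Cmat T * X - X * Cmat T)) \<and>
    (\<forall>f :: complex^'n^'n \<Rightarrow> complex^'n^'n. linear f \<longrightarrow> (\<forall>S. f S = 0 \<longrightarrow> S = 0) \<longrightarrow>
      dim (f ` {S. Cmat S * X = X * Cmat S}) + dim D = DIM(complex^'n^'n))"
proof -
  define N where "N = {S :: complex^'n^'n. Cmat S * X = X * Cmat S}"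
  define f where "f S = Cmat S * X - X * Cmat S" for S
  define F where "F = (\<lambda>S. mat_of (f S))"
  have f: "bounded_linear f"
    unfolding f_def
    by (intro bounded_linear_sub bounded_linear_compose[OF bounded_linear_mult_left bounded_linear_Cmat]
        bounded_linear_compose[OF bounded_linear_mult_right bounded_linear_Cmat])
  have F: "bounded_linear F" unfolding F_def by (rule bounded_linear_compose[OF bounded_linear_mat_of f])
  have N: "N = {S. f S = 0}" by (simp add: N_def f_def)
  have subN: "subspace N"
    unfolding N using f by (intro subspaceI) (simp_all add: linear_simps)
  define D where "D = {y. \<forall>x\<in>N. real_inner_class.orthogonal x y}"
  have subD: "subspace D" unfolding D_def by (rule subspace_orthogonal_to_vectors)
  have inj: "\<forall>x\<in>D. F x = 0 \<longrightarrow> x = 0"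
  proof (intro ballI impI)
    fix x assume x: "x \<in> D" "F x = 0"
    then have "f x = 0" by (metis F_def mat_of_inject zero_cmat.rep_eq)
    then have "x \<in> N" by (simp add: N)
    then have "real_inner_class.orthogonal x x" using x by (simp add: D_def)
    then show "x = 0" by (simp add: Linear_Algebra.orthogonal_self)
  qed
  obtain e where e: "e > 0" "\<forall>x\<in>D. norm (F x) \<ge> e * norm x"
    using injective_imp_isometric[OF closed_subspace[OF subD] subD F inj] by blast
  obtain K where K: "K > 0" "\<And>A :: 'n cmat. norm (mat_of A) \<le> norm A * K"
    using bounded_linear.pos_bounded[OF bounded_linear_mat_of] by blast
  obtain K' where K': "K' > 0" "\<And>A :: complex^'n^'n. norm (Cmat A) \<le> norm A * K'"
    using bounded_linear.pos_bounded[OF bounded_linear_Cmat] by blast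
  show ?thesis
  proof (intro exI conjI ballI allI impI)
    show "subspace D" by (rule subD)
    show "e / (K * K') > 0" using e K K' by simp
    show "e / (K * K') * norm (Cmat T) \<le> norm (Cmat T * X - X * Cmat T)" if "T \<in> D" for T
    proof -
      have "e * norm (Cmat T) \<le> e * (norm T * K')" using K'(2) e by (intro mult_left_mono) auto
      also have "\<dots> = (e * norm T) * K'" by simp
      also have "\<dots> \<le> norm (F T) * K'" using e that K' by (intro mult_right_mono) auto
      also have "\<dots> \<le> (norm (f T) * K) * K'" unfolding F_def using K(2) K'(1) by (intro mult_right_mono) auto
      finally show ?thesis using K K' by (simp add: f_def field_simps)
    qed
    fix h :: "complex^'n^'n \<Rightarrow> complex^'n^'n" assume h: "linear h" "\<forall>S. h S = 0 \<longrightarrow> S = 0"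
    have "inj h" using h linear_injective_0 by blast
    then have "dim (h ` N) = dim N"
      using h(1) dim_image_eq by (metis inj_on_subset subset_UNIV)
    moreover have "dim D + dim N = DIM(complex^'n^'n)"
      using dim_subspace_orthogonal_to_vectors[OF subN subspace_UNIV] by (simp add: D_def)
    ultimately show "dim (h ` {S. Cmat S * X = X * Cmat S}) + dim D = DIM(complex^'n^'n)"
      by (simp add: N_def)
  qed
qed

text \<open>The given \<open>g k\<close> need not be close to 1; they only guarantee that the space
  of intertwiners from X to \<open>A k\<close> is as large as the commutant of X. For
  \<open>A k\<close> near X this space meets D trivially, so by dimension it is a complement of D,
  and 1 is the sum of an intertwiner S and some T in D that turns out to be small.\<close>

lemma intertwiner_near_one:
  fixes X :: "'n::finite cmat" and A :: "nat \<Rightarrow> 'n cmat"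
  assumes A: "A \<longlonglongrightarrow> X" "\<And>k. g k * X = A k * g k" "\<And>k. h k * g k = 1"
  obtains S where "S \<longlonglongrightarrow> 1" "\<forall>\<^sub>F k in sequentially. S k * X = A k * S k"
proof -
  obtain D c where D: "subspace D" "c > 0"
    and D3: "\<forall>T\<in>D. c * norm (Cmat T) \<le> norm (Cmat T * X - X * Cmat T)"
    and D4: "\<forall>f :: complex^'n^'n \<Rightarrow> complex^'n^'n. linear f \<longrightarrow> (\<forall>S. f S = 0 \<longrightarrow> S = 0) \<longrightarrow>
      dim (f ` {S. Cmat S * X = X * Cmat S}) + dim D = DIM(complex^'n^'n)"
    using commutant_complement_bound[of X] by blast
  have ex: "\<exists>S. S * X = A k * S \<and> c / 2 * norm (1 - S) \<le> norm (A k - X)" if d: "norm (A k - X) \<le> c / 2" "norm (A k - X) < c" for k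
  proof -
    define f where "f S = mat_of (g k * Cmat S)" for S :: "complex^'n^'n"
    have f: "linear f" unfolding f_def
      by (intro bounded_linear.linear bounded_linear_compose[OF bounded_linear_mat_of]
          bounded_linear_compose[OF bounded_linear_mult_right bounded_linear_Cmat])
    have f0: "S = 0" if "f S = 0" for S
    proof -
      have "g k * Cmat S = 0" using that unfolding f_def by (metis mat_of_inject zero_cmat.rep_eq)
      then have "h k * g k * Cmat S = 0" by (simp add: mult.assoc)
      then have "Cmat S = 0" using A(3) by simp
      then show "S = 0" by (metis Cmat_inverse UNIV_I zero_cmat.rep_eq)
    qed
    define M where "M = f ` {S. Cmat S * X = X * Cmat S}"
    have subM: "subspace M"
      unfolding M_def
    proof (rule linear_subspace_image[OF f])
      have bl: "bounded_linear (\<lambda>S. Cmat S * X - X * Cmat S)"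
        by (intro bounded_linear_sub bounded_linear_compose[OF bounded_linear_mult_left bounded_linear_Cmat]
          bounded_linear_compose[OF bounded_linear_mult_right bounded_linear_Cmat])
      have "subspace {S. Cmat S * X - X * Cmat S = 0}"
        using linear_subspace_kernel[OF bounded_linear.linear[OF bl]] .
      then show "subspace {S. Cmat S * X = X * Cmat S}" by simp
    qed
    have M: "Cmat S * X = A k * Cmat S" if SM: "S \<in> M" for S
    proof -
      obtain T where T: "Cmat T * X = X * Cmat T" "S = f T" using SM unfolding M_def by blast
      then have S: "Cmat S = g k * Cmat T" by (simp add: f_def mat_of_inverse)
      then have "Cmat S * X = (g k * X) * Cmat T" by (simp add: mult.assoc T(1))
      also have "\<dots> = A k * Cmat S" by (simp add: A(2) S mult.assoc)
      finally show ?thesis .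
    qed
    have "M \<inter> D = {0}"
    proof
      show "{0} \<subseteq> M \<inter> D" using subM D(1) by (simp add: subspace_0)
      show "M \<inter> D \<subseteq> {0}"
      proof
        fix T assume T: "T \<in> M \<inter> D"
        have "Cmat T * X - X * Cmat T = (A k - X) * Cmat T"
          using M[of T] T by (simp add: left_diff_distrib)
        then have "c * norm (Cmat T) \<le> norm (A k - X) * norm (Cmat T)"
          using bspec[OF D3, of T] T norm_mult_ineq[of "A k - X" "Cmat T"] by simp
        moreover have "norm (A k - X) * norm (Cmat T) < c * norm (Cmat T)" if "Cmat T \<noteq> 0"
          using d(2) that by (intro mult_strict_right_mono) simp_all
        ultimately have "Cmat T = 0" by fastforce
        then show "T \<in> {0}" by (metis Cmat_inverse UNIV_I singletonI zero_cmat.rep_eq)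
      qed
    qed
    moreover have "dim M + dim D = DIM(complex^'n^'n)" unfolding M_def using D4 f f0 by blast
    ultimately have "dim {x + y |x y. x \<in> M \<and> y \<in> D} = DIM(complex^'n^'n)"
      using dim_sums_Int[OF subM D(1)] by simp
    then have "span {x + y |x y. x \<in> M \<and> y \<in> D} = UNIV" by (simp only: dim_eq_full)
    moreover have "span {x + y |x y. x \<in> M \<and> y \<in> D} = {x + y |x y. x \<in> M \<and> y \<in> D}"
      using subspace_sums[OF subM D(1)] by (simp only: span_eq_iff)
    ultimately have "mat_of (1::'n cmat) \<in> {x + y |x y. x \<in> M \<and> y \<in> D}" by simp
    then obtain S T where ST: "mat_of (1::'n cmat) = S + T" "S \<in> M" "T \<in> D" by blast
    have "(1::'n cmat) = Cmat (S + T)" by (metis ST(1) mat_of_inverse)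
    then have ST1: "1 = Cmat S + Cmat T" by (simp add: linear_simps(1)[OF bounded_linear_Cmat])
    let ?S = "Cmat S" and ?T = "Cmat T"
    have SX: "?S * X = A k * ?S" by (rule M[OF ST(2)])
    have T: "?T = 1 - ?S" using ST1 by (simp add: algebra_simps)
    \<comment> \<open>The identity commutes with X, so the commutator of T is minus that of S, which
      is small because S intertwines X with the nearby \<open>A k\<close>. The lower bound on D then
      makes T itself small.\<close>
    have "?T * X - X * ?T = (X * ?S) - ?S * X" by (simp add: T algebra_simps)
    also have "\<dots> = (X - A k) * ?S" by (simp add: SX algebra_simps)
    finally have "c * norm ?T \<le> norm ((X - A k) * ?S)" using bspec[OF D3 ST(3)] by simp
    also have "\<dots> \<le> norm (A k - X) * norm ?S"
      by (metis norm_mult_ineq norm_minus_commute)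
    also have "norm ?S \<le> 1 + norm ?T"
    proof -
      have "?S = 1 - ?T" using T by simp
      then show ?thesis using norm_triangle_ineq4[of 1 ?T] by simp
    qed
    then have "norm (A k - X) * norm ?S \<le> norm (A k - X) * (1 + norm ?T)" by (rule mult_left_mono) simp
    also have "\<dots> \<le> norm (A k - X) + c / 2 * norm ?T"
      using mult_right_mono[OF d(1), of "norm ?T"] by (simp add: algebra_simps)
    finally have "c / 2 * norm (1 - ?S) \<le> norm (A k - X)" by (simp add: T)
    then show ?thesis using SX by blast
  qed
  define S where "S k = (SOME S. S * X = A k * S \<and> c / 2 * norm (1 - S) \<le> norm (A k - X))" for k
  have lim: "(\<lambda>k. norm (A k - X)) \<longlonglongrightarrow> 0" using A(1) by (simp add: LIM_zero_iff tendsto_norm_zero_iff)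
  have "\<forall>\<^sub>F k in sequentially. norm (A k - X) < c / 2"
    by (rule order_tendstoD(2)[OF lim]) (use D(2) in simp)
  then have S: "\<forall>\<^sub>F k in sequentially. S k * X = A k * S k \<and> c / 2 * norm (1 - S k) \<le> norm (A k - X)"
  proof eventually_elim
    case (elim k)
    then have "norm (A k - X) \<le> c / 2" "norm (A k - X) < c" using D(2) by auto
    from someI_ex[OF ex[OF this]] show ?case unfolding S_def .
  qed
  have "(\<lambda>k. S k - 1) \<longlonglongrightarrow> 0"
  proof (rule Lim_null_comparison)
    show "\<forall>\<^sub>F k in sequentially. norm (S k - 1) \<le> norm (A k - X) * (2 / c)"
      using S by eventually_elim (use D(2) in \<open>simp add: field_simps norm_minus_commute\<close>)
    show "(\<lambda>k. norm (A k - X) * (2 / c)) \<longlonglongrightarrow> 0" by (rule tendsto_mult_left_zero[OF lim])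
  qed
  then have "S \<longlonglongrightarrow> 1" by (simp add: LIM_zero_iff)
  moreover have "\<forall>\<^sub>F k in sequentially. S k * X = A k * S k" using S by eventually_elim simp
  ultimately show thesis by (rule that)
qed

text \<open>An intertwiner S near 1 is made orthogonal by dividing it on the right by a square root
  of \<open>tr S * S\<close>. As X and \<open>A k\<close> are skew, \<open>tr S * S\<close> commutes
  with X, and so does the root, hence the quotient still intertwines. This product is not Hermitian
  in general, so the root near 1 from \<open>sqrt_exists\<close> is used instead of
  \<open>msqrt\<close>.\<close>

lemma orbit_sequence_lift:
  fixes X :: "'n::finite cmat"
  assumes skew: "tr X = - X" and A: "A \<longlonglongrightarrow> X" "\<And>k. A k \<in> (\<lambda>g. conj_act g X) ` SO"
  obtains g where "g \<longlonglongrightarrow> 1" "\<forall>\<^sub>F k in sequentially. g k \<in> SO \<and> A k = conj_act (g k) X"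
proof -
  have "\<exists>g. g \<in> SO \<and> A k = conj_act g X" for k using A(2)[of k] by auto
  then obtain g0 where g0: "\<And>k. g0 k \<in> SO" "\<And>k. A k = conj_act (g0 k) X" by metis
  have skA: "tr (A k) = - A k" for k unfolding g0(2) by (simp add: conj_act_def skew mult.assoc)
  obtain S where S: "S \<longlonglongrightarrow> 1" "\<forall>\<^sub>F k in sequentially. S k * X = A k * S k"
  proof (rule intertwiner_near_one[OF A(1), of g0 "\<lambda>k. tr (g0 k)"])
    show "g0 k * X = A k * g0 k" for k using g0 conj_act_eq_iff by metis
    show "tr (g0 k) * g0 k = 1" for k using SO_D g0(1) by blast
  qed blast
  define e where "e k = 1 - tr (S k) * S k" for k
  \<comment> \<open>Here h is the root of \<open>tr (S k) * S k\<close> close to 1 and h' is its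
    inverse.\<close>
  define good where "good k h h' \<longleftrightarrow> h * h' = 1 \<and> tr h' = h' \<and> h' * X = X * h' \<and> h * h = tr (S k) * S k \<and> norm (h - 1) \<le> norm (e k)"
    for k and h h' :: "'n cmat"
  have "(\<lambda>k. tr (S k) * S k) \<longlonglongrightarrow> tr 1 * 1" by (intro tendsto_intros S(1))
  then have "(\<lambda>k. 1 - tr (S k) * S k) \<longlonglongrightarrow> 1 - 1" by (intro tendsto_intros) simp
  then have e: "(\<lambda>k. norm (e k)) \<longlonglongrightarrow> 0" unfolding e_def by (intro tendsto_norm_zero) simp
  have ex: "\<exists>h h'. good k h h'" if k: "S k * X = A k * S k" "norm (e k) < 1" for k
  proof -
    have trS: "tr (S k) * A k = X * tr (S k)" using arg_cong[OF k(1), of tr] by (simp add: skew skA)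
    have eX: "e k * X = X * e k"
    proof -
      have "tr (S k) * S k * X = (tr (S k) * A k) * S k" by (simp add: mult.assoc k(1))
      also have "\<dots> = X * (tr (S k) * S k)" by (simp add: trS mult.assoc)
      finally show ?thesis by (simp add: e_def algebra_simps)
    qed
    have tre: "tr (e k) = e k" by (simp add: e_def)
    define P where "P = {y :: 'n cmat. tr y = y} \<inter> {y. y * X = X * y}"
    have c1: "closed P" unfolding P_def by (intro closed_Int closed_Collect_eq continuous_intros)
    have c2: "0 \<in> P" by (simp add: P_def)
    have c3: "(1/2) *\<^sub>R (e k + y * y) \<in> P" if "y \<in> P" for y
    proof -
      have y: "tr y = y" "y * X = X * y" using that by (auto simp: P_def)
      have "y * y * X = y * (y * X)" by (rule mult.assoc)
      also have "\<dots> = y * (X * y)" by (simp only: y(2))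
      also have "\<dots> = (y * X) * y" by (rule mult.assoc[symmetric])
      also have "\<dots> = X * (y * y)" by (simp only: y(2) mult.assoc)
      finally have "y * y * X = X * (y * y)" .
      then show ?thesis using y(1) tre eX by (simp add: P_def distrib_left distrib_right)
    qed
    obtain y where y: "y \<in> P" "norm y \<le> norm (e k)" "(1 - y) * (1 - y) = 1 - e k"
      using sqrt_exists[OF k(2) c1 c2 c3] by blast
    have "\<exists>B. (1 - y) * B = 1 \<and> B * (1 - y) = 1"
    proof (rule cmat_injective_invertible)
      fix x assume "(1 - y) \<rhd> x = 0"
      then have "x = y \<rhd> x" by (simp add: app_linear)
      then have "norm x \<le> norm y * norm x" using norm_app[of y x] by simp
      moreover have "norm y * norm x < 1 * norm x" if "x \<noteq> 0"
        using y(2) k(2) that by (intro mult_strict_right_mono) auto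
      ultimately show "x = 0" by fastforce
    qed
    then obtain B where B: "(1 - y) * B = 1" "B * (1 - y) = 1" by blast
    have hX: "X * (1 - y) = (1 - y) * X" using y(1) by (simp add: P_def algebra_simps)
    have trh: "tr (1 - y) = 1 - y" using y(1) by (simp add: P_def)
    have "tr B * (1 - y) = 1" using arg_cong[OF B(1), of tr] trh by simp
    then have "tr B * (1 - y) * B = B" by simp
    then have "tr B = B" using B(1) by (simp add: mult.assoc)
    moreover have "X * B = B * X" by (rule commute_cinv[OF B(1) hX])
    ultimately have "good k (1 - y) B" unfolding good_def using B y by (simp add: e_def)
    then show ?thesis by blast
  qed
  define h where "h k = (SOME h. \<exists>h'. good k h h')" for k
  define h' where "h' k = (SOME h'. good k (h k) h')" for k
  have "\<forall>\<^sub>F k in sequentially. norm (e k) < 1" by (rule order_tendstoD(2)[OF e]) simp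
  with S(2) have good: "\<forall>\<^sub>F k in sequentially. good k (h k) (h' k)"
  proof eventually_elim
    case (elim k)
    have "\<exists>h'. good k (h k) h'" unfolding h_def by (rule someI_ex[OF ex]) (use elim in auto)
    then show ?case unfolding h'_def by (rule someI_ex)
  qed
  have "(\<lambda>k. h k - 1) \<longlonglongrightarrow> 0"
    by (rule Lim_null_comparison[OF _ e]) (use good in \<open>eventually_elim, simp add: good_def\<close>)
  then have "h \<longlonglongrightarrow> 1" by (simp add: LIM_zero_iff)
  then have h': "h' \<longlonglongrightarrow> 1"
    by (rule tendsto_inverse_cmat) (use good in \<open>eventually_elim, simp add: good_def\<close>, simp)
  define g where "g k = S k * h' k" for k
  have "g \<longlonglongrightarrow> 1 * 1" unfolding g_def by (intro tendsto_intros S(1) h')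
  then have g1: "g \<longlonglongrightarrow> 1" by simp
  have orth: "\<forall>\<^sub>F k in sequentially. tr (g k) * g k = 1"
    using good
  proof eventually_elim
    case (elim k)
    have *: "h k * h' k = 1" "h' k * h k = 1" "tr (h' k) = h' k" "h k * h k = tr (S k) * S k"
      using elim cmat_left_inverse by (auto simp: good_def)
    have "tr (g k) * g k = h' k * (h k * h k) * h' k" by (simp add: g_def * mult.assoc)
    also have "\<dots> = (h' k * h k) * (h k * h' k)" by (simp add: mult.assoc)
    finally show ?case by (simp add: *)
  qed
  have "\<forall>\<^sub>F k in sequentially. g k \<in> SO" by (rule eventually_SO[OF g1 orth])
  with good S(2) have "\<forall>\<^sub>F k in sequentially. g k \<in> SO \<and> A k = conj_act (g k) X"
  proof eventually_elim
    case (elim k)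
    have "g k * X = S k * (h' k * X)" by (simp add: g_def mult.assoc)
    also have "h' k * X = X * h' k" using elim by (simp add: good_def)
    also have "S k * (X * h' k) = A k * g k" by (simp add: g_def mult.assoc[symmetric] elim)
    finally show ?case using elim conj_act_eq_iff[of "g k" X "A k"] by auto
  qed
  with g1 show thesis by (rule that)
qed

text \<open>Translating by a representative of the limit point moves a convergent sequence of the
  orbit to one converging to X, where it lifts to a sequence in \<open>SO\<close> tending to 1. So
  continuity may be tested after pulling back to \<open>SO\<close>; the second component carries the
  parameter of a homotopy.\<close>

lemma continuous_on_orbit:
  fixes X :: "'n::finite cmat" and F :: "'n cmat \<times> 'p::metric_space \<Rightarrow> 'q::topological_space"
  assumes skew: "tr X = - X" and f: "continuous_on (SO \<times> T) f"
    and F: "\<And>g t. g \<in> SO \<Longrightarrow> t \<in> T \<Longrightarrow> F (conj_act g X, t) = f (g, t)"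
  shows "continuous_on ((\<lambda>g. conj_act g X) ` SO \<times> T) F"
  unfolding continuous_on_sequentially
proof (intro allI ballI impI, elim conjE)
  fix x and z assume z: "z \<in> (\<lambda>g. conj_act g X) ` SO \<times> T"
    and x: "\<forall>n. x n \<in> (\<lambda>g. conj_act g X) ` SO \<times> T" and lim: "x \<longlonglongrightarrow> z"
  obtain g0 t where g0: "g0 \<in> SO" "t \<in> T" "z = (conj_act g0 X, t)" using z by auto
  have fst: "(\<lambda>n. fst (x n)) \<longlonglongrightarrow> conj_act g0 X" and snd: "(\<lambda>n. snd (x n)) \<longlonglongrightarrow> t"
    using tendsto_fst[OF lim] tendsto_snd[OF lim] g0(3) by simp_all
  have "(\<lambda>n. conj_act (tr g0) (fst (x n))) \<longlonglongrightarrow> conj_act (tr g0) (conj_act g0 X)"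
    unfolding conj_act_def[of "tr g0"] by (intro tendsto_intros fst)
  then have lim': "(\<lambda>n. conj_act (tr g0) (fst (x n))) \<longlonglongrightarrow> X" by (simp add: conj_act_inverse g0)
  have orb: "conj_act (tr g0) (fst (x n)) \<in> (\<lambda>g. conj_act g X) ` SO" for n
  proof -
    obtain g where "g \<in> SO" "fst (x n) = conj_act g X" using x by (metis imageE mem_Times_iff)
    then show ?thesis using g0(1) by (auto simp: conj_act_mult[symmetric] intro!: imageI SO_mult SO_tr)
  qed
  obtain g where g: "g \<longlonglongrightarrow> 1" "\<forall>\<^sub>F k in sequentially. g k \<in> SO \<and> conj_act (tr g0) (fst (x k)) = conj_act (g k) X"
    using orbit_sequence_lift[OF skew lim' orb] by blast
  have ev: "\<forall>\<^sub>F k in sequentially. g0 * g k \<in> SO \<and> F (x k) = f (g0 * g k, snd (x k))"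
    using g(2)
  proof eventually_elim
    case (elim k)
    have "conj_act (g0 * g k) X = conj_act (tr (tr g0)) (conj_act (tr g0) (fst (x k)))"
      using elim by (simp add: conj_act_mult)
    also have "\<dots> = fst (x k)" by (rule conj_act_inverse) (rule SO_tr[OF g0(1)])
    finally have 1: "conj_act (g0 * g k) X = fst (x k)" .
    have 2: "g0 * g k \<in> SO" using elim g0 by (intro SO_mult) auto
    have "snd (x k) \<in> T" using x by (auto simp: mem_Times_iff)
    from F[OF 2 this] 1 2 show ?case by simp
  qed
  have "(\<lambda>k. g0 * g k) \<longlonglongrightarrow> g0 * 1" by (intro tendsto_intros g(1))
  then have lim2: "(\<lambda>k. (g0 * g k, snd (x k))) \<longlonglongrightarrow> (g0, t)" by (intro tendsto_Pair snd) simp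
  have "\<forall>\<^sub>F k in sequentially. (g0 * g k, snd (x k)) \<in> SO \<times> T"
    using ev by eventually_elim (use x in \<open>auto simp: mem_Times_iff\<close>)
  with lim2 have "(\<lambda>k. f (g0 * g k, snd (x k))) \<longlonglongrightarrow> f (g0, t)"
    using f g0 by (intro continuous_on_tendsto_compose[OF f]) auto
  moreover have "f (g0, t) = F z" using F[OF g0(1,2)] g0(3) by simp
  ultimately have "(\<lambda>k. f (g0 * g k, snd (x k))) \<longlonglongrightarrow> F z" by simp
  then have "(\<lambda>k. F (x k)) \<longlonglongrightarrow> F z"
    by (rule Lim_transform_eventually) (use ev in \<open>eventually_elim, simp\<close>)
  then show "(F \<circ> x) \<longlonglongrightarrow> F z" by (simp add: o_def)
qed

section \<open>Deformation of a nilpotent orbit onto a compact orbit\<close>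

lemma sum_int_telescope:
  fixes f :: "int \<Rightarrow> 'a::ab_group_add"
  assumes "a \<le> b + 1"
  shows "(\<Sum>i\<in>{a..b}. f i - f (i + 1)) = f a - f (b + 1)"
proof -
  have "(\<Sum>i\<in>{a..a - 1 + int k}. f i - f (i + 1)) = f a - f (a + int k)" for k
  proof (induction k)
    case (Suc k)
    have "{a..a - 1 + int (Suc k)} = insert (a + int k) {a..a - 1 + int k}" by auto
    then show ?case using Suc by (simp add: algebra_simps)
  qed simp
  from this[of "nat (b + 1 - a)"] assms show ?thesis by simp
qed

text \<open>
  \<open>E i\<close> projects to the weight space of weight \<open>i\<close>; the operators \<open>N k\<close> carry the levels of the
  strings to their bottoms, so that \<open>p \<mapsto> (\<Sum>k\<in>K. adj (N k) * p * N k)\<close> maps into the commutant of \<open>X\<close>.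
\<close>

locale graded_nilpotent =
  fixes m :: int and X :: "'n::finite cmat" and E :: "int \<Rightarrow> 'n cmat" and K :: "'k set" and N :: "'k \<Rightarrow> 'n cmat"
  assumes E_grading: "grading m E"
    and adj_E: "adj (E i) = E i"
    and skew: "tr X = - X"
    and X_E: "X * E i = E (i + 2) * X"
    and filtered: "z * X = X * z \<Longrightarrow> j < i \<Longrightarrow> E j * z * E i = 0"
    and N_comm: "z * X = X * z \<Longrightarrow> (\<And>i. z * E i = E i * z) \<Longrightarrow> k \<in> K \<Longrightarrow> z * N k = N k * z"
    and N_sum: "(\<Sum>k\<in>K. adj (N k) * N k) = 1"
    and N_exp: "X * (\<Sum>k\<in>K. adj (N k) * p * N k) = (\<Sum>k\<in>K. adj (N k) * p * N k) * X"
begin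

abbreviation orbit :: "'n cmat set" where "orbit \<equiv> (\<lambda>g. conj_act g X) ` SO"

text \<open>The projections to the weight filtration. The centralizer of X preserves their ranges
  (\<open>commutant_P\<close>), though not those of the \<open>E i\<close>.\<close>

definition P :: "int \<Rightarrow> 'n cmat" where "P i = (\<Sum>j\<in>{i..m}. E j)"

lemmas E_mult = R_mult[OF E_grading] and E_mult2 = R_mult2[OF E_grading] and E_tr = R_tr[OF E_grading]

lemma m_nonneg: "0 \<le> m"
proof (rule ccontr)
  assume "\<not> 0 \<le> m"
  then show False using R_sum[OF E_grading] by simp
qed

lemma P_E: "P i * E j = (if i \<le> j then E j else 0)"
proof -
  have "P i * E j = (\<Sum>a\<in>{i..m}. if a = j then E j else 0)"
    unfolding P_def sum_distrib_right by (intro sum.cong refl) (simp add: E_mult)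
  then show ?thesis using R_outside[OF E_grading, of j] m_nonneg by auto
qed

lemma E_P: "E j * P i = (if i \<le> j then E j else 0)"
proof -
  have "E j * P i = (\<Sum>a\<in>{i..m}. if a = j then E j else 0)"
    unfolding P_def sum_distrib_left by (intro sum.cong refl) (simp add: E_mult)
  then show ?thesis using R_outside[OF E_grading, of j] m_nonneg by auto
qed

lemma adj_P: "adj (P i) = P i" by (simp add: P_def adj_E)

lemma P_P: "P i * P j = P (max i j)"
  by (rule grading_ext_right[OF E_grading]) (simp add: mult.assoc P_E)

lemma tr_P: "tr (P i) = 1 - P (1 - i)"
proof (rule grading_ext_right[OF E_grading])
  fix k
  have "tr (P i) * E k = tr (E (- k) * P i)" by (simp add: E_tr)
  then show "tr (P i) * E k = (1 - P (1 - i)) * E k" by (auto simp: E_P E_tr left_diff_distrib P_E)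
qed

lemma E_eq_P: "E i = P i - P (i + 1)"
  by (rule grading_ext_right[OF E_grading]) (auto simp: E_mult left_diff_distrib P_E)

lemma P_first: "P (- m) = 1" and P_last: "P (m + 1) = 0"
  using R_sum[OF E_grading] by (simp_all add: P_def)

lemma commutant_P: assumes "z * X = X * z" shows "P i * (z * P i) = z * P i"
proof (rule grading_ext[OF E_grading])
  fix k j
  have "E j * (P i * (z * P i)) * E k = (E j * P i) * z * (P i * E k)" by (simp only: mult.assoc)
  moreover have "E j * (z * P i) * E k = E j * z * (P i * E k)" by (simp only: mult.assoc)
  ultimately show "E j * (P i * (z * P i)) * E k = E j * (z * P i) * E k"
    using filtered[OF assms, of j k] by (auto simp: E_P P_E)
qed

lemma X_P: "X * P i = P (i + 2) * X"
proof (rule grading_ext_right[OF E_grading])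
  fix k
  have "X * P i * E k = X * (P i * E k)" "P (i + 2) * X * E k = P (i + 2) * (X * E k)" by (simp_all only: mult.assoc)
  then show "X * P i * E k = P (i + 2) * X * E k" by (simp add: P_E X_E mult.assoc[symmetric])
qed

section \<open>The moved filtration and its orthogonalization\<close>

definition flagM :: "'n cmat \<Rightarrow> int \<Rightarrow> 'n cmat" where
  "flagM g i = P i * (adj g * g) * P i + (1 - P i)"

text \<open>The orthogonal projection to the image of \<open>g * P i\<close>.\<close>

definition Q :: "'n cmat \<Rightarrow> int \<Rightarrow> 'n cmat" where
  "Q g i = g * P i * cinv (flagM g i) * P i * adj g"

text \<open>\<open>g * P i * tr g\<close> is the oblique projection to the image of
  \<open>g * P i\<close>, since \<open>tr g\<close> inverts g; the last clause thus puts the range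
  of T into that image. The three clauses characterize the orthogonal projection without mentioning
  a Gram matrix.\<close>

definition isQ :: "'n cmat \<Rightarrow> int \<Rightarrow> 'n cmat \<Rightarrow> bool" where
  "isQ g i T \<longleftrightarrow> adj T = T \<and> T * (g * P i) = g * P i \<and> g * P i * tr g * T = T"

lemma pos_gram: assumes "g \<in> SO" shows "pos (adj g * g)"
  using pos_conj[OF pos_one SO_D(2)[OF assms]] by simp

text \<open>\<open>flagM g i\<close> is the Gram matrix of g on the range of \<open>P i\<close>. The
  summand \<open>1 - P i\<close> extends it by the identity to the whole space, so that a full
  inverse is available.\<close>

lemma flagM_pos: assumes g: "g \<in> SO" shows "pos (flagM g i)"
  unfolding pos_def
proof (intro conjI allI impI)
  show "adj (flagM g i) = flagM g i" by (simp add: flagM_def adj_P mult.assoc)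
  fix x :: "complex^'n" assume x: "x \<noteq> 0"
  let ?y = "P i \<rhd> x" and ?z = "(1 - P i) \<rhd> x"
  have "x \<bullet> (P i \<rhd> (adj g * g) \<rhd> ?y) = ?y \<bullet> ((adj g * g) \<rhd> ?y)"
    using inner_adj[of x "P i" "(adj g * g) \<rhd> ?y"] by (simp add: adj_P)
  moreover have "(1 - P i) * (1 - P i) = 1 - P i" by (simp add: algebra_simps P_P)
  then have "x \<bullet> ?z = ?z \<bullet> ?z"
    using inner_adj[of x "1 - P i" ?z] by (simp add: adj_P flip: app_simps(1))
  ultimately have eq: "x \<bullet> (flagM g i \<rhd> x) = ?y \<bullet> ((adj g * g) \<rhd> ?y) + ?z \<bullet> ?z"
    by (simp add: flagM_def app_linear(1) inner_add_right)
  show "0 < x \<bullet> (flagM g i \<rhd> x)"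
  proof (cases "?y = 0")
    case True
    then have "?z = x" by (simp add: app_linear)
    then show ?thesis using eq True x by simp
  next
    case False
    then have "0 < ?y \<bullet> ((adj g * g) \<rhd> ?y)" using pos_gram[OF g] unfolding pos_def by blast
    then show ?thesis using eq by (simp add: add_pos_nonneg)
  qed
qed

lemma Q_isQ: assumes g: "g \<in> SO" shows "isQ g i (Q g i)"
proof -
  define M where "M = flagM g i"
  define C where "C = cinv M"
  have M: "pos M" unfolding M_def by (rule flagM_pos[OF g])
  have C: "M * C = 1" "C * M = 1" "adj C = C" using cinv_pos[OF M] pos_adj unfolding C_def by blast+
  have PP: "P i * P i = P i" by (simp add: P_P)
  have MP: "M * P i = P i * (adj g * g) * P i" "P i * M = P i * (adj g * g) * P i"
    by (simp_all add: M_def flagM_def distrib_left distrib_right left_diff_distrib right_diff_distrib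
        mult.assoc PP mult_assoc_rule[OF PP])
  have Q: "Q g i = g * P i * C * P i * adj g" by (simp add: Q_def M_def C_def)
  have a1: "adj (Q g i) = Q g i" by (simp add: Q C(3) adj_P mult.assoc)
  have "Q g i * (g * P i) = g * P i * C * (P i * (adj g * g) * P i)"
    by (simp only: Q mult.assoc)
  also have "\<dots> = g * P i * C * (M * P i)" by (simp only: MP(1))
  also have "\<dots> = g * P i * (C * M) * P i" by (simp only: mult.assoc)
  also have "\<dots> = g * P i" by (simp add: C mult.assoc PP)
  finally have a2: "Q g i * (g * P i) = g * P i" .
  have "g * P i * tr g * Q g i = g * (P i * (tr g * (g * (P i * (C * P i * adj g)))))"
    by (simp only: Q mult.assoc)
  then have "g * P i * tr g * Q g i = Q g i"
    by (simp add: SO_cancel[OF g] Q mult.assoc mult_assoc_rule[OF PP])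
  with a1 a2 show ?thesis unfolding isQ_def by blast
qed

text \<open>As z preserves the filtration, the image of \<open>g * z * P i\<close> lies in that of
  \<open>g * P i\<close>, where T acts as the identity.\<close>

lemma isQ_absorb:
  assumes T: "isQ g i T" "isQ (g * z) i T'" and z: "z * X = X * z"
  shows "T * T' = T'"
proof -
  have "T' = g * (z * P i) * tr (g * z) * T'" using T(2) by (simp add: isQ_def mult.assoc)
  also have "\<dots> = g * (P i * (z * P i)) * tr (g * z) * T'" by (simp only: commutant_P[OF z])
  finally have T': "T' = (g * P i) * (z * P i * tr (g * z) * T')" by (simp only: mult.assoc)
  then have "T * T' = T * ((g * P i) * (z * P i * tr (g * z) * T'))" by (rule arg_cong)
  also have "\<dots> = (T * (g * P i)) * (z * P i * tr (g * z) * T')" by (simp only: mult.assoc)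
  also have "\<dots> = T'" using T(1) T' by (simp add: isQ_def)
  finally show ?thesis .
qed

text \<open>Both z and its inverse preserve the filtration, so each of T and T' absorbs the other,
  and for self-adjoint matrices this gives equality. With z = 1 it is uniqueness of the projection;
  in general it is the independence of the representative g.\<close>

lemma isQ_unique:
  assumes T: "isQ g i T" "isQ (g * z) i T'" and z: "z * X = X * z" "z \<in> SO"
  shows "T = T'"
proof -
  have z': "tr z * X = X * tr z" using arg_cong[OF z(1), of tr] by (simp add: skew)
  have 1: "T * T' = T'" by (rule isQ_absorb[OF T z(1)])
  have "isQ (g * z * tr z) i T" using T(1) by (simp add: mult.assoc SO_D[OF z(2)])
  from isQ_absorb[OF T(2) this z'] have 2: "T' * T = T" .
  have "adj (T * T') = adj T'" using 1 by simp
  then show ?thesis using T 2 by (simp add: isQ_def)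
qed

lemma Q_eqI: "g \<in> SO \<Longrightarrow> isQ g i T \<Longrightarrow> Q g i = T"
  by (rule isQ_unique[where z = 1, OF Q_isQ]) (simp_all add: SO_one)

lemma continuous_on_Q: "continuous_on SO (\<lambda>g. Q g i)"
proof -
  have "continuous_on SO (\<lambda>g. flagM g i)" unfolding flagM_def by (intro continuous_intros continuous_on_id)
  then have "continuous_on SO (\<lambda>g. cinv (flagM g i))"
    by (rule continuous_on_compose2[OF continuous_on_cinv]) (auto intro: flagM_pos)
  then show ?thesis unfolding Q_def by (intro continuous_intros continuous_on_id)
qed

text \<open>The orthogonal complement of each step of the moved filtration inside the preceding
  one.\<close>

definition R :: "'n cmat \<Rightarrow> int \<Rightarrow> 'n cmat" where "R g i = Q g i - Q g (i + 1)"

text \<open>The regraded representative: g is applied to the vectors of weight i and the result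
  projected to the new degree i. It agrees with g up to parts of higher degree.\<close>

definition G :: "'n cmat \<Rightarrow> 'n cmat" where "G g = (\<Sum>i\<in>{-m..m}. R g i * g * E i)"

lemma continuous_on_R: "continuous_on SO (\<lambda>g. R g i)"
  unfolding R_def by (intro continuous_intros continuous_on_Q)

lemma continuous_on_G: "continuous_on SO G"
proof -
  have "continuous_on SO (\<lambda>g. \<Sum>i\<in>{-m..m}. R g i * g * E i)"
    by (intro continuous_intros continuous_on_R continuous_on_id)
  then show ?thesis by (simp add: G_def[abs_def])
qed

context
  fixes g :: "'n cmat"
  assumes g: "g \<in> SO"
begin

lemma Q_adj: "adj (Q g i) = Q g i" and Q_gP: "Q g i * (g * P i) = g * P i"
  and Q_range: "g * P i * tr g * Q g i = Q g i"
  using Q_isQ[OF g, of i] by (simp_all add: isQ_def)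

lemma Q_gP_le: assumes "i \<le> j" shows "Q g i * (g * P j) = g * P j"
proof -
  have P: "P j = P i * P j" using assms by (simp add: P_P)
  have "Q g i * (g * (P i * P j)) = (Q g i * (g * P i)) * P j" by (simp only: mult.assoc)
  then show ?thesis by (simp add: Q_gP mult.assoc flip: P)
qed

lemma trg_Q: "tr g * Q g i = P i * (tr g * Q g i)"
proof -
  have "tr g * (g * P i * tr g * Q g i) = P i * (tr g * Q g i)"
    by (simp add: mult.assoc SO_cancel[OF g])
  then show ?thesis by (simp add: Q_range)
qed

lemma Q_mult: "Q g i * Q g j = Q g (max i j)"
proof -
  have 1: "Q g i * Q g j = Q g j" if "i \<le> j" for i j
  proof -
    have "Q g i * (g * P j * tr g * Q g j) = (Q g i * (g * P j)) * (tr g * Q g j)" by (simp only: mult.assoc)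
    also have "\<dots> = g * P j * tr g * Q g j" by (simp only: Q_gP_le[OF that] mult.assoc)
    finally show ?thesis by (simp only: Q_range)
  qed
  have 2: "Q g i * Q g j = Q g i" if "j \<le> i" for i j
    using arg_cong[OF 1[OF that], of adj] by (simp add: Q_adj)
  show ?thesis by (cases "i \<le> j") (simp_all add: 1 2)
qed

text \<open>As g is orthogonal and opposite weights are paired, the annihilator of the image of
  \<open>g * P i\<close> under the bilinear form is the image of \<open>g * P (1 - i)\<close>; and
  the transpose of a Hermitian projection is again Hermitian. The claim is checked through
  \<open>isQ\<close>.\<close>

lemma tr_Q: "tr (Q g i) = 1 - Q g (1 - i)"
proof -
  have "isQ g (1 - i) (1 - tr (Q g i))"
    unfolding isQ_def
  proof (intro conjI)
    show "adj (1 - tr (Q g i)) = 1 - tr (Q g i)"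
      using tr_adj[of "Q g i"] by (simp add: Q_adj)
    have "tr (Q g i) = tr (Q g i) * (g * (tr (P i) * tr g))"
      using arg_cong[OF Q_range[of i], of tr] by (simp add: mult.assoc)
    then have "tr (Q g i) * (g * P (1 - i)) = tr (Q g i) * (g * (tr (P i) * tr g)) * (g * P (1 - i))" by simp
    also have "\<dots> = tr (Q g i) * (g * (tr (P i) * P (1 - i)))" by (simp add: mult.assoc SO_cancel[OF g])
    also have "tr (P i) * P (1 - i) = 0" by (simp add: tr_P left_diff_distrib P_P)
    finally show "(1 - tr (Q g i)) * (g * P (1 - i)) = g * P (1 - i)" by (simp add: left_diff_distrib)
    have "tr (Q g i) = tr (Q g i)" ..
    have "tr (Q g i * (g * P i)) = tr (g * P i)" by (simp only: Q_gP)
    then have "tr (P i) * tr g * tr (Q g i) = tr (P i) * tr g" by (simp add: mult.assoc)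
    then have "g * (tr (P i) * tr g * (1 - tr (Q g i))) = 0" by (simp add: right_diff_distrib)
    moreover have "g * (tr (P i) * tr g * (1 - tr (Q g i))) = (1 - tr (Q g i)) - g * P (1 - i) * tr g * (1 - tr (Q g i))"
      by (simp add: tr_P left_diff_distrib right_diff_distrib mult.assoc SO_D[OF g] SO_cancel[OF g])
    ultimately show "g * P (1 - i) * tr g * (1 - tr (Q g i)) = 1 - tr (Q g i)" by simp
  qed
  from Q_eqI[OF g this] show ?thesis by simp
qed

lemma R_grading: "grading m (R g)"
  unfolding grading_def
proof (intro conjI allI)
  fix i j
  show "R g i * R g j = (if i = j then R g i else 0)"
  proof -
    consider "i = j" | "i < j" | "j < i" by linarith
    then show ?thesis
      by cases (simp_all add: R_def left_diff_distrib right_diff_distrib Q_mult max_absorb1 max_absorb2)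
  qed
  have "tr (R g i) = Q g (- i) - Q g (1 - i)" by (simp add: R_def tr_Q)
  then show "tr (R g i) = R g (- i)" by (simp add: R_def add.commute)
next
  have "isQ g (- m) 1" by (simp add: isQ_def P_first SO_D[OF g])
  then have "Q g (- m) = 1" by (rule Q_eqI[OF g])
  moreover have "isQ g (m + 1) 0" by (simp add: isQ_def P_last)
  then have "Q g (m + 1) = 0" by (rule Q_eqI[OF g])
  ultimately show "(\<Sum>i\<in>{-m..m}. R g i) = 1"
    unfolding R_def using sum_int_telescope[of "- m" m "Q g"] m_nonneg by simp
qed

lemma R_gP: "j < k \<Longrightarrow> R g j * (g * P k) = 0"
  by (simp add: R_def left_diff_distrib Q_gP_le)

lemma trg_R: "tr g * R g i = P i * (tr g * R g i)"
proof -
  have RR: "Q g i * R g i = R g i" by (simp add: R_def right_diff_distrib Q_mult)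
  have "tr g * R g i = (tr g * Q g i) * R g i" by (simp only: RR mult.assoc)
  also have "\<dots> = (P i * (tr g * Q g i)) * R g i" by (simp only: trg_Q[symmetric])
  finally show ?thesis by (simp only: RR mult.assoc)
qed

text \<open>On the successive quotients of the filtration \<open>tr g\<close> inverts g; what
  escapes to higher steps is removed by \<open>R g i\<close>.\<close>

lemma R_g_cancel: "R g i * (g * (E i * (tr g * R g i))) = R g i"
proof -
  have "R g i * (g * (E i * (tr g * R g i)))
    = R g i * (g * (P i * (tr g * R g i))) - (R g i * (g * P (i + 1))) * (tr g * R g i)"
    by (simp only: E_eq_P left_diff_distrib right_diff_distrib mult.assoc)
  also have "\<dots> = R g i * (g * (tr g * R g i))" by (simp add: R_gP flip: trg_R)
  finally show ?thesis by (simp add: SO_cancel[OF g] R_mult[OF R_grading])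
qed

lemma G_E: "G g * E i = R g i * (g * E i)"
  using sum_R_right[OF E_grading, of "\<lambda>i. R g i * g" i] by (simp add: G_def mult.assoc)

lemma R_G: "R g i * G g = R g i * (g * E i)"
  using sum_R_left[OF R_grading, of i "\<lambda>i. g * E i"] by (simp add: G_def mult.assoc)

lemma E_trG: "E i * tr (G g) = E i * (tr g * R g i)"
  using arg_cong[OF G_E[of "- i"], of tr] by (simp add: E_tr R_tr[OF R_grading] mult.assoc)

lemma trG_R: "tr (G g) * R g i = E i * (tr g * R g i)"
  using arg_cong[OF R_G[of "- i"], of tr] by (simp add: E_tr R_tr[OF R_grading] mult.assoc)

lemma G_orth: "tr (G g) * G g = 1"
proof (rule grading_ext[OF E_grading])
  fix i j
  have d: "E i * (tr g * (R g i * (g * E i))) = E i" for i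
  proof -
    \<comment> \<open>\<open>tr g\<close> carries the range of \<open>Q g (i + 1)\<close> into that
      of \<open>P (i + 1)\<close>, on which \<open>E i\<close> vanishes.\<close>
    have "E i * (tr g * Q g (i + 1)) = (E i * P (i + 1)) * (tr g * Q g (i + 1))"
      by (subst trg_Q) (simp only: mult.assoc)
    then have "E i * (tr g * Q g (i + 1)) = 0" by (simp add: E_P)
    then have "E i * (tr g * Q g (i + 1)) * (g * E i) = 0" by simp
    then have q: "E i * (tr g * (Q g (i + 1) * (g * E i))) = 0" by (simp only: mult.assoc)
    have "Q g i * (g * (P i * E i)) = (Q g i * (g * P i)) * E i" by (simp only: mult.assoc)
    then have gE: "Q g i * (g * E i) = g * E i" by (simp add: Q_gP P_E mult.assoc)
    show ?thesis
      by (simp add: R_def left_diff_distrib right_diff_distrib gE q SO_cancel[OF g] E_mult)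
  qed
  have "E j * (tr (G g) * G g) * E i = (E j * tr (G g)) * (G g * E i)" by (simp only: mult.assoc)
  also have "\<dots> = E j * (tr g * (R g j * (R g i * (g * E i))))" by (simp only: E_trG G_E mult.assoc)
  also have "\<dots> = (if i = j then E i else 0)"
    by (cases "i = j") (simp_all add: R_mult2[OF R_grading] d)
  finally show "E j * (tr (G g) * G g) * E i = E j * 1 * E i" by (simp add: E_mult)
qed

text \<open>\<open>G g * tr g\<close> is orthogonal, does not lower degrees of \<open>R g\<close>,
  and is the identity on the associated graded space, so \<open>unipotent_SO\<close> determines its
  determinant.\<close>

lemma G_SO: "G g \<in> SO"
proof -
  have orth: "tr (G g * tr g) * (G g * tr g) = 1"
  proof -
    have "tr (G g * tr g) * (G g * tr g) = g * ((tr (G g) * G g) * tr g)" by (simp only: tr_simps mult.assoc)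
    then show ?thesis by (simp add: G_orth SO_D[OF g])
  qed
  have low: "R g j * (G g * tr g) * R g i = 0" if ji: "j < i" for i j
  proof -
    have "R g j * (G g * tr g) * R g i = (R g j * G g) * (tr g * R g i)" by (simp only: mult.assoc)
    also have "\<dots> = R g j * (g * ((E j * P i) * (tr g * R g i)))" by (subst trg_R) (simp only: R_G mult.assoc)
    finally show ?thesis using ji by (simp add: E_P)
  qed
  have "R g i * (G g * tr g) * R g i = R g i" for i
  proof -
    have "R g i * (G g * tr g) * R g i = (R g i * G g) * (tr g * R g i)" by (simp only: mult.assoc)
    then show ?thesis by (simp only: R_G mult.assoc R_g_cancel)
  qed
  from unipotent_SO[OF R_grading orth low this] have "G g * tr g \<in> SO" .
  from SO_mult[OF this g] show ?thesis by (simp add: mult.assoc SO_D[OF g])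
qed

lemma R_conj_R: "R g j * conj_act g X * R g i = R g j * (g * (P (i + 2) * (X * (tr g * R g i))))"
proof -
  have "R g j * conj_act g X * R g i = R g j * (g * (X * (tr g * R g i)))"
    by (simp only: conj_act_def mult.assoc)
  also have "\<dots> = R g j * (g * ((X * P i) * (tr g * R g i)))" by (subst trg_R) (simp only: mult.assoc)
  finally show ?thesis by (simp only: X_P mult.assoc)
qed

lemma graded_conj: "j < i + 2 \<Longrightarrow> R g j * conj_act g X * R g i = 0"
  using R_gP[of j "i + 2"] unfolding R_conj_R by (simp add: mult.assoc[symmetric])

text \<open>At s = 0 only the part of degree 2 for the grading \<open>R g\<close> is left, and X is
  homogeneous of degree 2 for E; passing to the graded part therefore replaces g by
  \<open>G g\<close>.\<close>

lemma resc_0_conj: "resc m (R g) 2 0 (conj_act g X) = conj_act (G g) X"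
proof (rule grading_ext[OF R_grading])
  fix i j
  have "R g j * conj_act (G g) X * R g i = (R g j * G g) * X * (tr (G g) * R g i)"
    by (simp only: conj_act_def mult.assoc)
  also have "\<dots> = R g j * (g * ((E j * (X * E i)) * (tr g * R g i)))"
    by (simp only: R_G trG_R mult.assoc)
  also have "E j * (X * E i) = (if j = i + 2 then E j * X else 0)" by (simp add: X_E E_mult2)
  finally have 1: "R g j * conj_act (G g) X * R g i = (if j = i + 2 then R g j * (g * (E j * (X * (tr g * R g i)))) else 0)"
    by (simp add: mult.assoc)
  have "R g j * (g * (E j * (X * (tr g * R g i)))) = R g j * conj_act g X * R g i" if "j = i + 2"
  proof -
    have "R g j * (g * (E j * (X * (tr g * R g i)))) = R g j * (g * (P j * (X * (tr g * R g i))))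
        - (R g j * (g * P (j + 1))) * (X * (tr g * R g i))"
      by (simp only: E_eq_P left_diff_distrib right_diff_distrib mult.assoc)
    then show ?thesis unfolding R_conj_R using that by (simp add: R_gP)
  qed
  with 1 show "R g j * resc m (R g) 2 0 (conj_act g X) * R g i = R g j * conj_act (G g) X * R g i"
    by (simp add: resc_0_component[OF R_grading])
qed

end

lemma conj_scal_X: assumes "0 < t" shows "conj_act (scal m E t) X = t\<^sup>2 *\<^sub>R X"
proof -
  have EXE: "E j * X * E i = (if j = i + 2 then E j * X else 0)" for i j
    by (simp add: mult.assoc X_E E_mult2)
  have "resc m E 2 t X = X"
    by (rule grading_ext[OF E_grading]) (simp add: resc_component[OF E_grading] EXE)
  moreover have "resc m E 2 t X = (t powi (- 2)) *\<^sub>R conj_act (scal m E t) X"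
    unfolding conj_act_def tr_scal[OF E_grading] by (rule resc_pos[OF E_grading assms]) (simp add: EXE)
  ultimately have "X = (t powi (- 2)) *\<^sub>R conj_act (scal m E t) X" by simp
  then have "t\<^sup>2 *\<^sub>R X = t\<^sup>2 *\<^sub>R ((t powi (- 2)) *\<^sub>R conj_act (scal m E t) X)" by (rule arg_cong)
  also have "\<dots> = conj_act (scal m E t) X" using assms by (simp add: power_int_minus)
  finally show ?thesis ..
qed

text \<open>For s > 0 the rescaled point is a multiple of a conjugate of X. The orbit is stable
  under positive multiples, since the torus of E scales X.\<close>

lemma resc_orbit:
  assumes g: "g \<in> SO" and s: "0 \<le> s"
  shows "resc m (R g) 2 s (conj_act g X) \<in> orbit"
proof (cases "s = 0")
  case True
  show ?thesis unfolding True resc_0_conj[OF g] using G_SO[OF g] by (rule imageI)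
next
  case False
  then have s: "0 < s" using s by simp
  \<comment> \<open>Conjugation by \<open>?k\<close> multiplies X by \<open>s powi (- 2)\<close>,
    the scalar that \<open>resc_pos\<close> leaves over.\<close>
  let ?l = "scal m (R g) s" and ?k = "scal m E (1 / s)"
  have k: "conj_act ?k X = (s powi (- 2)) *\<^sub>R X"
    using conj_scal_X[of "1 / s"] s by (simp add: power_int_minus power_divide inverse_eq_divide)
  have "resc m (R g) 2 s (conj_act g X) = (s powi (- 2)) *\<^sub>R conj_act ?l (conj_act g X)"
    unfolding conj_act_def[of ?l] tr_scal[OF R_grading[OF g]]
    by (rule resc_pos[OF R_grading[OF g] s graded_conj[OF g]])
  also have "\<dots> = conj_act (?l * g * ?k) X"
    unfolding conj_act_mult k by (simp add: conj_act_def)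
  finally show ?thesis
    using s g by (auto intro!: imageI SO_mult scal_SO[OF E_grading] scal_SO[OF R_grading[OF g]])
qed

section \<open>The averaged positive matrix and the motion to the compact orbit\<close>

definition h1 :: "'n cmat \<Rightarrow> 'n cmat" where
  "h1 g = (\<Sum>k\<in>K. adj (G g * N k * tr (G g)) * (G g * N k * tr (G g)))"

text \<open>The same average as \<open>h1 g\<close>, pulled back by \<open>G g\<close>
  (\<open>h1_eq\<close>). \<open>h1 g\<close> depends only on the point of the orbit, while
  \<open>p1 g\<close> is the one that commutes with X, by \<open>N_exp\<close>.\<close>

definition p1 :: "'n cmat \<Rightarrow> 'n cmat" where
  "p1 g = (\<Sum>k\<in>K. adj (N k) * (adj (G g) * G g) * N k)"

text \<open>The segment from 1 to \<open>h1 g\<close> stays among positive matrices; the geometric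
  mean and its root bend it into a path of \<open>SO\<close> that starts at 1.\<close>

definition W :: "'n cmat \<Rightarrow> real \<Rightarrow> 'n cmat" where
  "W g s = msqrt (gmean ((1 - s) *\<^sub>R 1 + s *\<^sub>R h1 g))"

lemma continuous_on_h1: "continuous_on SO h1"
proof -
  have "continuous_on SO (\<lambda>g. \<Sum>k\<in>K. adj (G g * N k * tr (G g)) * (G g * N k * tr (G g)))"
    by (intro continuous_intros continuous_on_G)
  then show ?thesis unfolding h1_def[abs_def] .
qed

lemma h1_eq: "h1 g = adj (tr (G g)) * p1 g * tr (G g)"
  by (simp add: h1_def p1_def sum_distrib_left sum_distrib_right mult.assoc)

lemma p1_pos: assumes g: "g \<in> SO" shows "pos (p1 g)"
  unfolding pos_def
proof (intro conjI allI impI)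
  let ?p = "adj (G g) * G g"
  have p: "pos ?p" by (rule pos_gram[OF G_SO[OF g]])
  show "adj (p1 g) = p1 g" by (simp add: p1_def mult.assoc)
  fix x :: "complex^'n" assume x: "x \<noteq> 0"
  have "finite K" using N_sum by (rule_tac ccontr) simp
  have eq: "x \<bullet> (p1 g \<rhd> x) = (\<Sum>k\<in>K. (N k \<rhd> x) \<bullet> (?p \<rhd> N k \<rhd> x))"
    unfolding p1_def app_sum_left inner_sum_right
  proof (intro sum.cong refl)
    fix k
    show "x \<bullet> ((adj (N k) * ?p * N k) \<rhd> x) = (N k \<rhd> x) \<bullet> (?p \<rhd> N k \<rhd> x)"
      using inner_adj[of x "adj (N k)" "?p \<rhd> N k \<rhd> x"] by simp
  qed
  have "\<exists>k\<in>K. N k \<rhd> x \<noteq> 0"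
  proof (rule ccontr)
    assume "\<not> ?thesis"
    then have "(\<Sum>k\<in>K. adj (N k) * N k) \<rhd> x = 0" by (simp add: app_sum_left)
    then show False using x N_sum by simp
  qed
  then obtain k where k: "k \<in> K" "N k \<rhd> x \<noteq> 0" by blast
  have nn: "0 \<le> y \<bullet> (?p \<rhd> y)" for y
  proof (cases "y = 0")
    case False
    then have "0 < y \<bullet> (?p \<rhd> y)" using p unfolding pos_def by blast
    then show ?thesis by simp
  qed simp
  have "0 < (N k \<rhd> x) \<bullet> (?p \<rhd> N k \<rhd> x)" using p k unfolding pos_def by blast
  then show "0 < x \<bullet> (p1 g \<rhd> x)"
    unfolding eq using \<open>finite K\<close> k nn by (intro sum_pos2[of K k]) auto
qed

lemma h1_pos: "g \<in> SO \<Longrightarrow> pos (h1 g)"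
  unfolding h1_eq by (rule pos_conj[OF p1_pos _]) (auto intro: G_orth)

lemma segment_pos:
  assumes "g \<in> SO" "s \<in> {0..1}" shows "pos ((1 - s) *\<^sub>R 1 + s *\<^sub>R h1 g)"
proof -
  consider "s = 0" | "s = 1" | "0 < s" "s < 1" using assms(2) by fastforce
  then show ?thesis
    by cases (simp_all add: pos_one h1_pos assms(1) pos_add pos_scaleR)
qed

lemma W_props:
  assumes "g \<in> SO" "s \<in> {0..1}"
  shows "W g s \<in> SO" "W g s * W g s = gmean ((1 - s) *\<^sub>R 1 + s *\<^sub>R h1 g)" "adj (W g s) = W g s"
proof -
  let ?h = "(1 - s) *\<^sub>R 1 + s *\<^sub>R h1 g"
  have h: "pos ?h" by (rule segment_pos[OF assms])
  have w: "pos (W g s)" "W g s * W g s = gmean ?h"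
    unfolding W_def by (rule msqrt(1)[OF gmean(1)[OF h]], rule msqrt(2)[OF gmean(1)[OF h]])
  show "W g s * W g s = gmean ?h" by (rule w(2))
  show "adj (W g s) = W g s" by (rule pos_adj[OF w(1)])
  show "W g s \<in> SO"
    unfolding W_def
    by (rule pos_orthogonal_SO[OF msqrt(1)[OF gmean(1)[OF h]] msqrt_orthogonal[OF gmean(1)[OF h] gmean_orthogonal[OF h]]])
qed

lemma W_0: "W g 0 = 1"
proof -
  have "gmean (1 :: 'n cmat) = 1" by (rule gmean_fixed[OF pos_one]) simp
  moreover have "msqrt (1 :: 'n cmat) = 1" by (rule msqrt_unique) (simp_all add: pos_one)
  ultimately show ?thesis by (simp add: W_def)
qed

text \<open>Pulled back by \<open>G g\<close>, the square of \<open>W g 1\<close> becomes the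
  geometric mean of \<open>p1 g\<close>, which commutes with X because \<open>p1 g\<close> does and
  X is skew. Its square root r centralizes X too, so dividing \<open>W g 1 * G g\<close> by r on the
  right leaves the resulting point unchanged and yields a unitary matrix.\<close>

lemma W_1_compact:
  assumes g: "g \<in> SO"
  shows "conj_act (W g 1 * G g) X \<in> (\<lambda>g. conj_act g X) ` SOr"
proof -
  let ?W = "W g 1" and ?G = "G g"
  have GS: "?G \<in> SO" by (rule G_SO[OF g])
  have W: "?W \<in> SO" "?W * ?W = gmean (h1 g)" "adj ?W = ?W"
    using W_props[OF g, of 1] by auto
  define p2 where "p2 = gmean (p1 g)"
  have p2: "pos p2" "tr p2 * p2 = 1" unfolding p2_def
    by (rule gmean(1)[OF p1_pos[OF g]], rule gmean_orthogonal[OF p1_pos[OF g]])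
  have "p2 = adj ?G * gmean (h1 g) * ?G"
  proof -
    have "adj ?G * h1 g * ?G = adj (tr ?G * ?G) * p1 g * (tr ?G * ?G)"
      by (simp add: h1_eq mult.assoc)
    then have "adj ?G * h1 g * ?G = p1 g" by (simp add: SO_D[OF GS])
    then show ?thesis unfolding p2_def using gmean_conj[OF h1_pos[OF g] SO_D(1)[OF GS]] by simp
  qed
  then have p2W: "adj ?G * (?W * (?W * ?G)) = p2" by (simp add: mult.assoc flip: W(2))
  have "X * p1 g = p1 g * X" unfolding p1_def by (rule N_exp)
  from gmean_commute[OF p1_pos[OF g] this skew] have Xp2: "X * p2 = p2 * X" by (simp add: p2_def)
  define r where "r = msqrt p2"
  have r: "pos r" "r * r = p2" "X * r = r * X"
    unfolding r_def by (rule msqrt(1)[OF p2(1)], rule msqrt(2)[OF p2(1)], rule msqrt(3)[OF p2(1) Xp2])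
  have ro: "tr r * r = 1" unfolding r_def by (rule msqrt_orthogonal[OF p2])
  have rS: "r \<in> SO" by (rule pos_orthogonal_SO[OF r(1) ro])
  have adjr: "adj (tr r) = tr r" using tr_adj[of r] pos_adj[OF r(1)] by simp
  define k where "k = ?W * ?G * tr r"
  have kS: "k \<in> SO" unfolding k_def by (intro SO_mult W(1) GS SO_tr rS)
  have "adj k * k = tr r * (adj ?G * (?W * (?W * ?G))) * tr r"
    by (simp add: k_def adjr W(3) mult.assoc)
  also have "\<dots> = (tr r * r) * (r * tr r)" by (simp add: p2W r(2)[symmetric] mult.assoc)
  also have "\<dots> = 1" by (simp add: SO_D[OF rS])
  finally have "k \<in> SOr" using kS by (simp add: SOr_def)
  moreover have "conj_act (tr r) X = X"
    unfolding conj_act_eq_iff[OF SO_tr[OF rS]] using arg_cong[OF r(3), of tr] by (simp add: skew)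
  then have "conj_act k X = conj_act (?W * ?G) X" unfolding k_def by (simp only: conj_act_mult)
  ultimately show ?thesis by (metis imageI)
qed

text \<open>A unitary g respects orthogonal complements, so it carries the grading E to the
  regrading, and the averaged Gram matrix is the identity.\<close>

lemma compact_fixed:
  assumes g: "g \<in> SOr"
  shows "G g = g" "h1 g = 1" "resc m (R g) 2 s (conj_act g X) = conj_act g X" "W g s = 1"
proof -
  have gS: "g \<in> SO" and adjg: "adj g * g = 1" using g by (auto simp: SOr_def)
  have ag: "adj g = tr g"
  proof -
    have "adj g = adj g * (g * tr g)" by (simp add: SO_D[OF gS])
    also have "\<dots> = (adj g * g) * tr g" by (simp only: mult.assoc)
    finally show ?thesis by (simp add: adjg)
  qed
  have at: "adj (tr g) = g" using tr_adj[of g] ag by simp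
  have "Q g i = g * P i * tr g" for i
  proof (rule Q_eqI[OF gS])
    show "isQ g i (g * P i * tr g)"
      by (simp add: isQ_def at ag adj_P mult.assoc SO_cancel[OF gS] SO_D[OF gS] P_P mult_assoc_rule[OF P_P])
  qed
  then have R: "R g i = g * E i * tr g" for i
    by (simp add: R_def E_eq_P left_diff_distrib right_diff_distrib)
  show Gg: "G g = g"
    by (rule grading_ext_right[OF E_grading]) (simp add: G_E[OF gS] R mult.assoc SO_cancel[OF gS] E_mult E_mult2)
  have "p1 g = 1" by (simp add: p1_def Gg adjg N_sum)
  then show h: "h1 g = 1" by (simp add: h1_eq Gg at SO_D[OF gS])
  have "W g 0 = W g s" by (simp add: W_def h flip: scaleR_left_distrib)
  then show "W g s = 1" by (simp add: W_0)
  have RXR: "R g j * conj_act g X * R g i = (if j = i + 2 then g * E j * X * tr g else 0)" for i j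
    by (simp add: R conj_act_def mult.assoc SO_cancel[OF gS] mult_assoc_rule[OF X_E] E_mult2)
  show "resc m (R g) 2 s (conj_act g X) = conj_act g X"
    by (rule grading_ext[OF R_grading[OF gS]]) (simp add: resc_component[OF R_grading[OF gS]] RXR)
qed

lemma orbit_invariance:
  assumes g: "g \<in> SO" "g' \<in> SO" and eq: "conj_act g X = conj_act g' X"
  shows "R g = R g'" "conj_act (G g) X = conj_act (G g') X" "h1 g = h1 g'"
proof -
  define z where "z = tr g * g'"
  have z: "z \<in> SO" unfolding z_def by (intro SO_mult SO_tr g)
  have g': "g' = g * z" by (simp add: z_def SO_cancel[OF g(1)])
  have "conj_act z X = X" unfolding z_def conj_act_mult eq[symmetric] by (rule conj_act_inverse[OF g(1)])
  then have zX: "z * X = X * z" using conj_act_eq_iff[OF z] by simp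
  have "Q g i = Q g' i" for i
    by (rule isQ_unique[OF Q_isQ[OF g(1)] _ zX z]) (use Q_isQ[OF g(2)] g' in simp)
  then show R: "R g = R g'" by (simp add: R_def fun_eq_iff)
  show GX: "conj_act (G g) X = conj_act (G g') X"
    using resc_0_conj[OF g(1)] resc_0_conj[OF g(2)] by (simp add: R eq)
  let ?G = "G g" and ?G' = "G g'"
  have GS: "?G \<in> SO" "?G' \<in> SO" by (rule G_SO[OF g(1)], rule G_SO[OF g(2)])
  define r where "r = tr ?G * ?G'"
  have rS: "r \<in> SO" unfolding r_def by (intro SO_mult SO_tr GS)
  have G': "?G' = ?G * r" by (simp add: r_def SO_cancel[OF GS(1)])
  have "conj_act r X = X" unfolding r_def conj_act_mult GX[symmetric] by (rule conj_act_inverse[OF GS(1)])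
  then have rX: "r * X = X * r" using conj_act_eq_iff[OF rS] by simp
  have GE: "conj_act (G k) (E i) = R k i" if k: "k \<in> SO" for k i
  proof -
    have "conj_act (G k) (E i) = (G k * E i) * tr (G k)" by (simp add: conj_act_def)
    also have "\<dots> = (R k i * G k) * tr (G k)" by (simp only: G_E[OF k] R_G[OF k])
    finally show ?thesis by (simp add: mult.assoc SO_D[OF G_SO[OF k]])
  qed
  \<comment> \<open>The gain over z: r commutes with the grading and not only with X, as
    \<open>N_comm\<close> demands.\<close>
  have rE: "r * E i = E i * r" for i
  proof -
    have "conj_act r (E i) = conj_act (tr ?G) (conj_act ?G (E i))"
      unfolding r_def conj_act_mult by (simp add: GE g R)
    then show ?thesis using conj_act_inverse[OF GS(1)] conj_act_eq_iff[OF rS] by simp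
  qed
  have "?G' * N k * tr ?G' = ?G * N k * tr ?G" if "k \<in> K" for k
  proof -
    have "conj_act r (N k) = N k" using N_comm[OF rX rE that] conj_act_eq_iff[OF rS] by simp
    then have "conj_act ?G' (N k) = conj_act ?G (N k)" unfolding G' conj_act_mult by simp
    then show ?thesis by (simp add: conj_act_def)
  qed
  then show "h1 g = h1 g'" unfolding h1_def by (intro sum.cong refl) simp
qed

lemma homotopic_canonI:
  fixes F :: "'a::topological_space \<times> real \<Rightarrow> 'b::topological_space"
  assumes F: "continuous_on (S \<times> {0..1}) F" "\<And>x s. x \<in> S \<Longrightarrow> s \<in> {0..1} \<Longrightarrow> F (x, s) \<in> T"
    and fg: "\<And>x. x \<in> S \<Longrightarrow> F (x, 0) = f x" "\<And>x. x \<in> S \<Longrightarrow> F (x, 1) = g x"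
  shows "homotopic_with_canon (\<lambda>x. True) S T f g"
proof -
  have "continuous_on ({0..1} \<times> S) (\<lambda>x. F (snd x, fst x))"
    by (rule continuous_on_compose2[OF F(1)])
      (auto intro!: continuous_on_Pair continuous_on_fst continuous_on_snd continuous_on_id)
  then have "continuous_map (prod_topology (top_of_set {0..1}) (top_of_set S)) (top_of_set T) (\<lambda>x. F (snd x, fst x))"
    using F(2) by (auto simp: prod_topology_subtopology_eu)
  then show ?thesis
    by (subst homotopic_with) (use fg in \<open>auto intro!: exI[of _ "\<lambda>x. F (snd x, fst x)"]\<close>)
qed

theorem orbit_deformation:
  "top_of_set orbit homotopy_equivalent_space top_of_set ((\<lambda>g. conj_act g X) ` SOr)"
proof -
  let ?C = "(\<lambda>g. conj_act g X) ` SOr"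
  \<comment> \<open>Any choice of representatives serves: by \<open>orbit_invariance\<close> the
    maps defined through \<open>lift\<close> agree with \<open>f1\<close> and \<open>f2\<close> at
    every g over the given point, which is the hypothesis of
    \<open>continuous_on_orbit\<close>.\<close>
  define lift where "lift A = (SOME g. g \<in> SO \<and> conj_act g X = A)" for A
  have lift: "lift A \<in> SO" "conj_act (lift A) X = A" if "A \<in> orbit" for A
  proof -
    have "\<exists>g. g \<in> SO \<and> conj_act g X = A" using that by auto
    from someI_ex[OF this] show "lift A \<in> SO" "conj_act (lift A) X = A" by (simp_all add: lift_def)
  qed
  define f1 where "f1 = (\<lambda>(g, s). resc m (R g) 2 s (conj_act g X))"
  define f2 where "f2 = (\<lambda>(g, s). conj_act (W g s) (conj_act (G g) X))"
  define F1 where "F1 = (\<lambda>(A, s). f1 (lift A, s :: real))"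
  define F2 where "F2 = (\<lambda>(A, s). f2 (lift A, s :: real))"
  have inv: "R (lift (conj_act g X)) = R g" "conj_act (G (lift (conj_act g X))) X = conj_act (G g) X"
    "h1 (lift (conj_act g X)) = h1 g" if "g \<in> SO" for g
    using orbit_invariance[OF lift(1) that lift(2)] that by auto
  have F1: "F1 (conj_act g X, s) = f1 (g, s)" if "g \<in> SO" for g s
    using inv[OF that] lift(2)[of "conj_act g X"] that by (simp add: F1_def f1_def)
  have F2: "F2 (conj_act g X, s) = f2 (g, s)" if "g \<in> SO" for g s
    using inv[OF that] by (simp add: F2_def f2_def W_def)
  have cfst: "continuous_on (SO \<times> T) (\<lambda>x. f (fst x))" if "continuous_on SO f" for f :: "'n cmat \<Rightarrow> 'n cmat" and T :: "real set"
    by (rule continuous_on_compose2[OF that continuous_on_fst[OF continuous_on_id]]) auto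
  have cpow: "continuous_on (SO \<times> {0..1}) (\<lambda>x :: 'n cmat \<times> real. if j < i then 0 else snd x ^ n)" for i j :: int and n
    by (cases "j < i") (simp_all add: continuous_on_power continuous_on_snd[OF continuous_on_id])
  have f1e: "f1 = (\<lambda>x. resc m (R (fst x)) 2 (snd x) (conj_act (fst x) X))"
    by (simp add: f1_def fun_eq_iff)
  have "continuous_on (SO \<times> {0..1}) f1"
    unfolding f1e resc_def conj_act_def
    by (intro continuous_intros cpow cfst[OF continuous_on_R] cfst[OF continuous_on_id])
  from continuous_on_orbit[OF skew this F1] have cF1: "continuous_on (orbit \<times> {0..1}) F1" .
  have "continuous_on (SO \<times> {0..1}) (\<lambda>x. (1 - snd x) *\<^sub>R 1 + snd x *\<^sub>R h1 (fst x))"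
    by (intro continuous_intros cfst[OF continuous_on_h1])
  then have "continuous_on (SO \<times> {0..1}) (\<lambda>x. gmean ((1 - snd x) *\<^sub>R 1 + snd x *\<^sub>R h1 (fst x)))"
    by (rule continuous_on_compose2[OF continuous_on_gmean]) (auto intro!: segment_pos)
  then have cW: "continuous_on (SO \<times> {0..1}) (\<lambda>x. W (fst x) (snd x))"
    unfolding W_def
    by (rule continuous_on_compose2[OF continuous_on_msqrt]) (auto intro!: gmean(1) segment_pos)
  have f2e: "f2 = (\<lambda>x. conj_act (W (fst x) (snd x)) (conj_act (G (fst x)) X))"
    by (simp add: f2_def fun_eq_iff)
  have "continuous_on (SO \<times> {0..1}) f2"
    unfolding f2e conj_act_def by (intro continuous_intros cW cfst[OF continuous_on_G])
  from continuous_on_orbit[OF skew this F2] have cF2: "continuous_on (orbit \<times> {0..1}) F2" .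
  have im1: "F1 (A, s) \<in> orbit" if "A \<in> orbit" "s \<in> {0..1}" for A s
    using that by (auto simp: F1 f1_def resc_orbit)
  have im2: "F2 (A, s) \<in> orbit" if "A \<in> orbit" "s \<in> {0..1}" for A s
    using that by (auto simp: F2 f2_def conj_act_mult[symmetric] intro!: imageI SO_mult W_props(1) G_SO)
  have sub: "?C \<subseteq> orbit" by (auto simp: SOr_def)
  define r where "r A = F2 (A, 1)" for A
  have rC: "r A \<in> ?C" if "A \<in> orbit" for A
    using that W_1_compact by (auto simp: r_def F2 f2_def conj_act_mult)
  have r_id: "r A = A" if A: "A \<in> ?C" for A
  proof -
    obtain g where g: "g \<in> SOr" "A = conj_act g X" using A by blast
    then have gS: "g \<in> SO" by (simp add: SOr_def)
    have "r A = conj_act (W g 1) (conj_act (G g) X)" unfolding r_def g(2) F2[OF gS] f2_def by simp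
    then show ?thesis by (simp add: compact_fixed[OF g(1)] g(2)) (simp add: conj_act_def)
  qed
  have cr: "continuous_on orbit r"
    unfolding r_def
    by (rule continuous_on_compose2[OF cF2])
      (auto intro!: continuous_on_Pair continuous_on_const continuous_on_id)
  define f0 where "f0 A = F1 (A, 0)" for A
  have h1: "homotopic_with_canon (\<lambda>x. True) orbit orbit f0 id"
  proof (rule homotopic_canonI[OF cF1 im1])
    show "F1 (A, 0) = f0 A" for A by (simp add: f0_def)
    show "F1 (A, 1) = id A" if A: "A \<in> orbit" for A
    proof -
      obtain g where g: "g \<in> SO" "A = conj_act g X" using A by blast
      have "resc m (R g) 2 1 (conj_act g X) = conj_act g X"
        by (rule resc_one[OF R_grading[OF g(1)] graded_conj[OF g(1)]])
      then show ?thesis unfolding g(2) F1[OF g(1)] f1_def by simp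
    qed
  qed
  have h2: "homotopic_with_canon (\<lambda>x. True) orbit orbit f0 r"
  proof (rule homotopic_canonI[OF cF2 im2])
    show "F2 (A, 1) = r A" for A by (simp add: r_def)
    show "F2 (A, 0) = f0 A" if A: "A \<in> orbit" for A
    proof -
      obtain g where g: "g \<in> SO" "A = conj_act g X" using A by blast
      have "F2 (A, 0) = conj_act 1 (conj_act (G g) X)" unfolding g(2) F2[OF g(1)] f2_def by (simp add: W_0)
      also have "\<dots> = conj_act (G g) X" by (simp add: conj_act_def)
      finally show ?thesis unfolding f0_def g(2) F1[OF g(1)] f1_def by (simp add: resc_0_conj[OF g(1)])
    qed
  qed
  have h3: "homotopic_with_canon (\<lambda>x. True) orbit orbit r id"
    by (rule homotopic_with_trans[OF homotopic_with_symD[OF h2] h1])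
  show ?thesis
    unfolding homotopy_equivalent_space_def
  proof (intro exI conjI)
    show "continuous_map (top_of_set orbit) (top_of_set ?C) r" using cr rC by auto
    show "continuous_map (top_of_set ?C) (top_of_set orbit) id" using sub by (auto simp: continuous_on_id)
    show "homotopic_with (\<lambda>x. True) (top_of_set orbit) (top_of_set orbit) (id \<circ> r) id" using h3 by simp
    show "homotopic_with (\<lambda>x. True) (top_of_set ?C) (top_of_set ?C) (r \<circ> id) id"
    proof (rule homotopic_with_equal)
      show "continuous_map (top_of_set ?C) (top_of_set ?C) (r \<circ> id)"
        using continuous_on_subset[OF cr sub] rC sub by auto
    qed (use r_id in auto)
  qed
qed

end

section \<open>Finite-dimensional representations of the split three-dimensional simple algebra\<close>

lemma mv_scaleR: "A *v (r *\<^sub>R x) = r *\<^sub>R (A *v x)" for A :: "complex^'n^'m"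
  by (vector matrix_vector_mult_def scaleR_sum_right)

lemma mv_minus: "A *v (- x) = - (A *v x)" for A :: "complex^'n^'m"
  using mv_scaleR[of A "-1" x] by simp

lemma mv_scaleR_left: "(r *\<^sub>R A) *v x = r *\<^sub>R (A *v x)" for A :: "complex^'n^'m"
  by (vector matrix_vector_mult_def scaleR_sum_right)

lemmas mv_linear = matrix_vector_right_distrib matrix_vector_mult_diff_distrib mv_scaleR mv_minus

lemma mv_sum: "A *v (\<Sum>i\<in>I. f i) = (\<Sum>i\<in>I. A *v f i)" for A :: "complex^'n^'m"
  by (induct I rule: infinite_finite_induct) (simp_all add: mv_linear)

lemma mpow_0 [simp]: "mpow A 0 u = u" by (simp add: mpow_def)
lemma mpow_Suc: "mpow A (Suc k) u = A *v mpow A k u" by (simp add: mpow_def)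
lemma mpow_Suc2: "mpow A (Suc k) u = mpow A k (A *v u)" by (simp add: mpow_def funpow_swap1)
lemma mpow_add: "mpow A (i + k) u = mpow A i (mpow A k u)" by (simp add: mpow_def funpow_add)

lemma mpow_linear: "mpow A k (x + y) = mpow A k x + mpow A k y" "mpow A k (x - y) = mpow A k x - mpow A k y"
  "mpow A k (r *\<^sub>R x) = r *\<^sub>R mpow A k x" "mpow A k (c *s x) = c *s mpow A k x" "mpow A k (- x) = - mpow A k x"
  "mpow A k 0 = 0"
  by (induction k) (simp_all add: mpow_Suc mv_linear vector_scalar_commute)

lemma mpow_sum: "mpow A k (\<Sum>i\<in>I. f i) = (\<Sum>i\<in>I. mpow A k (f i))"
  by (induct I rule: infinite_finite_induct) (simp_all add: mpow_linear)

lemma app_Cmat [simp]: "Cmat A \<rhd> u = A *v u"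
  by (simp add: app.rep_eq Cmat_inverse)

lemma mpow_power: "mpow A k u = (Cmat A ^ k) \<rhd> u"
  by (induction k) (simp_all add: mpow_Suc)

text \<open>The scalar arithmetic common to the induction steps of \<open>Y_mpow_X\<close> and
  \<open>X_mpow_Y\<close>.\<close>

lemma scaleR_combine:
  fixes p q :: "'a::real_vector"
  assumes "a' = a + 1" "a' * c' = a * c + b"
  shows "a *\<^sub>R (p + c *\<^sub>R q) + (p + b *\<^sub>R q) = a' *\<^sub>R (p + c' *\<^sub>R q)"
  by (simp add: scaleR_right_distrib assms(2)) (simp add: assms(1) algebra_simps)

locale sl2 =
  fixes X H Y :: "complex^'n^'n"
  assumes triple: "sl2_triple X H Y" and nilX: "nilpotent_mat X"
begin

lemma HX: "H *v (X *v u) = X *v (H *v u) + 2 *\<^sub>R (X *v u)"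
proof -
  have "(H ** X - X ** H) *v u = (2 *\<^sub>R X) *v u" using triple by (simp add: sl2_triple_def lie_bracket_def)
  then show ?thesis
    by (simp add: matrix_vector_mult_diff_rdistrib mv_scaleR_left algebra_simps flip: matrix_vector_mul_assoc)
qed

lemma HY: "H *v (Y *v u) = Y *v (H *v u) - 2 *\<^sub>R (Y *v u)"
proof -
  have "(H ** Y - Y ** H) *v u = (- 2) *\<^sub>R (Y *v u)"
    using triple by (simp only: sl2_triple_def lie_bracket_def mv_scaleR_left)
  then show ?thesis
    by (simp add: matrix_vector_mult_diff_rdistrib mv_scaleR_left algebra_simps flip: matrix_vector_mul_assoc)
qed

lemma YX: "Y *v (X *v u) = X *v (Y *v u) - H *v u"
proof -
  have "(X ** Y - Y ** X) *v u = H *v u" using triple by (simp add: sl2_triple_def lie_bracket_def)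
  then show ?thesis
    by (simp add: matrix_vector_mult_diff_rdistrib algebra_simps flip: matrix_vector_mul_assoc)
qed

lemma XY: "X *v (Y *v u) = Y *v (X *v u) + H *v u"
  using YX[of u] by simp

lemma H_mpow_X: "H *v mpow X i u = mpow X i (H *v u) + (2 * real i) *\<^sub>R mpow X i u"
  by (induction i) (simp_all add: mpow_Suc HX mv_linear algebra_simps)

lemma H_mpow_Y: "H *v mpow Y i u = mpow Y i (H *v u) - (2 * real i) *\<^sub>R mpow Y i u"
proof (induction i)
  case (Suc i)
  have "H *v mpow Y (Suc i) u = Y *v (mpow Y i (H *v u) - (2 * real i) *\<^sub>R mpow Y i u) - 2 *\<^sub>R (Y *v mpow Y i u)"
    by (simp only: mpow_Suc HY Suc)
  then show ?case by (simp add: mv_linear mpow_Suc scaleR_left_distrib)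
qed simp

text \<open>The vector u is not supposed to be an eigenvector of H: diagonalizability of H on the
  kernel of Y is going to be derived from this formula.\<close>

lemma Y_mpow_X:
  assumes "Y *v u = 0"
  shows "Y *v mpow X (Suc i) u = - (real (Suc i) *\<^sub>R mpow X i (H *v u + real i *\<^sub>R u))"
proof (induction i)
  case 0
  then show ?case using assms by (simp add: mpow_Suc YX mv_linear)
next
  case (Suc i)
  have "Y *v mpow X (Suc (Suc i)) u = X *v (Y *v mpow X (Suc i) u) - H *v mpow X (Suc i) u"
    by (subst mpow_Suc) (rule YX)
  also have "\<dots> = - (real (Suc i) *\<^sub>R mpow X (Suc i) (H *v u + real i *\<^sub>R u))
      - (mpow X (Suc i) (H *v u) + (2 * real (Suc i)) *\<^sub>R mpow X (Suc i) u)"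
    unfolding Suc H_mpow_X by (simp only: mv_linear mpow_Suc)
  also have "\<dots> = - (real (Suc i) *\<^sub>R (mpow X (Suc i) (H *v u) + real i *\<^sub>R mpow X (Suc i) u)
      + (mpow X (Suc i) (H *v u) + (2 * real (Suc i)) *\<^sub>R mpow X (Suc i) u))"
    by (simp only: mpow_linear) simp
  also have "\<dots> = - (real (Suc (Suc i)) *\<^sub>R (mpow X (Suc i) (H *v u) + real (Suc i) *\<^sub>R mpow X (Suc i) u))"
    by (subst scaleR_combine[where a' = "real (Suc (Suc i))" and c' = "real (Suc i)"]) (simp_all add: algebra_simps)
  also have "\<dots> = - (real (Suc (Suc i)) *\<^sub>R mpow X (Suc i) (H *v u + real (Suc i) *\<^sub>R u))"
    by (simp only: mpow_linear)
  finally show ?case .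
qed

lemma X_mpow_Y: "X *v mpow Y (Suc i) u = mpow Y (Suc i) (X *v u) + real (Suc i) *\<^sub>R mpow Y i (H *v u - real i *\<^sub>R u)"
proof (induction i)
  case 0
  then show ?case using YX[of u] by (simp add: mpow_Suc)
next
  case (Suc i)
  have "X *v mpow Y (Suc (Suc i)) u = Y *v (X *v mpow Y (Suc i) u) + H *v mpow Y (Suc i) u"
    unfolding mpow_Suc[of Y "Suc i"] by (rule XY)
  also have "\<dots> = mpow Y (Suc (Suc i)) (X *v u) + real (Suc i) *\<^sub>R mpow Y (Suc i) (H *v u - real i *\<^sub>R u)
      + (mpow Y (Suc i) (H *v u) - (2 * real (Suc i)) *\<^sub>R mpow Y (Suc i) u)"
    unfolding Suc H_mpow_Y by (simp only: mv_linear mpow_Suc)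
  also have "\<dots> = mpow Y (Suc (Suc i)) (X *v u) +
      (real (Suc i) *\<^sub>R (mpow Y (Suc i) (H *v u) + (- real i) *\<^sub>R mpow Y (Suc i) u)
      + (mpow Y (Suc i) (H *v u) + (- (2 * real (Suc i))) *\<^sub>R mpow Y (Suc i) u))"
    by (simp only: mpow_linear scaleR_minus_left add_uminus_conv_diff add.assoc)
  also have "\<dots> = mpow Y (Suc (Suc i)) (X *v u) +
      real (Suc (Suc i)) *\<^sub>R (mpow Y (Suc i) (H *v u) + (- real (Suc i)) *\<^sub>R mpow Y (Suc i) u)"
    by (subst scaleR_combine[where a' = "real (Suc (Suc i))" and c' = "- real (Suc i)"]) (simp_all add: algebra_simps)
  also have "\<dots> = mpow Y (Suc (Suc i)) (X *v u) + real (Suc (Suc i)) *\<^sub>R mpow Y (Suc i) (H *v u - real (Suc i) *\<^sub>R u)"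
    by (simp only: mpow_linear scaleR_minus_left add_uminus_conv_diff)
  finally show ?case .
qed

lemma nilpotent_X: obtains M where "\<And>u. mpow X M u = 0"
  using nilX by (auto simp: nilpotent_mat_def)

text \<open>\<open>[H, Y\<^sup>k] = - 2 k Y\<^sup>k\<close>, so \<open>Y\<^sup>k\<close> vanishes as soon as \<open>k\<close> exceeds the norm of \<open>H\<close>.\<close>

lemma nilpotent_Y: obtains M where "\<And>u. mpow Y M u = 0"
proof -
  let ?H = "Cmat H" and ?Y = "Cmat Y"
  define k where "k = Suc (nat \<lceil>norm ?H\<rceil>)"
  have k: "norm ?H < real k" unfolding k_def by linarith
  have "(2 * real k) *\<^sub>R ?Y ^ k = ?Y ^ k * ?H - ?H * ?Y ^ k"
  proof (rule cmat_eqI)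
    fix u
    have "H *v mpow Y k u = mpow Y k (H *v u) - (2 * real k) *\<^sub>R mpow Y k u" by (rule H_mpow_Y)
    then show "((2 * real k) *\<^sub>R ?Y ^ k) \<rhd> u = (?Y ^ k * ?H - ?H * ?Y ^ k) \<rhd> u"
      by (simp add: app_linear mpow_power)
  qed
  then have "norm ((2 * real k) *\<^sub>R ?Y ^ k) = norm (?Y ^ k * ?H - ?H * ?Y ^ k)" by (rule arg_cong)
  then have "2 * real k * norm (?Y ^ k) = norm (?Y ^ k * ?H - ?H * ?Y ^ k)" by simp
  also have "\<dots> \<le> norm (?Y ^ k) * norm ?H + norm ?H * norm (?Y ^ k)"
    by (rule order_trans[OF norm_triangle_ineq4 add_mono[OF norm_mult_ineq norm_mult_ineq]])
  finally have "real k * norm (?Y ^ k) \<le> norm ?H * norm (?Y ^ k)" by simp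
  moreover have "norm ?H * norm (?Y ^ k) < real k * norm (?Y ^ k)" if "?Y ^ k \<noteq> 0"
    using k that by (intro mult_strict_right_mono) auto
  ultimately have "?Y ^ k = 0" by fastforce
  then have "mpow Y k u = 0" for u by (simp add: mpow_power)
  then show thesis by (rule that)
qed

section \<open>Lowest weight vectors and complete reducibility\<close>

definition Lw :: "nat \<Rightarrow> (complex^'n) set" where
  "Lw k = {u. Y *v u = 0 \<and> H *v u = - real k *\<^sub>R u}"

lemma Lw_D: "u \<in> Lw k \<Longrightarrow> Y *v u = 0" "u \<in> Lw k \<Longrightarrow> H *v u = - real k *\<^sub>R u"
  by (auto simp: Lw_def)

lemma Lw_weight: "u \<in> Lw k \<Longrightarrow> H *v mpow X i u = (2 * real i - real k) *\<^sub>R mpow X i u"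
  by (simp add: H_mpow_X Lw_D mpow_linear algebra_simps)

lemma Lw_Y: "u \<in> Lw k \<Longrightarrow> Y *v mpow X (Suc i) u = (real (Suc i) * (real k - real i)) *\<^sub>R mpow X i u"
  by (subst Y_mpow_X) (simp_all add: Lw_D mpow_linear algebra_simps)

text \<open>For a positive weight r, Y maps \<open>mpow X (Suc i) w\<close> to a nonzero multiple of
  \<open>mpow X i w\<close>, so no power of X could kill a nonzero w.\<close>

lemma lowest_positive_weight:
  assumes w: "Y *v w = 0" "H *v w = r *\<^sub>R w" "0 < r"
  shows "w = 0"
proof (rule ccontr)
  assume "w \<noteq> 0"
  have "mpow X i w \<noteq> 0" for i
  proof (induction i)
    case (Suc i)
    have "Y *v mpow X (Suc i) w = (- (real (Suc i) * (r + real i))) *\<^sub>R mpow X i w"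
      by (subst Y_mpow_X) (simp_all add: w mpow_linear algebra_simps)
    moreover have "real (Suc i) * (r + real i) \<noteq> 0" using w(3) by simp
    ultimately have "Y *v mpow X (Suc i) w \<noteq> 0" using Suc by simp
    then show ?case by auto
  qed (use \<open>w \<noteq> 0\<close> in simp)
  then show False using nilpotent_X by blast
qed

text \<open>\<open>mpow X (Suc k) u\<close> is killed by Y and has the positive weight k +
  2.\<close>

lemma Lw_mpow_zero: assumes u: "u \<in> Lw k" "k < l" shows "mpow X l u = 0"
proof -
  have "mpow X (Suc k) u = 0"
  proof (rule lowest_positive_weight)
    show "Y *v mpow X (Suc k) u = 0" by (subst Lw_Y[OF u(1)]) simp
    show "H *v mpow X (Suc k) u = (2 * real (Suc k) - real k) *\<^sub>R mpow X (Suc k) u" by (rule Lw_weight[OF u(1)])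
  qed simp
  moreover have "l = (l - Suc k) + Suc k" using u(2) by simp
  ultimately show ?thesis by (metis mpow_add mpow_linear(6))
qed

lemma Lw_Y_mpow: assumes u: "u \<in> Lw k" "j \<le> k" shows "\<exists>c. c \<noteq> 0 \<and> mpow Y j (mpow X j u) = c *\<^sub>R u"
  using u(2)
proof (induction j)
  case 0
  show ?case by (rule exI[of _ 1]) simp
next
  case (Suc j)
  then obtain c where c: "c \<noteq> 0" "mpow Y j (mpow X j u) = c *\<^sub>R u" by auto
  have "mpow Y (Suc j) (mpow X (Suc j) u) = (real (Suc j) * (real k - real j) * c) *\<^sub>R u"
    by (simp only: mpow_Suc2[of Y] Lw_Y[OF u(1)] mpow_linear c scaleR_scaleR)
  moreover have "real (Suc j) * (real k - real j) * c \<noteq> 0" using c(1) Suc.prems by simp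
  ultimately show ?case by blast
qed

fun Hprod :: "real list \<Rightarrow> complex^'n \<Rightarrow> complex^'n" where
  "Hprod [] y = y"
| "Hprod (r # rs) y = Hprod rs (H *v y - r *\<^sub>R y)"

text \<open>An operator annihilated by a product of distinct linear factors is diagonalizable. In
  the induction \<open>H *v y - r *\<^sub>R y\<close> is a sum of eigenvectors for the other roots;
  subtracting a preimage of it under H - r from y leaves an eigenvector for r.\<close>

lemma eigen_decomposition:
  assumes S: "subspace S" "\<And>y. y \<in> S \<Longrightarrow> H *v y \<in> S"
  shows "distinct rs \<Longrightarrow> y \<in> S \<Longrightarrow> Hprod rs y = 0 \<Longrightarrow> y \<in> span {z \<in> S. \<exists>r\<in>set rs. H *v z = r *\<^sub>R z}"
proof (induction rs arbitrary: y)
  case Nil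
  then show ?case by (simp add: span_zero)
next
  case (Cons r rs)
  let ?E = "\<lambda>rs. {z \<in> S. \<exists>r\<in>set rs. H *v z = r *\<^sub>R z}"
  have 1: "H *v y - r *\<^sub>R y \<in> span (?E rs)"
    using Cons.prems S by (intro Cons.IH) (auto intro: subspace_diff subspace_scale)
  have "\<exists>y'\<in>span (?E rs). y' \<in> S \<and> H *v y' - r *\<^sub>R y' = z" if "z \<in> span (?E rs)" for z
    using that
  proof (induction rule: span_induct_alt)
    case base
    show ?case by (rule bexI[of _ 0]) (simp_all add: span_zero subspace_0[OF S(1)])
  next
    case (step c x z)
    then obtain y' where y': "y' \<in> span (?E rs)" "y' \<in> S" "H *v y' - r *\<^sub>R y' = z" by blast
    obtain r' where r': "r' \<in> set rs" "H *v x = r' *\<^sub>R x" and x: "x \<in> S" using step by blast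
    have "r' \<noteq> r" using r' Cons.prems(1) by auto
    \<comment> \<open>H - r acts on the eigenvector x as multiplication by the nonzero number r' -
      r.\<close>
    define d where "d = c / (r' - r)"
    define w where "w = d *\<^sub>R x"
    have "H *v w - r *\<^sub>R w = (d * (r' - r)) *\<^sub>R x"
      unfolding w_def by (simp add: mv_linear r' algebra_simps)
    then have w: "H *v w - r *\<^sub>R w = c *\<^sub>R x" using \<open>r' \<noteq> r\<close> by (simp add: d_def)
    show ?case
    proof (rule bexI[of _ "w + y'"], intro conjI)
      have "x \<in> span (?E rs)" using step(1) by (rule span_base)
      then show "w + y' \<in> span (?E rs)" unfolding w_def by (intro span_add span_scale y'(1))
      show "w + y' \<in> S" unfolding w_def using x y' S(1) by (intro subspace_add subspace_scale)
      have "H *v (w + y') - r *\<^sub>R (w + y') = (H *v w - r *\<^sub>R w) + (H *v y' - r *\<^sub>R y')"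
        by (simp add: mv_linear algebra_simps)
      then show "H *v (w + y') - r *\<^sub>R (w + y') = c *\<^sub>R x + z" by (simp only: w y')
    qed
  qed
  from this[OF 1] obtain y' where y': "y' \<in> span (?E rs)" "y' \<in> S" "H *v y' - r *\<^sub>R y' = H *v y - r *\<^sub>R y" by blast
  have "H *v (y - y') = r *\<^sub>R (y - y')" using y'(3) by (simp add: mv_linear algebra_simps)
  moreover have "y - y' \<in> S" using Cons.prems y' S(1) by (intro subspace_diff)
  ultimately have "y - y' \<in> span (?E (r # rs))" by (intro span_base) auto
  moreover have "y' \<in> span (?E (r # rs))" using y'(1) by (rule set_rev_mp[OF _ span_mono]) auto
  ultimately have "(y - y') + y' \<in> span (?E (r # rs))" by (rule span_add)
  then show ?case by simp
qed

text \<open>On the kernel of Y, applying X and then Y j times is, up to a nonzero factor, the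
  polynomial H (H + 1) ... (H + j - 1). Since X is nilpotent this polynomial in H vanishes there for
  large j, and its roots are distinct and not positive.\<close>

lemma mpow_Y_X_Hprod:
  "Y *v u = 0 \<Longrightarrow> \<exists>c. c \<noteq> 0 \<and> mpow Y j (mpow X j u) = c *\<^sub>R Hprod (map (\<lambda>m. - real m) (rev [0..<j])) u"
proof (induction j arbitrary: u)
  case 0
  show ?case by (rule exI[of _ 1]) simp
next
  case (Suc j)
  let ?u = "H *v u + real j *\<^sub>R u"
  have "Y *v ?u = 0" using HY[of u] Suc.prems by (simp add: mv_linear)
  from Suc.IH[OF this] obtain c where c: "c \<noteq> 0"
    "mpow Y j (mpow X j ?u) = c *\<^sub>R Hprod (map (\<lambda>m. - real m) (rev [0..<j])) ?u" by blast
  have "mpow Y (Suc j) (mpow X (Suc j) u) = - (real (Suc j) *\<^sub>R mpow Y j (mpow X j ?u))"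
    unfolding mpow_Suc2[of Y] Y_mpow_X[OF Suc.prems] by (simp only: mpow_linear)
  also have "\<dots> = (- (real (Suc j) * c)) *\<^sub>R Hprod (map (\<lambda>m. - real m) (rev [0..<j])) ?u" by (simp only: c) simp
  also have "Hprod (map (\<lambda>m. - real m) (rev [0..<j])) ?u = Hprod (map (\<lambda>m. - real m) (rev [0..<Suc j])) u" by simp
  finally show ?case using c(1) by (intro exI[of _ "- (real (Suc j) * c)"]) simp
qed

lemma lowest_weight_decomposition:
  assumes S: "subspace S" "\<And>y. y \<in> S \<Longrightarrow> H *v y \<in> S" "\<And>y. y \<in> S \<Longrightarrow> Y *v y = 0" and y: "y \<in> S"
  shows "y \<in> span (\<Union>k. S \<inter> Lw k)"
proof -
  obtain M where M: "\<And>u. mpow X M u = 0" using nilpotent_X by blast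
  let ?rs = "map (\<lambda>m. - real m) (rev [0..<M])"
  obtain c where "c \<noteq> 0" "mpow Y M (mpow X M y) = c *\<^sub>R Hprod ?rs y" using mpow_Y_X_Hprod[OF S(3)[OF y]] by blast
  then have "Hprod ?rs y = 0" by (simp add: M mpow_linear)
  moreover have "distinct ?rs" by (simp add: distinct_map inj_on_def)
  ultimately have "y \<in> span {z \<in> S. \<exists>r\<in>set ?rs. H *v z = r *\<^sub>R z}"
    using eigen_decomposition[OF S(1,2)] y by blast
  moreover have "{z \<in> S. \<exists>r\<in>set ?rs. H *v z = r *\<^sub>R z} \<subseteq> (\<Union>k. S \<inter> Lw k)"
    using S(3) by (auto simp: Lw_def)
  from span_mono[OF this] have "span {z \<in> S. \<exists>r\<in>set ?rs. H *v z = r *\<^sub>R z} \<subseteq> span (\<Union>k. S \<inter> Lw k)" .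
  ultimately show ?thesis by (rule rev_subsetD)
qed

lemma ex_lowest_weight:
  assumes U: "subspace U" "\<And>u. u \<in> U \<Longrightarrow> Y *v u \<in> U" "\<And>u. u \<in> U \<Longrightarrow> H *v u \<in> U" "U \<noteq> {0}"
  shows "\<exists>k. \<exists>u\<in>U. u \<noteq> 0 \<and> u \<in> Lw k"
proof -
  obtain u where u: "u \<in> U" "u \<noteq> 0" using U(1,4) subspace_0 by blast
  obtain M where M: "\<And>u. mpow Y M u = 0" using nilpotent_Y by blast
  define j where "j = (LEAST j. mpow Y j u = 0)"
  have j: "mpow Y j u = 0" unfolding j_def by (rule LeastI) (rule M)
  have "j \<noteq> 0" using j u(2) by (cases j) simp_all
  then obtain i where i: "j = Suc i" by (cases j) auto
  have ni: "mpow Y i u \<noteq> 0" using i not_less_Least[of i "\<lambda>j. mpow Y j u = 0"] by (simp add: j_def)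
  have iU: "mpow Y k u \<in> U" for k by (induction k) (simp_all add: u mpow_Suc U)
  let ?S = "{y \<in> U. Y *v y = 0}"
  have "mpow Y i u \<in> span (\<Union>k. ?S \<inter> Lw k)"
  proof (rule lowest_weight_decomposition)
    show "subspace ?S" using U(1) by (auto simp: subspace_def mv_linear)
    show "H *v y \<in> ?S" if "y \<in> ?S" for y using that U HY[of y] by simp
    show "mpow Y i u \<in> ?S" using iU j i by (simp add: mpow_Suc)
  qed simp
  moreover have "(\<Union>k. ?S \<inter> Lw k) \<subseteq> {0} \<Longrightarrow> span (\<Union>k. ?S \<inter> Lw k) \<subseteq> {0}"
    by (rule span_minimal) simp_all
  ultimately show ?thesis using ni by blast
qed

text \<open>If y of lowest weight -k is in the image of the m-th power of Y with m > k, then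
  applying X to the relation \<open>Y *v y = 0\<close> shows that it is in the image of the next
  power; the coefficient to divide by contains m - k. As Y is nilpotent, y vanishes.\<close>

lemma Lw_image_Y:
  assumes y: "y \<in> Lw k" "y = mpow Y j u" "k < j"
  shows "y = 0"
proof -
  have ex: "\<exists>u. y = mpow Y (j + i) u" for i
  proof (induction i)
    case (Suc i)
    define m where "m = j + i"
    obtain u where u: "y = mpow Y m u" using Suc unfolding m_def by blast
    have "mpow Y m (H *v u) = H *v y + (2 * real m) *\<^sub>R y" using H_mpow_Y[of m u] by (simp add: u)
    then have Hu: "mpow Y m (H *v u) = (2 * real m - real k) *\<^sub>R y"
      using Lw_D(2)[OF y(1)] by (simp add: scaleR_left_diff_distrib)
    define c where "c = real (Suc m) * (real m - real k)"
    have "0 = X *v mpow Y (Suc m) u" using Lw_D(1)[OF y(1)] by (simp add: mpow_Suc u[symmetric])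
    also have "\<dots> = mpow Y (Suc m) (X *v u) + real (Suc m) *\<^sub>R (mpow Y m (H *v u) - real m *\<^sub>R y)"
      unfolding X_mpow_Y by (simp only: mpow_linear u)
    also have "mpow Y m (H *v u) - real m *\<^sub>R y = (real m - real k) *\<^sub>R y"
    proof -
      have "mpow Y m (H *v u) - real m *\<^sub>R y = ((2 * real m - real k) - real m) *\<^sub>R y"
        by (simp only: Hu scaleR_left_diff_distrib)
      then show ?thesis by simp
    qed
    also have "real (Suc m) *\<^sub>R \<dots> = c *\<^sub>R y" by (simp add: c_def)
    finally have e: "c *\<^sub>R y = mpow Y (Suc m) (- (X *v u))"
      by (simp add: mpow_linear eq_neg_iff_add_eq_0 add.commute)
    have "c \<noteq> 0" using y(3) by (simp add: c_def m_def)
    then have "y = (1 / c) *\<^sub>R (c *\<^sub>R y)" by simp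
    also have "\<dots> = mpow Y (Suc m) ((1 / c) *\<^sub>R (- (X *v u)))" by (simp only: e mpow_linear)
    finally have "y = mpow Y (j + Suc i) ((1 / c) *\<^sub>R (- (X *v u)))" by (simp only: m_def add_Suc_right)
    then show ?case by (rule exI)
  next
    case 0
    show ?case using y(2) by (metis add_0_right)
  qed
  obtain M where M: "\<And>u. mpow Y M u = 0" using nilpotent_Y by blast
  obtain u where "y = mpow Y (j + M) u" using ex[of M] by blast
  then show ?thesis by (simp only: mpow_add M mpow_linear)
qed

text \<open>Induction on a power of Y killing x. The last nonzero \<open>mpow Y j x\<close> lies in
  the kernel of Y and splits into lowest weight vectors inside the image of the j-th power; each of
  them is either 0 or the j-th Y-image of a multiple of its own j-th X-image. Subtracting these
  preimages from x lowers the power.\<close>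

lemma complete_reducibility: "x \<in> span {mpow X l u |l k u. u \<in> Lw k}"
proof -
  let ?B = "{mpow X l u |l k u. u \<in> Lw k}"
  have "mpow Y j x = 0 \<Longrightarrow> x \<in> span ?B" for j
  proof (induction j arbitrary: x)
    case (Suc j)
    let ?S = "{y. Y *v y = 0 \<and> (\<exists>u. y = mpow Y j u)}"
    have "mpow Y j x \<in> span (\<Union>k. ?S \<inter> Lw k)"
    proof (rule lowest_weight_decomposition)
      show "subspace ?S"
        unfolding subspace_def
      proof (intro conjI ballI allI)
        show "0 \<in> ?S" by (auto intro: exI[of _ 0] simp: mpow_linear)
        show "a + b \<in> ?S" if ab: "a \<in> ?S" "b \<in> ?S" for a b
        proof -
          obtain a' b' where "a = mpow Y j a'" "b = mpow Y j b'" using ab by blast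
          then have "a + b = mpow Y j (a' + b')" by (simp add: mpow_linear)
          moreover have "Y *v (a + b) = 0" using ab by (simp add: mv_linear)
          ultimately show ?thesis by blast
        qed
        show "c *\<^sub>R a \<in> ?S" if a: "a \<in> ?S" for c a
        proof -
          obtain a' where "a = mpow Y j a'" using a by blast
          then have "c *\<^sub>R a = mpow Y j (c *\<^sub>R a')" by (simp add: mpow_linear)
          moreover have "Y *v (c *\<^sub>R a) = 0" using a by (simp add: mv_linear)
          ultimately show ?thesis by blast
        qed
      qed
      show "H *v y \<in> ?S" if y: "y \<in> ?S" for y
      proof -
        obtain u where u: "y = mpow Y j u" using y by blast
        have "H *v y = mpow Y j (H *v u - (2 * real j) *\<^sub>R u)" unfolding u H_mpow_Y by (simp add: mpow_linear)
        moreover have "Y *v (H *v y) = 0" using HY[of y] y by simp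
        ultimately show ?thesis by blast
      qed
      show "mpow Y j x \<in> ?S" using Suc.prems by (auto simp: mpow_Suc)
    qed simp
    moreover have "span (\<Union>k. ?S \<inter> Lw k) \<subseteq> (\<lambda>w. mpow Y j w) ` span ?B"
    proof (rule span_minimal)
      have "linear (mpow Y j)" by (rule linearI) (simp_all add: mpow_linear)
      then show "subspace ((\<lambda>w. mpow Y j w) ` span ?B)" by (intro linear_subspace_image) simp_all
      show "(\<Union>k. ?S \<inter> Lw k) \<subseteq> (\<lambda>w. mpow Y j w) ` span ?B"
      proof
        fix y assume "y \<in> (\<Union>k. ?S \<inter> Lw k)"
        then obtain k u where y: "y \<in> Lw k" "y = mpow Y j u" by blast
        show "y \<in> (\<lambda>w. mpow Y j w) ` span ?B"
        proof (cases "j \<le> k")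
          case True
          then obtain c where c: "c \<noteq> 0" "mpow Y j (mpow X j y) = c *\<^sub>R y" using Lw_Y_mpow[OF y(1)] by blast
          have eq: "y = mpow Y j ((1 / c) *\<^sub>R mpow X j y)" unfolding mpow_linear c(2) using c(1) by simp
          have "mpow X j y \<in> ?B" using y(1) by blast
          then have "(1 / c) *\<^sub>R mpow X j y \<in> span ?B" by (intro span_scale span_base)
          with eq show ?thesis by (rule image_eqI)
        next
          case False
          then have y0: "y = 0" by (intro Lw_image_Y[OF y]) simp
          show ?thesis by (rule image_eqI[of _ _ 0]) (simp_all add: y0 mpow_linear span_zero)
        qed
      qed
    qed
    ultimately have "mpow Y j x \<in> (\<lambda>w. mpow Y j w) ` span ?B" by (rule rev_subsetD)
    then obtain w where w: "mpow Y j x = mpow Y j w" "w \<in> span ?B" by (rule imageE)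
    have "x - w \<in> span ?B" by (rule Suc.IH) (simp add: mpow_linear w)
    from span_add[OF this w(2)] show ?case by simp
  qed (simp add: span_zero)
  moreover obtain M where "\<And>u. mpow Y M u = 0" using nilpotent_Y by blast
  ultimately show ?thesis by blast
qed

lemma eigen_sum_zero:
  assumes "finite I" "inj_on r I" "\<And>i. i \<in> I \<Longrightarrow> H *v z i = r i *\<^sub>R z i" "(\<Sum>i\<in>I. z i) = 0" "i \<in> I"
  shows "z i = 0"
  using assms
proof (induction I arbitrary: z i rule: finite_induct)
  case (insert j I)
  have ins: "z j + (\<Sum>i\<in>I. z i) = 0" using insert by simp
  have z: "z i = 0" if i: "i \<in> I" for i
  proof -
    have "(r i - r j) *\<^sub>R z i = 0"
    proof (rule insert.IH[where z = "\<lambda>i. (r i - r j) *\<^sub>R z i"])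
      show "inj_on r I" using insert.prems(1) by simp
      show "H *v ((r i - r j) *\<^sub>R z i) = r i *\<^sub>R (r i - r j) *\<^sub>R z i" if "i \<in> I" for i
        using insert.prems(2)[of i] that by (simp add: mv_linear mult.commute)
      have "(\<Sum>i\<in>I. (r i - r j) *\<^sub>R z i) = (\<Sum>i\<in>I. H *v z i) - r j *\<^sub>R (\<Sum>i\<in>I. z i)"
        using insert.prems(2) by (simp add: scaleR_left_diff_distrib sum_subtractf scaleR_sum_right)
      also have "\<dots> = H *v (z j + (\<Sum>i\<in>I. z i)) - r j *\<^sub>R (z j + (\<Sum>i\<in>I. z i))"
        using insert.prems(2)[of j] by (simp add: mv_linear mv_sum algebra_simps)
      also have "\<dots> = 0" unfolding ins by simp
      finally show "(\<Sum>i\<in>I. (r i - r j) *\<^sub>R z i) = 0" .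
    qed (rule i)
    moreover have "r i \<noteq> r j" using insert.prems(1) insert.hyps(2) i by (auto simp: inj_on_def)
    ultimately show ?thesis by simp
  qed
  then have "z j = 0" using ins by simp
  then show ?case using z insert.prems(4) by auto
qed simp

section \<open>The Casimir operator, irreducible submodules and the spaces L\<close>

definition cas :: "complex^'n \<Rightarrow> complex^'n" where
  "cas x = H *v (H *v x) - 2 *\<^sub>R (H *v x) + 4 *\<^sub>R (X *v (Y *v x))"

text \<open>\<open>cas\<close> is the Casimir element H^2 + 2 X Y + 2 Y X. Its value k^2 + 2 k grows
  with k and so tells strings of different lengths apart.\<close>

lemma cas_Lw: assumes u: "u \<in> Lw k" shows "cas (mpow X i u) = (real k * real k + 2 * real k) *\<^sub>R mpow X i u"
proof (cases i)
  case 0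
  then show ?thesis using u by (simp add: cas_def Lw_D mv_linear algebra_simps)
next
  case (Suc i')
  have "X *v (Y *v mpow X i u) = (real i * (real k - real i')) *\<^sub>R mpow X i u"
    unfolding Suc Lw_Y[OF u] by (simp add: mv_linear mpow_Suc)
  moreover define a where "a = 2 * real i - real k"
  moreover define b where "b = real i * (real k - real i')"
  ultimately have "H *v mpow X i u = a *\<^sub>R mpow X i u" "X *v (Y *v mpow X i u) = b *\<^sub>R mpow X i u"
    using Lw_weight[OF u, of i] by simp_all
  then have "cas (mpow X i u) = (a * a - 2 * a + 4 * b) *\<^sub>R mpow X i u"
    by (simp add: cas_def mv_linear scaleR_left_diff_distrib scaleR_left_distrib)
  also have "a * a - 2 * a + 4 * b = real k * real k + 2 * real k"
    by (simp add: a_def b_def Suc algebra_simps)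
  finally show ?thesis .
qed

text \<open>On the kernel of Y the equation factors as (H - k - 2) (H + k) x = 0, and the positive
  weight k + 2 cannot occur there.\<close>

lemma cas_lowest:
  assumes x: "cas x = (real k * real k + 2 * real k) *\<^sub>R x" "Y *v x = 0"
  shows "x \<in> Lw k"
proof -
  let ?w = "H *v x + real k *\<^sub>R x"
  have HH: "H *v (H *v x) = 2 *\<^sub>R (H *v x) + (real k * real k + 2 * real k) *\<^sub>R x"
    using x by (simp add: cas_def algebra_simps)
  have "?w = 0"
  proof (rule lowest_positive_weight)
    show "Y *v ?w = 0" using HY[of x] x(2) by (simp add: mv_linear)
    show "H *v ?w = (real k + 2) *\<^sub>R ?w" by (simp add: mv_linear HH algebra_simps)
  qed simp
  then show ?thesis using x(2) by (simp add: Lw_def add_eq_0_iff)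
qed

lemma submodule_iff:
  "submodule X H Y U \<longleftrightarrow> subspace U \<and> (\<forall>u\<in>U. X *v u \<in> U \<and> H *v u \<in> U \<and> Y *v u \<in> U)"
proof
  assume "submodule X H Y U"
  moreover have "X \<in> span {X, H, Y}" "H \<in> span {X, H, Y}" "Y \<in> span {X, H, Y}" by (auto intro: span_base)
  ultimately show "subspace U \<and> (\<forall>u\<in>U. X *v u \<in> U \<and> H *v u \<in> U \<and> Y *v u \<in> U)"
    unfolding submodule_def by blast
next
  assume U: "subspace U \<and> (\<forall>u\<in>U. X *v u \<in> U \<and> H *v u \<in> U \<and> Y *v u \<in> U)"
  have "Z *v u \<in> U" if "Z \<in> span {X, H, Y}" "u \<in> U" for Z u
    using that(1)
  proof (induction rule: span_induct_alt)
    case base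
    show ?case using U by (simp add: subspace_0)
  next
    case (step c A B)
    have "A *v u \<in> U" using step(1) U that(2) by auto
    then have "c *\<^sub>R (A *v u) + B *v u \<in> U" using step(2) U by (intro subspace_add subspace_scale) auto
    then show ?case by (simp add: matrix_vector_mult_add_rdistrib mv_scaleR_left)
  qed
  then show "submodule X H Y U" using U by (simp add: submodule_def)
qed

lemma string_submodule:
  assumes u: "u \<in> Lw k"
  shows "submodule X H Y (span ((\<lambda>i. mpow X i u) ` {..k}))"
proof -
  let ?T = "span ((\<lambda>i. mpow X i u) ` {..k})"
  have mem: "mpow X i u \<in> ?T" for i
    by (cases "i \<le> k") (auto intro: span_base simp: Lw_mpow_zero[OF u] span_zero)
  have lin: "linear ((*v) A)" for A :: "complex^'n^'n" by (rule linearI) (simp_all add: mv_linear)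
  have stable: "A *v x \<in> ?T" if A: "\<And>i. A *v mpow X i u \<in> ?T" and x: "x \<in> ?T" for A x
  proof -
    have "A *v x \<in> (*v) A ` ?T" using x by blast
    also have "(*v) A ` ?T = span ((*v) A ` (\<lambda>i. mpow X i u) ` {..k})" by (rule linear_span_image[OF lin, symmetric])
    also have "\<dots> \<subseteq> ?T" by (rule span_minimal) (use A in auto)
    finally show ?thesis .
  qed
  have "X *v mpow X i u \<in> ?T" for i using mem[of "Suc i"] by (simp add: mpow_Suc)
  moreover have "H *v mpow X i u \<in> ?T" for i unfolding Lw_weight[OF u] by (intro span_scale mem)
  moreover have "Y *v mpow X i u \<in> ?T" for i
  proof (cases i)
    case 0
    then show ?thesis using Lw_D(1)[OF u] by (simp add: span_zero)
  next
    case (Suc i')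
    show ?thesis unfolding Suc Lw_Y[OF u] by (intro span_scale mem)
  qed
  ultimately show ?thesis unfolding submodule_iff using stable by auto
qed

lemma Lw_mpow_nonzero: assumes u: "u \<in> Lw k" "u \<noteq> 0" "i \<le> k" shows "mpow X i u \<noteq> 0"
proof
  assume "mpow X i u = 0"
  moreover obtain c where "c \<noteq> 0" "mpow Y i (mpow X i u) = c *\<^sub>R u" using Lw_Y_mpow[OF u(1,3)] by blast
  ultimately show False using u(2) by (simp add: mpow_linear)
qed

lemma string_coefficients:
  assumes u: "u \<in> Lw k" "u \<noteq> 0" and 0: "(\<Sum>i\<le>k. a i *\<^sub>R mpow X i u) = 0" and i: "i \<le> k"
  shows "a i = 0"
proof -
  have "a i *\<^sub>R mpow X i u = 0"
  proof (rule eigen_sum_zero[of "{..k}" "\<lambda>i. 2 * real i - real k" "\<lambda>i. a i *\<^sub>R mpow X i u" i])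
    show "inj_on (\<lambda>i. 2 * real i - real k) {..k}" by (auto simp: inj_on_def)
    show "H *v (a i *\<^sub>R mpow X i u) = (2 * real i - real k) *\<^sub>R a i *\<^sub>R mpow X i u" for i
      by (simp add: mv_linear Lw_weight[OF u(1)] mult.commute)
  qed (use 0 i in auto)
  then show ?thesis using Lw_mpow_nonzero[OF u i] by simp
qed

lemma string_inj: assumes u: "u \<in> Lw k" "u \<noteq> 0" shows "inj_on (\<lambda>i. mpow X i u) {..k}"
proof (rule inj_onI)
  fix i j assume ij: "i \<in> {..k}" "j \<in> {..k}" "mpow X i u = mpow X j u"
  have "H *v mpow X i u = (2 * real j - real k) *\<^sub>R mpow X i u"
    using Lw_weight[OF u(1), of j] by (simp only: ij(3)[symmetric])
  then have "(2 * real i - real k) *\<^sub>R mpow X i u = (2 * real j - real k) *\<^sub>R mpow X i u"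
    by (simp only: Lw_weight[OF u(1)])
  then have "2 * real i - real k = 2 * real j - real k"
    using Lw_mpow_nonzero[OF u, of i] ij(1) by (simp only: scaleR_cancel_right) simp
  then show "i = j" by simp
qed

lemma span_string:
  assumes "x \<in> span ((\<lambda>i. mpow X i u) ` {..k})"
  shows "\<exists>a. x = (\<Sum>i\<le>k. a i *\<^sub>R mpow X i u)"
proof -
  have "finite I \<Longrightarrow> x \<in> span ((\<lambda>i. mpow X i u) ` I) \<Longrightarrow> \<exists>a. x = (\<Sum>i\<in>I. a i *\<^sub>R mpow X i u)" for I
  proof (induction I arbitrary: x rule: finite_induct)
    case (insert j I)
    then obtain c where "x - c *\<^sub>R mpow X j u \<in> span ((\<lambda>i. mpow X i u) ` I)"
      by (auto simp: span_breakdown_eq)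
    from insert.IH[OF this] obtain a where a: "x - c *\<^sub>R mpow X j u = (\<Sum>i\<in>I. a i *\<^sub>R mpow X i u)" by blast
    have "(\<Sum>i\<in>insert j I. (a(j := c)) i *\<^sub>R mpow X i u) = c *\<^sub>R mpow X j u + (\<Sum>i\<in>I. (a(j := c)) i *\<^sub>R mpow X i u)"
      using insert.hyps by simp
    also have "(\<Sum>i\<in>I. (a(j := c)) i *\<^sub>R mpow X i u) = (\<Sum>i\<in>I. a i *\<^sub>R mpow X i u)"
      using insert.hyps(2) by (intro sum.cong) auto
    also have "c *\<^sub>R mpow X j u + \<dots> = x" using a by (simp add: algebra_simps)
    finally show ?case by metis
  qed simp
  then show ?thesis using assms by blast
qed

lemma dim_string: assumes u: "u \<in> Lw k" "u \<noteq> 0" shows "dim (span ((\<lambda>i. mpow X i u) ` {..k})) = Suc k"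
proof -
  let ?f = "\<lambda>i. mpow X i u"
  have "independent (?f ` {..k})"
  proof (rule ccontr)
    assume "\<not> ?thesis"
    then obtain c v where c: "v \<in> ?f ` {..k}" "c v \<noteq> 0" "(\<Sum>v\<in>?f ` {..k}. c v *\<^sub>R v) = 0"
      using dependent_finite[of "?f ` {..k}"] by auto
    then have "(\<Sum>i\<le>k. c (?f i) *\<^sub>R ?f i) = 0" by (simp add: sum.reindex[OF string_inj[OF u]])
    then have "c (?f i) = 0" if "i \<le> k" for i using string_coefficients[OF u, of "\<lambda>i. c (?f i)"] that by blast
    then show False using c by auto
  qed
  then show ?thesis by (simp add: dim_eq_card_independent card_image[OF string_inj[OF u]])
qed

lemma cas_span:
  assumes "x \<in> span {mpow X i u |i u. u \<in> Lw k}"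
  shows "cas x = (real k * real k + 2 * real k) *\<^sub>R x"
  using assms
proof (induction rule: span_induct_alt)
  case base
  show ?case by (simp add: cas_def)
next
  case (step c x y)
  have "cas (c *\<^sub>R x + y) = c *\<^sub>R cas x + cas y" by (simp add: cas_def mv_linear algebra_simps)
  then show ?case using step cas_Lw by (auto simp: algebra_simps)
qed

lemma irreducible_string:
  assumes U: "irreducible_submodule X H Y U"
  shows "\<exists>k u. u \<in> Lw k \<and> u \<noteq> 0 \<and> U = span ((\<lambda>i. mpow X i u) ` {..k})"
proof -
  have sub: "submodule X H Y U" "U \<noteq> {0}" and min: "\<And>U'. U' \<subseteq> U \<Longrightarrow> submodule X H Y U' \<Longrightarrow> U' = {0} \<or> U' = U"
    using U by (auto simp: irreducible_submodule_def)
  then have S: "subspace U" "\<And>u. u \<in> U \<Longrightarrow> X *v u \<in> U" "\<And>u. u \<in> U \<Longrightarrow> H *v u \<in> U" "\<And>u. u \<in> U \<Longrightarrow> Y *v u \<in> U"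
    by (auto simp: submodule_iff)
  obtain k u where u: "u \<in> U" "u \<noteq> 0" "u \<in> Lw k" using ex_lowest_weight[OF S(1,4,3) sub(2)] by blast
  let ?T = "span ((\<lambda>i. mpow X i u) ` {..k})"
  have "mpow X i u \<in> U" for i by (induction i) (simp_all add: u mpow_Suc S)
  then have "?T \<subseteq> U" by (intro span_minimal S(1)) auto
  moreover have "u \<in> ?T" by (rule span_base) (auto intro: image_eqI[of _ _ 0])
  ultimately have "U = ?T" using min[OF _ string_submodule[OF u(3)]] u(2) by blast
  then show ?thesis using u by blast
qed

text \<open>A nonzero submodule contains a lowest weight vector x. The Casimir operator forces its
  weight to be that of u, and inside one string only multiples of u have this weight, so the
  submodule contains u.\<close>

lemma string_irreducible:
  assumes u: "u \<in> Lw k" "u \<noteq> 0"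
  shows "irreducible_submodule X H Y (span ((\<lambda>i. mpow X i u) ` {..k}))"
proof -
  let ?T = "span ((\<lambda>i. mpow X i u) ` {..k})"
  have uT: "u \<in> ?T" by (rule span_base) (auto intro: image_eqI[of _ _ 0])
  have "U = {0} \<or> U = ?T" if U: "U \<subseteq> ?T" "submodule X H Y U" for U
  proof (cases "U = {0}")
    case False
    have S: "subspace U" "\<And>u. u \<in> U \<Longrightarrow> X *v u \<in> U" "\<And>u. u \<in> U \<Longrightarrow> H *v u \<in> U" "\<And>u. u \<in> U \<Longrightarrow> Y *v u \<in> U"
      using U(2) by (auto simp: submodule_iff)
    obtain k' x where x: "x \<in> U" "x \<noteq> 0" "x \<in> Lw k'" using ex_lowest_weight[OF S(1,4,3) False] by blast
    have "?T \<subseteq> span {mpow X i u |i u. u \<in> Lw k}" by (rule span_mono) (use u in auto)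
    then have "cas x = (real k * real k + 2 * real k) *\<^sub>R x" using cas_span U(1) x(1) by blast
    then have xk: "x \<in> Lw k" using cas_lowest Lw_D(1)[OF x(3)] by blast
    obtain a where a: "x = (\<Sum>i\<le>k. a i *\<^sub>R mpow X i u)" using span_string U(1) x(1) by blast
    \<comment> \<open>H + k kills x and multiplies the i-th coefficient by 2 i, so only the
      coefficient with i = 0 can be nonzero.\<close>
    have "(\<Sum>i\<le>k. (2 * real i * a i) *\<^sub>R mpow X i u) = H *v x + real k *\<^sub>R x"
      unfolding a by (simp add: mv_sum mv_linear Lw_weight[OF u(1)] scaleR_sum_right sum.distrib[symmetric] algebra_simps)
    also have "\<dots> = 0" using Lw_D(2)[OF xk] by simp
    finally have "2 * real i * a i = 0" if "i \<le> k" for i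
      using string_coefficients[OF u, of "\<lambda>i. 2 * real i * a i"] that by blast
    then have a0: "a i = 0" if "i \<le> k" "i \<noteq> 0" for i using that by fastforce
    have "x = (\<Sum>i\<le>k. if i = 0 then a 0 *\<^sub>R u else 0)" unfolding a
      by (rule sum.cong) (use a0 in auto)
    then have xa: "x = a 0 *\<^sub>R u" by simp
    then have "a 0 \<noteq> 0" using x(2) by auto
    then have "u = (1 / a 0) *\<^sub>R x" using xa by simp
    then have uU: "u \<in> U" using x(1) S(1) by (metis subspace_scale)
    have "mpow X i u \<in> U" for i by (induction i) (simp_all add: uU mpow_Suc S)
    then have "?T \<subseteq> U" by (intro span_minimal S(1)) auto
    then show ?thesis using U(1) by blast
  qed simp
  then show ?thesis unfolding irreducible_submodule_def using string_submodule[OF u(1)] uT u(2) by blast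
qed

text \<open>Replaces the definition by irreducible real submodules with an eigenvector condition.
  The Casimir operator gives one inclusion, the strings generated by lowest weight vectors the
  other.\<close>

lemma L_space_eq: "L_space X H Y k = Lw k"
proof
  show "L_space X H Y k \<subseteq> Lw k"
  proof
    fix x assume "x \<in> L_space X H Y k"
    then have x: "x \<in> M_space X H Y k" "Y *v x = 0" by (auto simp: L_space_def)
    have "\<Union>{U. irreducible_submodule X H Y U \<and> dim U = Suc k} \<subseteq> span {mpow X i u |i u. u \<in> Lw k}"
    proof
      fix y assume "y \<in> \<Union>{U. irreducible_submodule X H Y U \<and> dim U = Suc k}"
      then obtain U where U: "irreducible_submodule X H Y U" "dim U = Suc k" "y \<in> U" by blast
      obtain k' u where u: "u \<in> Lw k'" "u \<noteq> 0" "U = span ((\<lambda>i. mpow X i u) ` {..k'})"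
        using irreducible_string[OF U(1)] by blast
      then have "k' = k" using U(2) dim_string[OF u(1,2)] by simp
      moreover have "span ((\<lambda>i. mpow X i u) ` {..k'}) \<subseteq> span {mpow X i u |i u. u \<in> Lw k'}"
        by (rule span_mono) (use u(1) in auto)
      ultimately show "y \<in> span {mpow X i u |i u. u \<in> Lw k}" using U(3) u(3) by blast
    qed
    then have "M_space X H Y k \<subseteq> span {mpow X i u |i u. u \<in> Lw k}"
      unfolding M_space_def by (rule span_minimal) simp
    then have "cas x = (real k * real k + 2 * real k) *\<^sub>R x" using cas_span x(1) by blast
    then show "x \<in> Lw k" using x(2) by (rule cas_lowest)
  qed
  show "Lw k \<subseteq> L_space X H Y k"
  proof
    fix u assume u: "u \<in> Lw k"
    have "u \<in> M_space X H Y k"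
    proof (cases "u = 0")
      case False
      let ?T = "span ((\<lambda>i. mpow X i u) ` {..k})"
      have "u \<in> ?T" by (rule span_base) (auto intro: image_eqI[of _ _ 0])
      then show ?thesis
        unfolding M_space_def using string_irreducible[OF u False] dim_string[OF u False] by (intro span_base) blast
    qed (simp add: M_space_def span_zero)
    then show "u \<in> L_space X H Y k" using Lw_D(1)[OF u] by (simp add: L_space_def)
  qed
qed

end

section \<open>Unitary strings\<close>

definition herm :: "complex^'n \<Rightarrow> complex^'n \<Rightarrow> complex" where
  "herm x y = (\<Sum>i\<in>UNIV. cnj (x $ i) * y $ i)"

definition outer :: "complex^'n \<Rightarrow> complex^'n \<Rightarrow> 'n::finite cmat" where
  "outer x y = Cmat (\<chi> i j. x $ i * cnj (y $ j))"

lemma outer_app: "outer x y \<rhd> z = herm y z *s x"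
  unfolding outer_def app_Cmat by (simp add: Finite_Cartesian_Product.vec_eq_iff matrix_vector_mult_def herm_def sum_distrib_left mult_ac)

lemma adj_outer: "adj (outer x y) = outer y x"
  unfolding outer_def by (simp add: adj_def Cmat_inverse Finite_Cartesian_Product.vec_eq_iff mult.commute map_fun_def)

text \<open>\<open>e d a l\<close> is level l of the a-th string of length d. Spanning is assumed in
  the form \<open>e_ext\<close>, so that matrix identities are checked on basis vectors;
  \<open>st\<close> and \<open>s\<close> describe complex conjugation, which turns strings upside
  down.\<close>

locale unitary_strings =
  fixes D :: "nat set" and t :: "nat \<Rightarrow> nat" and e :: "nat \<Rightarrow> nat \<Rightarrow> nat \<Rightarrow> complex^'n"
    and X :: "'n::finite cmat" and st :: "nat \<Rightarrow> nat \<Rightarrow> nat" and s :: "nat \<Rightarrow> nat \<Rightarrow> nat \<Rightarrow> real"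
  assumes finD: "finite D"
    and herm_e: "\<lbrakk>d \<in> D; a \<in> {1..t d}; l < d; d' \<in> D; a' \<in> {1..t d'}; l' < d'\<rbrakk> \<Longrightarrow>
      herm (e d a l) (e d' a' l') = (if d = d' \<and> a = a' \<and> l = l' then 1 else 0)"
    and e_ext: "(\<And>d a l. \<lbrakk>d \<in> D; a \<in> {1..t d}; l < d\<rbrakk> \<Longrightarrow> A \<rhd> e d a l = B \<rhd> e d a l) \<Longrightarrow> A = B"
    and X_e: "\<lbrakk>d \<in> D; a \<in> {1..t d}\<rbrakk> \<Longrightarrow> X \<rhd> e d a l = e d a (Suc l)"
    and e_0: "\<lbrakk>d \<in> D; a \<in> {1..t d}; d \<le> l\<rbrakk> \<Longrightarrow> e d a l = 0"
    and vcnj_e: "\<lbrakk>d \<in> D; a \<in> {1..t d}; l < d\<rbrakk> \<Longrightarrow> vcnj (e d a l) = s d a l *\<^sub>R e d (st d a) (d - 1 - l)"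
    and s_nz: "s d a l \<noteq> 0"
    and st: "\<lbrakk>d \<in> D; a \<in> {1..t d}\<rbrakk> \<Longrightarrow> st d a \<in> {1..t d}" "\<lbrakk>d \<in> D; a \<in> {1..t d}\<rbrakk> \<Longrightarrow> st d (st d a) = a"
    and X_skew: "tr X = - X"
begin

definition Idx :: "(nat \<times> nat \<times> nat) set" where
  "Idx = (SIGMA d:D. {1..t d} \<times> {..<d})"

definition ee :: "nat \<times> nat \<times> nat \<Rightarrow> complex^'n" where
  "ee = (\<lambda>(d, a, l). e d a l)"

definition wt :: "nat \<times> nat \<times> nat \<Rightarrow> int" where
  "wt = (\<lambda>(d, a, l). 2 * int l - int d + 1)"

lemma finite_Idx: "finite Idx" unfolding Idx_def using finD by auto

lemma Idx_iff: "(d, a, l) \<in> Idx \<longleftrightarrow> d \<in> D \<and> a \<in> {1..t d} \<and> l < d" by (auto simp: Idx_def)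

lemma herm_ee: "x \<in> Idx \<Longrightarrow> y \<in> Idx \<Longrightarrow> herm (ee x) (ee y) = (if x = y then 1 else 0)"
  by (cases x; cases y) (auto simp: Idx_iff ee_def herm_e)

lemma ee_ext: assumes "\<And>x. x \<in> Idx \<Longrightarrow> A \<rhd> ee x = B \<rhd> ee x" shows "A = B"
proof (rule e_ext)
  fix d a l assume "d \<in> D" "a \<in> {1..t d}" "l < d"
  then show "A \<rhd> e d a l = B \<rhd> e d a l" using assms[of "(d, a, l)"] by (simp add: Idx_iff ee_def)
qed

lemma sum_outer_app:
  assumes "S \<subseteq> Idx" "y \<in> Idx"
  shows "(\<Sum>x\<in>S. outer (f x) (ee x)) \<rhd> ee y = (if y \<in> S then f y else 0)"
proof -
  have "(\<Sum>x\<in>S. outer (f x) (ee x)) \<rhd> ee y = (\<Sum>x\<in>S. if x = y then f y else 0)"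
    unfolding app_sum_left
  proof (intro sum.cong refl)
    fix x assume "x \<in> S"
    then show "outer (f x) (ee x) \<rhd> ee y = (if x = y then f y else 0)"
      using herm_ee[of x y] assms by (auto simp: outer_app)
  qed
  also have "\<dots> = (if y \<in> S then f y else 0)" using finite_subset[OF assms(1) finite_Idx] by simp
  finally show ?thesis .
qed

text \<open>The weight projections written in the unitary basis, which makes them self-adjoint at
  sight.\<close>

definition E :: "int \<Rightarrow> 'n cmat" where
  "E i = (\<Sum>x\<in>{x \<in> Idx. wt x = i}. outer (ee x) (ee x))"

lemma E_ee: "y \<in> Idx \<Longrightarrow> E i \<rhd> ee y = (if wt y = i then ee y else 0)"
  unfolding E_def by (subst sum_outer_app) auto

lemma E_e: "\<lbrakk>d \<in> D; a \<in> {1..t d}\<rbrakk> \<Longrightarrow> E i \<rhd> e d a l = (if 2 * int l - int d + 1 = i then e d a l else 0)"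
  using E_ee[of "(d, a, l)" i] by (cases "l < d") (auto simp: Idx_iff ee_def wt_def e_0)

lemma adj_E: "adj (E i) = E i"
  by (simp add: E_def adj_outer)

lemma X_E: "X * E i = E (i + 2) * X"
  by (rule e_ext) (auto simp: E_e X_e)

lemma Xpow_e: "\<lbrakk>d \<in> D; a \<in> {1..t d}\<rbrakk> \<Longrightarrow> X ^ k \<rhd> e d a l = e d a (l + k)"
  by (induction k) (simp_all add: X_e)

lemma Xpow_E: "X ^ k * E i = E (i + 2 * int k) * X ^ k"
  by (rule e_ext) (auto simp: E_e Xpow_e)

definition m :: int where "m = int (Max (insert 0 D))"

text \<open>For Hermitian \<open>E i\<close> transposition is conjugation by \<open>vcnj\<close>,
  and complex conjugation reverses strings and hence weights.\<close>

lemma E_grading: "grading m E"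
  unfolding grading_def
proof (intro conjI allI)
  fix i j
  show "E i * E j = (if i = j then E i else 0)" by (rule ee_ext) (auto simp: E_ee)
  show "tr (E i) = E (- i)"
  proof (rule e_ext)
    fix d a l assume dal: "d \<in> D" "a \<in> {1..t d}" "l < d"
    let ?a = "st d a" and ?l = "d - 1 - l"
    have st': "?a \<in> {1..t d}" "st d ?a = a" "?l < d" "d - 1 - ?l = l" using st dal by auto
    have "tr (E i) \<rhd> vcnj (e d ?a ?l) = vcnj (E i \<rhd> e d ?a ?l)"
      using vcnj_app[of "E i" "e d ?a ?l"] by (simp add: adj_E)
    also have "\<dots> = (if 2 * int l - int d + 1 = - i then vcnj (e d ?a ?l) else 0)"
      using dal st' by (auto simp: E_e of_nat_diff)
    finally have "s d ?a ?l *\<^sub>R (tr (E i) \<rhd> e d a l) = s d ?a ?l *\<^sub>R (E (- i) \<rhd> e d a l)"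
      using dal st' by (auto simp: vcnj_e app_linear E_e)
    then show "tr (E i) \<rhd> e d a l = E (- i) \<rhd> e d a l" using s_nz by simp
  qed
next
  show "(\<Sum>i\<in>{- m..m}. E i) = 1"
  proof (rule ee_ext)
    fix x assume x: "x \<in> Idx"
    then obtain d a l where dal: "x = (d, a, l)" "d \<in> D" "l < d" by (cases x) (auto simp: Idx_iff)
    have "int d \<le> m" unfolding m_def using dal(2) finD by (auto intro: Max_ge)
    then have "wt x \<in> {- m..m}" using dal by (auto simp: wt_def)
    then show "(\<Sum>i\<in>{- m..m}. E i) \<rhd> ee x = 1 \<rhd> ee x" using x by (simp add: app_sum_left E_ee)
  qed
qed

section \<open>Recovering the bottoms of strings from powers of X\<close>

definition Dn :: "'n cmat" where
  "Dn = (\<Sum>x\<in>Idx. outer (case x of (d, a, l) \<Rightarrow> if l = 0 then 0 else e d a (l - 1)) (ee x))"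

lemma Dn_e: "\<lbrakk>d \<in> D; a \<in> {1..t d}; Suc l < d\<rbrakk> \<Longrightarrow> Dn \<rhd> e d a (Suc l) = e d a l"
  using sum_outer_app[of Idx "(d, a, Suc l)"] by (simp add: Dn_def ee_def Idx_iff)

lemma Dnpow_e: "\<lbrakk>d \<in> D; a \<in> {1..t d}; l + k < d\<rbrakk> \<Longrightarrow> Dn ^ k \<rhd> e d a (l + k) = e d a l"
  by (induction k arbitrary: l) (simp_all add: power_commutes[symmetric] Dn_e del: power_Suc add: power_Suc2)

definition N :: "nat \<times> nat \<Rightarrow> 'n cmat" where
  "N = (\<lambda>(d, l). \<Sum>x\<in>{x \<in> Idx. fst x = d \<and> snd (snd x) = l}. outer (e d (fst (snd x)) 0) (ee x))"

lemma N_e: "\<lbrakk>d' \<in> D; a \<in> {1..t d'}\<rbrakk> \<Longrightarrow> N (d, l) \<rhd> e d' a l' = (if d' = d \<and> l' = l \<and> l < d then e d a 0 else 0)"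
proof (cases "l' < d'")
  case True
  assume "d' \<in> D" "a \<in> {1..t d'}"
  then show ?thesis
    using True sum_outer_app[of "{x \<in> Idx. fst x = d \<and> snd (snd x) = l}" "(d', a, l')" "\<lambda>x. e d (fst (snd x)) 0"]
    by (auto simp: N_def ee_def Idx_iff)
qed (auto simp: e_0)

lemma adjN_e: assumes d': "d' \<in> D" "a \<in> {1..t d'}" "l' < d'"
  shows "adj (N (d, l)) \<rhd> e d' a l' = (if d' = d \<and> l' = 0 then e d a l else 0)"
proof (cases "d = d' \<and> l < d'")
  case False
  then have "{x \<in> Idx. fst x = d \<and> snd (snd x) = l} = {} \<or> d \<noteq> d'" by (auto simp: Idx_def)
  then show ?thesis
  proof
    assume "d \<noteq> d'"
    have "herm (e d (fst (snd x)) 0) (e d' a l') = 0" if "x \<in> {x \<in> Idx. fst x = d \<and> snd (snd x) = l}" for x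
      using that d' \<open>d \<noteq> d'\<close> by (cases x) (auto simp: Idx_iff intro!: trans[OF herm_e])
    then show ?thesis using \<open>d \<noteq> d'\<close>
      by (auto simp: N_def adj_outer app_sum_left outer_app intro!: sum.neutral)
  next
    assume 0: "{x \<in> Idx. fst x = d \<and> snd (snd x) = l} = {}"
    then have "N (d, l) = 0" unfolding N_def by (simp only: prod.case 0 sum.empty)
    then show ?thesis using False d' by (auto simp: e_0)
  qed
next
  case True
  then have d: "d = d'" "l < d" by auto
  let ?S = "{x \<in> Idx. fst x = d \<and> snd (snd x) = l}"
  have "adj (N (d, l)) \<rhd> e d' a l' = (\<Sum>x\<in>?S. herm (e d (fst (snd x)) 0) (e d a l') *s ee x)"
    by (simp add: N_def adj_outer app_sum_left outer_app d)
  also have "\<dots> = (\<Sum>x\<in>?S. if x = (d, a, l) then (if l' = 0 then e d a l else 0) else 0)"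
  proof (intro sum.cong refl)
    fix x assume "x \<in> ?S"
    then obtain a' where x: "x = (d, a', l)" "a' \<in> {1..t d}" by (cases x) (auto simp: Idx_iff)
    show "herm (e d (fst (snd x)) 0) (e d a l') *s ee x = (if x = (d, a, l) then (if l' = 0 then e d a l else 0) else 0)"
      using x d' d by (auto simp: herm_e ee_def)
  qed
  also have "\<dots> = (if l' = 0 then e d a l else 0)" using d' d finite_Idx by (simp add: Idx_iff)
  finally show ?thesis using d by simp
qed

text \<open>In weight 1 - d live the bottoms of the strings of length d and higher levels of longer
  strings. The latter are not killed by the d-th power of X, and \<open>Dn\<close> brings them back.
  So a vector of this weight killed by \<open>X ^ d\<close> is in the range of
  \<open>N (d, 0)\<close>.\<close>

lemma bottom_eq: "E (1 - int d) = N (d, 0) + Dn ^ d * X ^ d * E (1 - int d)" if "0 < d"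
proof (rule e_ext)
  fix d' a l assume dal: "d' \<in> D" "a \<in> {1..t d'}" "l < d'"
  show "E (1 - int d) \<rhd> e d' a l = (N (d, 0) + Dn ^ d * X ^ d * E (1 - int d)) \<rhd> e d' a l"
  proof (cases "2 * int l - int d' + 1 = 1 - int d")
    case True
    then have d': "d' = 2 * l + d" by linarith
    show ?thesis
    proof (cases "l = 0")
      case True
      then show ?thesis using dal d' that by (simp add: app_linear E_e N_e Xpow_e e_0)
    next
      case False
      then have "l + d < d'" using d' by simp
      then show ?thesis using dal d' False by (simp add: app_linear E_e N_e Xpow_e Dnpow_e)
    qed
  next
    case False
    then show ?thesis using dal that by (auto simp: app_linear E_e N_e)
  qed
qed

text \<open>Vectors of weight at most -d can be raised d times without loss; hence a vector killed
  by \<open>X ^ d\<close> has no component in these weights.\<close>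

lemma below_eq: "E (- int k) = Dn ^ d * X ^ d * E (- int k)" if "d \<le> k"
proof (rule e_ext)
  fix d' a l assume dal: "d' \<in> D" "a \<in> {1..t d'}" "l < d'"
  show "E (- int k) \<rhd> e d' a l = (Dn ^ d * X ^ d * E (- int k)) \<rhd> e d' a l"
  proof (cases "2 * int l - int d' + 1 = - int k")
    case True
    then have "l + d < d'" using that by linarith
    then show ?thesis using dal True by (simp add: E_e Xpow_e Dnpow_e)
  qed (use dal in \<open>simp add: E_e\<close>)
qed

lemma commute_Xpow: assumes "z * X = X * z" shows "z * X ^ k = X ^ k * z"
proof (induction k)
  case (Suc k)
  have "z * X ^ Suc k = (z * X) * X ^ k" by (simp add: mult.assoc)
  also have "\<dots> = X * (z * X ^ k)" by (simp only: assms mult.assoc)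
  finally show ?case by (simp only: Suc power_Suc mult.assoc)
qed simp

lemma commutant_e: assumes "z * X = X * z" "d \<in> D" "a \<in> {1..t d}" shows "z \<rhd> e d a l = X ^ l \<rhd> z \<rhd> e d a 0"
proof -
  have "z \<rhd> e d a l = (z * X ^ l) \<rhd> e d a 0" using Xpow_e[OF assms(2,3), of l 0] by simp
  then show ?thesis by (simp add: commute_Xpow[OF assms(1)])
qed

lemma Xpow_commutant_bottom:
  assumes "z * X = X * z" "d \<in> D" "a \<in> {1..t d}" shows "X ^ d \<rhd> z \<rhd> e d a 0 = 0"
proof -
  have "e d a d = 0" by (rule e_0[OF assms(2,3)]) simp
  then show ?thesis using commutant_e[OF assms, of d] by simp
qed

text \<open>z sends the bottom of a string of length d to a vector killed by \<open>X ^ d\<close>,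
  which by \<open>below_eq\<close> has no component of weight below 1 - d. The higher levels follow
  by applying powers of X.\<close>

lemma filtered: assumes z: "z * X = X * z" and ji: "j < i" shows "E j * z * E i = 0"
proof (rule e_ext)
  fix d a l assume dal: "d \<in> D" "a \<in> {1..t d}" "l < d"
  show "(E j * z * E i) \<rhd> e d a l = 0 \<rhd> e d a l"
  proof (cases "2 * int l - int d + 1 = i")
    case True
    \<comment> \<open>-k is the weight from which \<open>X ^ l\<close> leads to weight j; as j is
      less than i = 2 l - d + 1, it is at most -d.\<close>
    define k where "k = nat (2 * int l - j)"
    have k: "- int k = j - 2 * int l" "d \<le> k" using True ji dal by (auto simp: k_def)
    let ?w = "z \<rhd> e d a 0"
    have "E (- int k) \<rhd> ?w = Dn ^ d \<rhd> (X ^ d * E (- int k)) \<rhd> ?w"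
      by (subst below_eq[OF k(2)]) (simp add: mult.assoc)
    also have "\<dots> = 0" unfolding Xpow_E using Xpow_commutant_bottom[OF z dal(1,2)] by simp
    finally have 0: "E (- int k) \<rhd> ?w = 0" .
    have "(E j * z * E i) \<rhd> e d a l = (E j * X ^ l) \<rhd> ?w"
      using dal True commutant_e[OF z dal(1,2), of l] by (simp add: E_e)
    also have "E j * X ^ l = X ^ l * E (- int k)" using Xpow_E[of l "- int k"] k by simp
    finally show ?thesis using 0 by simp
  qed (use dal in \<open>simp add: E_e\<close>)
qed

text \<open>Preserving weights in addition, z sends a bottom of a string of length d to a vector of
  weight 1 - d killed by \<open>X ^ d\<close>, and by \<open>bottom_eq\<close> this is again a
  combination of bottoms of strings of length d.\<close>

lemma N_comm:
  assumes z: "z * X = X * z" "\<And>i. z * E i = E i * z"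
  shows "z * N (d, l) = N (d, l) * z"
proof (rule e_ext)
  fix d' a l' assume dal: "d' \<in> D" "a \<in> {1..t d'}" "l' < d'"
  let ?w = "z \<rhd> e d' a 0"
  have "E (1 - int d') \<rhd> ?w = (z * E (1 - int d')) \<rhd> e d' a 0" by (simp add: z(2))
  also have "\<dots> = ?w" using dal by (simp add: E_e)
  finally have Ew: "E (1 - int d') \<rhd> ?w = ?w" .
  have "?w = (N (d', 0) + Dn ^ d' * X ^ d' * E (1 - int d')) \<rhd> ?w"
    using Ew bottom_eq[of d'] dal(3) by simp
  also have "\<dots> = N (d', 0) \<rhd> ?w"
    using Xpow_commutant_bottom[OF z(1) dal(1,2)] by (simp add: app_linear Ew)
  finally have w: "N (d', 0) \<rhd> ?w = ?w" ..
  have NX: "N (d, l) * X ^ l' * N (d', 0) = (if d' = d \<and> l' = l then N (d', 0) else 0)"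
    by (rule e_ext) (use dal in \<open>auto simp: N_e Xpow_e\<close>)
  have "(N (d, l) * z) \<rhd> e d' a l' = (N (d, l) * X ^ l' * N (d', 0)) \<rhd> ?w"
    using commutant_e[OF z(1) dal(1,2), of l'] w by simp
  also have "\<dots> = (if d' = d \<and> l' = l then ?w else 0)" unfolding NX
    by (simp only: if_distrib[of "\<lambda>A. A \<rhd> ?w"] app_simps w)
  also have "\<dots> = (z * N (d, l)) \<rhd> e d' a l'" using dal by (auto simp: N_e)
  finally show "(z * N (d, l)) \<rhd> e d' a l' = (N (d, l) * z) \<rhd> e d' a l'" ..
qed

abbreviation NK :: "(nat \<times> nat) set" where "NK \<equiv> SIGMA d:D. {..<d}"

lemma N_sum: "(\<Sum>k\<in>NK. adj (N k) * N k) = 1"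
proof (rule e_ext)
  fix d a l assume dal: "d \<in> D" "a \<in> {1..t d}" "l < d"
  have "(\<Sum>k\<in>NK. adj (N k) * N k) \<rhd> e d a l = (\<Sum>k\<in>NK. if k = (d, l) then e d a l else 0)"
    unfolding app_sum_left
  proof (intro sum.cong refl)
    fix k assume "k \<in> NK"
    then obtain d' l' where k: "k = (d', l')" "l' < d'" by auto
    show "(adj (N k) * N k) \<rhd> e d a l = (if k = (d, l) then e d a l else 0)"
      using dal k by (auto simp: N_e adjN_e)
  qed
  also have "\<dots> = e d a l" using dal finD by simp
  finally show "(\<Sum>k\<in>NK. adj (N k) * N k) \<rhd> e d a l = 1 \<rhd> e d a l" by simp
qed

lemma N_X: "N (d, Suc l) * X = (if Suc l < d then N (d, l) else 0)" "N (d, 0) * X = 0"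
  by (rule e_ext, auto simp: N_e X_e)+

lemma X_adjN: "X * adj (N (d, l)) = adj (N (d, Suc l))"
  by (rule e_ext) (auto simp: adjN_e X_e)

lemma adjN_top: "adj (N (d, d)) = 0"
  by (rule e_ext) (auto simp: adjN_e e_0)

text \<open>The sum copies one and the same block of p, taken at the bottoms, to all levels of the
  strings of equal length. Multiplying by X on either side shifts the level by one.\<close>

lemma N_exp: "X * (\<Sum>k\<in>NK. adj (N k) * p * N k) = (\<Sum>k\<in>NK. adj (N k) * p * N k) * X"
proof -
  have 1: "X * (\<Sum>l<d. adj (N (d, l)) * p * N (d, l)) = (\<Sum>l<d. adj (N (d, l)) * p * N (d, l)) * X" for d
  proof -
    \<comment> \<open>The summands after the shift; both the one at level 0 and the one at level d
      vanish, so the ranges on the two sides match.\<close>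
    define g where "g l = (case l of 0 \<Rightarrow> 0 | Suc l' \<Rightarrow> adj (N (d, l)) * p * N (d, l'))" for l
    have "X * (\<Sum>l<d. adj (N (d, l)) * p * N (d, l)) = (\<Sum>l<d. g (Suc l))"
      unfolding sum_distrib_left by (intro sum.cong refl) (simp add: g_def X_adjN mult.assoc[symmetric])
    also have "\<dots> = (\<Sum>l<Suc d. g l)" unfolding sum.lessThan_Suc_shift by (simp add: g_def)
    also have "\<dots> = (\<Sum>l<d. g l)" by (simp add: g_def adjN_top split: nat.split)
    also have "\<dots> = (\<Sum>l<d. adj (N (d, l)) * p * N (d, l)) * X"
      unfolding sum_distrib_right
    proof (intro sum.cong refl)
      fix l assume "l \<in> {..<d}"
      then show "g l = adj (N (d, l)) * p * N (d, l) * X"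
        by (cases l) (simp_all add: g_def mult.assoc N_X)
    qed
    finally show ?thesis .
  qed
  have S: "(\<Sum>k\<in>NK. adj (N k) * p * N k) = (\<Sum>d\<in>D. \<Sum>l<d. adj (N (d, l)) * p * N (d, l))"
    using finD by (subst sum.Sigma) (auto intro!: sum.cong)
  show ?thesis unfolding S sum_distrib_left[of X _ D] sum_distrib_right[of _ D X] using 1 by simp
qed

sublocale graded_nilpotent m X E NK N
proof
  show "z * N k = N k * z" if "z * X = X * z" "\<And>i. z * E i = E i * z" "k \<in> NK" for z k
    using N_comm[OF that(1,2)] by (cases k) simp
qed (rule E_grading adj_E X_skew X_E filtered N_sum N_exp | assumption)+

end

section \<open>Orthonormal lists for the symmetric bilinear form\<close>

lemma scaleR_eq_smult: "r *\<^sub>R x = complex_of_real r *s x" for x :: "complex^'n"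
  unfolding Finite_Cartesian_Product.vec_eq_iff vector_scaleR_component vector_smult_component
  by (simp add: scaleR_conv_of_real)

lemma smult_scaleR: "c *s (r *\<^sub>R x) = r *\<^sub>R (c *s x)" for x :: "complex^'n"
  by (simp add: Finite_Cartesian_Product.vec_eq_iff)

lemma bil_commute: "bil x y = bil y x"
  by (simp add: bil_def mult.commute)

lemma bil_linear:
  "bil (x + y) z = bil x z + bil y z" "bil z (x + y) = bil z x + bil z y"
  "bil (x - y) z = bil x z - bil y z" "bil z (x - y) = bil z x - bil z y"
  "bil (c *s x) z = c * bil x z" "bil z (c *s x) = c * bil z x"
  "bil (r *\<^sub>R x) z = complex_of_real r * bil x z" "bil z (r *\<^sub>R x) = complex_of_real r * bil z x"
  "bil (- x) z = - bil x z" "bil z (- x) = - bil z x"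
  "bil 0 z = 0" "bil z 0 = 0"
  unfolding scaleR_eq_smult
  by (simp_all add: bil_def algebra_simps sum.distrib sum_subtractf sum_distrib_left sum_negf)

lemma bil_sum: "bil z (\<Sum>i\<in>I. f i) = (\<Sum>i\<in>I. bil z (f i))" "bil (\<Sum>i\<in>I. f i) z = (\<Sum>i\<in>I. bil (f i) z)"
  by (induct I rule: infinite_finite_induct) (simp_all add: bil_linear)

lemma bil_eq_0: assumes "\<And>y. bil x y = 0" shows "x = 0"
proof -
  have "x $ i = 0" for i using assms[of "axis i 1"] by (simp add: bil_def axis_def if_distrib cong: if_cong)
  then show ?thesis by (simp add: Finite_Cartesian_Product.vec_eq_iff)
qed

lemma bil_mult_left: "bil (A *v x) y = bil x (Finite_Cartesian_Product.transpose A *v y)"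
proof -
  have "bil (A *v x) y = (\<Sum>i\<in>UNIV. \<Sum>j\<in>UNIV. A $ i $ j * x $ j * y $ i)"
    by (simp add: bil_def matrix_vector_mult_def sum_distrib_right)
  also have "\<dots> = (\<Sum>j\<in>UNIV. \<Sum>i\<in>UNIV. A $ i $ j * x $ j * y $ i)" by (rule sum.swap)
  also have "\<dots> = bil x (Finite_Cartesian_Product.transpose A *v y)"
    by (simp add: bil_def matrix_vector_mult_def sum_distrib_left Finite_Cartesian_Product.transpose_def mult_ac
        del: transpose_matrix_vector)
  finally show ?thesis .
qed

lemma so_C_transpose: "A \<in> so_C \<Longrightarrow> Finite_Cartesian_Product.transpose A = - A"
  by (simp add: so_C_def add_eq_0_iff2)

lemma minus_mv: "(- A) *v x = - (A *v x)" for A :: "complex^'n^'m"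
  using mv_scaleR_left[of "-1" A x] by simp

lemma bil_so_C: "A \<in> so_C \<Longrightarrow> bil (A *v x) y = - bil x (A *v y)"
  unfolding bil_mult_left by (simp only: so_C_transpose minus_mv bil_linear)

definition bil_orthonormal :: "(complex^'n) list \<Rightarrow> bool" where
  "bil_orthonormal bs \<longleftrightarrow> (\<forall>i<length bs. \<forall>j<length bs. bil (bs ! i) (bs ! j) = (if i = j then 1 else 0))"

lemma orthonormal_distinct: assumes "bil_orthonormal bs" shows "distinct bs"
  unfolding distinct_conv_nth
proof (intro allI impI notI)
  fix i j assume ij: "i < length bs" "j < length bs" "i \<noteq> j" "bs ! i = bs ! j"
  note o = assms[unfolded bil_orthonormal_def, rule_format]
  have "bil (bs ! i) (bs ! i) = 1" using o[OF ij(1,1)] by simp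
  moreover have "bil (bs ! i) (bs ! j) = 0" using o[OF ij(1,2)] ij(3) by simp
  ultimately show False unfolding ij(4) by simp
qed

lemma orthonormal_set: assumes "bil_orthonormal bs" "x \<in> set bs" "y \<in> set bs" shows "bil x y = (if x = y then 1 else 0)"
proof -
  obtain i j where ij: "i < length bs" "x = bs ! i" "j < length bs" "y = bs ! j" using assms(2,3) by (metis in_set_conv_nth)
  have "x = y \<longleftrightarrow> i = j" using orthonormal_distinct[OF assms(1)] ij by (simp add: nth_eq_iff_index_eq)
  then show ?thesis using assms(1)[unfolded bil_orthonormal_def, rule_format, OF ij(1,3)] unfolding ij(2,4) by simp
qed

lemma orthonormal_coeff:
  assumes "bil_orthonormal bs" "x \<in> set bs"
  shows "bil x (\<Sum>y\<in>set bs. u y *s y) = u x"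
proof -
  have "bil x (\<Sum>y\<in>set bs. u y *s y) = (\<Sum>y\<in>set bs. if y = x then u x else 0)"
    unfolding bil_sum
  proof (intro sum.cong refl)
    fix y assume "y \<in> set bs"
    then show "bil x (u y *s y) = (if y = x then u x else 0)"
      using orthonormal_set[OF assms, of y] by (simp add: bil_linear)
  qed
  also have "\<dots> = u x" using assms(2) by simp
  finally show ?thesis .
qed

lemma orthonormal_independent: assumes "bil_orthonormal bs" shows "vec.independent (set bs)"
proof
  assume "vec.dependent (set bs)"
  then obtain u x where u: "x \<in> set bs" "u x \<noteq> 0" "(\<Sum>y\<in>set bs. u y *s y) = 0"
    using vec.dependent_finite[of "set bs"] by auto
  show False using orthonormal_coeff[OF assms u(1), of u] u(2) unfolding u(3) by (simp add: bil_linear)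
qed

lemma orthonormal_representation:
  assumes bs: "bil_orthonormal bs" "x \<in> vec.span (set bs)" "i < length bs"
  shows "vec.representation (set bs) x (bs ! i) = bil (bs ! i) x"
proof -
  have "(\<Sum>y\<in>set bs. vec.representation (set bs) x y *s y) = x"
    by (rule vec.sum_representation_eq[OF orthonormal_independent[OF bs(1)] bs(2)]) auto
  then show ?thesis using orthonormal_coeff[OF bs(1), of "bs ! i" "vec.representation (set bs) x"] bs(3) by simp
qed

text \<open>For an orthonormal list the coordinates are values of the bilinear form, which frees the
  matrix computations from \<open>vec.representation\<close>.\<close>

lemma matrix_wrt_orthonormal:
  assumes "bil_orthonormal bs" "\<And>j. j < length bs \<Longrightarrow> T (bs ! j) \<in> vec.span (set bs)"
  shows "matrix_wrt bs T = Matrix.mat (length bs) (length bs) (\<lambda>(i, j). bil (bs ! i) (T (bs ! j)))"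
  unfolding matrix_wrt_def using orthonormal_representation[OF assms(1)] assms(2) by (intro eq_matI) auto

section \<open>Adapted bases\<close>

locale adapted =
  fixes X H Y :: "complex^'n^'n" and v :: "nat \<Rightarrow> nat \<Rightarrow> complex^'n"
  assumes X_so: "X \<in> so_C" and H_so: "H \<in> so_C" and Y_so: "Y \<in> so_C"
    and sl2: "sl2_triple X H Y" and nilp: "nilpotent_mat X"
    and adapted_v: "adapted_bases X H Y v"

sublocale adapted \<subseteq> sl2 X H Y
  by standard (rule sl2, rule nilp)

context adapted
begin

abbreviation t :: "nat \<Rightarrow> nat" where "t \<equiv> mult X H Y"
abbreviation D :: "nat set" where "D \<equiv> parts X H Y"

definition b :: "nat \<Rightarrow> nat \<Rightarrow> nat \<Rightarrow> complex^'n" where "b d j l = mpow X l (v d j)"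

lemma v_basis:
  assumes "d \<in> D"
  shows "inj_on (v d) {1..t d}" "vec.independent (v d ` {1..t d})" "vec.span (v d ` {1..t d}) = Lw (d - 1)"
proof -
  have *: "inj_on (v d) {1..t d} \<and> vec.independent (v d ` {1..t d}) \<and> vec.span (v d ` {1..t d}) = L_space X H Y (d - 1)"
    using adapted_v[unfolded adapted_bases_def Let_def, THEN conjunct1] assms by (rule bspec)
  show "inj_on (v d) {1..t d}" "vec.independent (v d ` {1..t d})" "vec.span (v d ` {1..t d}) = Lw (d - 1)"
    by (rule *[THEN conjunct1] *[THEN conjunct2, THEN conjunct1] *[THEN conjunct2, THEN conjunct2, unfolded L_space_eq])+
qed

lemma D_pos: "d \<in> D \<Longrightarrow> 0 < d" "d \<in> D \<Longrightarrow> 0 < t d" by (auto simp: parts_def)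

lemma v_Lw: "d \<in> D \<Longrightarrow> j \<in> {1..t d} \<Longrightarrow> v d j \<in> Lw (d - 1)"
  by (subst v_basis(3)[symmetric]) (auto intro: vec.span_base)

lemma b_0: "d \<in> D \<Longrightarrow> j \<in> {1..t d} \<Longrightarrow> d \<le> l \<Longrightarrow> b d j l = 0"
  unfolding b_def using D_pos(1)[of d] by (intro Lw_mpow_zero[OF v_Lw]) auto

lemma X_b: "X *v b d j l = b d j (Suc l)" by (simp add: b_def mpow_Suc)

lemma H_b: "d \<in> D \<Longrightarrow> j \<in> {1..t d} \<Longrightarrow> H *v b d j l = (2 * real l - (real d - 1)) *\<^sub>R b d j l"
  unfolding b_def using Lw_weight[OF v_Lw, of d j l] D_pos(1)[of d] by (simp add: of_nat_diff)

text \<open>\<open>adapted_bases\<close> speaks of parts only; for other d the multiplicity is 0, so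
  the lowest weight space is zero.\<close>

lemma Lw_sum: assumes "u \<in> Lw k" shows "\<exists>c. u = (\<Sum>j\<in>{1..t (Suc k)}. c j *s v (Suc k) j) \<and> (Suc k \<notin> D \<longrightarrow> u = 0)"
proof (cases "Suc k \<in> D")
  case True
  let ?V = "v (Suc k) ` {1..t (Suc k)}"
  have "u \<in> vec.span ?V" using v_basis(3)[OF True] assms by simp
  then obtain c where "u = (\<Sum>x\<in>?V. c x *s x)" by (subst (asm) vec.span_finite) auto
  then have "u = (\<Sum>j\<in>{1..t (Suc k)}. c (v (Suc k) j) *s v (Suc k) j)"
    by (simp only: sum.reindex[OF v_basis(1)[OF True]] o_def)
  then show ?thesis by (intro exI[of _ "\<lambda>j. c (v (Suc k) j)"] conjI) (auto simp: True)
next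
  case False
  then have "vec.dim (Lw k) = 0" by (simp add: parts_def mult_def L_space_eq)
  then have u0: "u = 0" using assms by (auto simp: vec.dim_eq_0)
  show ?thesis by (rule exI[of _ "\<lambda>_. 0"]) (simp add: u0)
qed

lemma finite_D: "finite D"
proof -
  obtain M where M: "\<And>u. mpow X M u = 0" using nilpotent_X by blast
  have "d \<le> M" if d: "d \<in> D" for d
  proof (rule ccontr)
    assume "\<not> d \<le> M"
    have "1 \<in> {1..t d}" using D_pos(2)[OF d] by simp
    have "v d 1 \<noteq> 0" using v_basis(2)[OF d] \<open>1 \<in> {1..t d}\<close> vec.dependent_zero by (metis image_eqI)
    moreover have "mpow X M (v d 1) \<noteq> 0"
      using Lw_mpow_nonzero[OF v_Lw[OF d \<open>1 \<in> {1..t d}\<close>] \<open>v d 1 \<noteq> 0\<close>, of M] \<open>\<not> d \<le> M\<close> by simp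
    ultimately show False using M by simp
  qed
  then show ?thesis by (meson finite_nat_set_iff_bounded_le)
qed

section \<open>Spanning and Gram relations of the strings\<close>

definition B :: "(complex^'n) set" where
  "B = {b d j l |d j l. d \<in> D \<and> j \<in> {1..t d} \<and> l < d}"

text \<open>Complete reducibility concerns real spans of strings; expanding lowest weight vectors in
  the complex bases brings them into the complex span of \<open>B\<close>.\<close>

lemma b_span: "x \<in> vec.span B"
proof -
  have sub: "subspace (vec.span B)"
    unfolding subspace_def scaleR_eq_smult by (auto intro: vec.span_zero vec.span_add vec.span_scale)
  have "{mpow X l u |l k u. u \<in> Lw k} \<subseteq> vec.span B"
  proof safe
    fix l k u assume "u \<in> Lw k"
    then obtain c where c: "u = (\<Sum>j\<in>{1..t (Suc k)}. c j *s v (Suc k) j)" "Suc k \<notin> D \<longrightarrow> u = 0" using Lw_sum by blast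
    show "mpow X l u \<in> vec.span B"
    proof (cases "Suc k \<in> D")
      case True
      have "mpow X l u = (\<Sum>j\<in>{1..t (Suc k)}. c j *s b (Suc k) j l)"
        unfolding c(1) mpow_sum by (simp only: mpow_linear b_def)
      also have "\<dots> \<in> vec.span B"
      proof (intro vec.span_sum vec.span_scale)
        fix j assume j: "j \<in> {1..t (Suc k)}"
        show "b (Suc k) j l \<in> vec.span B"
          using True j by (cases "l < Suc k") (auto simp: b_0 vec.span_zero B_def intro!: vec.span_base)
      qed
      finally show ?thesis .
    qed (use c in \<open>simp add: mpow_linear vec.span_zero\<close>)
  qed
  then have "span {mpow X l u |l k u. u \<in> Lw k} \<subseteq> vec.span B" using sub by (rule span_minimal)
  then show ?thesis using complete_reducibility by blast
qed

lemma linear_eq_on_b: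
  assumes "\<And>x y. f (x + y) = f x + f y" "\<And>c x. f (c *s x) = c *s f x"
    and "\<And>x y. g (x + y) = g x + g y" "\<And>c x. g (c *s x) = c *s g x"
    and "\<And>d j l. \<lbrakk>d \<in> D; j \<in> {1..t d}; l < d\<rbrakk> \<Longrightarrow> f (b d j l) = g (b d j l)"
  shows "f x = (g x :: complex^'n)"
proof -
  have f0: "f 0 = 0" using assms(2)[of 0 0] by simp
  have g0: "g 0 = 0" using assms(4)[of 0 0] by simp
  have "vec.subspace {x. f x = g x}" by (auto simp: vec.subspace_def assms(1-4) f0 g0)
  moreover have "B \<subseteq> {x. f x = g x}" using assms(5) by (auto simp: B_def)
  ultimately have "vec.span B \<subseteq> {x. f x = g x}" by (metis vec.span_minimal)
  then show ?thesis using b_span by blast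
qed

lemma bil_b_eq_0: assumes "\<And>d j l. \<lbrakk>d \<in> D; j \<in> {1..t d}; l < d\<rbrakk> \<Longrightarrow> bil x (b d j l) = 0" shows "x = 0"
proof (rule bil_eq_0)
  fix y
  have "vec.subspace {y. bil x y = 0}" by (auto simp: vec.subspace_def bil_linear)
  moreover have "B \<subseteq> {y. bil x y = 0}" using assms by (auto simp: B_def)
  ultimately have "vec.span B \<subseteq> {y. bil x y = 0}" by (metis vec.span_minimal)
  then show "bil x y = 0" using b_span by blast
qed

lemma bil_mpow: "bil (mpow X l x) y = (-1) ^ l * bil x (mpow X l y)"
proof (induction l arbitrary: y)
  case (Suc l)
  have "bil (mpow X (Suc l) x) y = - bil (mpow X l x) (X *v y)" unfolding mpow_Suc by (rule bil_so_C[OF X_so])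
  also have "\<dots> = - ((-1) ^ l * bil x (mpow X (Suc l) y))" by (simp only: Suc mpow_Suc2)
  finally show ?case by simp
qed simp

lemma form_sym: "form X d x y = (-1) ^ (d - 1) * form X d y x"
  unfolding form_def by (subst bil_commute) (rule bil_mpow)

text \<open>Skewness of H kills pairings of weights that are not opposite. For opposite weights and
  different lengths, moving all powers of X to the vector from the shorter string gives a power
  exceeding its length.\<close>

lemma gram:
  assumes d: "d \<in> D" "i \<in> {1..t d}" and d': "d' \<in> D" "j \<in> {1..t d'}"
  shows "bil (b d i l) (b d' j m) = (if d = d' \<and> l + m = d - 1 then (-1) ^ l * form X d (v d i) (v d j) else 0)"
proof -
  have w: "(2 * real l - (real d - 1) + (2 * real m - (real d' - 1))) * bil (b d i l) (b d' j m) = 0"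
  proof -
    have "bil (H *v b d i l) (b d' j m) + bil (b d i l) (H *v b d' j m) = 0" using bil_so_C[OF H_so] by simp
    then show ?thesis unfolding H_b[OF d] H_b[OF d'] bil_linear by (simp add: algebra_simps)
  qed
  have e: "bil (b d i l) (b d' j m) = (-1) ^ l * bil (v d i) (mpow X (l + m) (v d' j))"
    unfolding b_def bil_mpow mpow_add ..
  show ?thesis
  proof (cases "2 * (l + m) + 2 = d + d'")
    case False
    have "2 * real l - (real d - 1) + (2 * real m - (real d' - 1)) \<noteq> 0"
    proof
      assume "2 * real l - (real d - 1) + (2 * real m - (real d' - 1)) = 0"
      then have "real (2 * (l + m) + 2) = real (d + d')" by simp
      then show False using False by (simp only: of_nat_eq_iff)
    qed
    then have "bil (b d i l) (b d' j m) = 0" using w by (simp only: mult_eq_0_iff of_real_eq_0_iff simp_thms)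
    moreover have "\<not> (d = d' \<and> l + m = d - 1)" using False D_pos(1)[OF d(1)] by auto
    ultimately show ?thesis by (simp only: if_False)
  next
    case True
    consider "d = d'" | "d' < d" | "d < d'" by linarith
    then show ?thesis
    proof cases
      case 1
      then have "l + m = d - 1" using True by simp
      then show ?thesis using 1 e by (simp add: form_def)
    next
      case 2
      then have "d' \<le> l + m" using True by simp
      then have "b d' j (l + m) = 0" by (rule b_0[OF d'])
      then show ?thesis using 2 e by (simp add: b_def bil_linear)
    next
      case 3
      then have "d \<le> l + m" using True by simp
      then have "b d i (l + m) = 0" by (rule b_0[OF d])
      then have "bil (mpow X (l + m) (v d i)) (v d' j) = 0" by (simp add: b_def bil_linear)
      then have "bil (v d i) (mpow X (l + m) (v d' j)) = 0" unfolding bil_mpow by simp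
      then show ?thesis using 3 e by simp
    qed
  qed
qed

lemma form_odd: "\<lbrakk>d \<in> D; odd d; i \<in> {1..t d}; j \<in> {1..t d}\<rbrakk> \<Longrightarrow> form X d (v d i) (v d j) = (if i = j then 1 else 0)"
  using adapted_v by (auto simp: adapted_bases_def odd_parts_def)

lemma form_even:
  assumes "d \<in> D" "even d"
  shows "j \<in> {1..t d div 2} \<Longrightarrow> form X d (v d j) (v d (t d div 2 + j)) = 1"
    "\<lbrakk>i \<in> {1..t d}; j \<in> {1..t d}; \<bar>int i - int j\<bar> \<noteq> int (t d div 2)\<rbrakk> \<Longrightarrow> form X d (v d i) (v d j) = 0"
    "form X d x y = - form X d y x"
proof -
  have e: "d \<in> even_parts X H Y" using assms by (simp add: even_parts_def)
  show "j \<in> {1..t d div 2} \<Longrightarrow> form X d (v d j) (v d (t d div 2 + j)) = 1"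
    "\<lbrakk>i \<in> {1..t d}; j \<in> {1..t d}; \<bar>int i - int j\<bar> \<noteq> int (t d div 2)\<rbrakk> \<Longrightarrow> form X d (v d i) (v d j) = 0"
    using adapted_v e unfolding adapted_bases_def by blast+
  have "odd (d - 1)" using assms D_pos(1) by (simp add: even_diff_nat)
  then show "form X d x y = - form X d y x" by (subst form_sym) simp
qed

text \<open>Evenness is not part of \<open>adapted_bases\<close>. With an odd number 2 h + 1 of
  vectors the vanishing conditions leave a combination z of the last and the first vector in the
  radical of the form; nondegeneracy gives z = 0, against linear independence.\<close>

lemma t_even: assumes d: "d \<in> D" "even d" shows "even (t d)"
proof (rule ccontr)
  assume "odd (t d)"
  define h where "h = t d div 2"
  have t: "t d = 2 * h + 1" using \<open>odd (t d)\<close> by (simp add: h_def)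
  \<comment> \<open>The last vector can pair nontrivially only with the one at h + 1, which pairs to
    -1 with the first; the coefficient cancels this pairing. For h = 0 there is a single vector, and
    alternation suffices.\<close>
  define z where "z = (if h = 0 then v d (t d) else v d (t d) + form X d (v d (Suc h)) (v d (t d)) *s v d 1)"
  have fl: "form X d x (y + c *s y') = form X d x y + c * form X d x y'" for x y y' c
    by (simp add: form_def mpow_linear bil_linear)
  have z0: "form X d (v d i) z = 0" if i: "i \<in> {1..t d}" for i
  proof (cases "h = 0")
    case True
    then have "i = t d" using i t by simp
    then show ?thesis using form_even(3)[OF d, of "v d i" "v d i"] True by (simp add: z_def)
  next
    case False
    show ?thesis
    proof (cases "i = Suc h")
      case True
      have "form X d (v d (Suc h)) (v d 1) = -1"
        using form_even(3)[OF d, of "v d (Suc h)" "v d 1"] form_even(1)[OF d, of 1] False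
        by (simp add: h_def[symmetric])
      then show ?thesis using False True by (simp add: z_def fl)
    next
      case ih: False
      have "form X d (v d i) (v d (t d)) = 0"
        by (rule form_even(2)[OF d]) (use i ih t False in \<open>auto simp: h_def[symmetric]\<close>)
      moreover have "form X d (v d i) (v d 1) = 0"
        by (rule form_even(2)[OF d]) (use i ih t False in \<open>auto simp: h_def[symmetric]\<close>)
      ultimately show ?thesis using False by (simp add: z_def fl)
    qed
  qed
  have t_in: "t d \<in> {1..t d}" "1 \<in> {1..t d}" using t by auto
  have zz: "\<exists>c. z = v d (t d) + c *s v d 1" by (cases "h = 0") (auto simp: z_def intro: exI[of _ 0])
  have "bil (mpow X (d - 1) z) (b d' j l) = 0" if "d' \<in> D" "j \<in> {1..t d'}" "l < d'" for d' j l
  proof -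
    obtain c where c: "z = v d (t d) + c *s v d 1" using zz by blast
    have "mpow X (d - 1) z = b d (t d) (d - 1) + c *s b d 1 (d - 1)" by (simp add: c mpow_linear b_def)
    then have 1: "bil (mpow X (d - 1) z) (b d' j l) = bil (b d (t d) (d - 1)) (b d' j l) + c * bil (b d 1 (d - 1)) (b d' j l)"
      by (simp add: bil_linear)
    show ?thesis
    proof (cases "d' = d \<and> l = 0")
      case True
      then have "bil (mpow X (d - 1) z) (b d' j l) = bil (v d j) (mpow X (d - 1) z)" by (simp add: bil_commute b_def)
      also have "\<dots> = form X d (v d j) z" by (simp add: form_def)
      finally show ?thesis using z0 True that by simp
    next
      case False
      then show ?thesis unfolding 1 gram[OF d(1) t_in(1) that(1,2)] gram[OF d(1) t_in(2) that(1,2)] by auto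
    qed
  qed
  then have "mpow X (d - 1) z = 0" by (rule bil_b_eq_0)
  moreover have zL: "z \<in> Lw (d - 1)"
  proof -
    obtain c where c: "z = v d (t d) + c *s v d 1" using zz by blast
    show ?thesis unfolding c v_basis(3)[OF d(1), symmetric]
      by (intro vec.span_add vec.span_scale vec.span_base imageI t_in)
  qed
  ultimately have "z = 0" using Lw_mpow_nonzero[OF zL, of "d - 1"] by blast
  have inj: "inj_on (v d) {1..t d}" and ind: "vec.independent (v d ` {1..t d})" using v_basis[OF d(1)] by auto
  show False
  proof (cases "h = 0")
    case True
    then have "v d (t d) = 0" using \<open>z = 0\<close> by (simp add: z_def)
    then show False using ind t_in(1) vec.dependent_zero by (metis image_eqI)
  next
    case False
    define c where "c = form X d (v d (Suc h)) (v d (t d))"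
    have "v d (t d) = (- c) *s v d 1" using \<open>z = 0\<close> False
      by (simp add: z_def c_def eq_neg_iff_add_eq_0)
    moreover have "v d 1 \<noteq> v d (t d)" using inj_onD[OF inj _ t_in(2) t_in(1)] False t by auto
    ultimately have "v d (t d) \<in> vec.span (v d ` {1..t d} - {v d (t d)})"
      using t_in by (metis DiffI empty_iff imageI insert_iff vec.span_base vec.span_scale)
    then show False using ind t_in(1) unfolding vec.dependent_def by blast
  qed
qed

section \<open>The real structure on the strings\<close>

definition st :: "nat \<Rightarrow> nat \<Rightarrow> nat" where
  "st d j = (if odd d then j else if j \<le> t d div 2 then j + t d div 2 else j - t d div 2)"

definition sg :: "nat \<Rightarrow> nat \<Rightarrow> real" where
  "sg d j = (if odd d \<or> j \<le> t d div 2 then 1 else -1)"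

text \<open>The real structure for which the vectors of \<open>\<H>\<close> are real: it sends \<open>b d j l\<close> to \<open>sb d j l\<close>.\<close>

definition sb :: "nat \<Rightarrow> nat \<Rightarrow> nat \<Rightarrow> complex^'n" where
  "sb d j l = ((-1) ^ l * sg d j) *\<^sub>R b d (st d j) (d - 1 - l)"

lemma st_in: assumes "d \<in> D" "j \<in> {1..t d}" shows "st d j \<in> {1..t d}" "st d (st d j) = j"
proof -
  have "t d = 2 * (t d div 2)" if "even d" using t_even[OF assms(1) that] by simp
  then show "st d j \<in> {1..t d}" "st d (st d j) = j" using assms(2) unfolding st_def by (auto split: if_splits)
qed

text \<open>This is the meaning of \<open>st\<close> and \<open>sg\<close>: up to the sign,
  \<open>v d (st d j)\<close> is the basis vector dual to \<open>v d j\<close>.\<close>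

lemma form_st: assumes d: "d \<in> D" "i \<in> {1..t d}" "j \<in> {1..t d}"
  shows "form X d (v d i) (v d (st d j)) = (if i = j then complex_of_real (sg d j) else 0)"
proof (cases "odd d")
  case True
  then show ?thesis using d by (simp add: st_def sg_def form_odd)
next
  case False
  define h where "h = t d div 2"
  have t: "t d = 2 * h" using t_even[OF d(1)] False by (simp add: h_def)
  have ev: "even d" using False by simp
  note f = form_even[OF d(1) ev, folded h_def]
  show ?thesis
  proof (cases "j \<le> h")
    case True
    then have st: "st d j = h + j" "sg d j = 1" using False by (simp_all add: st_def sg_def h_def[symmetric])
    show ?thesis
    proof (cases "i = j")
      case eq: True
      then show ?thesis using f(1)[of j] True d st by simp
    next
      case False
      then have "form X d (v d i) (v d (h + j)) = 0" by (intro f(2)) (use d True t in auto)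
      then show ?thesis using False st by simp
    qed
  next
    case gt: False
    then have st: "st d j = j - h" "sg d j = -1" using False by (simp_all add: st_def sg_def h_def[symmetric])
    show ?thesis
    proof (cases "i = j")
      case eq: True
      have "j - h \<in> {1..h}" "h + (j - h) = j" using gt d t by auto
      then show ?thesis using f(1)[of "j - h"] f(3)[of "v d j" "v d (j - h)"] st eq by simp
    next
      case False
      then have "form X d (v d i) (v d (j - h)) = 0" by (intro f(2)) (use d gt t in auto)
      then show ?thesis using False st by simp
    qed
  qed
qed

lemma m1_sq: "(-1) ^ l * (-1) ^ l = (1::'a::comm_ring_1)"
  by (simp only: power_mult_distrib[symmetric]) simp

lemma sg_sq: "sg d j * sg d j = 1" by (simp add: sg_def)

text \<open>For the Hermitian form obtained from \<open>bil\<close> and the real structure the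
  strings are thus orthonormal.\<close>

lemma gram_sb:
  assumes d: "d \<in> D" "i \<in> {1..t d}" "l < d" and d': "d' \<in> D" "j \<in> {1..t d'}" "m < d'"
  shows "bil (b d i l) (sb d' j m) = (if d = d' \<and> i = j \<and> l = m then 1 else 0)"
proof -
  have e: "bil (b d i l) (sb d' j m) = complex_of_real ((- 1) ^ m * sg d' j) *
      (if d = d' \<and> l + (d' - 1 - m) = d - 1 then (-1) ^ l * form X d (v d i) (v d (st d' j)) else 0)"
    unfolding sb_def bil_linear gram[OF d(1,2) d'(1) st_in(1)[OF d'(1,2)]] by simp
  show ?thesis
  proof (cases "d = d' \<and> l = m")
    case True
    then have c: "l + (d' - 1 - m) = d - 1" "j \<in> {1..t d}" "d = d'" "l = m" using d' by auto
    have f: "form X d (v d i) (v d (st d' j)) = (if i = j then complex_of_real (sg d j) else 0)"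
      using form_st[OF d(1,2) c(2)] by (simp only: c(3)[symmetric])
    have "complex_of_real ((-1) ^ m * sg d j) * ((-1) ^ m * complex_of_real (sg d j)) = ((-1) ^ m * (-1) ^ m) * complex_of_real (sg d j * sg d j)"
      by simp
    also have "\<dots> = 1" by (simp only: m1_sq sg_sq of_real_1 mult_1)
    finally show ?thesis unfolding e f using c by simp
  next
    case False
    then have "\<not> (d = d' \<and> l + (d' - 1 - m) = d - 1)" using d(3) d'(3) by auto
    then show ?thesis unfolding e using False by auto
  qed
qed

lemma sb_st: assumes "d \<in> D" "j \<in> {1..t d}" "l < d"
  shows "b d (st d j) (d - 1 - l) = ((-1) ^ l * sg d j) *\<^sub>R sb d j l"
  unfolding sb_def scaleR_scaleR
proof -
  have "((-1) ^ l * sg d j) * ((-1) ^ l * sg d j) = ((-1) ^ l * (-1) ^ l) * (sg d j * sg d j)" by (simp only: mult_ac)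
  also have "\<dots> = 1" by (simp only: sg_sq m1_sq mult_1)
  finally show "b d (st d j) (d - 1 - l) = ((-1) ^ l * sg d j * ((-1) ^ l * sg d j)) *\<^sub>R b d (st d j) (d - 1 - l)" by simp
qed

text \<open>Together the two claims make the real structure compatible with \<open>bil\<close>:
  conjugate vectors have conjugate products.\<close>

lemma gram_real: assumes d: "d \<in> D" "i \<in> {1..t d}" "l < d" and d': "d' \<in> D" "j \<in> {1..t d'}" "m < d'"
  shows "bil (b d i l) (b d' j m) \<in> \<real>" "bil (sb d i l) (sb d' j m) = bil (b d i l) (b d' j m)"
proof -
  define j' where "j' = st d' j"
  define m' where "m' = d' - 1 - m"
  have jm: "j' \<in> {1..t d'}" "m' < d'" "j = st d' j'" "m = d' - 1 - m'"
    using st_in[OF d'(1,2)] d'(3) by (auto simp: j'_def m'_def)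
  have eq: "b d' j m = ((-1) ^ m' * sg d' j') *\<^sub>R sb d' j' m'" unfolding jm(3,4) by (rule sb_st[OF d'(1) jm(1,2)])
  have v1: "bil (b d i l) (b d' j m) = complex_of_real ((-1) ^ m' * sg d' j') * (if d = d' \<and> i = j' \<and> l = m' then 1 else 0)"
    unfolding eq bil_linear gram_sb[OF d d'(1) jm(1,2)] ..
  show "bil (b d i l) (b d' j m) \<in> \<real>" unfolding v1 by (intro Reals_mult Reals_of_real) simp
  have "bil (sb d i l) (sb d' j m) = complex_of_real ((-1) ^ l * sg d i) * bil (b d (st d i) (d - 1 - l)) (sb d' j m)"
    unfolding sb_def[of d i l] bil_linear ..
  also have "bil (b d (st d i) (d - 1 - l)) (sb d' j m) = (if d = d' \<and> st d i = j \<and> d - 1 - l = m then 1 else 0)"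
    using d(3) by (intro gram_sb d d' st_in(1)) simp
  also have "(d = d' \<and> st d i = j \<and> d - 1 - l = m) \<longleftrightarrow> (d = d' \<and> i = j' \<and> l = m')"
  proof (cases "d = d'")
    case True
    have "st d i = j \<longleftrightarrow> i = j'"
    proof
      assume "st d i = j"
      then show "i = j'" using st_in(2)[OF d(1,2)] by (simp only: j'_def True)
    next
      assume "i = j'"
      then show "st d i = j" using st_in(2)[OF d'(1,2)] by (simp only: j'_def True)
    qed
    moreover have "d - 1 - l = m \<longleftrightarrow> l = m'" unfolding m'_def using d(3) d'(3) True by linarith
    ultimately show ?thesis by blast
  qed simp
  also have "complex_of_real ((-1) ^ l * sg d i) * (if d = d' \<and> i = j' \<and> l = m' then 1 else 0)
    = complex_of_real ((-1) ^ m' * sg d' j') * (if d = d' \<and> i = j' \<and> l = m' then 1 else 0)"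
    by (cases "d = d' \<and> i = j' \<and> l = m'") simp_all
  finally show "bil (sb d i l) (sb d' j m) = bil (b d i l) (b d' j m)" unfolding v1 .
qed

end

lemma distinct_concat_map:
  assumes "distinct xs" "\<And>x. x \<in> set xs \<Longrightarrow> distinct (f x)"
    and "\<And>x y z. \<lbrakk>x \<in> set xs; y \<in> set xs; z \<in> set (f x); z \<in> set (f y)\<rbrakk> \<Longrightarrow> x = y"
  shows "distinct (concat (map f xs))"
  using assms
proof (induction xs)
  case (Cons x xs)
  have "distinct (concat (map f xs))" by (rule Cons.IH) (use Cons.prems in auto)
  moreover have "set (f x) \<inter> set (concat (map f xs)) = {}"
  proof (rule ccontr)
    assume "set (f x) \<inter> set (concat (map f xs)) \<noteq> {}"
    then obtain y z where "y \<in> set xs" "z \<in> set (f x)" "z \<in> set (f y)" by auto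
    then have "x = y" using Cons.prems(3)[of x y z] by simp
    then show False using \<open>y \<in> set xs\<close> Cons.prems(1) by simp
  qed
  ultimately show ?case using Cons.prems(2)[of x] by simp
qed simp

lemma concat_concat: "concat (concat xss) = concat (map concat xss)"
  by (induction xss) auto

lemma half_smult: "(1 / 2) *s (x + y) + (- \<i> / 2) *s (\<i> *s (x - y)) = x"
  "(1 / 2) *s (x + y) + (\<i> / 2) *s (\<i> *s (x - y)) = y" for x y :: "complex^'n"
  by (simp_all add: Finite_Cartesian_Product.vec_eq_iff field_simps)

context adapted
begin

section \<open>The vectors of H as real and imaginary parts\<close>

definition Pv :: "nat \<Rightarrow> nat \<Rightarrow> nat \<Rightarrow> complex^'n" where "Pv d j l = b d j l + sb d j l"
text \<open>For the real structure \<open>Pv\<close> is twice the real part of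
  \<open>b d j l\<close>, and \<open>Nv\<close> is minus twice its imaginary part, so both are real
  vectors.\<close>

definition Nv :: "nat \<Rightarrow> nat \<Rightarrow> nat \<Rightarrow> complex^'n" where "Nv d j l = \<i> *s (b d j l - sb d j l)"

lemma b_PN: "b d j l = (1 / 2) *s Pv d j l + (- \<i> / 2) *s Nv d j l"
  "sb d j l = (1 / 2) *s Pv d j l + (\<i> / 2) *s Nv d j l"
  by (simp_all only: Pv_def Nv_def half_smult)

lemma bil_PN:
  assumes d: "d \<in> D" "i \<in> {1..t d}" "l < d" and d': "d' \<in> D" "j \<in> {1..t d'}" "m < d'"
  defines "\<delta> \<equiv> (if d = d' \<and> i = j \<and> l = m then 1 else 0 :: complex)"
  shows "bil (Pv d i l) (Pv d' j m) = 2 * (\<delta> + bil (b d i l) (b d' j m))"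
    "bil (Pv d i l) (Nv d' j m) = 0" "bil (Nv d i l) (Pv d' j m) = 0"
    "bil (Nv d i l) (Nv d' j m) = 2 * (\<delta> - bil (b d i l) (b d' j m))"
    "bil (Pv d i l) (sb d' j m) = cnj (bil (Pv d i l) (b d' j m))"
    "bil (Nv d i l) (sb d' j m) = cnj (bil (Nv d i l) (b d' j m))"
proof -
  define q where "q = bil (b d i l) (b d' j m)"
  have 0: "cnj q = q" unfolding q_def using gram_real(1)[OF d d'] by (simp only: Reals_cnj_iff)
  have 1: "bil (b d i l) (sb d' j m) = \<delta>" unfolding \<delta>_def by (rule gram_sb[OF d d'])
  have 2: "bil (sb d i l) (b d' j m) = \<delta>" unfolding bil_commute[of "sb d i l"] gram_sb[OF d' d] \<delta>_def by auto
  have 3: "bil (sb d i l) (sb d' j m) = q" unfolding q_def by (rule gram_real(2)[OF d d'])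
  have 4: "bil (b d i l) (b d' j m) = q" by (simp only: q_def)
  have 5: "cnj \<delta> = \<delta>" by (simp add: \<delta>_def)
  show "bil (Pv d i l) (Pv d' j m) = 2 * (\<delta> + bil (b d i l) (b d' j m))"
    "bil (Pv d i l) (Nv d' j m) = 0" "bil (Nv d i l) (Pv d' j m) = 0"
    "bil (Nv d i l) (Nv d' j m) = 2 * (\<delta> - bil (b d i l) (b d' j m))"
    "bil (Pv d i l) (sb d' j m) = cnj (bil (Pv d i l) (b d' j m))"
    "bil (Nv d i l) (sb d' j m) = cnj (bil (Nv d i l) (b d' j m))"
    unfolding Pv_def Nv_def bil_linear 1 2 3 4 by (simp_all add: algebra_simps 0 5)
qed

text \<open>Two levels in the lower half of strings have opposite weights only if both are the
  middle level, which exists for odd d.\<close>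

lemma bil_b_low:
  assumes d: "d \<in> D" "i \<in> {1..t d}" "2 * l \<le> d - 1" and d': "d' \<in> D" "j \<in> {1..t d'}" "2 * m \<le> d' - 1"
  shows "bil (b d i l) (b d' j m) = (if d = d' \<and> i = j \<and> l = m \<and> 2 * l = d - 1 then (-1) ^ l else 0)"
proof (cases "d = d' \<and> l + m = d - 1")
  case False
  then have "\<not> (d = d' \<and> i = j \<and> l = m \<and> 2 * l = d - 1)" by auto
  then show ?thesis unfolding gram[OF d(1,2) d'(1,2)] using False by (simp only: if_False)
next
  case True
  then have lm: "l = m" "2 * l = d - 1" "d = d'" using d(3) d'(3) by auto
  then have "odd d" using D_pos(1)[OF d(1)] by presburger
  then show ?thesis unfolding gram[OF d(1,2) d'(1,2)] using form_odd[OF d(1) _ d(2), of j] d' True lm by simp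
qed

text \<open>\<open>Pv\<close> and \<open>Nv\<close> have square 2 below the middle. At the middle of
  an odd string one of them vanishes, depending on the parity of l, and the other has square
  4.\<close>

definition cf :: "nat \<Rightarrow> nat \<Rightarrow> real" where "cf d l = (if 2 * l = d - 1 then 1 / 2 else 1 / sqrt 2)"

text \<open>Every vector of \<open>\<H>\<close> is a \<open>Wv c\<close>; the code \<open>(ty, d, j, l)\<close> is canonical if it lies in \<open>GC\<close>.\<close>

definition Wv :: "bool \<times> nat \<times> nat \<times> nat \<Rightarrow> complex^'n" where
  "Wv = (\<lambda>(ty, d, j, l). cf d l *\<^sub>R (if ty then Pv d j l else Nv d j l))"

definition GC :: "(bool \<times> nat \<times> nat \<times> nat) set" where
  "GC = {(ty, d, j, l). d \<in> D \<and> j \<in> {1..t d} \<and> 2 * l \<le> d - 1 \<and> (2 * l = d - 1 \<longrightarrow> ty = even l)}"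

lemma GC_D: assumes "(ty, d, j, l) \<in> GC"
  shows "d \<in> D" "j \<in> {1..t d}" "2 * l \<le> d - 1" "l < d" "2 * l = d - 1 \<Longrightarrow> ty = even l"
proof -
  show d: "d \<in> D" "j \<in> {1..t d}" "2 * l \<le> d - 1" "2 * l = d - 1 \<Longrightarrow> ty = even l" using assms by (auto simp: GC_def)
  show "l < d" using D_pos(1)[OF d(1)] d(3) by linarith
qed

lemma cf_sq: "complex_of_real (cf d l) * (complex_of_real (cf d l) * x) = (if 2 * l = d - 1 then x / 4 else x / 2)"
proof -
  have "cf d l * cf d l = (if 2 * l = d - 1 then 1 / 4 else 1 / 2)" by (simp add: cf_def)
  then have "complex_of_real (cf d l) * complex_of_real (cf d l) = (if 2 * l = d - 1 then 1 / 4 else 1 / 2)"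
    by (simp add: of_real_mult[symmetric] del: of_real_mult)
  then have "complex_of_real (cf d l) * complex_of_real (cf d l) * x = (if 2 * l = d - 1 then x / 4 else x / 2)" by simp
  then show ?thesis by (simp only: mult.assoc)
qed

lemma Wv_orth: assumes "x \<in> GC" "y \<in> GC" shows "bil (Wv x) (Wv y) = (if x = y then 1 else 0)"
proof -
  obtain ty d i l where x: "x = (ty, d, i, l)" by (cases x)
  obtain ty' d' j m where y: "y = (ty', d', j, m)" by (cases y)
  note d = GC_D[OF assms(1)[unfolded x]] and d' = GC_D[OF assms(2)[unfolded y]]
  note PN = bil_PN[OF d(1,2,4) d'(1,2,4)] and low = bil_b_low[OF d(1-3) d'(1-3)]
  have e: "bil (Wv x) (Wv y) = complex_of_real (cf d l) * (complex_of_real (cf d' m) *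
      bil (if ty then Pv d i l else Nv d i l) (if ty' then Pv d' j m else Nv d' j m))"
    by (simp add: x y Wv_def bil_linear)
  show ?thesis
  proof (cases "ty = ty'")
    case False
    then show ?thesis unfolding e by (cases ty; cases ty') (simp_all add: PN x y)
  next
    case True
    show ?thesis
    proof (cases "d = d' \<and> i = j \<and> l = m")
      case False
      have z: "bil (b d i l) (b d' j m) = 0" unfolding low using False by auto
      show ?thesis unfolding e using False True by (cases ty) (auto simp: PN z x y)
    next
      case eq: True
      have xy: "x = y" using True eq by (simp add: x y)
      have q: "bil (b d i l) (b d' j m) = (if 2 * l = d - 1 then (-1) ^ l else 0)" unfolding low using eq by simp
      have c: "cf d' m = cf d l" using eq by simp
      have n: "bil (if ty then Pv d i l else Nv d i l) (if ty' then Pv d' j m else Nv d' j m) = (if 2 * l = d - 1 then 4 else 2)"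
        using True eq d(5) PN(1,4) unfolding q by (cases ty; cases "even l") (simp_all split: if_splits)
      show ?thesis unfolding e n c cf_sq using xy by simp
    qed
  qed
qed

text \<open>Reality of \<open>Wv x\<close>, expressed by its products with the strings.\<close>

lemma Wv_real: assumes "x \<in> GC" and d': "d' \<in> D" "j \<in> {1..t d'}" "m < d'"
  shows "bil (Wv x) (sb d' j m) = cnj (bil (Wv x) (b d' j m))"
proof -
  obtain ty d i l where x: "x = (ty, d, i, l)" by (cases x)
  note d = GC_D[OF assms(1)[unfolded x]]
  show ?thesis using bil_PN(5,6)[OF d(1,2,4) d'] by (simp add: x Wv_def bil_linear)
qed

lemma cf_nz: "cf d l \<noteq> 0" by (simp add: cf_def)

lemma sb_mid: assumes "odd d" "2 * l = d - 1" shows "sb d j l = (-1) ^ l *\<^sub>R b d j l"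
proof -
  have "d - 1 - l = l" using assms(2) by simp
  then show ?thesis using assms by (simp add: sb_def st_def sg_def)
qed

lemma PN_mid: assumes "odd d" "2 * l = d - 1"
  shows "odd l \<Longrightarrow> Pv d j l = 0" "even l \<Longrightarrow> Nv d j l = 0"
  using sb_mid[OF assms] by (simp_all add: Pv_def Nv_def)

lemma PN_in_span:
  assumes "d \<in> D" "j \<in> {1..t d}" "2 * l \<le> d - 1" "\<And>ty. (ty, d, j, l) \<in> GC \<Longrightarrow> Wv (ty, d, j, l) \<in> S" "vec.subspace S"
  shows "Pv d j l \<in> S" "Nv d j l \<in> S" "b d j l \<in> S" "sb d j l \<in> S"
proof -
  have W: "(if ty then Pv d j l else Nv d j l) \<in> S" for ty
  proof (cases "(ty, d, j, l) \<in> GC")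
    case True
    have "(if ty then Pv d j l else Nv d j l) = (1 / cf d l) *\<^sub>R Wv (ty, d, j, l)" by (simp add: Wv_def cf_nz)
    also have "\<dots> \<in> S" unfolding scaleR_eq_smult by (intro vec.subspace_scale[OF assms(5)] assms(4) True)
    finally show ?thesis .
  next
    case False
    then have *: "2 * l = d - 1" "ty \<noteq> even l" using assms(1-3) by (auto simp: GC_def)
    then have "odd d" using D_pos(1)[OF assms(1)] by presburger
    then have "(if ty then Pv d j l else Nv d j l) = 0" using PN_mid[of d l j] * by (cases ty) simp_all
    then show ?thesis using vec.subspace_0[OF assms(5)] by simp
  qed
  show P: "Pv d j l \<in> S" and N: "Nv d j l \<in> S" using W[of True] W[of False] by simp_all
  show "b d j l \<in> S" "sb d j l \<in> S" unfolding b_PN by (intro vec.subspace_add[OF assms(5)] vec.subspace_scale[OF assms(5)] P N)+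
qed

lemma b_high: assumes "d \<in> D" "j \<in> {1..t d}" "l < d"
  shows "b d j l = ((-1) ^ (d - 1 - l) * sg d (st d j)) *\<^sub>R sb d (st d j) (d - 1 - l)"
  using sb_st[OF assms(1) st_in(1)[OF assms(1,2)], of "d - 1 - l"] st_in(2)[OF assms(1,2)] assms(3) by simp

lemma span_Wv_GC: "x \<in> vec.span (Wv ` GC)"
proof -
  have low: "b d j l \<in> vec.span (Wv ` GC)" "sb d j l \<in> vec.span (Wv ` GC)" if "d \<in> D" "j \<in> {1..t d}" "2 * l \<le> d - 1" for d j l
    by (rule PN_in_span[OF that], erule vec.span_base[OF imageI], rule vec.subspace_span)+
  have "b d j l \<in> vec.span (Wv ` GC)" if d: "d \<in> D" "j \<in> {1..t d}" "l < d" for d j l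
  proof (cases "2 * l \<le> d - 1")
    case False
    then show ?thesis unfolding b_high[OF d] scaleR_eq_smult
      by (intro vec.span_scale low d(1) st_in(1) d(2)) simp
  qed (use low d in simp)
  then have "B \<subseteq> vec.span (Wv ` GC)" by (auto simp: B_def)
  then have "vec.span B \<subseteq> vec.span (Wv ` GC)" by (rule vec.span_minimal) (rule vec.subspace_span)
  then show ?thesis using b_span by auto
qed

text \<open>Beyond the middle, the vector at level l is formed from the same two levels as the one
  at its mirror image, so its code names the lower of the two levels and the other type.\<close>

definition codeO :: "nat \<Rightarrow> nat \<Rightarrow> nat \<Rightarrow> bool \<times> nat \<times> nat \<times> nat" where
  "codeO \<theta> l j = (if l \<le> (\<theta> - 1) div 2 then (even l, \<theta>, j, l) else (odd l, \<theta>, j, \<theta> - 1 - l))"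

definition codeE :: "nat \<Rightarrow> nat \<Rightarrow> nat \<Rightarrow> bool \<times> nat \<times> nat \<times> nat" where
  "codeE \<eta> l j = (if j \<le> t \<eta> then (True, \<eta>, j, l) else (False, \<eta>, j - t \<eta>, l))"

lemma w_odd_code:
  assumes "odd \<theta>" "l < \<theta>" shows "w_odd X v \<theta> l j = Wv (codeO \<theta> l j)"
proof -
  obtain k where k: "\<theta> = 2 * k + 1" using assms(1) by (rule oddE)
  have s: "sb \<theta> j l' = (-1) ^ l' *\<^sub>R b \<theta> j (2 * k - l')" for l' using assms(1) by (simp add: sb_def st_def sg_def k)
  have pw: "mpow X l' (v \<theta> j) = b \<theta> j l'" for l' by (simp add: b_def)
  have mid: "(\<theta> - 1) div 2 = k" "\<theta> - 1 = 2 * k" using k by simp_all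
  consider "l < k" | "l = k" | "k < l" "l \<le> 2 * k" using assms(2) k by linarith
  then show ?thesis
  proof cases
    case 1
    then have c: "cf \<theta> l = 1 / sqrt 2" unfolding cf_def mid(2) by simp
    show ?thesis unfolding w_odd_def Let_def codeO_def mid pw using 1
      by (cases "even l") (simp_all add: Wv_def c Pv_def Nv_def s smult_scaleR)
  next
    case 2
    then have c: "cf \<theta> l = 1 / 2" unfolding cf_def mid(2) by simp
    have m: "sb \<theta> j l = (-1) ^ l *\<^sub>R b \<theta> j l" by (rule sb_mid[OF assms(1)]) (simp add: 2 k)
    show ?thesis
    proof (cases "even l")
      case True
      then have "Pv \<theta> j l = 2 *\<^sub>R b \<theta> j l"
        by (simp only: Pv_def m minus_one_power_iff if_True scaleR_one scaleR_2)
      then show ?thesis unfolding w_odd_def Let_def codeO_def mid pw using 2 True by (simp add: Wv_def c[unfolded 2])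
    next
      case False
      then have "Nv \<theta> j l = 2 *\<^sub>R (\<i> *s b \<theta> j l)"
        by (simp only: Nv_def m minus_one_power_iff if_False scaleR_minus1_left diff_minus_eq_add scaleR_2[symmetric] smult_scaleR)
      then show ?thesis unfolding w_odd_def Let_def codeO_def mid pw using 2 False by (simp add: Wv_def c[unfolded 2])
    qed
  next
    case 3
    define l' where "l' = 2 * k - l"
    have l': "l = 2 * k - l'" "even l = even l'" "2 * k - l = l'" "l' < k" using 3 unfolding l'_def by presburger+
    then have c: "cf \<theta> l' = 1 / sqrt 2" unfolding cf_def mid(2) by simp
    have s': "sb \<theta> j l' = (-1) ^ l' *\<^sub>R b \<theta> j l" using s[of l'] l'(1) by simp
    have n: "\<not> l \<le> k" "\<not> l < k" "l \<noteq> k" using 3 by auto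
    show ?thesis unfolding w_odd_def Let_def codeO_def mid pw l'(2,3)
      by (cases "even l'") (simp_all add: n Wv_def c Pv_def Nv_def s' smult_scaleR)
  qed
qed

lemma w_even_code:
  assumes "\<eta> \<in> D" "even \<eta>" "l < \<eta> div 2" "j \<in> {1..2 * t \<eta>}"
  shows "w_even X (t \<eta>) v \<eta> l j = Wv (codeE \<eta> l j)"
proof -
  define h where "h = t \<eta> div 2"
  have th: "t \<eta> = 2 * h" using t_even[OF assms(1,2)] by (simp add: h_def)
  have c: "cf \<eta> l = 1 / sqrt 2" using assms(2,3) unfolding cf_def by (simp; presburger)
  have s: "sb \<eta> i l = ((-1) ^ l * sg \<eta> i) *\<^sub>R b \<eta> (st \<eta> i) (\<eta> - 1 - l)" for i by (simp only: sb_def)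
  have st1: "st \<eta> i = i + h" "sg \<eta> i = 1" if "i \<le> h" for i using that assms(2) by (simp_all add: st_def sg_def h_def)
  have st2: "st \<eta> i = i - h" "sg \<eta> i = -1" if "\<not> i \<le> h" for i using that assms(2) by (simp_all add: st_def sg_def h_def)
  have pw: "mpow X l' (v \<eta> i) = b \<eta> i l'" for l' i by (simp add: b_def)
  have hh: "2 * h div 2 = h" by simp
  consider "j \<le> h" | "h < j" "j \<le> 2 * h" | "2 * h < j" "j \<le> 3 * h" | "3 * h < j" by linarith
  then show ?thesis
  proof cases
    case 1
    then have "j \<le> 2 * h" by simp
    then show ?thesis unfolding w_even_def Let_def codeE_def th hh pw using 1
      by (simp add: Wv_def c Pv_def s st1[OF 1] add.commute)
  next
    case 2
    then have n: "\<not> j \<le> h" by simp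
    then show ?thesis unfolding w_even_def Let_def codeE_def th hh pw using 2
      by (simp add: Wv_def c Pv_def s st2[OF n])
  next
    case 3
    then have n: "\<not> j \<le> h" "\<not> j \<le> 2 * h" "j - 2 * h \<le> h" "j - 2 * h + h = j - h" by auto
    then show ?thesis unfolding w_even_def Let_def codeE_def th hh pw using 3
      by (simp add: Wv_def c Nv_def s st1[OF n(3)] smult_scaleR)
  next
    case 4
    then have n: "\<not> j \<le> h" "\<not> j \<le> 2 * h" "\<not> j - 2 * h \<le> h" "\<not> j \<le> 3 * h" "j - 2 * h - h = j - 3 * h" by auto
    then show ?thesis unfolding w_even_def Let_def codeE_def th hh pw using 4
      by (simp add: Wv_def c Nv_def s st2[OF n(3)] smult_scaleR)
  qed
qed

section \<open>The list H cut into blocks, one for each pair of a part and a level\<close>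

definition blocks :: "(nat \<times> nat) list" where
  "blocks = concat (map (\<lambda>\<eta>. map (Pair \<eta>) [0..<\<eta> div 2]) (sorted_list_of_set (even_parts X H Y))) @
     concat (map (\<lambda>\<theta>. map (Pair \<theta>) [0..<\<theta>]) (sorted_list_of_set (odd_parts X H Y)))"

definition blk :: "nat \<times> nat \<Rightarrow> (complex^'n) list" where
  "blk = (\<lambda>(d, l). if even d then D_basis X H Y v d l else C_basis X H Y v d l)"

definition blkc :: "nat \<times> nat \<Rightarrow> (bool \<times> nat \<times> nat \<times> nat) list" where
  "blkc = (\<lambda>(d, l). if even d then map (codeE d l) [1..<Suc (2 * t d)] else map (codeO d l) [1..<Suc (t d)])"

lemma finite_parts: "finite (even_parts X H Y)" "finite (odd_parts X H Y)"
  using finite_D by (simp_all add: even_parts_def odd_parts_def)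

lemma set_blocks: "set blocks = {(d, l). d \<in> D \<and> l < (if even d then d div 2 else d)}"
  unfolding blocks_def by (simp add: finite_parts) (auto simp: even_parts_def odd_parts_def image_iff split: if_splits)

lemma distinct_blocks: "distinct blocks"
proof -
  have "distinct (concat (map (\<lambda>d. map (Pair d) [0..<g d]) (sorted_list_of_set S)))" for S g
    by (rule distinct_concat_map) (auto simp: distinct_map inj_on_def)
  then show ?thesis unfolding blocks_def using finite_parts by (auto simp: even_parts_def odd_parts_def)
qed

lemma H_basis_blocks: "H_basis X H Y v = concat (map blk blocks)"
proof -
  have ev: "even \<eta>" if "\<eta> \<in> set (sorted_list_of_set (even_parts X H Y))" for \<eta>
    using that unfolding set_sorted_list_of_set[OF finite_parts(1)] by (simp add: even_parts_def)
  have od: "odd \<theta>" if "\<theta> \<in> set (sorted_list_of_set (odd_parts X H Y))" for \<theta>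
    using that unfolding set_sorted_list_of_set[OF finite_parts(2)] by (simp add: odd_parts_def)
  have 1: "concat (map (\<lambda>\<eta>. concat (map (D_basis X H Y v \<eta>) [0..<\<eta> div 2])) (sorted_list_of_set (even_parts X H Y)))
    = concat (map (\<lambda>\<eta>. concat (map blk (map (Pair \<eta>) [0..<\<eta> div 2]))) (sorted_list_of_set (even_parts X H Y)))"
    by (intro arg_cong[of _ _ concat] map_cong refl) (auto simp: blk_def dest: ev)
  have 2: "concat (map (\<lambda>\<theta>. concat (map (C_basis X H Y v \<theta>) [0..<\<theta>])) (sorted_list_of_set (odd_parts X H Y)))
    = concat (map (\<lambda>\<theta>. concat (map blk (map (Pair \<theta>) [0..<\<theta>]))) (sorted_list_of_set (odd_parts X H Y)))"
    by (intro arg_cong[of _ _ concat] map_cong refl) (auto simp: blk_def dest: od)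
  show ?thesis unfolding H_basis_def 1 2 blocks_def
    by (simp only: map_append concat_append map_concat concat_concat map_map o_def)
qed

lemma blk_code: "p \<in> set blocks \<Longrightarrow> blk p = map Wv (blkc p)"
  unfolding set_blocks
  by (auto simp: blk_def blkc_def D_basis_def C_basis_def w_odd_code w_even_code)

lemma set_blkc:
  assumes "p \<in> set blocks"
  shows "set (blkc p) \<subseteq> GC" "distinct (blkc p)"
    "set (blkc p) = (case p of (d, l) \<Rightarrow> {(ty, d', j, l'). d' = d \<and> j \<in> {1..t d} \<and>
      (if even d then l' = l else (ty, l') = (if l \<le> (d - 1) div 2 then (even l, l) else (odd l, d - 1 - l)))})"
proof -
  obtain d l where p: "p = (d, l)" by (cases p)
  have d: "d \<in> D" "l < (if even d then d div 2 else d)" using assms by (auto simp: set_blocks p)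
  show 3: "set (blkc p) = (case p of (d, l) \<Rightarrow> {(ty, d', j, l'). d' = d \<and> j \<in> {1..t d} \<and>
      (if even d then l' = l else (ty, l') = (if l \<le> (d - 1) div 2 then (even l, l) else (odd l, d - 1 - l)))})"
  proof (cases "even d")
    case True
    have "set (blkc p) = codeE d l ` {1..2 * t d}" using True by (auto simp: blkc_def p)
    also have "\<dots> = {(ty, d', j, l'). d' = d \<and> j \<in> {1..t d} \<and> l' = l}"
    proof safe
      fix ty j assume j: "j \<in> {1..t d}"
      show "(ty, d, j, l) \<in> codeE d l ` {1..2 * t d}"
        by (rule image_eqI[where x = "if ty then j else j + t d"]) (use j in \<open>auto simp: codeE_def\<close>)
    qed (auto simp: codeE_def split: if_splits)
    finally show ?thesis using True by (simp add: p)
  next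
    case False
    then have "set (blkc p) = codeO d l ` {1..t d}" by (auto simp: blkc_def p)
    then show ?thesis using False by (auto simp: p codeO_def split: if_splits)
  qed
  show "set (blkc p) \<subseteq> GC"
  proof (cases "even d")
    case True
    then have "2 * l \<le> d - 1" "2 * l \<noteq> d - 1" using d(2) D_pos(1)[OF d(1)] by (simp; presburger)+
    then show ?thesis unfolding 3 using d True by (auto simp: GC_def p)
  next
    case False
    then obtain k where k: "d = 2 * k + 1" by (rule oddE)
    show ?thesis unfolding 3 using d False by (auto simp: GC_def k p split: if_splits)
  qed
  show "distinct (blkc p)"
    by (auto simp: blkc_def p distinct_map inj_on_def codeE_def codeO_def split: if_splits)
qed

definition HC :: "(bool \<times> nat \<times> nat \<times> nat) list" where "HC = concat (map blkc blocks)"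

lemma H_basis_code: "H_basis X H Y v = map Wv HC"
  unfolding H_basis_blocks HC_def map_concat map_map
  by (intro arg_cong[of _ _ concat] map_cong refl) (simp add: blk_code)

lemma distinct_HC: "distinct HC"
  unfolding HC_def
proof (rule distinct_concat_map[OF distinct_blocks])
  show "p \<in> set blocks \<Longrightarrow> distinct (blkc p)" for p by (rule set_blkc(2))
  fix p q z assume pq: "p \<in> set blocks" "q \<in> set blocks" "z \<in> set (blkc p)" "z \<in> set (blkc q)"
  obtain d l where p: "p = (d, l)" by (cases p)
  obtain d' l' where q: "q = (d', l')" by (cases q)
  have d: "l < (if even d then d div 2 else d)" "l' < (if even d' then d' div 2 else d')"
    using pq(1,2) by (auto simp: set_blocks p q)
  show "p = q"
  proof (cases "even d")
    case True
    then show ?thesis using pq(3,4) unfolding set_blkc(3)[OF pq(1)] set_blkc(3)[OF pq(2)] by (auto simp: p q)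
  next
    case False
    then obtain k where k: "d = 2 * k + 1" by (rule oddE)
    have "d' = d" using pq(3,4) unfolding set_blkc(3)[OF pq(1)] set_blkc(3)[OF pq(2)] by (auto simp: p q)
    moreover have "l' = l" using pq(3,4) d unfolding set_blkc(3)[OF pq(1)] set_blkc(3)[OF pq(2)]
      by (auto simp: p q k split: if_splits)
    ultimately show ?thesis by (simp add: p q)
  qed
qed

lemma set_HC: "set HC = GC"
proof
  show "set HC \<subseteq> GC" using set_blkc(1) by (auto simp: HC_def)
  show "GC \<subseteq> set HC"
  proof
    fix c assume "c \<in> GC"
    then obtain ty d j l where c: "c = (ty, d, j, l)" and g: "(ty, d, j, l) \<in> GC" by (cases c) auto
    note d = GC_D[OF g]
    have "\<exists>p\<in>set blocks. c \<in> set (blkc p)"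
    proof (cases "even d")
      case True
      then have p: "(d, l) \<in> set blocks" using d by (auto simp: set_blocks)
      show ?thesis by (rule bexI[OF _ p]) (unfold set_blkc(3)[OF p], use True d in \<open>simp add: c\<close>)
    next
      case False
      then obtain k where k: "d = 2 * k + 1" by (rule oddE)
      have lk: "l \<le> k" using d(3) k by simp
      show ?thesis
      proof (cases "ty = even l")
        case True
        have p: "(d, l) \<in> set blocks" using d False by (auto simp: set_blocks)
        show ?thesis by (rule bexI[OF _ p]) (unfold set_blkc(3)[OF p], use True lk d in \<open>simp add: c k\<close>)
      next
        case ty: False
        then have "l \<noteq> k" using d(5) k by auto
        then have l': "\<not> 2 * k - l \<le> k" "2 * k - (2 * k - l) = l" "odd (2 * k - l) = odd l" using lk by auto
        have p: "(d, 2 * k - l) \<in> set blocks" using d False k by (auto simp: set_blocks)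
        show ?thesis by (rule bexI[OF _ p]) (unfold set_blkc(3)[OF p], use ty l' d in \<open>simp add: c k\<close>)
      qed
    qed
    then show "c \<in> set HC" by (auto simp: HC_def)
  qed
qed

lemma orthonormal_map_Wv: assumes "distinct cs" "set cs \<subseteq> GC" shows "bil_orthonormal (map Wv cs)"
  unfolding bil_orthonormal_def
proof (intro allI impI)
  fix i j assume ij: "i < length (map Wv cs)" "j < length (map Wv cs)"
  then have "cs ! i \<in> GC" "cs ! j \<in> GC" using assms(2) by (auto intro: nth_mem subsetD)
  then show "bil (map Wv cs ! i) (map Wv cs ! j) = (if i = j then 1 else 0)"
    using Wv_orth[of "cs ! i" "cs ! j"] ij assms(1) by (simp add: nth_eq_iff_index_eq)
qed

lemma H_basis_orthonormal: "bil_orthonormal (H_basis X H Y v)"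
  unfolding H_basis_code by (rule orthonormal_map_Wv[OF distinct_HC]) (simp add: set_HC)

lemma blk_orthonormal: "p \<in> set blocks \<Longrightarrow> bil_orthonormal (blk p)"
  unfolding blk_code by (rule orthonormal_map_Wv[OF set_blkc(2,1)])

lemma set_H_basis: "set (H_basis X H Y v) = Wv ` GC"
  by (simp add: H_basis_code set_HC)

lemma span_H_basis: "vec.span (set (H_basis X H Y v)) = UNIV"
  unfolding set_H_basis using span_Wv_GC by blast

lemma length_H_basis: "length (H_basis X H Y v) = CARD('n)"
proof -
  let ?S = "set (H_basis X H Y v)"
  have "vec.dim (UNIV :: (complex^'n) set) = card ?S"
    by (rule vec.dim_eq_card) (simp_all add: span_H_basis orthonormal_independent[OF H_basis_orthonormal])
  then show ?thesis using distinct_card[OF orthonormal_distinct[OF H_basis_orthonormal]] by (simp add: card_cart_basis)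
qed

lemma length_blk: "(d, l) \<in> set blocks \<Longrightarrow> length (blk (d, l)) = (if even d then 2 * t d else t d)"
  by (simp add: blk_def D_basis_def C_basis_def)

lemma Lw_subspace: "vec.subspace (Lw (d - 1))" if "d \<in> D"
  unfolding v_basis(3)[OF that, symmetric] by (rule vec.subspace_span)

text \<open>Lets the invariance of W in the definition of K be read as invariance of the span of a
  block, as is the case by definition for the odd parts.\<close>

lemma span_blk_even: assumes p: "(\<eta>, l) \<in> set blocks" and e: "even \<eta>"
  shows "vec.span (set (blk (\<eta>, l))) = W_space X H Y \<eta> l"
proof -
  have d: "\<eta> \<in> D" "l < \<eta> div 2" using p e by (auto simp: set_blocks)
  define L where "L = Lw (\<eta> - 1)"
  have L: "vec.subspace L" unfolding L_def by (rule Lw_subspace[OF d(1)])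
  have W: "W_space X H Y \<eta> l = {mpow X l x + mpow X (\<eta> - 1 - l) y |x y. x \<in> L \<and> y \<in> L}"
    by (simp add: W_space_def L_space_eq L_def)
  have sub: "vec.subspace (W_space X H Y \<eta> l)"
    unfolding vec.subspace_def
  proof (intro conjI ballI allI)
    show "0 \<in> W_space X H Y \<eta> l" unfolding W using vec.subspace_0[OF L] by (auto intro!: exI[of _ 0] simp: mpow_linear)
  next
    fix u w assume "u \<in> W_space X H Y \<eta> l" "w \<in> W_space X H Y \<eta> l"
    then obtain x y x' y' where "u = mpow X l x + mpow X (\<eta> - 1 - l) y" "w = mpow X l x' + mpow X (\<eta> - 1 - l) y'"
      "x \<in> L" "y \<in> L" "x' \<in> L" "y' \<in> L" unfolding W by blast
    then have "u + w = mpow X l (x + x') + mpow X (\<eta> - 1 - l) (y + y') \<and> x + x' \<in> L \<and> y + y' \<in> L"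
      using vec.subspace_add[OF L] by (simp add: mpow_linear algebra_simps)
    then show "u + w \<in> W_space X H Y \<eta> l" unfolding W by blast
  next
    fix c u assume "u \<in> W_space X H Y \<eta> l"
    then obtain x y where "u = mpow X l x + mpow X (\<eta> - 1 - l) y" "x \<in> L" "y \<in> L" unfolding W by blast
    then have "c *s u = mpow X l (c *s x) + mpow X (\<eta> - 1 - l) (c *s y) \<and> c *s x \<in> L \<and> c *s y \<in> L"
      using vec.subspace_scale[OF L] by (simp only: mpow_linear vec.scale_right_distrib simp_thms)
    then show "c *s u \<in> W_space X H Y \<eta> l" unfolding W by blast
  qed
  have bW: "b \<eta> j l \<in> W_space X H Y \<eta> l" "b \<eta> j (\<eta> - 1 - l) \<in> W_space X H Y \<eta> l" if "j \<in> {1..t \<eta>}" for j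
  proof -
    have v: "v \<eta> j \<in> L" unfolding L_def by (rule v_Lw[OF d(1) that])
    have 0: "mpow X k 0 = 0" for k by (simp add: mpow_linear)
    have "b \<eta> j l = mpow X l (v \<eta> j) + mpow X (\<eta> - 1 - l) 0" "b \<eta> j (\<eta> - 1 - l) = mpow X l 0 + mpow X (\<eta> - 1 - l) (v \<eta> j)"
      by (simp_all add: b_def 0)
    then show "b \<eta> j l \<in> W_space X H Y \<eta> l" "b \<eta> j (\<eta> - 1 - l) \<in> W_space X H Y \<eta> l"
      unfolding W using v vec.subspace_0[OF L] by blast+
  qed
  have sb: "sb \<eta> j l \<in> W_space X H Y \<eta> l" if "j \<in> {1..t \<eta>}" for j
    unfolding sb_def scaleR_eq_smult by (intro vec.subspace_scale[OF sub] bW st_in(1) d(1) that)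
  have S: "set (blk (\<eta>, l)) = Wv ` {(ty, d', j, l'). d' = \<eta> \<and> j \<in> {1..t \<eta>} \<and> l' = l}"
    unfolding blk_code[OF p] set_map set_blkc(3)[OF p] using e by simp
  have "set (blk (\<eta>, l)) \<subseteq> W_space X H Y \<eta> l"
  proof
    fix w assume "w \<in> set (blk (\<eta>, l))"
    then obtain ty j where w: "w = Wv (ty, \<eta>, j, l)" "j \<in> {1..t \<eta>}" unfolding S by auto
    show "w \<in> W_space X H Y \<eta> l" unfolding w Wv_def Pv_def Nv_def scaleR_eq_smult prod.case
      using bW(1)[OF w(2)] sb[OF w(2)]
      by (auto intro!: vec.subspace_scale[OF sub] vec.subspace_add[OF sub] vec.subspace_diff[OF sub])
  qed
  moreover have "W_space X H Y \<eta> l \<subseteq> vec.span (set (blk (\<eta>, l)))"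
  proof -
    let ?S = "vec.span (set (blk (\<eta>, l)))"
    have l2: "2 * l \<le> \<eta> - 1" using d by linarith
    have bS: "b \<eta> j l \<in> ?S" "sb \<eta> j l \<in> ?S" if "j \<in> {1..t \<eta>}" for j
      by (rule PN_in_span[OF d(1) that l2 _ vec.subspace_span]; rule vec.span_base; use that in \<open>auto simp: S\<close>)+
    have bS': "b \<eta> j (\<eta> - 1 - l) \<in> ?S" if j: "j \<in> {1..t \<eta>}" for j
    proof -
      have "\<eta> - 1 - l < \<eta>" "\<eta> - 1 - (\<eta> - 1 - l) = l" using l2 D_pos(1)[OF d(1)] by auto
      then show ?thesis using b_high[OF d(1) j, of "\<eta> - 1 - l"] bS(2)[OF st_in(1)[OF d(1) j]]
        by (simp add: scaleR_eq_smult vec.span_scale)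
    qed
    have m: "mpow X k x \<in> ?S" if x: "x \<in> L" and bk: "\<And>j. j \<in> {1..t \<eta>} \<Longrightarrow> b \<eta> j k \<in> ?S" for k x
    proof -
      obtain c where c: "x = (\<Sum>j\<in>{1..t \<eta>}. c j *s v \<eta> j)"
        using Lw_sum[of x "\<eta> - 1"] x D_pos(1)[OF d(1)] unfolding L_def by auto
      show ?thesis unfolding c mpow_sum mpow_linear b_def[symmetric] using bk by (intro vec.span_sum vec.span_scale)
    qed
    show ?thesis unfolding W using m bS(1) bS' by (auto intro!: vec.span_add)
  qed
  ultimately show ?thesis using vec.span_minimal[OF _ sub] by blast
qed

end

section \<open>Compact groups of block matrices\<close>

lemma less_double_cases:
  fixes m :: nat
  assumes "i < 2 * m" obtains "i < m" | i' where "i = m + i'" "i' < m"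
  using assms by (metis add_diff_inverse_nat mult_2 nat_add_left_cancel_less)

lemma sum_double: "(\<Sum>l<2 * m. f l) = (\<Sum>l<m. f l) + (\<Sum>l<m. f (m + l))" for f :: "nat \<Rightarrow> 'a::comm_monoid_add"
proof -
  have "{..<2 * m} = {..<m} \<union> (+) m ` {..<m}" by (auto elim: less_double_cases)
  moreover have "(\<Sum>l\<in>(+) m ` {..<m}. f l) = (\<Sum>l<m. f (m + l))" by (simp add: sum.reindex)
  moreover have "sum f ({..<m} \<union> (+) m ` {..<m}) = sum f {..<m} + sum f ((+) m ` {..<m})"
    by (rule sum.union_disjoint) auto
  ultimately show ?thesis by simp
qed

lemma mult_entry:
  assumes "A \<in> carrier_mat n k" "B \<in> carrier_mat k m" "i < n" "j < m"
  shows "(A * B) $$ (i, j) = (\<Sum>l<k. A $$ (i, l) * B $$ (l, j))"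
  using assms by (simp add: scalar_prod_def lessThan_atLeast0)

lemma mult_eq_one_iff:
  fixes A B :: "'a::semiring_1 mat"
  assumes "A \<in> carrier_mat n k" "B \<in> carrier_mat k n"
  shows "A * B = 1\<^sub>m n \<longleftrightarrow> (\<forall>i<n. \<forall>j<n. (\<Sum>l<k. A $$ (i, l) * B $$ (l, j)) = (if i = j then 1 else 0))"
proof
  assume eq: "A * B = 1\<^sub>m n"
  show "\<forall>i<n. \<forall>j<n. (\<Sum>l<k. A $$ (i, l) * B $$ (l, j)) = (if i = j then 1 else 0)"
  proof (intro allI impI)
    fix i j assume ij: "i < n" "j < n"
    show "(\<Sum>l<k. A $$ (i, l) * B $$ (l, j)) = (if i = j then 1 else 0)"
      unfolding mult_entry[OF assms ij, symmetric] eq using ij by simp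
  qed
next
  assume "\<forall>i<n. \<forall>j<n. (\<Sum>l<k. A $$ (i, l) * B $$ (l, j)) = (if i = j then 1 else 0)"
  note * = this[rule_format]
  show "A * B = 1\<^sub>m n"
  proof (rule eq_matI)
    fix i j assume "i < dim_row (1\<^sub>m n :: 'a mat)" "j < dim_col (1\<^sub>m n :: 'a mat)"
    then have ij: "i < n" "j < n" by simp_all
    show "(A * B) $$ (i, j) = 1\<^sub>m n $$ (i, j)" unfolding mult_entry[OF assms ij] *[OF ij] using ij by simp
  qed (use assms in auto)
qed

lemma Orth_iff: "A \<in> Orth n \<longleftrightarrow> A \<in> carrier_mat n n \<and>
    (\<forall>i<n. \<forall>j<n. (\<Sum>l<n. A $$ (l, i) * A $$ (l, j)) = (if i = j then 1 else 0))"
proof (cases "A \<in> carrier_mat n n")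
  case True
  then have "transpose_mat A * A = 1\<^sub>m n \<longleftrightarrow>
      (\<forall>i<n. \<forall>j<n. (\<Sum>l<n. transpose_mat A $$ (i, l) * A $$ (l, j)) = (if i = j then 1 else 0))"
    by (intro mult_eq_one_iff) auto
  also have "\<dots> \<longleftrightarrow> (\<forall>i<n. \<forall>j<n. (\<Sum>l<n. A $$ (l, i) * A $$ (l, j)) = (if i = j then 1 else 0))"
    using True by simp
  finally show ?thesis using True by (simp add: Orth_def)
qed (simp add: Orth_def)

section \<open>Unitary matrices and their real and quaternionic counterparts\<close>

definition unitary_mat :: "nat \<Rightarrow> complex mat \<Rightarrow> bool" where
  "unitary_mat n U \<longleftrightarrow> U \<in> carrier_mat n n \<and>
    (\<forall>i<n. \<forall>j<n. (\<Sum>l<n. cnj (U $$ (l, i)) * U $$ (l, j)) = (if i = j then 1 else 0))"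

lemma unitary_mat_iff:
  assumes "U \<in> carrier_mat n n"
  shows "unitary_mat n U \<longleftrightarrow> transpose_mat (map_mat cnj U) * U = 1\<^sub>m n"
  using assms by (subst mult_eq_one_iff[of _ n n]) (auto simp: unitary_mat_def)

lemma unitary_mat_adjoint:
  assumes "unitary_mat n U" shows "unitary_mat n (transpose_mat (map_mat cnj U))"
proof -
  let ?V = "transpose_mat (map_mat cnj U)"
  have U: "U \<in> carrier_mat n n" "?V \<in> carrier_mat n n" using assms by (auto simp: unitary_mat_def)
  have "?V * U = 1\<^sub>m n" using assms unitary_mat_iff[OF U(1)] by simp
  then have "U * ?V = 1\<^sub>m n" by (rule mat_mult_left_right_inverse[OF U(2,1)])
  moreover have "transpose_mat (map_mat cnj ?V) = U" using U by (intro eq_matI) auto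
  ultimately show ?thesis using unitary_mat_iff[OF U(2)] by simp
qed

interpretation cnj_hom: comm_ring_hom cnj by standard auto

lemma cnj_det_unitary: assumes "unitary_mat n U" shows "Determinant.det U * cnj (Determinant.det U) = 1"
proof -
  let ?V = "transpose_mat (map_mat cnj U)"
  have U: "U \<in> carrier_mat n n" "?V \<in> carrier_mat n n" "map_mat cnj U \<in> carrier_mat n n"
    using assms by (auto simp: unitary_mat_def)
  have "Determinant.det (?V * U) = 1" using assms unitary_mat_iff[OF U(1)] by simp
  then show ?thesis by (simp add: Determinant.det_mult[OF U(2,1)] Determinant.det_transpose[OF U(3)] cnj_hom.hom_det mult.commute)
qed

lemma wp_C_carrier: "U \<in> carrier_mat n n \<Longrightarrow> wp_C U \<in> carrier_mat (2 * n) (2 * n)"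
  unfolding wp_C_def mult_2 by (intro four_block_carrier_mat) auto

lemma wp_C_entry:
  assumes "U \<in> carrier_mat n n" "i < n" "j < n"
  shows "wp_C U $$ (i, j) = Re (U $$ (i, j))" "wp_C U $$ (i, n + j) = - Im (U $$ (i, j))"
    "wp_C U $$ (n + i, j) = Im (U $$ (i, j))" "wp_C U $$ (n + i, n + j) = Re (U $$ (i, j))"
  using assms by (auto simp: wp_C_def)

lemma wp_H_carrier: "A \<in> carrier_mat n n \<Longrightarrow> wp_H A \<in> carrier_mat (2 * n) (2 * n)"
  unfolding wp_H_def mult_2 by (intro four_block_carrier_mat) auto

lemma wp_H_entry:
  assumes "A \<in> carrier_mat n n" "i < n" "j < n"
  shows "wp_H A $$ (i, j) = qP (A $$ (i, j))" "wp_H A $$ (i, n + j) = - cnj (qQ (A $$ (i, j)))"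
    "wp_H A $$ (n + i, j) = qQ (A $$ (i, j))" "wp_H A $$ (n + i, n + j) = cnj (qP (A $$ (i, j)))"
  using assms by (auto simp: wp_H_def)

lemma wp_C_Orth: assumes "unitary_mat n U" shows "wp_C U \<in> Orth (2 * n)"
  unfolding Orth_iff
proof (intro conjI allI impI)
  have U: "U \<in> carrier_mat n n" using assms by (simp add: unitary_mat_def)
  show "wp_C U \<in> carrier_mat (2 * n) (2 * n)" by (rule wp_C_carrier[OF U])
  have un: "(\<Sum>l<n. cnj (U $$ (l, i)) * U $$ (l, j)) = (if i = j then 1 else 0)" if "i < n" "j < n" for i j
    using assms that by (simp add: unitary_mat_def)
  have re: "(\<Sum>l<n. Re (U $$ (l, i)) * Re (U $$ (l, j)) + Im (U $$ (l, i)) * Im (U $$ (l, j))) = (if i = j then 1 else 0)"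
    "(\<Sum>l<n. Re (U $$ (l, i)) * Im (U $$ (l, j)) - Im (U $$ (l, i)) * Re (U $$ (l, j))) = 0"
    "(\<Sum>l<n. Im (U $$ (l, i)) * Im (U $$ (l, j)) + Re (U $$ (l, i)) * Re (U $$ (l, j))) = (if i = j then 1 else 0)"
    if "i < n" "j < n" for i j
    using arg_cong[OF un[OF that], of Re] arg_cong[OF un[OF that], of Im] by (simp_all add: add.commute split: if_splits)
  fix i j assume ij: "i < 2 * n" "j < 2 * n"
  note e = wp_C_entry[OF U]
  show "(\<Sum>l<2 * n. wp_C U $$ (l, i) * wp_C U $$ (l, j)) = (if i = j then 1 else 0)"
  proof (rule less_double_cases[OF ij(1)]; rule less_double_cases[OF ij(2)])
    assume "i < n" "j < n"
    then show ?thesis using re(1)[of i j] by (simp add: sum_double e sum.distrib)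
  next
    fix j' assume *: "i < n" "j = n + j'" "j' < n"
    then show ?thesis using re(2)[of i j'] by (simp add: sum_double e sum_negf sum_subtractf)
  next
    fix i' assume *: "i = n + i'" "i' < n" "j < n"
    then show ?thesis using re(2)[of i' j] by (simp add: sum_double e sum_negf sum_subtractf)
  next
    fix i' j' assume "i = n + i'" "i' < n" "j = n + j'" "j' < n"
    then show ?thesis using re(3)[of i' j'] by (simp add: sum_double e sum.distrib)
  qed
qed

text \<open>Over the complex numbers, one block row and one block column operation with the factor i
  make \<open>wp_C U\<close> block triangular with U and its conjugate on the diagonal; the
  determinant is thus the squared modulus of that of U.\<close>

lemma det_wp_C: assumes "unitary_mat n U" shows "Determinant.det (wp_C U) = 1"
proof -
  have U: "U \<in> carrier_mat n n" using assms by (simp add: unitary_mat_def)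
  define r where "r = map_mat complex_of_real (map_mat Re U)"
  define s where "s = map_mat complex_of_real (map_mat Im U)"
  have rs: "r \<in> carrier_mat n n" "s \<in> carrier_mat n n" using U by (auto simp: r_def s_def)
  define M where "M = map_mat complex_of_real (wp_C U)"
  have M: "M = four_block_mat r (- s) s r"
    unfolding M_def wp_C_def r_def s_def using U by (intro eq_matI) auto
  define I where "I = \<i> \<cdot>\<^sub>m 1\<^sub>m n"
  define W where "W = four_block_mat (1\<^sub>m n) I (0\<^sub>m n n) (1\<^sub>m n)"
  define W' where "W' = four_block_mat (1\<^sub>m n) (- I) (0\<^sub>m n n) (1\<^sub>m n)"
  have I: "I \<in> carrier_mat n n" by (simp add: I_def)
  have cs: "M \<in> carrier_mat (n + n) (n + n)" "W \<in> carrier_mat (n + n) (n + n)" "W' \<in> carrier_mat (n + n) (n + n)"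
    unfolding M W_def W'_def using rs I by auto
  have Ir: "I * r = \<i> \<cdot>\<^sub>m r" "I * s = \<i> \<cdot>\<^sub>m s" unfolding I_def
    by (simp_all add: mult_smult_assoc_mat[OF one_carrier_mat rs(1)] mult_smult_assoc_mat[OF one_carrier_mat rs(2)] left_mult_one_mat[OF rs(1)] left_mult_one_mat[OF rs(2)])
  have "W * M = four_block_mat (1\<^sub>m n * r + I * s) (1\<^sub>m n * (- s) + I * r) (0\<^sub>m n n * r + 1\<^sub>m n * s) (0\<^sub>m n n * (- s) + 1\<^sub>m n * r)"
    unfolding W_def M by (rule mult_four_block_mat[OF _ I]) (use rs in auto)
  also have "\<dots> = four_block_mat U (\<i> \<cdot>\<^sub>m U) s r"
    using U rs unfolding Ir by (intro eq_matI) (auto simp: r_def s_def complex_eq_iff)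
  finally have WM: "W * M = four_block_mat U (\<i> \<cdot>\<^sub>m U) s r" .
  have "W * M * W' = four_block_mat (U * 1\<^sub>m n + (\<i> \<cdot>\<^sub>m U) * 0\<^sub>m n n) (U * (- I) + (\<i> \<cdot>\<^sub>m U) * 1\<^sub>m n)
      (s * 1\<^sub>m n + r * 0\<^sub>m n n) (s * (- I) + r * 1\<^sub>m n)"
    unfolding WM W'_def by (rule mult_four_block_mat) (use rs I U in auto)
  also have "\<dots> = four_block_mat U (0\<^sub>m n n) s (map_mat cnj U)"
  proof -
    have "U * (- I) = - (\<i> \<cdot>\<^sub>m U)" "s * (- I) = - (\<i> \<cdot>\<^sub>m s)"
      using U rs I by (simp_all add: I_def mult_smult_distrib[OF U one_carrier_mat] mult_smult_distrib[OF rs(2) one_carrier_mat])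
    then show ?thesis using U rs by (intro eq_matI) (auto simp: r_def s_def complex_eq_iff)
  qed
  finally have "Determinant.det (W * M * W') = Determinant.det U * cnj (Determinant.det U)"
    using det_four_block_mat_upper_right_zero[OF U refl rs(2), of "map_mat cnj U"] U by (simp add: cnj_hom.hom_det)
  moreover have "Determinant.det W = 1" "Determinant.det W' = 1"
    unfolding W_def W'_def using I by (simp_all add: det_four_block_mat_lower_left_zero[of _ n _ n])
  moreover have "Determinant.det (W * M * W') = Determinant.det W * Determinant.det M * Determinant.det W'"
    using cs by (simp add: Determinant.det_mult[of _ "n + n"])
  ultimately have "Determinant.det M = 1" using cnj_det_unitary[OF assms] by simp
  then show ?thesis unfolding M_def by (simp add: of_real_hom.hom_det)
qed

lemma qP_simps: "qP (p + q) = qP p + qP q" "qP (qcnj p * q) = cnj (qP p) * qP q + cnj (qQ p) * qQ q"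
    "qP 0 = 0" "qP 1 = 1" "qP (qcnj p) = cnj (qP p)"
  and qQ_simps: "qQ (p + q) = qQ p + qQ q" "qQ (qcnj p * q) = qP p * qQ q - qQ p * qP q"
    "qQ 0 = 0" "qQ 1 = 0" "qQ (qcnj p) = - qQ p"
  by (simp_all add: qP_def qQ_def qcnj_def times_quat_def plus_quat_def zero_quat_def one_quat_def complex_eq_iff algebra_simps)

lemma qPQ_sum: "qP (sum f S) = (\<Sum>x\<in>S. qP (f x))" "qQ (sum f S) = (\<Sum>x\<in>S. qQ (f x))"
  by (induct S rule: infinite_finite_induct) (simp_all add: qP_simps qQ_simps)

lemma quat_eq_iff: "p = q \<longleftrightarrow> qP p = qP q \<and> qQ p = qQ q"
  by (cases p; cases q) (auto simp: qP_def qQ_def complex_eq_iff)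

lemma qcnj_qcnj: "qcnj (qcnj q) = q" by (cases q) (simp add: qcnj_def)

text \<open>The complex Gram matrix of \<open>wp_H A\<close> is arranged like \<open>wp_H\<close> of
  the quaternionic Gram matrix of A: its second block column repeats the first one up to conjugation
  and sign.\<close>

lemma unitary_wp_H_iff:
  assumes A: "A \<in> carrier_mat m m"
  shows "unitary_mat (2 * m) (wp_H A) \<longleftrightarrow> transpose_mat (map_mat qcnj A) * A = 1\<^sub>m m"
proof -
  define S where "S i j = (\<Sum>l<m. qcnj (A $$ (l, i)) * A $$ (l, j))" for i j
  have "transpose_mat (map_mat qcnj A) * A = 1\<^sub>m m \<longleftrightarrow> (\<forall>i<m. \<forall>j<m. S i j = (if i = j then 1 else 0))"
    using A by (subst mult_eq_one_iff[of _ m m]) (auto simp: S_def)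
  moreover have "unitary_mat (2 * m) (wp_H A) \<longleftrightarrow> (\<forall>i<m. \<forall>j<m. S i j = (if i = j then 1 else 0))"
  proof -
    define T where "T i j = (\<Sum>l<2 * m. cnj (wp_H A $$ (l, i)) * wp_H A $$ (l, j))" for i j
    note e = wp_H_entry[OF A]
    have T: "T i j = qP (S i j)" "T i (m + j) = - cnj (qQ (S i j))" "T (m + i) j = qQ (S i j)" "T (m + i) (m + j) = cnj (qP (S i j))"
      if "i < m" "j < m" for i j
      using that unfolding T_def S_def sum_double
      by (simp_all add: e qPQ_sum qP_simps qQ_simps) (simp_all add: sum.distrib sum_subtractf sum_negf algebra_simps)
    have "unitary_mat (2 * m) (wp_H A) \<longleftrightarrow> (\<forall>i<2 * m. \<forall>j<2 * m. T i j = (if i = j then 1 else 0))"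
      using wp_H_carrier[OF A] by (simp add: unitary_mat_def T_def)
    also have "\<dots> \<longleftrightarrow> (\<forall>i<m. \<forall>j<m. S i j = (if i = j then 1 else 0))"
    proof
      assume *: "\<forall>i<2 * m. \<forall>j<2 * m. T i j = (if i = j then 1 else 0)"
      show "\<forall>i<m. \<forall>j<m. S i j = (if i = j then 1 else 0)"
      proof (intro allI impI)
        fix i j assume ij: "i < m" "j < m"
        have "qP (S i j) = (if i = j then 1 else 0)" using *[rule_format, of i j] ij T(1)[OF ij] by simp
        moreover have "qQ (S i j) = 0" using *[rule_format, of "m + i" j] ij T(3)[OF ij] by simp
        ultimately show "S i j = (if i = j then 1 else 0)" by (simp add: quat_eq_iff qP_simps qQ_simps)
      qed
    next
      assume *: "\<forall>i<m. \<forall>j<m. S i j = (if i = j then 1 else 0)"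
      show "\<forall>i<2 * m. \<forall>j<2 * m. T i j = (if i = j then 1 else 0)"
      proof (intro allI impI)
        fix i j assume ij: "i < 2 * m" "j < 2 * m"
        show "T i j = (if i = j then 1 else 0)"
          by (rule less_double_cases[OF ij(1)]; rule less_double_cases[OF ij(2)])
            (use * in \<open>auto simp: T qP_simps qQ_simps\<close>)
      qed
    qed
    finally show ?thesis .
  qed
  ultimately show ?thesis by simp
qed

text \<open>\<open>Sp\<close> asks for a two-sided inverse, and quaternions do not commute. The
  one-sided relation is turned into the other one by passing to complex matrices, where the adjoint
  of a unitary matrix is unitary.\<close>

lemma Sp_iff: "A \<in> Sp m \<longleftrightarrow> A \<in> carrier_mat m m \<and> unitary_mat (2 * m) (wp_H A)"
proof (cases "A \<in> carrier_mat m m")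
  case A: True
  let ?B = "transpose_mat (map_mat qcnj A)"
  have B: "?B \<in> carrier_mat m m" using A by simp
  have inv: "invertible_mat A" if u: "unitary_mat (2 * m) (wp_H A)"
  proof -
    have 1: "?B * A = 1\<^sub>m m" using u unitary_wp_H_iff[OF A] by simp
    have "transpose_mat (map_mat cnj (wp_H A)) = wp_H ?B"
      using A unfolding wp_H_def by (intro eq_matI) (auto simp: qP_simps qQ_simps)
    then have "unitary_mat (2 * m) (wp_H ?B)" using unitary_mat_adjoint[OF u] by simp
    then have "transpose_mat (map_mat qcnj ?B) * ?B = 1\<^sub>m m" using unitary_wp_H_iff[OF B] by simp
    moreover have "transpose_mat (map_mat qcnj ?B) = A" using A by (intro eq_matI) (auto simp: qcnj_qcnj)
    ultimately have "A * ?B = 1\<^sub>m m" by simp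
    then show ?thesis using 1 A unfolding invertible_mat_def inverts_mat_def by auto
  qed
  show ?thesis unfolding Sp_def using A inv unitary_wp_H_iff[OF A] by auto
qed (simp add: Sp_def)

text \<open>The minus sign at \<open>B2\<close> in the coordinates is that of j i = - k.\<close>

lemma quat_block_eq:
  assumes "A1 \<in> carrier_mat m m" "A2 \<in> carrier_mat m m" "B1 \<in> carrier_mat m m" "B2 \<in> carrier_mat m m"
  defines "q \<equiv> map_mat (of_real :: real \<Rightarrow> quat)"
  defines "A \<equiv> (q A1 + qi \<cdot>\<^sub>m q A2) + qj \<cdot>\<^sub>m (q B1 + qi \<cdot>\<^sub>m q B2)"
  shows "A \<in> carrier_mat m m" "quat_block A1 A2 B1 B2 = wp_C (wp_H A)"
    "\<And>i j. i < m \<Longrightarrow> j < m \<Longrightarrow> A $$ (i, j) = Quat (A1 $$ (i, j)) (A2 $$ (i, j)) (B1 $$ (i, j)) (- B2 $$ (i, j))"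
proof -
  show A: "A \<in> carrier_mat m m" unfolding A_def q_def using assms by auto
  have q: "of_real a + qi * of_real b + qj * (of_real c + qi * of_real d) = Quat a b c (- d)" for a b c d
    by (simp add: qi_def qj_def of_real_def one_quat_def scaleR_quat_def times_quat_def plus_quat_def)
  show e: "A $$ (i, j) = Quat (A1 $$ (i, j)) (A2 $$ (i, j)) (B1 $$ (i, j)) (- B2 $$ (i, j))" if "i < m" "j < m" for i j
    unfolding A_def q_def using assms(1-4) that by (simp add: q[symmetric] add.assoc)
  have d: "dim_row A = m" "dim_col A = m" using A by auto
  show "quat_block A1 A2 B1 B2 = wp_C (wp_H A)"
    unfolding quat_block_def wp_C_def wp_H_def using assms(1-4) d by (intro eq_matI) (auto simp: e qP_def qQ_def)
qed

lemma diag_block_carrier: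
  assumes "\<And>p. p \<in> set ps \<Longrightarrow> F p \<in> carrier_mat (n p) (n p)"
  shows "diag_block_mat (map F ps) \<in> carrier_mat (sum_list (map n ps)) (sum_list (map n ps))"
proof -
  have *: "map dim_row (map F ps) = map n ps" "map dim_col (map F ps) = map n ps" using assms by auto
  show ?thesis by (simp only: carrier_mat_def mem_Collect_eq dim_diag_block_mat * simp_thms)
qed

lemma diag_block_Cons:
  assumes "F p \<in> carrier_mat n n" "diag_block_mat (map F ps) \<in> carrier_mat k k"
  shows "diag_block_mat (map F (p # ps)) = four_block_mat (F p) (0\<^sub>m n k) (0\<^sub>m k n) (diag_block_mat (map F ps))"
  using assms by (simp add: Let_def)

lemma diag_block_Orth:
  assumes "\<And>p. p \<in> set ps \<Longrightarrow> F p \<in> Orth (n p)"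
  shows "diag_block_mat (map F ps) \<in> Orth (sum_list (map n ps)) \<and>
    Determinant.det (diag_block_mat (map F ps)) = (\<Prod>p\<leftarrow>ps. Determinant.det (F p))"
  using assms
proof (induction ps)
  case Nil
  have "(0\<^sub>m 0 0 :: real mat) = 1\<^sub>m 0" by (intro eq_matI) auto
  then show ?case by (simp add: Orth_def)
next
  case (Cons p ps)
  let ?D = "diag_block_mat (map F ps)" and ?k = "sum_list (map n ps)"
  have D: "?D \<in> Orth ?k" "Determinant.det ?D = (\<Prod>p\<leftarrow>ps. Determinant.det (F p))" using Cons by auto
  then have Dc: "?D \<in> carrier_mat ?k ?k" "transpose_mat ?D * ?D = 1\<^sub>m ?k" by (auto simp: Orth_def)
  have P: "F p \<in> carrier_mat (n p) (n p)" "transpose_mat (F p) * F p = 1\<^sub>m (n p)" using Cons.prems[of p] by (auto simp: Orth_def)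
  note eq = diag_block_Cons[OF P(1) Dc(1)]
  let ?M = "four_block_mat (F p) (0\<^sub>m (n p) ?k) (0\<^sub>m ?k (n p)) ?D"
  have tr: "transpose_mat ?M = four_block_mat (transpose_mat (F p)) (0\<^sub>m (n p) ?k) (0\<^sub>m ?k (n p)) (transpose_mat ?D)"
    using transpose_four_block_mat[OF P(1) _ _ Dc(1), of "0\<^sub>m (n p) ?k" "0\<^sub>m ?k (n p)"] by simp
  have "transpose_mat ?M * ?M = 1\<^sub>m (n p + ?k)"
    unfolding tr using P Dc
      mult_four_block_mat[of "transpose_mat (F p)" "n p" "n p" "0\<^sub>m (n p) ?k" ?k "0\<^sub>m ?k (n p)" ?k "transpose_mat ?D"
        "F p" "n p" "0\<^sub>m (n p) ?k" ?k "0\<^sub>m ?k (n p)" ?D]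
    by simp
  then have "?M \<in> Orth (n p + ?k)" using P Dc by (simp add: Orth_def)
  moreover have "Determinant.det ?M = Determinant.det (F p) * Determinant.det ?D"
    by (rule det_four_block_mat_upper_right_zero) (use P Dc in auto)
  ultimately show ?case unfolding eq using D(2) by simp
qed

section \<open>Coordinate matrices along concatenated lists\<close>

definition mform :: "(complex^'n) list \<Rightarrow> (complex^'n) list \<Rightarrow> (complex^'n \<Rightarrow> complex^'n) \<Rightarrow> complex mat" where
  "mform as cs T = Matrix.mat (length as) (length cs) (\<lambda>(i, j). bil (as ! i) (T (cs ! j)))"

lemma mform_append:
  "mform (as @ as') (cs @ cs') T = four_block_mat (mform as cs T) (mform as cs' T) (mform as' cs T) (mform as' cs' T)"
  unfolding mform_def by (intro eq_matI) (auto simp: nth_append)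

lemma mform_eq_zero: "mform as cs T = 0\<^sub>m (length as) (length cs) \<longleftrightarrow> (\<forall>a\<in>set as. \<forall>c\<in>set cs. bil a (T c) = 0)"
proof
  assume eq: "mform as cs T = 0\<^sub>m (length as) (length cs)"
  have "bil (as ! i) (T (cs ! j)) = 0" if "i < length as" "j < length cs" for i j
    using arg_cong[OF eq, of "\<lambda>M. M $$ (i, j)"] that by (simp add: mform_def)
  then show "\<forall>a\<in>set as. \<forall>c\<in>set cs. bil a (T c) = 0" by (auto simp: in_set_conv_nth)
next
  assume "\<forall>a\<in>set as. \<forall>c\<in>set cs. bil a (T c) = 0"
  then show "mform as cs T = 0\<^sub>m (length as) (length cs)" unfolding mform_def by (intro eq_matI) auto
qed

lemma four_block_mat_inject:
  assumes "A \<in> carrier_mat n m" "A' \<in> carrier_mat n m" "B \<in> carrier_mat n m'" "B' \<in> carrier_mat n m'"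
    and "C \<in> carrier_mat n' m" "C' \<in> carrier_mat n' m" "D \<in> carrier_mat n' m'" "D' \<in> carrier_mat n' m'"
  shows "four_block_mat A B C D = four_block_mat A' B' C' D' \<longleftrightarrow> A = A' \<and> B = B' \<and> C = C' \<and> D = D'"
proof
  assume eq: "four_block_mat A B C D = four_block_mat A' B' C' D'"
  have e: "four_block_mat A B C D $$ (i, j) = four_block_mat A' B' C' D' $$ (i, j)" for i j by (simp only: eq)
  have "A $$ (i, j) = A' $$ (i, j)" if "i < n" "j < m" for i j using e[of i j] assms that by simp
  moreover have "B $$ (i, j) = B' $$ (i, j)" if "i < n" "j < m'" for i j using e[of i "m + j"] assms that by simp
  moreover have "C $$ (i, j) = C' $$ (i, j)" if "i < n'" "j < m" for i j using e[of "n + i" j] assms that by simp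
  moreover have "D $$ (i, j) = D' $$ (i, j)" if "i < n'" "j < m'" for i j using e[of "n + i" "m + j"] assms that by simp
  ultimately show "A = A' \<and> B = B' \<and> C = C' \<and> D = D'" using assms by (intro conjI eq_matI) auto
qed simp

lemma mform_carrier: "mform as cs T \<in> carrier_mat (length as) (length cs)" by (simp add: mform_def)

lemma mform_concat_iff:
  assumes "distinct ps" "\<And>p. p \<in> set ps \<Longrightarrow> F p \<in> carrier_mat (length (f p)) (length (f p))"
  shows "mform (concat (map f ps)) (concat (map f ps)) T = diag_block_mat (map F ps) \<longleftrightarrow>
    (\<forall>p\<in>set ps. mform (f p) (f p) T = F p) \<and>
    (\<forall>p\<in>set ps. \<forall>q\<in>set ps. p \<noteq> q \<longrightarrow> (\<forall>a\<in>set (f p). \<forall>c\<in>set (f q). bil a (T c) = 0))"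
  using assms
proof (induction ps)
  case Nil
  show ?case by (auto simp: mform_def)
next
  case (Cons p ps)
  let ?R = "concat (map f ps)" and ?D = "diag_block_mat (map F ps)"
  have P: "F p \<in> carrier_mat (length (f p)) (length (f p))" using Cons.prems by simp
  have "?D \<in> carrier_mat (sum_list (map (\<lambda>p. length (f p)) ps)) (sum_list (map (\<lambda>p. length (f p)) ps))"
    using Cons.prems by (intro diag_block_carrier) simp
  then have D: "?D \<in> carrier_mat (length ?R) (length ?R)" by (simp add: length_concat o_def)
  have "mform (concat (map f (p # ps))) (concat (map f (p # ps))) T = diag_block_mat (map F (p # ps)) \<longleftrightarrow>
      mform (f p) (f p) T = F p \<and> mform (f p) ?R T = 0\<^sub>m (length (f p)) (length ?R) \<and>
      mform ?R (f p) T = 0\<^sub>m (length ?R) (length (f p)) \<and> mform ?R ?R T = ?D"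
    unfolding diag_block_Cons[where F = F, OF P D]
    unfolding list.map concat.simps mform_append
    by (rule four_block_mat_inject) (use P D in \<open>auto intro: mform_carrier\<close>)
  then show ?case using Cons.prems unfolding mform_eq_zero by (subst (asm) Cons.IH) (auto 0 3)
qed

section \<open>Complex matrices of numeric size\<close>

text \<open>An arbitrary enumeration of the index type. It also decides the order of the columns of
  \<open>Bm\<close>, and therefore does not show in \<open>Lambda_H\<close>.\<close>

definition idx :: "nat \<Rightarrow> 'n::finite" where "idx = (SOME f. bij_betw f {..<CARD('n)} UNIV)"

lemma idx_bij: "bij_betw (idx :: nat \<Rightarrow> 'n::finite) {..<CARD('n)} UNIV"
proof -
  have "\<exists>f :: nat \<Rightarrow> 'n. bij_betw f {..<CARD('n)} UNIV" using ex_bij_betw_nat_finite[of "UNIV :: 'n set"] by (simp add: lessThan_atLeast0)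
  then show ?thesis unfolding idx_def by (rule someI_ex)
qed

lemma sum_idx: "(\<Sum>k<CARD('n). f (idx k)) = (\<Sum>x\<in>UNIV. f (x :: 'n::finite))"
  by (rule sum.reindex_bij_betw[OF idx_bij])

lemma idx_cases: obtains k where "k < CARD('n)" "x = (idx k :: 'n::finite)"
  using idx_bij unfolding bij_betw_def by (metis UNIV_I imageE lessThan_iff)

lemma idx_eq_iff: "i < CARD('n) \<Longrightarrow> j < CARD('n) \<Longrightarrow> (idx i :: 'n::finite) = idx j \<longleftrightarrow> i = j"
  using idx_bij unfolding bij_betw_def inj_on_def by blast

definition toJ :: "'n::finite cmat \<Rightarrow> complex mat" where
  "toJ A = Matrix.mat CARD('n) CARD('n) (\<lambda>(i, j). mat_of A $ idx i $ idx j)"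

lemma toJ_carrier: "toJ (A :: 'n::finite cmat) \<in> carrier_mat CARD('n) CARD('n)"
  by (simp add: toJ_def)

lemma toJ_entry: "i < CARD('n) \<Longrightarrow> j < CARD('n) \<Longrightarrow> toJ (A :: 'n::finite cmat) $$ (i, j) = mat_of A $ idx i $ idx j"
  by (simp add: toJ_def)

lemma toJ_inject: "toJ A = toJ B \<longleftrightarrow> A = (B :: 'n::finite cmat)"
proof
  assume eq: "toJ A = toJ B"
  have "mat_of A $ a $ c = mat_of B $ a $ c" for a c
  proof -
    obtain i j where "i < CARD('n)" "j < CARD('n)" "a = idx i" "c = idx j" by (metis idx_cases)
    then show ?thesis using toJ_entry[of i j A] toJ_entry[of i j B] eq by simp
  qed
  then have "mat_of A = mat_of B" by (simp add: Finite_Cartesian_Product.vec_eq_iff)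
  then show "A = B" by (simp add: mat_of_inject)
qed simp

text \<open>The expansion into elementary matrices, from which continuity in the entries is
  immediate.\<close>

definition ofJ :: "complex mat \<Rightarrow> 'n::finite cmat" where
  "ofJ M = (\<Sum>i<CARD('n). \<Sum>j<CARD('n). Cmat (\<chi> a c. if a = idx i \<and> c = idx j then M $$ (i, j) else 0))"

lemma mat_of_sum: "mat_of (\<Sum>i\<in>I. f i) = (\<Sum>i\<in>I. mat_of (f i))"
  by (rule linear_sum[OF bounded_linear.linear[OF bounded_linear_mat_of]])

lemma mat_of_ofJ: assumes "i < CARD('n)" "j < CARD('n)" shows "mat_of (ofJ M :: 'n::finite cmat) $ idx i $ idx j = M $$ (i, j)"
proof -
  have "mat_of (ofJ M :: 'n cmat) $ idx i $ idx j =
      (\<Sum>i'<CARD('n). \<Sum>j'<CARD('n). if (idx i :: 'n) = idx i' \<and> (idx j :: 'n) = idx j' then M $$ (i', j') else 0)"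
    unfolding ofJ_def mat_of_sum by (simp add: sum_component Cmat_inverse)
  also have "\<dots> = (\<Sum>i'<CARD('n). \<Sum>j'<CARD('n). if i = i' \<and> j = j' then M $$ (i', j') else 0)"
    by (intro sum.cong refl) (simp add: idx_eq_iff assms)
  also have "\<dots> = (\<Sum>i'<CARD('n). if i = i' then (\<Sum>j'<CARD('n). if j = j' then M $$ (i', j') else 0) else 0)"
    by (intro sum.cong refl) simp
  also have "\<dots> = M $$ (i, j)" using assms by simp
  finally show ?thesis .
qed

lemma toJ_ofJ: "M \<in> carrier_mat CARD('n) CARD('n) \<Longrightarrow> toJ (ofJ M :: 'n::finite cmat) = M"
  unfolding toJ_def by (intro eq_matI) (auto simp: mat_of_ofJ)

lemma ofJ_toJ: "ofJ (toJ A) = (A :: 'n::finite cmat)"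
  using toJ_ofJ[OF toJ_carrier[of A]] toJ_inject by blast

lemma toJ_mult: "toJ (A * B) = toJ A * toJ (B :: 'n::finite cmat)"
proof (rule eq_matI)
  fix i j assume "i < dim_row (toJ A * toJ B)" "j < dim_col (toJ A * toJ B)"
  then have ij: "i < CARD('n)" "j < CARD('n)" using toJ_carrier[of A] toJ_carrier[of B] by auto
  have "(toJ A * toJ B) $$ (i, j) = (\<Sum>k<CARD('n). mat_of A $ idx i $ idx k * mat_of B $ idx k $ idx j)"
    unfolding mult_entry[OF toJ_carrier toJ_carrier ij] by (intro sum.cong refl) (simp add: toJ_entry ij)
  also have "\<dots> = (\<Sum>x\<in>UNIV. mat_of A $ idx i $ x * mat_of B $ x $ idx j)" by (rule sum_idx)
  finally show "toJ (A * B) $$ (i, j) = (toJ A * toJ B) $$ (i, j)"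
    by (simp add: toJ_entry ij times_cmat.rep_eq matrix_matrix_mult_def)
qed (simp_all add: toJ_def)

lemma toJ_one: "toJ (1 :: 'n::finite cmat) = 1\<^sub>m CARD('n)"
  unfolding toJ_def by (intro eq_matI) (auto simp: one_cmat.rep_eq Finite_Cartesian_Product.mat_def idx_eq_iff)

lemma toJ_tr: "toJ (tr A) = transpose_mat (toJ (A :: 'n::finite cmat))"
  unfolding toJ_def by (intro eq_matI) (auto simp: tr.rep_eq Finite_Cartesian_Product.transpose_def)

lemma toJ_adj: "toJ (adj A) = transpose_mat (map_mat cnj (toJ (A :: 'n::finite cmat)))"
  unfolding toJ_def by (intro eq_matI) (auto simp: adj.rep_eq)

text \<open>The two sums over permutations are matched by transporting permutations along
  \<open>idx\<close>, which preserves signs.\<close>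

lemma det_toJ: "Determinant.det (toJ A) = Determinants.det (mat_of (A :: 'n::finite cmat))"
proof -
  let ?n = "CARD('n)"
  define g where "g = inv_into {..<?n} (idx :: nat \<Rightarrow> 'n)"
  have g: "bij_betw g UNIV {..<?n}" "\<And>x. idx (g x) = x" "\<And>k. k < ?n \<Longrightarrow> g (idx k) = k"
    using idx_bij[where 'n = 'n] bij_betw_inv_into[OF idx_bij[where 'n = 'n]] unfolding g_def
    by (auto simp: bij_betw_def f_inv_into_f inv_into_f_f)
  have inj: "inj_on (idx :: nat \<Rightarrow> 'n) {..<?n}" using idx_bij by (rule bij_betw_imp_inj_on)
  have "Determinant.det (toJ A) = (\<Sum>p | p permutes {..<?n}. of_int (sign p) * (\<Prod>i<?n. toJ A $$ (i, p i)))"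
    using toJ_carrier[of A] by (simp add: Determinant.det_def lessThan_atLeast0)
  also have "\<dots> = (\<Sum>p | p permutes (UNIV :: 'n set). of_int (sign p) * (\<Prod>x\<in>UNIV. mat_of A $ x $ p x))"
  proof (rule sum.reindex_bij_witness[where i = "map_permutation UNIV g" and j = "map_permutation {..<?n} idx"])
    fix p assume p: "p \<in> {p. p permutes {..<?n}}"
    let ?q = "map_permutation {..<?n} idx p :: 'n \<Rightarrow> 'n"
    show "map_permutation UNIV g ?q = p"
      by (rule map_permutation_compose_inv[OF idx_bij]) (use p g in auto)
    show "?q \<in> {p. p permutes UNIV}" using map_permutation_permutes[OF idx_bij] p by simp
    have "(\<Prod>x\<in>UNIV. mat_of A $ x $ ?q x) = (\<Prod>i<?n. mat_of A $ idx i $ ?q (idx i))"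
      by (rule prod.reindex_bij_betw[OF idx_bij, symmetric])
    also have "\<dots> = (\<Prod>i<?n. toJ A $$ (i, p i))"
    proof (intro prod.cong refl)
      fix i assume i: "i \<in> {..<?n}"
      then have "p i \<in> {..<?n}" using p by (simp only: permutes_in_image mem_Collect_eq)
      then show "mat_of A $ idx i $ ?q (idx i) = toJ A $$ (i, p i)"
        using i map_permutation_apply[OF inj i, of p] by (simp add: toJ_entry)
    qed
    finally show "of_int (sign ?q) * (\<Prod>x\<in>UNIV. mat_of A $ x $ ?q x) = of_int (sign p) * (\<Prod>i<?n. toJ A $$ (i, p i))"
      using sign_map_permutation[OF inj, of p] p by simp
  next
    fix p assume p: "p \<in> {p. p permutes (UNIV :: 'n set)}"
    show "map_permutation {..<?n} idx (map_permutation UNIV g p) = p"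
      by (rule map_permutation_compose_inv[OF g(1)]) (use p g in auto)
    show "map_permutation UNIV g p \<in> {p. p permutes {..<?n}}" using map_permutation_permutes[OF g(1)] p by simp
  qed
  also have "\<dots> = Determinants.det (mat_of A)" by (simp add: Determinants.det_def)
  finally show ?thesis .
qed

lemma SOr_D: "g \<in> SOr \<Longrightarrow> g \<in> SO" "g \<in> SOr \<Longrightarrow> adj g = tr g"
proof -
  show "g \<in> SOr \<Longrightarrow> g \<in> SO" by (simp add: SOr_def)
  assume g: "g \<in> SOr"
  then have "adj g = adj g * (g * tr g)" by (simp add: SOr_def SO_D)
  also have "\<dots> = tr g" using g by (simp add: SOr_def mult.assoc[symmetric])
  finally show "adj g = tr g" .
qed

lemma map_of_real_gram:
  "Q \<in> carrier_mat n n \<Longrightarrow> map_mat complex_of_real (transpose_mat Q * Q) =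
    transpose_mat (map_mat complex_of_real Q) * map_mat complex_of_real Q"
  by (intro eq_matI) (auto simp: scalar_prod_def)

text \<open>Equality of \<open>adj A\<close> and \<open>tr A\<close> says that all entries are
  real.\<close>

lemma toJ_SOr: "toJ ` (SOr :: 'n::finite cmat set) = SOn CARD('n)"
proof (intro subset_antisym subsetI)
  fix M assume "M \<in> toJ ` (SOr :: 'n cmat set)"
  then obtain A :: "'n cmat" where A: "A \<in> SOr" "M = toJ A" by auto
  let ?Q = "map_mat Re (toJ A)"
  have "cnj (mat_of A $ a $ c) = mat_of A $ a $ c" for a c
  proof -
    have "mat_of (adj A) $ c $ a = mat_of (tr A) $ c $ a" by (simp add: SOr_D(2)[OF A(1)])
    then show ?thesis by (simp add: adj.rep_eq tr.rep_eq Finite_Cartesian_Product.transpose_def)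
  qed
  then have real: "toJ A = map_mat complex_of_real ?Q"
    unfolding toJ_def by (intro eq_matI) (auto simp: complex_eq_iff)
  have Q: "?Q \<in> carrier_mat CARD('n) CARD('n)" using toJ_carrier[of A] by simp
  have "map_mat complex_of_real (transpose_mat ?Q * ?Q) = toJ (tr A * A)"
    unfolding toJ_mult toJ_tr map_of_real_gram[OF Q] real[symmetric] ..
  also have "\<dots> = map_mat complex_of_real (1\<^sub>m CARD('n))"
    using A(1) by (simp add: SOr_def SO_D toJ_one of_real_hom.mat_hom_one)
  finally have "transpose_mat ?Q * ?Q = 1\<^sub>m CARD('n)" by (rule of_real_hom.mat_hom_inj)
  moreover have "complex_of_real (Determinant.det ?Q) = complex_of_real 1"
    unfolding of_real_hom.hom_det[symmetric] real[symmetric] det_toJ using A(1) by (simp add: SOr_def SO_def)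
  then have "Determinant.det ?Q = 1" by (simp only: of_real_eq_iff)
  ultimately show "M \<in> SOn CARD('n)" unfolding SOn_def using real A(2) Q by (auto simp: Orth_def intro!: image_eqI)
next
  fix M assume "M \<in> SOn CARD('n)"
  then obtain Q where Q: "M = map_mat complex_of_real Q" "Q \<in> carrier_mat CARD('n) CARD('n)"
      "transpose_mat Q * Q = 1\<^sub>m CARD('n)" "Determinant.det Q = 1"
    by (auto simp: SOn_def Orth_def)
  define A :: "'n cmat" where "A = ofJ M"
  have M: "M \<in> carrier_mat CARD('n) CARD('n)" using Q by simp
  have A: "toJ A = M" unfolding A_def by (rule toJ_ofJ[OF M])
  have "toJ (adj A) = toJ (tr A)" unfolding toJ_adj toJ_tr A Q(1) using Q(2) by (intro eq_matI) auto
  then have adj: "adj A = tr A" by (simp only: toJ_inject)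
  have "toJ (tr A * A) = map_mat complex_of_real (transpose_mat Q * Q)"
    unfolding toJ_mult toJ_tr A Q(1) map_of_real_gram[OF Q(2)] ..
  also have "\<dots> = toJ (1 :: 'n cmat)" unfolding Q(3) toJ_one by (rule of_real_hom.mat_hom_one)
  finally have "tr A * A = 1" by (simp only: toJ_inject)
  moreover have "Determinants.det (mat_of A) = 1"
    unfolding det_toJ[symmetric] A Q(1) by (simp add: of_real_hom.hom_det Q(4))
  ultimately show "M \<in> toJ ` (SOr :: 'n cmat set)" using adj A by (auto simp: SOr_def SO_def intro!: image_eqI[of _ _ A])
qed

section \<open>The compact orbit as a homogeneous space\<close>

lemma compact_SOr: "compact (SOr :: 'n::finite cmat set)"
proof -
  have eq: "SOr = {g :: 'n cmat. tr g * g = 1} \<inter> {g. Determinants.det (mat_of g) = 1} \<inter> {g. adj g * g = 1}"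
    by (auto simp: SOr_def SO_def)
  have "closed {g :: 'n cmat. tr g * g = 1}" "closed {g :: 'n cmat. adj g * g = 1}"
    by (intro closed_Collect_eq continuous_intros)+
  moreover have "closed {g :: 'n cmat. Determinants.det (mat_of g) = 1}"
    by (intro closed_Collect_eq continuous_det_mat_of continuous_on_const)
  ultimately have "closed (SOr :: 'n cmat set)" unfolding eq by (intro closed_Int)
  moreover have "bounded (SOr :: 'n cmat set)"
  proof (rule boundedI[where B = 1])
    fix g :: "'n cmat" assume "g \<in> SOr"
    then have "adj g * g = 1" by (simp add: SOr_def)
    then have iso: "norm (g \<rhd> x) = norm x" for x
    proof -
      have "(g \<rhd> x) \<bullet> (g \<rhd> x) = ((adj g * g) \<rhd> x) \<bullet> x" unfolding inner_adj by simp
      then show ?thesis using \<open>adj g * g = 1\<close> by (simp add: norm_eq_sqrt_inner)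
    qed
    show "norm g \<le> 1" unfolding norm_cmat.rep_eq
      by (rule onorm_le) (use iso in \<open>simp add: app.rep_eq\<close>)
  qed
  ultimately show ?thesis by (simp add: compact_eq_bounded_closed)
qed

lemma continuous_map_toJ: "continuous_map euclidean (mat_topology CARD('n)) (toJ :: 'n::finite cmat \<Rightarrow> complex mat)"
  unfolding mat_topology_def
proof (rule continuous_map_pullback')
  show "topspace euclidean \<subseteq> (toJ :: 'n cmat \<Rightarrow> complex mat) -` carrier_mat CARD('n) CARD('n)" by (auto simp: toJ_carrier)
  have "continuous_map euclidean euclidean (\<lambda>A :: 'n cmat. toJ A $$ (i, j))" if "i < CARD('n)" "j < CARD('n)" for i j
    unfolding toJ_entry[OF that] by (auto intro!: continuous_intros)
  then show "continuous_map euclidean (product_topology (\<lambda>_. euclidean) ({..<CARD('n)} \<times> {..<CARD('n)}))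
      ((\<lambda>A. \<lambda>ij\<in>{..<CARD('n)} \<times> {..<CARD('n)}. A $$ ij) \<circ> (toJ :: 'n cmat \<Rightarrow> complex mat))"
    unfolding continuous_map_componentwise by auto
qed

lemma continuous_map_ofJ: "continuous_map (mat_topology CARD('n)) euclidean (ofJ :: complex mat \<Rightarrow> 'n::finite cmat)"
proof -
  have entry: "continuous_map (mat_topology CARD('n)) euclidean (\<lambda>M. M $$ (i, j))" if ij: "i < CARD('n)" "j < CARD('n)" for i j
  proof -
    let ?I = "{..<CARD('n)} \<times> {..<CARD('n)}"
    have "continuous_map (product_topology (\<lambda>_. euclidean :: complex topology) ?I) euclidean (\<lambda>x. x (i, j))"
      using ij by (intro continuous_map_product_projection) auto
    from continuous_map_pullback[OF this, of "carrier_mat CARD('n) CARD('n)" "\<lambda>A. \<lambda>ij\<in>?I. A $$ ij"]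
    show ?thesis unfolding mat_topology_def using ij by (simp add: o_def)
  qed
  have "continuous_map (mat_topology CARD('n)) euclidean
      (\<lambda>M. Cmat (\<chi> a c. if a = idx i \<and> c = idx j then M $$ (i, j) else 0) :: 'n cmat)" if "i < CARD('n)" "j < CARD('n)" for i j
  proof -
    have "continuous_on UNIV (\<lambda>z. Cmat (\<chi> a c. if a = idx i \<and> c = idx j then z else 0) :: 'n cmat)"
    proof (intro continuous_intros)
      show "continuous_on UNIV (\<lambda>z. if a = idx i \<and> c = idx j then z else (0 :: complex))" for a c :: 'n
        by (cases "a = idx i \<and> c = idx j") auto
    qed
    then have "continuous_map euclidean euclidean (\<lambda>z. Cmat (\<chi> a c. if a = idx i \<and> c = idx j then z else 0) :: 'n cmat)" by simp
    from continuous_map_compose[OF entry[OF that] this] show ?thesis by (simp add: o_def)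
  qed
  then show ?thesis unfolding ofJ_def by (intro continuous_map_sum finite_lessThan) auto
qed

text \<open>The orbit map of a compact group into a Hausdorff space is a quotient map onto its
  image, as is the projection to the cosets. The two have the same fibres, so each factors through
  the other, and the factors are mutually inverse.\<close>

theorem coset_space_homeomorphic_orbit:
  fixes X :: "'n::finite cmat"
  shows "coset_space CARD('n) (SOn CARD('n)) (toJ ` {k \<in> SOr. k * X = X * k})
    homeomorphic_space top_of_set ((\<lambda>g. conj_act g X) ` SOr)"
proof -
  let ?n = "CARD('n)" and ?L = "{k \<in> SOr. k * X = X * k}" and ?orb = "(\<lambda>g. conj_act g X) ` SOr"
  define T where "T = subtopology (mat_topology ?n) (SOn ?n)"
  define p where "p = (\<lambda>M. (\<lambda>k. M * k) ` toJ ` ?L)"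
  define f where "f M = conj_act (ofJ M) X" for M
  have tT: "topspace T = toJ ` (SOr :: 'n cmat set)"
    unfolding T_def toJ_SOr[where 'n = 'n, symmetric] topspace_subtopology topspace_mat_topology by (auto simp: toJ_carrier)
  have p: "quotient_map T (coset_space ?n (SOn ?n) (toJ ` ?L)) p"
    unfolding coset_space_def T_def p_def by (rule quotient_map_quotient_topology)
  have f: "quotient_map T (top_of_set ?orb) f"
  proof (rule continuous_imp_quotient_map)
    have "continuous_on UNIV (\<lambda>g. conj_act g X)" unfolding conj_act_def by (intro continuous_intros)
    then have cc: "continuous_map euclidean euclidean (\<lambda>g. conj_act g X)" by simp
    have "continuous_map T euclidean ((\<lambda>g. conj_act g X) \<circ> ofJ)"
      unfolding T_def by (rule continuous_map_compose[OF continuous_map_from_subtopology[OF continuous_map_ofJ] cc])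
    then have "continuous_map T euclidean f" by (simp only: f_def[abs_def] o_def)
    then show "continuous_map T (top_of_set ?orb) f"
      unfolding continuous_map_in_subtopology tT by (auto simp: f_def ofJ_toJ)
    have "continuous_map (top_of_set (SOr :: 'n cmat set)) T toJ"
      unfolding T_def continuous_map_in_subtopology toJ_SOr[where 'n = 'n, symmetric]
      using continuous_map_from_subtopology[OF continuous_map_toJ] by auto
    moreover have "compactin (top_of_set (SOr :: 'n cmat set)) SOr"
      unfolding compactin_subtopology using compact_SOr by simp
    ultimately have "compactin T (toJ ` (SOr :: 'n cmat set))" by (rule image_compactin[rotated])
    then show "compact_space T" unfolding compact_space_def tT .
    show "Hausdorff_space (top_of_set ?orb)" by (intro Hausdorff_space_subtopology Hausdorff_space_euclidean)
    show "f ` topspace T = topspace (top_of_set ?orb)"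
      unfolding tT by (auto simp: f_def ofJ_toJ image_image)
  qed
  have fibre: "p x = p y \<longleftrightarrow> f x = f y" if xy: "x \<in> topspace T" "y \<in> topspace T" for x y
  proof -
    obtain g h :: "'n cmat" where gh: "g \<in> SOr" "h \<in> SOr" "x = toJ g" "y = toJ h" using xy unfolding tT by auto
    note SO = SOr_D(1)[OF gh(1)] SOr_D(1)[OF gh(2)]
    have pg: "p (toJ z) = toJ ` ((*) z ` ?L)" for z unfolding p_def image_image toJ_mult ..
    have "p x = p y \<longleftrightarrow> (*) g ` ?L = (*) h ` ?L"
      unfolding gh pg by (rule inj_image_eq_iff) (auto simp: inj_def toJ_inject)
    moreover have "f x = f y \<longleftrightarrow> conj_act g X = conj_act h X" by (simp add: f_def gh ofJ_toJ)
    moreover have "(*) g ` ?L = (*) h ` ?L \<longleftrightarrow> conj_act g X = conj_act h X"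
    proof
      assume "(*) g ` ?L = (*) h ` ?L"
      moreover have "1 \<in> ?L" by (simp add: SOr_def SO_one)
      ultimately have "g * 1 \<in> (*) h ` ?L" by blast
      then obtain k where k: "k \<in> ?L" "g = h * k" by auto
      then have kk: "k \<in> SOr" "k * X = X * k" by auto
      have "conj_act k X = X" unfolding conj_act_eq_iff[OF SOr_D(1)[OF kk(1)]] by (rule kk(2))
      then show "conj_act g X = conj_act h X" unfolding k(2) conj_act_mult by simp
    next
      assume eq: "conj_act g X = conj_act h X"
      have sub: "(*) a ` ?L \<subseteq> (*) c ` ?L" if ac: "a \<in> SOr" "c \<in> SOr" "conj_act a X = conj_act c X" for a c
      proof clarify
        fix k assume k: "k \<in> SOr" "k * X = X * k"
        note SO' = SOr_D(1)[OF ac(1)] SOr_D(1)[OF ac(2)] SOr_D(1)[OF k(1)]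
        define k' where "k' = tr c * a * k"
        have kX: "conj_act k X = X" unfolding conj_act_eq_iff[OF SO'(3)] by (rule k(2))
        have k'X: "conj_act k' X = X" by (simp only: k'_def conj_act_mult kX ac(3) conj_act_inverse[OF SO'(2)])
        have k'SO: "k' \<in> SO" unfolding k'_def by (intro SO_mult SO_tr SO')
        have "adj (tr c) = c" unfolding tr_adj[symmetric] SOr_D(2)[OF ac(2)] by simp
        then have "adj k' = tr k'" unfolding k'_def
          by (simp add: SOr_D(2)[OF ac(1)] SOr_D(2)[OF k(1)] mult.assoc)
        then have "k' \<in> SOr" using k'SO by (simp add: SOr_def SO_D)
        moreover have "a * k = c * k'" unfolding k'_def by (simp add: mult.assoc SO_cancel SO')
        moreover have "k' * X = X * k'" using k'X unfolding conj_act_eq_iff[OF k'SO] .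
        ultimately show "a * k \<in> (*) c ` ?L" by (intro image_eqI[of _ _ k']) simp_all
      qed
      show "(*) g ` ?L = (*) h ` ?L" using sub[OF gh(1,2) eq] sub[OF gh(2,1) eq[symmetric]] by blast
    qed
    ultimately show ?thesis by simp
  qed
  have fp: "f x = f y" if "x \<in> topspace T" "y \<in> topspace T" "p x = p y" for x y
    using fibre[OF that(1,2)] that(3) by simp
  have pf: "p x = p y" if "x \<in> topspace T" "y \<in> topspace T" "f x = f y" for x y
    using fibre[OF that(1,2)] that(3) by simp
  obtain u where u: "continuous_map (coset_space ?n (SOn ?n) (toJ ` ?L)) (top_of_set ?orb) u"
      "u ` topspace (coset_space ?n (SOn ?n) (toJ ` ?L)) = f ` topspace T" "\<And>x. x \<in> topspace T \<Longrightarrow> u (p x) = f x"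
    by (rule quotient_map_lift_exists[OF p quotient_imp_continuous_map[OF f] fp]) (assumption+, rule that)
  obtain w where w: "continuous_map (top_of_set ?orb) (coset_space ?n (SOn ?n) (toJ ` ?L)) w"
      "w ` topspace (top_of_set ?orb) = p ` topspace T" "\<And>x. x \<in> topspace T \<Longrightarrow> w (f x) = p x"
    by (rule quotient_map_lift_exists[OF f quotient_imp_continuous_map[OF p] pf]) (assumption+, rule that)
  have wu: "w (u z) = z" if "z \<in> topspace (coset_space ?n (SOn ?n) (toJ ` ?L))" for z
  proof -
    have "z \<in> p ` topspace T" using that unfolding quotient_imp_surjective_map[OF p] .
    then obtain x where "z = p x" "x \<in> topspace T" by (rule imageE)
    then show ?thesis by (simp only: u(3) w(3))
  qed
  have uw: "u (w z) = z" if "z \<in> topspace (top_of_set ?orb)" for z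
  proof -
    have "z \<in> f ` topspace T" using that unfolding quotient_imp_surjective_map[OF f] .
    then obtain x where "z = f x" "x \<in> topspace T" by (rule imageE)
    then show ?thesis by (simp only: u(3) w(3))
  qed
  show ?thesis unfolding homeomorphic_space_def homeomorphic_maps_def
    by (intro exI[of _ u] exI[of _ w] conjI ballI u(1) w(1) wu uw)
qed

section \<open>Transport of the adjoint orbit to orthonormal coordinates\<close>

lemma SO_C_SO: "g \<in> SO_C \<longleftrightarrow> Cmat g \<in> SO"
proof -
  have "tr (Cmat g) * Cmat g = Cmat (Finite_Cartesian_Product.transpose g ** g)"
    by (simp add: tr_def times_cmat_def Cmat_inverse map_fun_def)
  moreover have "Cmat A = 1 \<longleftrightarrow> A = Finite_Cartesian_Product.mat 1" for A :: "complex^'n^'n"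
    by (simp add: one_cmat_def Cmat_inject)
  ultimately show ?thesis by (auto simp: SO_C_def SO_def Cmat_inverse)
qed

lemma Cmat_mult: "Cmat (A ** B) = Cmat A * Cmat B"
  by (simp add: times_cmat_def Cmat_inverse map_fun_def)

lemma Cmat_Ad: assumes "g \<in> SO_C" shows "Cmat (Ad g A) = conj_act (Cmat g) (Cmat A)"
proof -
  let ?t = "Finite_Cartesian_Product.transpose g"
  have 1: "?t ** g = Finite_Cartesian_Product.mat 1" using assms by (simp add: SO_C_def)
  then have 2: "g ** ?t = Finite_Cartesian_Product.mat 1" by (simp only: matrix_left_right_inverse)
  have "matrix_inv g = ?t"
    unfolding matrix_inv_def
  proof (rule some_equality)
    fix y assume y: "g ** y = Finite_Cartesian_Product.mat 1 \<and> y ** g = Finite_Cartesian_Product.mat 1"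
    have "y = (y ** g) ** ?t" by (simp only: matrix_mul_assoc[symmetric] 2 matrix_mul_rid)
    then show "y = ?t" using y by simp
  qed (use 1 2 in simp)
  then show ?thesis by (simp add: Ad_def Cmat_mult conj_act_def tr_def Cmat_inverse map_fun_def)
qed

text \<open>B is only orthogonal, because the ordered basis H may have determinant -1; conjugation
  by B preserves \<open>SO\<close> all the same.\<close>

lemma adjoint_orbit_homeomorphic:
  fixes X :: "complex^'n^'n" and B :: "'n::finite cmat"
  assumes B: "tr B * B = 1"
  shows "top_of_set (adjoint_orbit X) homeomorphic_space
    top_of_set ((\<lambda>g. conj_act g (tr B * Cmat X * B)) ` SO)"
proof -
  let ?X = "tr B * Cmat X * B"
  have B': "B * tr B = 1" using B cmat_left_inverse by auto
  note c = mult_assoc_rule[OF B] mult_assoc_rule[OF B']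
  have d: "Determinants.det (mat_of (tr B)) * Determinants.det (mat_of B) = 1"
    using B by (simp only: det_mat_of_mult[symmetric] det_mat_of_one)
  have SO: "tr B * g * B \<in> SO" "B * g * tr B \<in> SO" if "g \<in> SO" for g :: "'n cmat"
  proof -
    note gc = SO_D(1)[OF that] SO_cancel(1)[OF that]
    have "Determinants.det (mat_of g) = 1" using that by (simp add: SO_def)
    then have "Determinants.det (mat_of (tr B * g * B)) = 1" "Determinants.det (mat_of (B * g * tr B)) = 1"
      using d by (simp_all add: det_mat_of_mult mult.commute)
    then show "tr B * g * B \<in> SO" "B * g * tr B \<in> SO" unfolding SO_def by (simp_all add: mult.assoc c B B' gc)
  qed
  define F where "F A = tr B * Cmat A * B" for A
  define G where "G Z = mat_of (B * Z * tr B)" for Z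
  have FG: "F (G Z) = Z" for Z by (simp add: F_def G_def mat_of_inverse mult.assoc c B B')
  have GF: "G (F A) = A" for A by (simp add: F_def G_def mult.assoc c B B' Cmat_inverse)
  have orb: "F (Ad g X) = conj_act (tr B * Cmat g * B) ?X" if "g \<in> SO_C" for g
    unfolding F_def Cmat_Ad[OF that] by (simp add: conj_act_def mult.assoc c B B')
  have F_im: "F ` adjoint_orbit X \<subseteq> (\<lambda>g. conj_act g ?X) ` SO"
    unfolding adjoint_orbit_def using orb SO(1) by (auto simp: SO_C_SO)
  have G_im: "G ` (\<lambda>g. conj_act g ?X) ` SO \<subseteq> adjoint_orbit X"
  proof clarify
    fix g :: "'n cmat" assume g: "g \<in> SO"
    let ?h = "mat_of (B * g * tr B)"
    have h: "?h \<in> SO_C" using SO(2)[OF g] by (simp add: SO_C_SO mat_of_inverse)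
    have "tr B * Cmat ?h * B = g" by (simp add: mat_of_inverse mult.assoc c B B')
    then have "G (conj_act g ?X) = G (F (Ad ?h X))" using orb[OF h] by simp
    then show "G (conj_act g ?X) \<in> adjoint_orbit X" unfolding GF adjoint_orbit_def using h by auto
  qed
  have cF: "continuous_on UNIV F" unfolding F_def by (intro continuous_intros)
  have cG: "continuous_on UNIV G" unfolding G_def by (intro continuous_intros)
  have "homeomorphic_maps (top_of_set (adjoint_orbit X)) (top_of_set ((\<lambda>g. conj_act g ?X) ` SO)) F G"
    unfolding homeomorphic_maps_def continuous_map_in_subtopology
    using F_im G_im FG GF continuous_on_subset[OF cF] continuous_on_subset[OF cG] by auto
  then show ?thesis unfolding homeomorphic_space_def by blast
qed

section \<open>Matrices with respect to the blocks of \<open>\<H>\<close>\<close>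

lemma distinct_concat_mapD:
  "\<lbrakk>distinct (concat (map f xs)); x \<in> set xs; y \<in> set xs; x \<noteq> y\<rbrakk> \<Longrightarrow> set (f x) \<inter> set (f y) = {}"
  by (induction xs) auto

text \<open>Multiplying x by z and its conjugate y by the conjugate of z is, on the real vectors x +
  y and i (x - y), the 2 by 2 pattern of \<open>wp_C\<close>. The last two identities go back from
  the real vectors to x and y.\<close>

lemma smult_PN:
  fixes x y p q :: "complex^'n"
  shows "z *s x + cnj z *s y = Re z *\<^sub>R (x + y) + Im z *\<^sub>R (\<i> *s (x - y))"
    "\<i> *s (z *s x - cnj z *s y) = Re z *\<^sub>R (\<i> *s (x - y)) - Im z *\<^sub>R (x + y)"
    "(1 / 2) *s (Re z *\<^sub>R p + Im z *\<^sub>R q) + (- \<i> / 2) *s (Re z *\<^sub>R q - Im z *\<^sub>R p) = z *s ((1 / 2) *s p + (- \<i> / 2) *s q)"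
    "(1 / 2) *s (Re z *\<^sub>R p + Im z *\<^sub>R q) + (\<i> / 2) *s (Re z *\<^sub>R q - Im z *\<^sub>R p) = cnj z *s ((1 / 2) *s p + (\<i> / 2) *s q)"
  unfolding scaleR_eq_smult by (simp_all add: Finite_Cartesian_Product.vec_eq_iff complex_eq_iff field_simps)

lemma mv_smult: "A *v (c *s x) = c *s (A *v x)" for A :: "complex^'n^'m"
  by (rule vector_scalar_commute)

lemma map_diag_block_mat: "map_mat complex_of_real (diag_block_mat Ms) = diag_block_mat (map (map_mat complex_of_real) Ms)"
proof (induction Ms)
  case (Cons M Ms)
  have 1: "map_mat complex_of_real (four_block_mat A B C D) =
      four_block_mat (map_mat complex_of_real A) (map_mat complex_of_real B) (map_mat complex_of_real C) (map_mat complex_of_real D)"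
    if "dim_row B = dim_row A" "dim_col B = dim_col D" "dim_row C = dim_row D" "dim_col C = dim_col A" for A B C D
    by (rule eq_matI) (use that in auto)
  show ?case unfolding diag_block_mat.simps Let_def list.map Cons.IH[symmetric] by (subst 1) auto
qed auto

lemma orthonormal_expand:
  assumes bs: "bil_orthonormal bs" "x \<in> vec.span (set bs)"
  shows "x = (\<Sum>i<length bs. bil (bs ! i) x *s bs ! i)"
proof -
  have "x = (\<Sum>y\<in>set bs. vec.representation (set bs) x y *s y)"
    by (rule vec.sum_representation_eq[OF orthonormal_independent[OF bs(1)] bs(2), symmetric]) auto
  also have "\<dots> = (\<Sum>i<length bs. vec.representation (set bs) x (bs ! i) *s bs ! i)"
    by (rule sum.reindex_bij_betw[symmetric]) (rule bij_betw_nth[OF orthonormal_distinct[OF bs(1)]], auto)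
  also have "\<dots> = (\<Sum>i<length bs. bil (bs ! i) x *s bs ! i)"
    by (intro sum.cong refl) (simp add: orthonormal_representation[OF bs])
  finally show ?thesis .
qed

lemma orthonormal_nth: "bil_orthonormal bs \<Longrightarrow> i < length bs \<Longrightarrow> j < length bs \<Longrightarrow> bil (bs ! i) (bs ! j) = (if i = j then 1 else 0)"
  by (simp add: bil_orthonormal_def)

lemma bil_orthonormal_comb:
  assumes "bil_orthonormal bs" "i < length bs"
  shows "bil (bs ! i) (\<Sum>k<length bs. c k *\<^sub>R bs ! k) = complex_of_real (c i)"
proof -
  have "bil (bs ! i) (\<Sum>k<length bs. c k *\<^sub>R bs ! k) = (\<Sum>k<length bs. if k = i then complex_of_real (c i) else 0)"
    unfolding bil_sum bil_linear by (intro sum.cong refl) (use orthonormal_nth[OF assms] in auto)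
  then show ?thesis using assms(2) by simp
qed

lemma matrix_wrt_iff:
  assumes bs: "bil_orthonormal bs" and M: "M \<in> carrier_mat (length bs) (length bs)"
  shows "(\<forall>j<length bs. T (bs ! j) = (\<Sum>i<length bs. M $$ (i, j) *\<^sub>R bs ! i)) \<longleftrightarrow>
    (\<forall>j<length bs. T (bs ! j) \<in> vec.span (set bs)) \<and> matrix_wrt bs T = map_mat complex_of_real M"
    (is "?L \<longleftrightarrow> ?R")
proof
  assume L: ?L
  have sp: "T (bs ! j) \<in> vec.span (set bs)" if j: "j < length bs" for j
  proof -
    have e: "T (bs ! j) = (\<Sum>i<length bs. M $$ (i, j) *\<^sub>R bs ! i)" using L j by blast
    show ?thesis unfolding e scaleR_eq_smult by (intro vec.span_sum vec.span_scale vec.span_base nth_mem) simp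
  qed
  have mw: "matrix_wrt bs T = Matrix.mat (length bs) (length bs) (\<lambda>(i, j). bil (bs ! i) (T (bs ! j)))"
    by (rule matrix_wrt_orthonormal[where bs = bs and T = T, OF bs]) (rule sp)
  have "matrix_wrt bs T = map_mat complex_of_real M"
    unfolding mw
  proof (rule eq_matI)
    fix i j assume "i < dim_row (map_mat complex_of_real M)" "j < dim_col (map_mat complex_of_real M)"
    then have ij: "i < length bs" "j < length bs" using M by auto
    have e: "T (bs ! j) = (\<Sum>i<length bs. M $$ (i, j) *\<^sub>R bs ! i)" using L ij(2) by blast
    have "bil (bs ! i) (T (bs ! j)) = complex_of_real (M $$ (i, j))" unfolding e by (rule bil_orthonormal_comb[OF bs ij(1)])
    then show "Matrix.mat (length bs) (length bs) (\<lambda>(i, j). bil (bs ! i) (T (bs ! j))) $$ (i, j) = map_mat complex_of_real M $$ (i, j)"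
      using M ij by simp
  qed (use M in auto)
  then show ?R using sp by blast
next
  assume R: ?R
  have mw: "matrix_wrt bs T = Matrix.mat (length bs) (length bs) (\<lambda>(i, j). bil (bs ! i) (T (bs ! j)))"
    by (rule matrix_wrt_orthonormal[where bs = bs and T = T, OF bs]) (use R in blast)
  have R2: "matrix_wrt bs T = map_mat complex_of_real M" using R by blast
  have e: "map_mat complex_of_real M = Matrix.mat (length bs) (length bs) (\<lambda>(i, j). bil (bs ! i) (T (bs ! j)))"
    by (rule trans[OF R2[symmetric] mw])
  show ?L
  proof (intro allI impI)
    fix j assume j: "j < length bs"
    have c: "bil (bs ! i) (T (bs ! j)) = complex_of_real (M $$ (i, j))" if "i < length bs" for i
      using arg_cong[OF e, of "\<lambda>N. N $$ (i, j)"] M that j by simp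
    have "T (bs ! j) \<in> vec.span (set bs)" using R j by blast
    then have "T (bs ! j) = (\<Sum>i<length bs. bil (bs ! i) (T (bs ! j)) *s bs ! i)" by (rule orthonormal_expand[OF bs])
    also have "\<dots> = (\<Sum>i<length bs. M $$ (i, j) *\<^sub>R bs ! i)"
      unfolding scaleR_eq_smult by (intro sum.cong refl) (simp only: c lessThan_iff)
    finally show "T (bs ! j) = (\<Sum>i<length bs. M $$ (i, j) *\<^sub>R bs ! i)" .
  qed
qed

lemma image_span_subset_iff:
  fixes g :: "complex^'n^'n"
  shows "(*v) g ` vec.span (set bs) \<subseteq> vec.span (set bs) \<longleftrightarrow> (\<forall>j<length bs. g *v (bs ! j) \<in> vec.span (set bs))"
proof
  assume sub: "(*v) g ` vec.span (set bs) \<subseteq> vec.span (set bs)"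
  show "\<forall>j<length bs. g *v (bs ! j) \<in> vec.span (set bs)"
    using sub vec.span_base[OF nth_mem, of _ bs] by blast
next
  assume *: "\<forall>j<length bs. g *v (bs ! j) \<in> vec.span (set bs)"
  have "vec.subspace {x. g *v x \<in> vec.span (set bs)}"
    unfolding vec.subspace_def by (auto simp: mv_linear mv_smult intro: vec.span_add vec.span_scale vec.span_zero)
  moreover have "set bs \<subseteq> {x. g *v x \<in> vec.span (set bs)}" using * by (auto simp: in_set_conv_nth)
  ultimately have "vec.span (set bs) \<subseteq> {x. g *v x \<in> vec.span (set bs)}" by (intro vec.span_minimal)
  then show "(*v) g ` vec.span (set bs) \<subseteq> vec.span (set bs)" by auto
qed

lemma sum_Suc_shift: "(\<Sum>i\<in>{1..n}. f i) = (\<Sum>i<n. f (Suc i))" for f :: "nat \<Rightarrow> 'a::comm_monoid_add"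
  using sum.atLeast1_atMost_eq[of f n] by simp

context adapted
begin

lemma H_ext:
  assumes "\<And>p a. p \<in> set blocks \<Longrightarrow> a \<in> set (blk p) \<Longrightarrow> bil a x = bil a y" shows "x = y"
proof -
  have "set (H_basis X H Y v) \<subseteq> {a. bil a (x - y) = 0}"
    using assms unfolding H_basis_blocks by (auto simp: bil_linear)
  moreover have "vec.subspace {a. bil a (x - y) = 0}" by (auto simp: vec.subspace_def bil_linear)
  ultimately have "vec.span (set (H_basis X H Y v)) \<subseteq> {a. bil a (x - y) = 0}" by (rule vec.span_minimal)
  then have "bil (x - y) z = 0" for z unfolding span_H_basis using bil_commute[of "x - y" z] by auto
  then have "x - y = 0" by (rule bil_eq_0)
  then show ?thesis by simp
qed

lemma cross_orth:
  assumes "p \<in> set blocks" "q \<in> set blocks" "p \<noteq> q" "a \<in> set (blk p)" "c \<in> set (blk q)" shows "bil a c = 0"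
proof -
  obtain x y where xy: "a = Wv x" "x \<in> set (blkc p)" "c = Wv y" "y \<in> set (blkc q)"
    using assms(4,5) unfolding blk_code[OF assms(1)] blk_code[OF assms(2)] by auto
  have "x \<noteq> y" using distinct_concat_mapD[OF distinct_HC[unfolded HC_def] assms(1-3)] xy by auto
  then show ?thesis using Wv_orth[of x y] xy set_blkc(1)[OF assms(1)] set_blkc(1)[OF assms(2)] by auto
qed

section \<open>Endomorphisms in block form\<close>

definition BF :: "complex^'n^'n \<Rightarrow> (nat \<times> nat \<Rightarrow> real mat) \<Rightarrow> bool" where
  "BF g F \<longleftrightarrow> (\<forall>p\<in>set blocks. \<forall>j<length (blk p). g *v (blk p ! j) = (\<Sum>i<length (blk p). F p $$ (i, j) *\<^sub>R (blk p ! i)))"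

lemma Lambda_mform: "Lambda_H X H Y v g = mform (H_basis X H Y v) (H_basis X H Y v) ((*v) g)"
  unfolding Lambda_H_def mform_def by (rule matrix_wrt_orthonormal[OF H_basis_orthonormal]) (simp add: span_H_basis)

lemma Lambda_iff:
  assumes F: "\<And>p. p \<in> set blocks \<Longrightarrow> F p \<in> carrier_mat (length (blk p)) (length (blk p))"
  shows "Lambda_H X H Y v g = map_mat complex_of_real (diag_block_mat (map F blocks)) \<longleftrightarrow> BF g F"
proof -
  have "Lambda_H X H Y v g = map_mat complex_of_real (diag_block_mat (map F blocks)) \<longleftrightarrow>
    (\<forall>p\<in>set blocks. mform (blk p) (blk p) ((*v) g) = map_mat complex_of_real (F p)) \<and>
    (\<forall>p\<in>set blocks. \<forall>q\<in>set blocks. p \<noteq> q \<longrightarrow> (\<forall>a\<in>set (blk p). \<forall>c\<in>set (blk q). bil a (g *v c) = 0))"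
    (is "_ \<longleftrightarrow> ?A \<and> ?B")
    unfolding Lambda_mform H_basis_blocks map_diag_block_mat map_map o_def
    by (rule mform_concat_iff[OF distinct_blocks]) (use F in auto)
  also have "?A \<and> ?B \<longleftrightarrow> BF g F"
  proof
    assume AB: "?A \<and> ?B"
    show "BF g F" unfolding BF_def
    proof (intro ballI allI impI)
      fix p j assume p: "p \<in> set blocks" and j: "j < length (blk p)"
      let ?y = "\<Sum>i<length (blk p). F p $$ (i, j) *\<^sub>R (blk p ! i)"
      show "g *v (blk p ! j) = ?y"
      proof (rule H_ext)
        fix q a assume q: "q \<in> set blocks" "a \<in> set (blk q)"
        show "bil a (g *v (blk p ! j)) = bil a ?y"
        proof (cases "q = p")
          case True
          then obtain k where k: "k < length (blk p)" "a = blk p ! k" using q by (auto simp: in_set_conv_nth)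
          have e: "mform (blk p) (blk p) ((*v) g) = map_mat complex_of_real (F p)" using AB p by blast
          show ?thesis unfolding k(2) bil_orthonormal_comb[OF blk_orthonormal[OF p] k(1)]
            using arg_cong[OF e, of "\<lambda>N. N $$ (k, j)"] F[OF p] k(1) j by (simp add: mform_def)
        next
          case False
          have "bil a ?y = 0" unfolding bil_sum bil_linear
            by (rule sum.neutral) (use cross_orth[OF q(1) p False q(2)] in auto)
          moreover have "bil a (g *v (blk p ! j)) = 0" using AB q p False j by auto
          ultimately show ?thesis by simp
        qed
      qed
    qed
  next
    assume BF: "BF g F"
    have A: ?A
    proof
      fix p assume p: "p \<in> set blocks"
      show "mform (blk p) (blk p) ((*v) g) = map_mat complex_of_real (F p)"
        unfolding mform_def
      proof (rule eq_matI)
        fix i j assume "i < dim_row (map_mat complex_of_real (F p))" "j < dim_col (map_mat complex_of_real (F p))"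
        then have ij: "i < length (blk p)" "j < length (blk p)" using F[OF p] by auto
        have e: "g *v (blk p ! j) = (\<Sum>k<length (blk p). F p $$ (k, j) *\<^sub>R (blk p ! k))" using BF p ij by (simp add: BF_def)
        show "Matrix.mat (length (blk p)) (length (blk p)) (\<lambda>(i, j). bil (blk p ! i) (g *v blk p ! j)) $$ (i, j) = map_mat complex_of_real (F p) $$ (i, j)"
          using ij F[OF p] by (simp add: e bil_orthonormal_comb[OF blk_orthonormal[OF p] ij(1)])
      qed (use F[OF p] in auto)
    qed
    have B: ?B
    proof (intro ballI impI)
      fix p q a c assume *: "p \<in> set blocks" "q \<in> set blocks" "p \<noteq> q" "a \<in> set (blk p)" "c \<in> set (blk q)"
      obtain j where j: "j < length (blk q)" "c = blk q ! j" using *(5) by (auto simp: in_set_conv_nth)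
      have e: "g *v c = (\<Sum>k<length (blk q). F q $$ (k, j) *\<^sub>R (blk q ! k))" using BF *(2) j by (simp add: BF_def)
      show "bil a (g *v c) = 0" unfolding e bil_sum bil_linear
        by (rule sum.neutral) (use cross_orth[OF *(1-4)] in auto)
    qed
    show "?A \<and> ?B" using A B by blast
  qed
  finally show ?thesis .
qed

section \<open>From blocks of H to the action on strings\<close>

definition bm :: "(nat \<Rightarrow> quat mat) \<Rightarrow> (nat \<Rightarrow> real mat) \<Rightarrow> nat \<times> nat \<Rightarrow> real mat" where
  "bm A C = (\<lambda>(d, l). if even d then wp_C (wp_H (A d)) else C d)"

text \<open>The complex matrix by which the tuple acts on the strings of length d. The shift by one
  reconciles the numbering of the vectors from 1 with matrix indices from 0.\<close>

definition Gm :: "(nat \<Rightarrow> quat mat) \<Rightarrow> (nat \<Rightarrow> real mat) \<Rightarrow> nat \<Rightarrow> nat \<Rightarrow> nat \<Rightarrow> complex" where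
  "Gm A C d i j = (if even d then wp_H (A d) $$ (i - 1, j - 1) else complex_of_real (C d $$ (i - 1, j - 1)))"

definition dims :: "(nat \<Rightarrow> quat mat) \<Rightarrow> (nat \<Rightarrow> real mat) \<Rightarrow> bool" where
  "dims A C \<longleftrightarrow> (\<forall>d\<in>D. if even d then A d \<in> carrier_mat (t d div 2) (t d div 2) else C d \<in> carrier_mat (t d) (t d))"

text \<open>Multiplication by the complex matrix \<open>G d\<close>, written on the real vectors of
  the lower half levels: the link between the blocks of H and \<open>acts\<close>.\<close>

definition PNf :: "complex^'n^'n \<Rightarrow> (nat \<Rightarrow> nat \<Rightarrow> nat \<Rightarrow> complex) \<Rightarrow> bool" where
  "PNf g G \<longleftrightarrow> (\<forall>d\<in>D. \<forall>j\<in>{1..t d}. \<forall>l. 2 * l \<le> d - 1 \<longrightarrow>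
    g *v Pv d j l = (\<Sum>i\<in>{1..t d}. Re (G d i j) *\<^sub>R Pv d i l + Im (G d i j) *\<^sub>R Nv d i l) \<and>
    g *v Nv d j l = (\<Sum>i\<in>{1..t d}. Re (G d i j) *\<^sub>R Nv d i l - Im (G d i j) *\<^sub>R Pv d i l))"

text \<open>The matrix is the same on all levels; this expresses that g commutes with X, H and Y
  (\<open>acts_commute\<close>).\<close>

definition acts :: "complex^'n^'n \<Rightarrow> (nat \<Rightarrow> nat \<Rightarrow> nat \<Rightarrow> complex) \<Rightarrow> bool" where
  "acts g G \<longleftrightarrow> (\<forall>d\<in>D. \<forall>j\<in>{1..t d}. \<forall>l<d. g *v b d j l = (\<Sum>i\<in>{1..t d}. G d i j *s b d i l))"

text \<open>Compatibility of the matrices with the real structure. For odd d it says that the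
  entries are real, for even d that the matrix commutes with the quaternionic structure given by
  \<open>st\<close> and \<open>sg\<close>.\<close>

definition realG :: "(nat \<Rightarrow> nat \<Rightarrow> nat \<Rightarrow> complex) \<Rightarrow> bool" where
  "realG G \<longleftrightarrow> (\<forall>d\<in>D. \<forall>i\<in>{1..t d}. \<forall>j\<in>{1..t d}. G d (st d i) (st d j) = complex_of_real (sg d i * sg d j) * cnj (G d i j))"

lemma sum_st: assumes "d \<in> D" shows "(\<Sum>i\<in>{1..t d}. f (st d i)) = (\<Sum>i\<in>{1..t d}. f i)"
  using st_in[OF assms] by (intro sum.reindex_bij_witness[of _ "st d" "st d"]) auto

lemma acts_PNf: assumes r: "realG G" and g: "acts g G" shows "PNf g G"
  unfolding PNf_def
proof (intro ballI allI impI)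
  fix d j l assume d: "d \<in> D" "j \<in> {1..t d}" "2 * l \<le> d - 1"
  then have l: "l < d" "d - 1 - l < d" using D_pos(1)[OF d(1)] by auto
  have gb: "g *v b d j l = (\<Sum>i\<in>{1..t d}. G d i j *s b d i l)" using g d l by (simp add: acts_def)
  have gs: "g *v sb d j l = (\<Sum>i\<in>{1..t d}. cnj (G d i j) *s sb d i l)"
  proof -
    have "g *v b d (st d j) (d - 1 - l) = (\<Sum>i\<in>{1..t d}. G d i (st d j) *s b d i (d - 1 - l))"
      using g d(1) st_in(1)[OF d(1,2)] l unfolding acts_def by blast
    also have "\<dots> = (\<Sum>i\<in>{1..t d}. G d (st d i) (st d j) *s b d (st d i) (d - 1 - l))" by (rule sum_st[OF d(1), symmetric])
    finally have "g *v sb d j l = (\<Sum>i\<in>{1..t d}. ((-1) ^ l * sg d j) *\<^sub>R (G d (st d i) (st d j) *s b d (st d i) (d - 1 - l)))"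
      unfolding sb_def mv_scaleR by (simp only: scaleR_sum_right)
    also have "\<dots> = (\<Sum>i\<in>{1..t d}. cnj (G d i j) *s sb d i l)"
    proof (intro sum.cong refl)
      fix i assume i: "i \<in> {1..t d}"
      have G: "G d (st d i) (st d j) = complex_of_real (sg d i * sg d j) * cnj (G d i j)" using r d i by (simp add: realG_def)
      have s: "(-1) ^ l * sg d j * (sg d i * sg d j) = (-1) ^ l * sg d i" using sg_sq[of d j] by simp
      have "((-1) ^ l * sg d j) *\<^sub>R (G d (st d i) (st d j) *s b d (st d i) (d - 1 - l))
        = complex_of_real ((-1) ^ l * sg d j * (sg d i * sg d j)) *s (cnj (G d i j) *s b d (st d i) (d - 1 - l))"
        unfolding G scaleR_eq_smult vec.scale_scale by (simp only: of_real_mult mult.assoc)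
      also have "\<dots> = cnj (G d i j) *s sb d i l"
        unfolding s sb_def scaleR_eq_smult vec.scale_scale by (simp only: mult.commute)
      finally show "((-1) ^ l * sg d j) *\<^sub>R (G d (st d i) (st d j) *s b d (st d i) (d - 1 - l)) = cnj (G d i j) *s sb d i l" .
    qed
    finally show ?thesis .
  qed
  have "g *v Pv d j l = (\<Sum>i\<in>{1..t d}. G d i j *s b d i l + cnj (G d i j) *s sb d i l)"
    unfolding Pv_def mv_linear gb gs by (simp only: sum.distrib)
  moreover have "g *v Nv d j l = (\<Sum>i\<in>{1..t d}. \<i> *s (G d i j *s b d i l - cnj (G d i j) *s sb d i l))"
    unfolding Nv_def mv_smult mv_linear gb gs by (simp only: sum_subtractf[symmetric] vec.scale_sum_right)
  ultimately show "g *v Pv d j l = (\<Sum>i\<in>{1..t d}. Re (G d i j) *\<^sub>R Pv d i l + Im (G d i j) *\<^sub>R Nv d i l) \<and>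
      g *v Nv d j l = (\<Sum>i\<in>{1..t d}. Re (G d i j) *\<^sub>R Nv d i l - Im (G d i j) *\<^sub>R Pv d i l)"
    unfolding smult_PN(1,2) Pv_def Nv_def by blast
qed

text \<open>The real vectors give b and sb on the lower half levels; the upper half levels are
  conjugates of lower ones, and there \<open>realG\<close> turns the conjugate matrix back into
  \<open>G d\<close>.\<close>

lemma PNf_acts: assumes r: "realG G" and g: "PNf g G" shows "acts g G"
  unfolding acts_def
proof (intro ballI allI impI)
  fix d j l assume d: "d \<in> D" "j \<in> {1..t d}" "l < d"
  have low: "g *v b d j l = (\<Sum>i\<in>{1..t d}. G d i j *s b d i l)" "g *v sb d j l = (\<Sum>i\<in>{1..t d}. cnj (G d i j) *s sb d i l)"
    if j: "j \<in> {1..t d}" and l: "2 * l \<le> d - 1" for j l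
  proof -
    have PN: "g *v Pv d j l = (\<Sum>i\<in>{1..t d}. Re (G d i j) *\<^sub>R Pv d i l + Im (G d i j) *\<^sub>R Nv d i l)"
      "g *v Nv d j l = (\<Sum>i\<in>{1..t d}. Re (G d i j) *\<^sub>R Nv d i l - Im (G d i j) *\<^sub>R Pv d i l)"
      using g d(1) j l unfolding PNf_def by blast+
    have e: "g *v b d j l = (1 / 2) *s (g *v Pv d j l) + (- \<i> / 2) *s (g *v Nv d j l)"
      "g *v sb d j l = (1 / 2) *s (g *v Pv d j l) + (\<i> / 2) *s (g *v Nv d j l)"
      unfolding b_PN mv_linear mv_smult by (rule refl)+
    show "g *v b d j l = (\<Sum>i\<in>{1..t d}. G d i j *s b d i l)"
      unfolding e PN vec.scale_sum_right sum.distrib[symmetric] smult_PN(3) b_PN(1)[symmetric] ..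
    show "g *v sb d j l = (\<Sum>i\<in>{1..t d}. cnj (G d i j) *s sb d i l)"
      unfolding e PN vec.scale_sum_right sum.distrib[symmetric] smult_PN(4) b_PN(2)[symmetric] ..
  qed
  show "g *v b d j l = (\<Sum>i\<in>{1..t d}. G d i j *s b d i l)"
  proof (cases "2 * l \<le> d - 1")
    case True
    then show ?thesis using low(1) d(2) by blast
  next
    case False
    define k where "k = d - 1 - l"
    have k: "2 * k \<le> d - 1" using False by (simp add: k_def)
    have "g *v b d j l = ((-1) ^ k * sg d (st d j)) *\<^sub>R (\<Sum>i\<in>{1..t d}. cnj (G d i (st d j)) *s sb d i k)"
      unfolding b_high[OF d] k_def[symmetric] mv_scaleR low(2)[OF st_in(1)[OF d(1,2)] k] ..
    also have "\<dots> = (\<Sum>i\<in>{1..t d}. ((-1) ^ k * sg d (st d j)) *\<^sub>R (cnj (G d (st d i) (st d j)) *s sb d (st d i) k))"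
      unfolding scaleR_sum_right by (rule sum_st[OF d(1), symmetric])
    also have "\<dots> = (\<Sum>i\<in>{1..t d}. G d i j *s b d i l)"
    proof (intro sum.cong refl)
      fix i assume i: "i \<in> {1..t d}"
      have G: "G d i j = complex_of_real (sg d (st d i) * sg d (st d j)) * cnj (G d (st d i) (st d j))"
        using r d(1) st_in[OF d(1,2)] st_in[OF d(1) i] unfolding realG_def by metis
      have s: "sg d (st d i) * sg d (st d j) * ((-1) ^ k * sg d (st d i)) = (-1) ^ k * sg d (st d j)" using sg_sq[of d "st d i"] by simp
      have "G d i j *s b d i l = complex_of_real (sg d (st d i) * sg d (st d j) * ((-1) ^ k * sg d (st d i))) *s
          (cnj (G d (st d i) (st d j)) *s sb d (st d i) k)"
        unfolding b_high[OF d(1) i d(3)] k_def[symmetric] G scaleR_eq_smult vec.scale_scale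
        by (simp only: of_real_mult mult.assoc mult.commute mult.left_commute)
      then show "((-1) ^ k * sg d (st d j)) *\<^sub>R (cnj (G d (st d i) (st d j)) *s sb d (st d i) k) = G d i j *s b d i l"
        unfolding s scaleR_eq_smult by simp
    qed
    finally show ?thesis .
  qed
qed

lemma blk_even_nth:
  assumes p: "(d, l) \<in> set blocks" "even d" "j < t d"
  shows "blk (d, l) ! j = cf d l *\<^sub>R Pv d (Suc j) l" "blk (d, l) ! (t d + j) = cf d l *\<^sub>R Nv d (Suc j) l"
proof -
  have "blk (d, l) ! i = Wv (codeE d l (Suc i))" if "i < 2 * t d" for i
    unfolding blk_code[OF p(1)] using that p(2) by (simp add: blkc_def nth_append del: upt_Suc)
  then show "blk (d, l) ! j = cf d l *\<^sub>R Pv d (Suc j) l" "blk (d, l) ! (t d + j) = cf d l *\<^sub>R Nv d (Suc j) l"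
    using p(3) by (simp_all add: Wv_def codeE_def)
qed

lemma blk_odd_nth:
  assumes p: "(d, l) \<in> set blocks" "odd d" "j < t d"
  shows "blk (d, l) ! j = (if l \<le> (d - 1) div 2 then cf d l *\<^sub>R (if even l then Pv d (Suc j) l else Nv d (Suc j) l)
    else cf d (d - 1 - l) *\<^sub>R (if odd l then Pv d (Suc j) (d - 1 - l) else Nv d (Suc j) (d - 1 - l)))"
proof -
  have "blk (d, l) ! j = Wv (codeO d l (Suc j))"
    unfolding blk_code[OF p(1)] using p(2,3) by (simp add: blkc_def nth_append del: upt_Suc)
  then show ?thesis by (simp add: Wv_def codeO_def)
qed

lemma scaled_eq:
  fixes g :: "complex^'n^'n" and I :: "'b set" assumes "c \<noteq> 0"
  shows "g *v (c *\<^sub>R x) = (\<Sum>i\<in>I. a i *\<^sub>R (c *\<^sub>R z i)) \<longleftrightarrow> g *v x = (\<Sum>i\<in>I. a i *\<^sub>R z i)"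
proof -
  have "(\<Sum>i\<in>I. a i *\<^sub>R (c *\<^sub>R z i)) = c *\<^sub>R (\<Sum>i\<in>I. a i *\<^sub>R z i)"
    unfolding scaleR_sum_right by (intro sum.cong refl) simp
  then show ?thesis using assms by (simp add: mv_scaleR)
qed

lemma BF_even:
  assumes p: "(d, l) \<in> set blocks" "even d" and A: "wp_H (A d) \<in> carrier_mat (t d) (t d)"
  shows "(\<forall>j<length (blk (d, l)). g *v (blk (d, l) ! j) = (\<Sum>i<length (blk (d, l)). bm A C (d, l) $$ (i, j) *\<^sub>R (blk (d, l) ! i))) \<longleftrightarrow>
    (\<forall>j\<in>{1..t d}. g *v Pv d j l = (\<Sum>i\<in>{1..t d}. Re (Gm A C d i j) *\<^sub>R Pv d i l + Im (Gm A C d i j) *\<^sub>R Nv d i l) \<and>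
      g *v Nv d j l = (\<Sum>i\<in>{1..t d}. Re (Gm A C d i j) *\<^sub>R Nv d i l - Im (Gm A C d i j) *\<^sub>R Pv d i l))"
proof -
  let ?t = "t d" and ?U = "wp_H (A d)"
  define E where "E j \<longleftrightarrow> g *v (blk (d, l) ! j) = (\<Sum>i<2 * ?t. wp_C ?U $$ (i, j) *\<^sub>R (blk (d, l) ! i))" for j
  note nt = blk_even_nth[OF p] and w = wp_C_entry[OF A]
  have E1: "E j \<longleftrightarrow> g *v Pv d (Suc j) l = (\<Sum>i<?t. Re (?U $$ (i, j)) *\<^sub>R Pv d (Suc i) l + Im (?U $$ (i, j)) *\<^sub>R Nv d (Suc i) l)"
    (is "_ \<longleftrightarrow> ?R") if j: "j < ?t" for j
  proof -
    have "(\<Sum>i<2 * ?t. wp_C ?U $$ (i, j) *\<^sub>R (blk (d, l) ! i)) =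
        cf d l *\<^sub>R (\<Sum>i<?t. Re (?U $$ (i, j)) *\<^sub>R Pv d (Suc i) l + Im (?U $$ (i, j)) *\<^sub>R Nv d (Suc i) l)"
      unfolding sum_double sum.distrib[symmetric] scaleR_sum_right
      by (intro sum.cong refl) (simp add: nt w j scaleR_add_right mult.commute)
    then show ?thesis unfolding E_def nt(1)[OF j] mv_scaleR using cf_nz[of d l] by simp
  qed
  have E2: "E (?t + j) \<longleftrightarrow> g *v Nv d (Suc j) l = (\<Sum>i<?t. Re (?U $$ (i, j)) *\<^sub>R Nv d (Suc i) l - Im (?U $$ (i, j)) *\<^sub>R Pv d (Suc i) l)"
    if j: "j < ?t" for j
  proof -
    have "(\<Sum>i<2 * ?t. wp_C ?U $$ (i, ?t + j) *\<^sub>R (blk (d, l) ! i)) =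
        cf d l *\<^sub>R (\<Sum>i<?t. Re (?U $$ (i, j)) *\<^sub>R Nv d (Suc i) l - Im (?U $$ (i, j)) *\<^sub>R Pv d (Suc i) l)"
      unfolding sum_double sum.distrib[symmetric] scaleR_sum_right
      by (intro sum.cong refl) (simp add: nt w j scaleR_diff_right mult.commute)
    then show ?thesis unfolding E_def nt(2)[OF j] mv_scaleR using cf_nz[of d l] by simp
  qed
  have len: "length (blk (d, l)) = 2 * ?t" using length_blk[OF p(1)] p(2) by simp
  have b: "bm A C (d, l) = wp_C ?U" using p(2) by (simp add: bm_def)
  have "(\<forall>j<length (blk (d, l)). g *v (blk (d, l) ! j) = (\<Sum>i<length (blk (d, l)). bm A C (d, l) $$ (i, j) *\<^sub>R (blk (d, l) ! i)))
    \<longleftrightarrow> (\<forall>j<2 * ?t. E j)" unfolding len b E_def ..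
  also have "\<dots> \<longleftrightarrow> (\<forall>j<?t. E j \<and> E (?t + j))"
  proof
    assume *: "\<forall>j<?t. E j \<and> E (?t + j)"
    show "\<forall>j<2 * ?t. E j"
    proof (intro allI impI)
      fix j assume "j < 2 * ?t"
      then show "E j" by (rule less_double_cases) (use * in auto)
    qed
  qed auto
  also have "\<dots> \<longleftrightarrow> (\<forall>j\<in>{1..?t}. g *v Pv d j l = (\<Sum>i\<in>{1..?t}. Re (Gm A C d i j) *\<^sub>R Pv d i l + Im (Gm A C d i j) *\<^sub>R Nv d i l) \<and>
      g *v Nv d j l = (\<Sum>i\<in>{1..?t}. Re (Gm A C d i j) *\<^sub>R Nv d i l - Im (Gm A C d i j) *\<^sub>R Pv d i l))" (is "_ \<longleftrightarrow> (\<forall>j\<in>_. ?Q j)")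
  proof -
    have "E j \<and> E (?t + j) \<longleftrightarrow> ?Q (Suc j)" if "j < ?t" for j
      unfolding E1[OF that] E2[OF that] sum_Suc_shift Gm_def using p(2) by simp
    moreover have "{1..?t} = Suc ` {..<?t}" by (simp add: image_Suc_lessThan)
    ultimately show ?thesis by auto
  qed
  finally show ?thesis .
qed

lemma BF_odd:
  assumes p: "(d, l) \<in> set blocks" "odd d"
    and c: "(if l \<le> (d - 1) div 2 then (even l, l) else (odd l, d - 1 - l)) = (ty, l')"
  shows "(\<forall>j<length (blk (d, l)). g *v (blk (d, l) ! j) = (\<Sum>i<length (blk (d, l)). bm A C (d, l) $$ (i, j) *\<^sub>R (blk (d, l) ! i))) \<longleftrightarrow>
    (\<forall>j\<in>{1..t d}. g *v (if ty then Pv d j l' else Nv d j l') = (\<Sum>i\<in>{1..t d}. Re (Gm A C d i j) *\<^sub>R (if ty then Pv d i l' else Nv d i l')))"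
proof -
  let ?t = "t d"
  have len: "length (blk (d, l)) = ?t" using length_blk[OF p(1)] p(2) by simp
  have b: "bm A C (d, l) = C d" using p(2) by (simp add: bm_def)
  have nt: "blk (d, l) ! j = cf d l' *\<^sub>R (if ty then Pv d (Suc j) l' else Nv d (Suc j) l')" if "j < ?t" for j
    unfolding blk_odd_nth[OF p that] using c by (auto split: if_splits)
  define Z where "Z j = (if ty then Pv d j l' else Nv d j l')" for j
  have E: "g *v (blk (d, l) ! j) = (\<Sum>i<?t. C d $$ (i, j) *\<^sub>R (blk (d, l) ! i)) \<longleftrightarrow>
      g *v Z (Suc j) = (\<Sum>i\<in>{1..?t}. Re (Gm A C d i (Suc j)) *\<^sub>R Z i)" if "j < ?t" for j
  proof -
    have 1: "(\<Sum>i<?t. C d $$ (i, j) *\<^sub>R (blk (d, l) ! i)) = (\<Sum>i<?t. C d $$ (i, j) *\<^sub>R (cf d l' *\<^sub>R Z (Suc i)))"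
      by (intro sum.cong refl) (simp only: nt lessThan_iff Z_def)
    have 2: "Re (Gm A C d (Suc i) (Suc j)) = C d $$ (i, j)" for i using p(2) by (simp add: Gm_def)
    show ?thesis unfolding 1 nt[OF that] Z_def[symmetric] scaled_eq[OF cf_nz] sum_Suc_shift 2 ..
  qed
  have S: "{1..?t} = Suc ` {..<?t}" by (simp add: image_Suc_lessThan)
  show ?thesis unfolding len b Z_def[symmetric] using E unfolding S by auto
qed

lemma wp_H_dim: assumes "dims A C" "d \<in> D" "even d" shows "wp_H (A d) \<in> carrier_mat (t d) (t d)"
proof -
  have "A d \<in> carrier_mat (t d div 2) (t d div 2)" using assms by (auto simp: dims_def)
  then have "wp_H (A d) \<in> carrier_mat (2 * (t d div 2)) (2 * (t d div 2))" by (rule wp_H_carrier)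
  then show ?thesis using t_even[OF assms(2,3)] by simp
qed

text \<open>For an odd part, \<open>Pv\<close> and \<open>Nv\<close> of one level lie in the two
  different blocks l and d - 1 - l; at the middle level one of them is zero and imposes no
  condition.\<close>

lemma BF_iff_PNf: assumes dm: "dims A C" shows "BF g (bm A C) \<longleftrightarrow> PNf g (Gm A C)"
proof
  assume BF: "BF g (bm A C)"
  show "PNf g (Gm A C)" unfolding PNf_def
  proof (intro ballI allI impI)
    fix d j l assume d: "d \<in> D" "j \<in> {1..t d}" "2 * l \<le> d - 1"
    show "g *v Pv d j l = (\<Sum>i\<in>{1..t d}. Re (Gm A C d i j) *\<^sub>R Pv d i l + Im (Gm A C d i j) *\<^sub>R Nv d i l) \<and>
      g *v Nv d j l = (\<Sum>i\<in>{1..t d}. Re (Gm A C d i j) *\<^sub>R Nv d i l - Im (Gm A C d i j) *\<^sub>R Pv d i l)"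
    proof (cases "even d")
      case True
      then have p: "(d, l) \<in> set blocks" using d D_pos(1)[OF d(1)] by (auto simp: set_blocks)
      show ?thesis using BF p BF_even[where A = A and d = d and l = l and C = C and g = g, OF p True wp_H_dim[where A = A and d = d, OF dm d(1) True]] d(2) unfolding BF_def by blast
    next
      case False
      then obtain k where k: "d = 2 * k + 1" by (rule oddE)
      have lk: "l \<le> k" using d(3) k by simp
      have Z: "g *v (if ty then Pv d j l else Nv d j l) = (\<Sum>i\<in>{1..t d}. Re (Gm A C d i j) *\<^sub>R (if ty then Pv d i l else Nv d i l))" for ty
      proof -
        have odd: "odd d" using False by simp
        consider "ty = even l" | "ty \<noteq> even l" "l < k" | "ty \<noteq> even l" "l = k" using lk by linarith
        then show ?thesis
        proof cases
          case 1
          have p: "(d, l) \<in> set blocks" using d(1) k lk by (auto simp: set_blocks)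
          have c: "(if l \<le> (d - 1) div 2 then (even l, l) else (odd l, d - 1 - l)) = (ty, l)" using 1 k lk by simp
          show ?thesis using BF p BF_odd[OF p odd c, where A = A and C = C and g = g] d(2) unfolding BF_def by blast
        next
          case 2
          have p: "(d, 2 * k - l) \<in> set blocks" using d(1) k by (auto simp: set_blocks)
          have c: "(if 2 * k - l \<le> (d - 1) div 2 then (even (2 * k - l), 2 * k - l) else (odd (2 * k - l), d - 1 - (2 * k - l))) = (ty, l)"
            using 2 k lk by auto
          show ?thesis using BF p BF_odd[OF p odd c, where A = A and C = C and g = g] d(2) unfolding BF_def by blast
        next
          case 3
          have m: "2 * l = d - 1" using 3 k by simp
          have "(if ty then Pv d i l else Nv d i l) = 0" for i using PN_mid[OF odd m, of i] 3(1) by (cases ty) simp_all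
          then show ?thesis by simp
        qed
      qed
      show ?thesis using Z[of True] Z[of False] False by (simp add: Gm_def)
    qed
  qed
next
  assume PN: "PNf g (Gm A C)"
  show "BF g (bm A C)" unfolding BF_def
  proof
    fix p assume p: "p \<in> set blocks"
    obtain d l where dl: "p = (d, l)" by (cases p)
    note p' = p[unfolded dl]
    have d: "d \<in> D" "l < (if even d then d div 2 else d)" using p' by (auto simp: set_blocks)
    show "\<forall>j<length (blk p). g *v (blk p ! j) = (\<Sum>i<length (blk p). bm A C p $$ (i, j) *\<^sub>R (blk p ! i))"
    proof (cases "even d")
      case True
      then have "2 * l \<le> d - 1" using d(2) by simp
      then show ?thesis unfolding dl BF_even[where A = A and d = d and l = l, OF p' True wp_H_dim[where A = A and d = d, OF dm d(1) True]] using PN d(1) unfolding PNf_def by blast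
    next
      case False
      then obtain k where k: "d = 2 * k + 1" by (rule oddE)
      obtain ty l' where c: "(if l \<le> (d - 1) div 2 then (even l, l) else (odd l, d - 1 - l)) = (ty, l')" by fastforce
      have "2 * l' \<le> d - 1" using c k d(2) False by (auto split: if_splits)
      then have PN': "g *v Pv d j l' = (\<Sum>i\<in>{1..t d}. Re (Gm A C d i j) *\<^sub>R Pv d i l' + Im (Gm A C d i j) *\<^sub>R Nv d i l')"
        "g *v Nv d j l' = (\<Sum>i\<in>{1..t d}. Re (Gm A C d i j) *\<^sub>R Nv d i l' - Im (Gm A C d i j) *\<^sub>R Pv d i l')"
        if "j \<in> {1..t d}" for j using PN d(1) that unfolding PNf_def by blast+
      have im: "Im (Gm A C d i j) = 0" for i j using False by (simp add: Gm_def)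
      show ?thesis unfolding dl BF_odd[OF p' False c] using PN' by (cases ty) (simp_all add: im)
    qed
  qed
qed

lemma even_index_cases:
  assumes "d \<in> D" "even d" "i \<in> {1..t d}"
  obtains i' where "i' < t d div 2" "i = Suc i'" "st d i = Suc (t d div 2 + i')" "sg d i = 1"
  | i' where "i' < t d div 2" "i = Suc (t d div 2 + i')" "st d i = Suc i'" "sg d i = -1"
proof -
  define h where "h = t d div 2"
  have t: "t d = 2 * h" using t_even[OF assms(1,2)] by (simp add: h_def)
  have "i - 1 < 2 * h" using assms(3) t by auto
  then show thesis
  proof (rule less_double_cases)
    assume "i - 1 < h"
    then show thesis by (intro that(1)[of "i - 1"]) (use assms in \<open>auto simp: st_def sg_def h_def[symmetric]\<close>)
  next
    fix i' assume "i - 1 = h + i'" "i' < h"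
    then show thesis by (intro that(2)[of i']) (use assms in \<open>auto simp: st_def sg_def h_def[symmetric]\<close>)
  qed
qed

text \<open>The block pattern of \<open>wp_H\<close> is exactly this symmetry.\<close>

lemma realG_Gm: assumes dm: "dims A C" shows "realG (Gm A C)"
  unfolding realG_def
proof (intro ballI)
  fix d i j assume d: "d \<in> D" "i \<in> {1..t d}" "j \<in> {1..t d}"
  show "Gm A C d (st d i) (st d j) = complex_of_real (sg d i * sg d j) * cnj (Gm A C d i j)"
  proof (cases "even d")
    case True
    have "A d \<in> carrier_mat (t d div 2) (t d div 2)" using dm d(1) True by (auto simp: dims_def)
    note w = wp_H_entry[OF this]
    show ?thesis
      by (rule even_index_cases[OF d(1) True d(2)]; rule even_index_cases[OF d(1) True d(3)]) (simp_all add: Gm_def True w)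
  qed (simp add: Gm_def st_def sg_def)
qed

lemma BF_iff_acts: assumes "dims A C" shows "BF g (bm A C) \<longleftrightarrow> acts g (Gm A C)"
  using BF_iff_PNf[OF assms] acts_PNf[OF realG_Gm[OF assms]] PNf_acts[OF realG_Gm[OF assms]] by blast

text \<open>X, H and Y change levels and multiply by scalars that depend on d and l but not on the
  string, while g mixes strings of equal length in the same way on every level.\<close>

lemma acts_commute:
  assumes g: "acts g G"
  shows "g *v (X *v x) = X *v (g *v x)" "g *v (H *v x) = H *v (g *v x)" "g *v (Y *v x) = Y *v (g *v x)"
proof -
  have gb: "g *v b d j l = (\<Sum>i\<in>{1..t d}. G d i j *s b d i l)" if "d \<in> D" "j \<in> {1..t d}" for d j l
    using g that by (cases "l < d") (auto simp: acts_def b_0)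
  have lin: "A *v (B *v (x + y)) = A *v (B *v x) + A *v (B *v y)" "A *v (B *v (c *s x)) = c *s (A *v (B *v x))"
    for A B :: "complex^'n^'n" and x y c by (simp_all only: mv_linear mv_smult)
  show "g *v (X *v x) = X *v (g *v x)"
  proof (rule linear_eq_on_b[where f = "\<lambda>x. g *v (X *v x)"]; (rule lin)?)
    fix d j l assume d: "d \<in> D" "j \<in> {1..t d}"
    show "g *v (X *v b d j l) = X *v (g *v b d j l)" unfolding X_b gb[OF d] mv_sum mv_smult ..
  qed
  show "g *v (H *v x) = H *v (g *v x)"
  proof (rule linear_eq_on_b[where f = "\<lambda>x. g *v (H *v x)"]; (rule lin)?)
    fix d j l assume d: "d \<in> D" "j \<in> {1..t d}"
    show "g *v (H *v b d j l) = H *v (g *v b d j l)"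
      unfolding H_b[OF d] mv_scaleR gb[OF d] mv_sum mv_smult scaleR_sum_right
      by (intro sum.cong refl) (simp add: H_b[OF d(1)] smult_scaleR)
  qed
  show "g *v (Y *v x) = Y *v (g *v x)"
  proof (rule linear_eq_on_b[where f = "\<lambda>x. g *v (Y *v x)"]; (rule lin)?)
    fix d j l assume d: "d \<in> D" "j \<in> {1..t d}"
    have "\<exists>r l'. \<forall>j\<in>{1..t d}. Y *v b d j l = r *\<^sub>R b d j l'"
    proof (cases l)
      case 0
      then have "\<forall>j\<in>{1..t d}. Y *v b d j l = 0 *\<^sub>R b d j 0" using Lw_D(1)[OF v_Lw[OF d(1)]] by (simp add: b_def)
      then show ?thesis by blast
    next
      case (Suc k)
      then have "\<forall>j\<in>{1..t d}. Y *v b d j l = (real (Suc k) * (real (d - 1) - real k)) *\<^sub>R b d j k"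
        using Lw_Y[OF v_Lw[OF d(1)]] by (simp add: b_def)
      then show ?thesis by blast
    qed
    then obtain r l' where Yb: "\<And>j. j \<in> {1..t d} \<Longrightarrow> Y *v b d j l = r *\<^sub>R b d j l'" by blast
    show "g *v (Y *v b d j l) = Y *v (g *v b d j l)"
      unfolding Yb[OF d(2)] mv_scaleR gb[OF d] mv_sum mv_smult scaleR_sum_right
      by (intro sum.cong refl) (simp add: Yb smult_scaleR)
  qed
qed

end

section \<open>The compact group \<open>K\<close>\<close>

lemma herm_bil: "herm x y = bil (vcnj x) y" by (simp add: herm_def bil_def)

lemma herm_linear:
  "herm x (c *s y) = c * herm x y" "herm x (r *\<^sub>R y) = complex_of_real r * herm x y"
  "herm (r *\<^sub>R x) y = complex_of_real r * herm x y" "herm x (sum f I) = (\<Sum>i\<in>I. herm x (f i))"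
proof -
  have "vcnj (r *\<^sub>R x) = r *\<^sub>R vcnj x" by (simp add: Finite_Cartesian_Product.vec_eq_iff)
  then show "herm x (c *s y) = c * herm x y" "herm x (r *\<^sub>R y) = complex_of_real r * herm x y"
    "herm (r *\<^sub>R x) y = complex_of_real r * herm x y" "herm x (sum f I) = (\<Sum>i\<in>I. herm x (f i))"
    by (simp_all only: herm_bil bil_linear bil_sum)
qed

lemma herm_cnj: "cnj (herm x y) = herm y x" "herm (vcnj x) (vcnj y) = cnj (herm x y)"
  by (simp_all add: herm_def mult.commute)

lemma bil_app: "bil (A \<rhd> x) y = bil x (tr A \<rhd> y)"
  by (simp add: app.rep_eq tr.rep_eq bil_mult_left)

lemma app_smult: "A \<rhd> (c *s x) = c *s (A \<rhd> x)"
  by (simp add: app.rep_eq mv_smult)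

lemma Cmat_commute: "(\<And>x. A *v (B *v x) = B *v (A *v x)) \<Longrightarrow> Cmat A * Cmat B = Cmat B * Cmat A"
  by (rule cmat_eqI) simp

lemma det_Orth_sq: assumes "C \<in> Orth n" shows "Determinant.det C * Determinant.det C = 1"
proof -
  have C: "C \<in> carrier_mat n n" "transpose_mat C * C = 1\<^sub>m n" using assms by (auto simp: Orth_def)
  have "Determinant.det (transpose_mat C * C) = 1" by (simp add: C(2))
  then show ?thesis using Determinant.det_mult[of "transpose_mat C" n C] Determinant.det_transpose[OF C(1)] C(1) by simp
qed

context adapted
begin

lemma odd_partsD: "\<theta> \<in> odd_parts X H Y \<Longrightarrow> \<theta> \<in> D" "\<theta> \<in> odd_parts X H Y \<Longrightarrow> odd \<theta>"
  and even_partsD: "\<eta> \<in> even_parts X H Y \<Longrightarrow> \<eta> \<in> D" "\<eta> \<in> even_parts X H Y \<Longrightarrow> even \<eta>"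
  by (auto simp: odd_parts_def even_parts_def)

lemma in_blocks_odd: assumes "\<theta> \<in> odd_parts X H Y" "l \<in> {0..\<theta> - 1}"
  shows "(\<theta>, l) \<in> set blocks" "blk (\<theta>, l) = C_basis X H Y v \<theta> l" "vec.span (set (blk (\<theta>, l))) = V_space X H Y v \<theta> l" "bm A C (\<theta>, l) = C \<theta>"
proof -
  note o = odd_partsD[OF assms(1)]
  show "(\<theta>, l) \<in> set blocks" using o assms(2) D_pos(1)[OF o(1)] by (auto simp: set_blocks)
  show b: "blk (\<theta>, l) = C_basis X H Y v \<theta> l" using o(2) by (simp add: blk_def)
  show "vec.span (set (blk (\<theta>, l))) = V_space X H Y v \<theta> l" by (simp add: V_space_def b)
  show "bm A C (\<theta>, l) = C \<theta>" using o(2) by (simp add: bm_def)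
qed

lemma in_blocks_even: assumes "\<eta> \<in> even_parts X H Y" "l \<in> {0..\<eta> div 2 - 1}"
  shows "(\<eta>, l) \<in> set blocks" "blk (\<eta>, l) = D_basis X H Y v \<eta> l" "vec.span (set (blk (\<eta>, l))) = W_space X H Y \<eta> l"
    "bm A C (\<eta>, l) = wp_C (wp_H (A \<eta>))"
proof -
  note e = even_partsD[OF assms(1)]
  have "0 < \<eta> div 2" using e(2) D_pos(1)[OF e(1)] by auto
  then show p: "(\<eta>, l) \<in> set blocks" using e assms(2) by (auto simp: set_blocks)
  show "blk (\<eta>, l) = D_basis X H Y v \<eta> l" using e(2) by (simp add: blk_def)
  show "vec.span (set (blk (\<eta>, l))) = W_space X H Y \<eta> l" by (rule span_blk_even[OF p e(2)])
  show "bm A C (\<eta>, l) = wp_C (wp_H (A \<eta>))" using e(2) by (simp add: bm_def)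
qed

lemma blocks_cases:
  assumes "p \<in> set blocks"
  obtains \<eta> l where "p = (\<eta>, l)" "\<eta> \<in> even_parts X H Y" "l \<in> {0..\<eta> div 2 - 1}"
  | \<theta> l where "p = (\<theta>, l)" "\<theta> \<in> odd_parts X H Y" "l \<in> {0..\<theta> - 1}"
proof -
  obtain d l where p: "p = (d, l)" by (cases p)
  have d: "d \<in> D" "l < (if even d then d div 2 else d)" using assms by (auto simp: set_blocks p)
  show thesis
  proof (cases "even d")
    case True
    then show thesis using that(1)[OF p] d by (auto simp: even_parts_def)
  next
    case False
    then show thesis using that(2)[OF p] d by (auto simp: odd_parts_def)
  qed
qed

text \<open>\<open>D_domain\<close> without extensionality and without the condition on
  determinants, which corresponds to membership in \<open>SO_C\<close> and is treated by
  \<open>det_D_SO\<close>.\<close>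

definition adm :: "(nat \<Rightarrow> quat mat) \<Rightarrow> (nat \<Rightarrow> real mat) \<Rightarrow> bool" where
  "adm A C \<longleftrightarrow> (\<forall>\<eta>\<in>even_parts X H Y. A \<eta> \<in> Sp (t \<eta> div 2)) \<and> (\<forall>\<theta>\<in>odd_parts X H Y. C \<theta> \<in> Orth (t \<theta>))"

lemma adm_dims: "adm A C \<Longrightarrow> dims A C"
  unfolding adm_def dims_def by (auto simp: even_parts_def odd_parts_def Sp_def Orth_def)

lemma bm_carrier: assumes "dims A C" "p \<in> set blocks" shows "bm A C p \<in> carrier_mat (length (blk p)) (length (blk p))"
  using assms(2)
proof (cases rule: blocks_cases)
  case (1 \<eta> l)
  note e = even_partsD[OF 1(2)]
  show ?thesis using wp_C_carrier[OF wp_H_dim[where A = A and d = \<eta>, OF assms(1) e]] length_blk[of \<eta> l] assms(2) e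
    unfolding 1(1) in_blocks_even(4)[OF 1(2,3)] by simp
next
  case (2 \<theta> l)
  note o = odd_partsD[OF 2(2)]
  have "C \<theta> \<in> carrier_mat (t \<theta>) (t \<theta>)" using assms(1) o by (auto simp: dims_def)
  then show ?thesis using length_blk[of \<theta> l] assms(2) o unfolding 2(1) in_blocks_odd(4)[OF 2(2,3)] by simp
qed

lemma BF_iff_matrix:
  assumes "dims A C"
  shows "BF g (bm A C) \<longleftrightarrow> (\<forall>p\<in>set blocks. (*v) g ` vec.span (set (blk p)) \<subseteq> vec.span (set (blk p)) \<and>
    matrix_wrt (blk p) ((*v) g) = map_mat complex_of_real (bm A C p))"
  unfolding BF_def image_span_subset_iff
  by (intro ball_cong refl matrix_wrt_iff blk_orthonormal bm_carrier[OF assms])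

lemma D_SO_blocks: "D_SO X H Y (A, C) = diag_block_mat (map (bm A C) blocks)"
proof -
  have r: "map (bm A C) (map (Pair d) [0..<n]) = replicate n (if even d then wp_C (wp_H (A d)) else C d)" for d n
    by (simp add: bm_def o_def map_replicate_const)
  have ev: "even \<eta>" if "\<eta> \<in> set (sorted_list_of_set (even_parts X H Y))" for \<eta>
    using that unfolding set_sorted_list_of_set[OF finite_parts(1)] by (simp add: even_parts_def)
  have od: "odd \<theta>" if "\<theta> \<in> set (sorted_list_of_set (odd_parts X H Y))" for \<theta>
    using that unfolding set_sorted_list_of_set[OF finite_parts(2)] by (simp add: odd_parts_def)
  have 1: "map (\<lambda>\<eta>. replicate (\<eta> div 2) (wp_C (wp_H (A \<eta>)))) (sorted_list_of_set (even_parts X H Y)) =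
      map (\<lambda>\<eta>. map (bm A C) (map (Pair \<eta>) [0..<\<eta> div 2])) (sorted_list_of_set (even_parts X H Y))"
    unfolding r by (intro map_cong refl) (simp add: ev)
  have 2: "map (\<lambda>\<theta>. replicate \<theta> (C \<theta>)) (sorted_list_of_set (odd_parts X H Y)) =
      map (\<lambda>\<theta>. map (bm A C) (map (Pair \<theta>) [0..<\<theta>])) (sorted_list_of_set (odd_parts X H Y))"
    unfolding r by (intro map_cong refl) (simp add: od)
  show ?thesis unfolding D_SO_def prod.case 1 2 blocks_def by (simp only: map_append map_concat map_map o_def)
qed

lemma Lambda_iff_D_SO: "dims A C \<Longrightarrow> Lambda_H X H Y v g = map_mat complex_of_real (D_SO X H Y (A, C)) \<longleftrightarrow> BF g (bm A C)"
  unfolding D_SO_blocks by (rule Lambda_iff) (rule bm_carrier)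

lemma quat_block_exists:
  assumes "A \<in> Sp m"
  shows "let q = map_mat (of_real :: real \<Rightarrow> quat) in
    \<exists>A1 \<in> carrier_mat m m. \<exists>A2 \<in> carrier_mat m m. \<exists>B1 \<in> carrier_mat m m. \<exists>B2 \<in> carrier_mat m m.
      (q A1 + qi \<cdot>\<^sub>m q A2) + qj \<cdot>\<^sub>m (q B1 + qi \<cdot>\<^sub>m q B2) \<in> Sp m \<and> wp_C (wp_H A) = quat_block A1 A2 B1 B2"
proof -
  have A: "A \<in> carrier_mat m m" using assms by (simp add: Sp_def)
  define A1 A2 B1 B2 where "A1 = map_mat qRe A" and "A2 = map_mat qIm1 A" and "B1 = map_mat qIm2 A" and "B2 = map_mat (\<lambda>q. - qIm3 q) A"
  note defs = A1_def A2_def B1_def B2_def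
  have c: "A1 \<in> carrier_mat m m" "A2 \<in> carrier_mat m m" "B1 \<in> carrier_mat m m" "B2 \<in> carrier_mat m m"
    using A by (auto simp: defs)
  define q where "q = map_mat (of_real :: real \<Rightarrow> quat)"
  have eq: "(q A1 + qi \<cdot>\<^sub>m q A2) + qj \<cdot>\<^sub>m (q B1 + qi \<cdot>\<^sub>m q B2) = A" (is "?Q = A")
  proof (rule eq_matI)
    fix i j assume "i < dim_row A" "j < dim_col A"
    then have ij: "i < m" "j < m" using A by auto
    show "?Q $$ (i, j) = A $$ (i, j)" unfolding q_def quat_block_eq(3)[OF c ij] using A ij by (simp add: defs)
  qed (use quat_block_eq(1)[OF c] A in \<open>auto simp: q_def\<close>)
  have "wp_C (wp_H A) = quat_block A1 A2 B1 B2" unfolding quat_block_eq(2)[OF c] eq[unfolded q_def] ..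
  then show ?thesis unfolding Let_def q_def[symmetric] using c eq assms by (intro bexI[of _ A1] bexI[of _ A2] bexI[of _ B1] bexI[of _ B2]) auto
qed

text \<open>Gathers conditions (1) to (4) for all parts into one tuple of matrices and one statement
  on blocks.\<close>

lemma K_iff: "g \<in> K_group X H Y v \<longleftrightarrow> g \<in> centralizer X H Y \<and> (\<exists>A C. adm A C \<and> BF g (bm A C))"
proof
  assume "g \<in> K_group X H Y v"
  note k = this[unfolded K_group_def mem_Collect_eq]
  note K1 = k[THEN conjunct1] and K2 = k[THEN conjunct2, THEN conjunct1]
    and K3 = k[THEN conjunct2, THEN conjunct2, THEN conjunct1]
    and K4 = k[THEN conjunct2, THEN conjunct2, THEN conjunct2, THEN conjunct1]
    and K5 = bspec[OF k[THEN conjunct2, THEN conjunct2, THEN conjunct2, THEN conjunct2]]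
  obtain C where C: "\<forall>\<theta> \<in> odd_parts X H Y. C \<theta> \<in> Orth (t \<theta>) \<and> (\<forall>l \<in> {0..\<theta> - 1}.
      matrix_wrt (C_basis X H Y v \<theta> l) ((*v) g) = map_mat complex_of_real (C \<theta>))"
    using bchoice[OF K3[unfolded Bex_def]] by blast
  have "\<forall>\<eta>\<in>even_parts X H Y. \<exists>A. A \<in> Sp (t \<eta> div 2) \<and> (\<forall>l \<in> {0..\<eta> div 2 - 1}.
      matrix_wrt (D_basis X H Y v \<eta> l) ((*v) g) = map_mat complex_of_real (wp_C (wp_H A)))"
  proof
    fix \<eta> assume "\<eta> \<in> even_parts X H Y"
    from K5[OF this, unfolded Let_def] obtain A1 A2 B1 B2
      where c: "A1 \<in> carrier_mat (t \<eta> div 2) (t \<eta> div 2)" "A2 \<in> carrier_mat (t \<eta> div 2) (t \<eta> div 2)"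
        "B1 \<in> carrier_mat (t \<eta> div 2) (t \<eta> div 2)" "B2 \<in> carrier_mat (t \<eta> div 2) (t \<eta> div 2)"
        and S: "(map_mat of_real A1 + qi \<cdot>\<^sub>m map_mat of_real A2) + qj \<cdot>\<^sub>m (map_mat of_real B1 + qi \<cdot>\<^sub>m map_mat of_real B2) \<in> Sp (t \<eta> div 2)"
        and M: "\<forall>l \<in> {0..\<eta> div 2 - 1}. matrix_wrt (D_basis X H Y v \<eta> l) ((*v) g) = map_mat complex_of_real (quat_block A1 A2 B1 B2)"
      by blast
    show "\<exists>A. A \<in> Sp (t \<eta> div 2) \<and> (\<forall>l \<in> {0..\<eta> div 2 - 1}.
      matrix_wrt (D_basis X H Y v \<eta> l) ((*v) g) = map_mat complex_of_real (wp_C (wp_H A)))"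
      using S M unfolding quat_block_eq(2)[OF c] by blast
  qed
  from bchoice[OF this] obtain A where A: "\<forall>\<eta>\<in>even_parts X H Y. A \<eta> \<in> Sp (t \<eta> div 2) \<and> (\<forall>l \<in> {0..\<eta> div 2 - 1}.
      matrix_wrt (D_basis X H Y v \<eta> l) ((*v) g) = map_mat complex_of_real (wp_C (wp_H (A \<eta>))))" by blast
  have adm: "adm A C" using A C by (auto simp: adm_def)
  have "BF g (bm A C)" unfolding BF_iff_matrix[OF adm_dims[OF adm]]
  proof
    fix p assume "p \<in> set blocks"
    then show "(*v) g ` vec.span (set (blk p)) \<subseteq> vec.span (set (blk p)) \<and>
      matrix_wrt (blk p) ((*v) g) = map_mat complex_of_real (bm A C p)"
    proof (cases rule: blocks_cases)
      case (1 \<eta> l)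
      show ?thesis unfolding 1(1) in_blocks_even(3)[OF 1(2,3)] unfolding in_blocks_even(2,4)[OF 1(2,3)] using A K4 1(2,3) by blast
    next
      case (2 \<theta> l)
      show ?thesis unfolding 2(1) in_blocks_odd(3)[OF 2(2,3)] unfolding in_blocks_odd(2,4)[OF 2(2,3)] using C K2 2(2,3) by blast
    qed
  qed
  then show "g \<in> centralizer X H Y \<and> (\<exists>A C. adm A C \<and> BF g (bm A C))" using adm K1 by blast
next
  assume "g \<in> centralizer X H Y \<and> (\<exists>A C. adm A C \<and> BF g (bm A C))"
  then obtain A C where g: "g \<in> centralizer X H Y" and adm: "adm A C" and BF: "BF g (bm A C)" by blast
  note M = BF[unfolded BF_iff_matrix[OF adm_dims[OF adm]], rule_format]
  have O: "(*v) g ` V_space X H Y v \<theta> l \<subseteq> V_space X H Y v \<theta> l \<and> matrix_wrt (C_basis X H Y v \<theta> l) ((*v) g) = map_mat complex_of_real (C \<theta>)"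
    if "\<theta> \<in> odd_parts X H Y" "l \<in> {0..\<theta> - 1}" for \<theta> l
    using M[OF in_blocks_odd(1)[OF that]] unfolding in_blocks_odd(3)[OF that] unfolding in_blocks_odd(2,4)[OF that] .
  have E: "(*v) g ` W_space X H Y \<eta> l \<subseteq> W_space X H Y \<eta> l \<and> matrix_wrt (D_basis X H Y v \<eta> l) ((*v) g) = map_mat complex_of_real (wp_C (wp_H (A \<eta>)))"
    if "\<eta> \<in> even_parts X H Y" "l \<in> {0..\<eta> div 2 - 1}" for \<eta> l
    using M[OF in_blocks_even(1)[OF that]] unfolding in_blocks_even(3)[OF that] unfolding in_blocks_even(2,4)[OF that] .
  show "g \<in> K_group X H Y v" unfolding K_group_def mem_Collect_eq
  proof (intro conjI ballI g)
    show "\<exists>A\<in>Orth (t \<theta>). \<forall>l\<in>{0..\<theta> - 1}. matrix_wrt (C_basis X H Y v \<theta> l) ((*v) g) = map_mat complex_of_real A"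
      if "\<theta> \<in> odd_parts X H Y" for \<theta> using adm O that unfolding adm_def by blast
    fix \<eta> assume \<eta>: "\<eta> \<in> even_parts X H Y"
    have "A \<eta> \<in> Sp (t \<eta> div 2)" using adm \<eta> by (simp add: adm_def)
    from quat_block_exists[OF this, unfolded Let_def] obtain A1 A2 B1 B2
      where c: "A1 \<in> carrier_mat (t \<eta> div 2) (t \<eta> div 2)" "A2 \<in> carrier_mat (t \<eta> div 2) (t \<eta> div 2)"
        "B1 \<in> carrier_mat (t \<eta> div 2) (t \<eta> div 2)" "B2 \<in> carrier_mat (t \<eta> div 2) (t \<eta> div 2)"
        and S: "(map_mat of_real A1 + qi \<cdot>\<^sub>m map_mat of_real A2) + qj \<cdot>\<^sub>m (map_mat of_real B1 + qi \<cdot>\<^sub>m map_mat of_real B2) \<in> Sp (t \<eta> div 2)"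
        and e: "wp_C (wp_H (A \<eta>)) = quat_block A1 A2 B1 B2" by blast
    show "let m = t \<eta> div 2; q = map_mat (of_real :: real \<Rightarrow> quat) in
        \<exists>A1 \<in> carrier_mat m m. \<exists>A2 \<in> carrier_mat m m. \<exists>B1 \<in> carrier_mat m m. \<exists>B2 \<in> carrier_mat m m.
          (q A1 + qi \<cdot>\<^sub>m q A2) + qj \<cdot>\<^sub>m (q B1 + qi \<cdot>\<^sub>m q B2) \<in> Sp m \<and>
          (\<forall>l \<in> {0..\<eta> div 2 - 1}.
             matrix_wrt (D_basis X H Y v \<eta> l) ((*v) g) = map_mat complex_of_real (quat_block A1 A2 B1 B2))"
      unfolding Let_def using c S E[OF \<eta>] unfolding e by blast
  qed (use O E in blast)+
qed

text \<open>The blocks of even parts have determinant 1. An odd part repeats its block an odd number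
  of times, and since the determinant is 1 or -1 this power of it is the determinant itself.\<close>

lemma det_D_SO:
  assumes "adm A C"
  shows "D_SO X H Y (A, C) \<in> Orth CARD('n)"
    "Determinant.det (D_SO X H Y (A, C)) = (\<Prod>\<theta>\<in>odd_parts X H Y. Determinant.det (C \<theta>))"
proof -
  have Sp: "unitary_mat (t \<eta>) (wp_H (A \<eta>))" if "\<eta> \<in> even_parts X H Y" for \<eta>
  proof -
    have "unitary_mat (2 * (t \<eta> div 2)) (wp_H (A \<eta>))" using assms that Sp_iff by (auto simp: adm_def)
    then show ?thesis using t_even[OF even_partsD[OF that]] by simp
  qed
  have O: "bm A C p \<in> Orth (length (blk p))" if p: "p \<in> set blocks" for p
    using p
  proof (cases rule: blocks_cases)
    case (1 \<eta> l)
    show ?thesis using wp_C_Orth[OF Sp[OF 1(2)]] length_blk[of \<eta> l] p even_partsD[OF 1(2)]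
      unfolding 1(1) in_blocks_even(4)[OF 1(2,3)] by simp
  next
    case (2 \<theta> l)
    show ?thesis using assms 2(2) length_blk[of \<theta> l] p odd_partsD[OF 2(2)]
      unfolding 2(1) in_blocks_odd(4)[OF 2(2,3)] by (simp add: adm_def)
  qed
  have len: "(\<Sum>p\<leftarrow>blocks. length (blk p)) = CARD('n)"
    using length_H_basis unfolding H_basis_blocks by (simp add: length_concat o_def)
  note dO = diag_block_Orth[where ps = blocks and F = "bm A C" and n = "\<lambda>p. length (blk p)", OF O]
  show "D_SO X H Y (A, C) \<in> Orth CARD('n)" unfolding D_SO_blocks using dO len by simp
  define \<delta> where "\<delta> d = (if even d then 1 else Determinant.det (C d))" for d
  have d1: "Determinant.det (bm A C p) = \<delta> (fst p)" if p: "p \<in> set blocks" for p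
    using p
  proof (cases rule: blocks_cases)
    case (1 \<eta> l)
    show ?thesis using det_wp_C[OF Sp[OF 1(2)]] even_partsD[OF 1(2)] unfolding 1(1) in_blocks_even(4)[OF 1(2,3)] by (simp add: \<delta>_def)
  next
    case (2 \<theta> l)
    show ?thesis using odd_partsD[OF 2(2)] unfolding 2(1) in_blocks_odd(4)[OF 2(2,3)] by (simp add: \<delta>_def)
  qed
  have S: "set blocks = Sigma D (\<lambda>d. {..<if even d then d div 2 else d})" unfolding set_blocks by auto
  have "Determinant.det (D_SO X H Y (A, C)) = (\<Prod>p\<leftarrow>blocks. Determinant.det (bm A C p))" unfolding D_SO_blocks using dO by blast
  also have "\<dots> = (\<Prod>p\<in>set blocks. Determinant.det (bm A C p))" by (rule prod.distinct_set_conv_list[OF distinct_blocks, symmetric])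
  also have "\<dots> = (\<Prod>p\<in>set blocks. \<delta> (fst p))" by (intro prod.cong refl d1)
  also have "\<dots> = (\<Prod>d\<in>D. \<Prod>l<(if even d then d div 2 else d). \<delta> d)"
    unfolding S using finite_D by (subst prod.Sigma) (auto intro!: prod.cong)
  also have "\<dots> = (\<Prod>d\<in>D. if odd d then Determinant.det (C d) else 1)"
  proof (intro prod.cong refl)
    fix d assume d: "d \<in> D"
    show "(\<Prod>l<(if even d then d div 2 else d). \<delta> d) = (if odd d then Determinant.det (C d) else 1)"
    proof (cases "even d")
      case False
      then have "d \<in> odd_parts X H Y" using d by (simp add: odd_parts_def)
      then have sq: "Determinant.det (C d) * Determinant.det (C d) = 1" using assms det_Orth_sq by (auto simp: adm_def)
      obtain k where k: "d = Suc (2 * k)" using False by (auto elim: oddE)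
      have "Determinant.det (C d) ^ d = Determinant.det (C d) * (Determinant.det (C d) * Determinant.det (C d)) ^ k"
        by (subst (2) k) (simp add: power_mult power2_eq_square)
      then show ?thesis using False by (simp add: \<delta>_def sq)
    qed (simp add: \<delta>_def)
  qed
  also have "\<dots> = (\<Prod>\<theta>\<in>odd_parts X H Y. Determinant.det (C \<theta>))"
    unfolding odd_parts_def by (rule prod.inter_filter[OF finite_D, symmetric])
  finally show "Determinant.det (D_SO X H Y (A, C)) = (\<Prod>\<theta>\<in>odd_parts X H Y. Determinant.det (C \<theta>))" .
qed

section \<open>Coordinates with respect to \<open>\<H>\<close>\<close>

definition Bm :: "'n cmat" where
  "Bm = Cmat (\<chi> a c. H_basis X H Y v ! (inv_into {..<CARD('n)} idx c) $ a)"

lemma Bm_col: assumes "j < CARD('n)" shows "mat_of Bm $ a $ idx j = H_basis X H Y v ! j $ a"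
proof -
  have "inv_into {..<CARD('n)} idx (idx j :: 'n) = j"
    using assms idx_bij[where 'n = 'n] by (auto simp: bij_betw_def intro: inv_into_f_f)
  then show ?thesis by (simp add: Bm_def Cmat_inverse)
qed

lemma Bm_axis: "j < CARD('n) \<Longrightarrow> Bm \<rhd> axis (idx j) 1 = H_basis X H Y v ! j"
  by (simp add: Finite_Cartesian_Product.vec_eq_iff entry_app[symmetric] Bm_col)

lemma tr_Bm_app: "j < CARD('n) \<Longrightarrow> (tr Bm \<rhd> x) $ idx j = bil (H_basis X H Y v ! j) x"
  by (simp add: app.rep_eq tr.rep_eq Finite_Cartesian_Product.transpose_def matrix_vector_mult_def bil_def Bm_col
      del: transpose_matrix_vector)

lemma toJ_conj_Bm: "toJ (tr Bm * Cmat g * Bm) = Lambda_H X H Y v g"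
proof (rule eq_matI)
  show d: "dim_row (toJ (tr Bm * Cmat g * Bm)) = dim_row (Lambda_H X H Y v g)" "dim_col (toJ (tr Bm * Cmat g * Bm)) = dim_col (Lambda_H X H Y v g)"
    by (simp_all add: toJ_def Lambda_mform mform_def length_H_basis)
  fix i j assume "i < dim_row (Lambda_H X H Y v g)" "j < dim_col (Lambda_H X H Y v g)"
  then have ij: "i < CARD('n)" "j < CARD('n)" by (simp_all add: Lambda_mform mform_def length_H_basis)
  then show "toJ (tr Bm * Cmat g * Bm) $$ (i, j) = Lambda_H X H Y v g $$ (i, j)"
    by (simp add: toJ_entry entry_app Bm_axis tr_Bm_app Lambda_mform mform_def length_H_basis)
qed

lemma tr_Bm: "tr Bm * Bm = 1" "Bm * tr Bm = 1"
proof -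
  have "toJ (tr Bm * Cmat (Finite_Cartesian_Product.mat 1) * Bm) = 1\<^sub>m CARD('n)"
    unfolding toJ_conj_Bm Lambda_mform mform_def length_H_basis
    by (intro eq_matI) (simp_all add: orthonormal_nth[OF H_basis_orthonormal] length_H_basis)
  also have "Cmat (Finite_Cartesian_Product.mat 1) = (1 :: 'n cmat)" by (simp add: one_cmat_def)
  finally have "toJ (tr Bm * Bm) = toJ (1 :: 'n cmat)" by (simp add: toJ_one)
  then show "tr Bm * Bm = 1" by (simp only: toJ_inject)
  then show "Bm * tr Bm = 1" using cmat_left_inverse by auto
qed

lemmas Bm_cancel = mult_assoc_rule[OF tr_Bm(1)] mult_assoc_rule[OF tr_Bm(2)] tr_Bm

lemma Bm_tr_app: "Bm \<rhd> tr Bm \<rhd> x = x" "tr Bm \<rhd> Bm \<rhd> x = x"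
  unfolding app_simps(1)[symmetric] tr_Bm by simp_all

definition Xh :: "'n cmat" where "Xh = tr Bm * Cmat X * Bm"
definition e :: "nat \<Rightarrow> nat \<Rightarrow> nat \<Rightarrow> complex^'n" where "e d j l = tr Bm \<rhd> b d j l"
definition s :: "nat \<Rightarrow> nat \<Rightarrow> nat \<Rightarrow> real" where "s d j l = (-1) ^ l * sg d j"

text \<open>The vectors of H are real for the real structure, so in the coordinates of H it becomes
  ordinary complex conjugation.\<close>

lemma vcnj_e_sb: assumes "d \<in> D" "j \<in> {1..t d}" "l < d" shows "vcnj (e d j l) = tr Bm \<rhd> sb d j l"
proof -
  have "vcnj (e d j l) $ x = (tr Bm \<rhd> sb d j l) $ x" for x
  proof -
    obtain k where k: "k < CARD('n)" "x = idx k" by (rule idx_cases)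
    have "H_basis X H Y v ! k \<in> Wv ` GC" unfolding set_H_basis[symmetric] using k length_H_basis by (intro nth_mem) simp
    then obtain c where "c \<in> GC" "H_basis X H Y v ! k = Wv c" by auto
    then show ?thesis using Wv_real[of c, OF _ assms] by (simp add: k tr_Bm_app e_def)
  qed
  then show ?thesis by (simp add: Finite_Cartesian_Product.vec_eq_iff)
qed

sublocale us: unitary_strings D t e Xh st s
proof
  show "finite D" by (rule finite_D)
  show "herm (e d a l) (e d' a' l') = (if d = d' \<and> a = a' \<and> l = l' then 1 else 0)"
    if "d \<in> D" "a \<in> {1..t d}" "l < d" "d' \<in> D" "a' \<in> {1..t d'}" "l' < d'" for d a l d' a' l'
  proof -
    have "herm (e d a l) (e d' a' l') = bil (b d' a' l') (sb d a l)"
      unfolding herm_bil vcnj_e_sb[OF that(1-3)] bil_commute[of "tr Bm \<rhd> sb d a l"] unfolding e_def bil_app by (simp add: Bm_tr_app)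
    then show ?thesis using gram_sb[OF that(4-6,1-3)] by auto
  qed
  show "A = A'" if AB: "\<And>d a l. \<lbrakk>d \<in> D; a \<in> {1..t d}; l < d\<rbrakk> \<Longrightarrow> A \<rhd> e d a l = A' \<rhd> e d a l" for A A' :: "'n cmat"
  proof (rule cmat_eqI)
    fix y
    have "A \<rhd> tr Bm \<rhd> x = A' \<rhd> tr Bm \<rhd> x" for x
      by (rule linear_eq_on_b[where f = "\<lambda>x. A \<rhd> tr Bm \<rhd> x"]) (use AB in \<open>simp_all add: app_linear app_smult e_def\<close>)
    from this[of "Bm \<rhd> y"] show "A \<rhd> y = A' \<rhd> y" by (simp add: Bm_tr_app)
  qed
  show "Xh \<rhd> e d a l = e d a (Suc l)" for d a l by (simp add: Xh_def e_def Bm_tr_app X_b)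
  show "e d a l = 0" if "d \<in> D" "a \<in> {1..t d}" "d \<le> l" for d a l
    using app_smult[of "tr Bm" 0 0] by (simp add: e_def b_0[OF that])
  show "vcnj (e d a l) = s d a l *\<^sub>R e d (st d a) (d - 1 - l)" if "d \<in> D" "a \<in> {1..t d}" "l < d" for d a l
    unfolding vcnj_e_sb[OF that] unfolding sb_def s_def e_def scaleR_eq_smult by (rule app_smult)
  show "s d a l \<noteq> 0" for d a l by (simp add: s_def sg_def)
  show "st d a \<in> {1..t d}" "st d (st d a) = a" if "d \<in> D" "a \<in> {1..t d}" for d a using st_in[OF that] by auto
  have "tr (Cmat X) = - Cmat X"
    using so_C_transpose[OF X_so] by (simp add: tr_def uminus_cmat_def Cmat_inverse map_fun_def)
  then show "tr Xh = - Xh" by (simp add: Xh_def mult.assoc)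
qed

lemma SO_Bm: "k \<in> SO \<Longrightarrow> Bm * k * tr Bm \<in> SO"
proof -
  assume k: "k \<in> SO"
  have "Determinants.det (mat_of (tr Bm)) * Determinants.det (mat_of Bm) = 1"
    by (simp only: det_mat_of_mult[symmetric] tr_Bm det_mat_of_one)
  moreover have "Determinants.det (mat_of k) = 1" using k by (simp add: SO_def)
  ultimately have "Determinants.det (mat_of (Bm * k * tr Bm)) = 1" by (simp add: det_mat_of_mult mult.commute)
  then show ?thesis unfolding SO_def by (simp add: mult.assoc Bm_cancel SO_D[OF k] SO_cancel[OF k])
qed

lemma det_Lambda: "g \<in> SO_C \<Longrightarrow> Determinant.det (Lambda_H X H Y v g) = 1"
proof -
  assume g: "g \<in> SO_C"
  have "Determinants.det (mat_of (tr Bm)) * Determinants.det (mat_of Bm) = 1"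
    by (simp only: det_mat_of_mult[symmetric] tr_Bm det_mat_of_one)
  moreover have "Determinants.det (mat_of (Cmat g)) = 1" using g unfolding SO_C_SO by (simp add: SO_def)
  ultimately show ?thesis unfolding toJ_conj_Bm[symmetric] det_toJ by (simp add: det_mat_of_mult mult.commute)
qed

section \<open>The image of K as the stabilizer of X in the compact group\<close>

abbreviation Stab :: "'n cmat set" where "Stab \<equiv> {k \<in> SOr. k * Xh = Xh * k}"

text \<open>The first of three inclusions that close up to a circle: from the image of K to the
  image of D, then to the stabilizer (\<open>D_SO_sub\<close>), and back to the image of K
  (\<open>Stab_sub\<close>). The circle proves both descriptions at once.\<close>

lemma Lambda_K_sub: "Lambda_H X H Y v ` K_group X H Y v \<subseteq> {map_mat complex_of_real (D_SO X H Y g) | g. g \<in> D_domain X H Y}"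
proof clarify
  fix g assume "g \<in> K_group X H Y v"
  then obtain A C where g: "g \<in> centralizer X H Y" and adm: "adm A C" and BF: "BF g (bm A C)" unfolding K_iff by blast
  \<comment> \<open>Tuples in \<open>D_domain\<close> are extensional, and the blocks only see the
    values at parts.\<close>
  define A' C' where "A' = restrict A (even_parts X H Y)" and "C' = restrict C (odd_parts X H Y)"
  have eq: "D_SO X H Y (A', C') = D_SO X H Y (A, C)"
    unfolding D_SO_blocks
  proof (intro arg_cong[of _ _ diag_block_mat] map_cong refl)
    fix p assume "p \<in> set blocks"
    then show "bm A' C' p = bm A C p"
      by (cases rule: blocks_cases) (simp_all add: in_blocks_even(4) in_blocks_odd(4) A'_def C'_def)
  qed
  have L: "Lambda_H X H Y v g = map_mat complex_of_real (D_SO X H Y (A, C))" using Lambda_iff_D_SO[OF adm_dims[OF adm]] BF by simp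
  have "g \<in> SO_C" using g by (simp add: centralizer_def)
  from det_Lambda[OF this] have "complex_of_real (Determinant.det (D_SO X H Y (A, C))) = complex_of_real 1"
    unfolding L by (simp add: of_real_hom.hom_det)
  then have "(\<Prod>\<theta>\<in>odd_parts X H Y. Determinant.det (C \<theta>)) = 1" unfolding of_real_eq_iff det_D_SO(2)[OF adm] .
  moreover have "(\<Prod>\<theta>\<in>odd_parts X H Y. Determinant.det (C' \<theta>)) = (\<Prod>\<theta>\<in>odd_parts X H Y. Determinant.det (C \<theta>))"
    by (intro prod.cong refl) (simp add: C'_def)
  moreover have "A' \<in> (\<Pi>\<^sub>E \<eta>\<in>even_parts X H Y. Sp (t \<eta> div 2))" "C' \<in> (\<Pi>\<^sub>E \<theta>\<in>odd_parts X H Y. Orth (t \<theta>))"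
    using adm by (simp_all add: A'_def C'_def adm_def PiE_iff)
  ultimately have "(A', C') \<in> D_domain X H Y"
    unfolding D_domain_def by (intro SigmaI CollectI conjI) (simp_all only:)
  then show "\<exists>h. Lambda_H X H Y v g = map_mat complex_of_real (D_SO X H Y h) \<and> h \<in> D_domain X H Y"
    using L eq by (intro exI[of _ "(A', C')"]) simp
qed

lemma D_SO_sub: "{map_mat complex_of_real (D_SO X H Y g) | g. g \<in> D_domain X H Y} \<subseteq> toJ ` Stab"
proof clarify
  fix A C assume AC: "(A, C) \<in> D_domain X H Y"
  then have adm: "adm A C" and d: "(\<Prod>\<theta>\<in>odd_parts X H Y. Determinant.det (C \<theta>)) = 1"
    by (auto simp: D_domain_def adm_def)
  let ?M = "map_mat complex_of_real (D_SO X H Y (A, C))"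
  have "?M \<in> SOn CARD('n)" unfolding SOn_def using det_D_SO[OF adm] d by auto
  then obtain k :: "'n cmat" where k: "k \<in> SOr" "toJ k = ?M" unfolding toJ_SOr[where 'n = 'n, symmetric] by auto
  define g where "g = mat_of (Bm * k * tr Bm)"
  have gk: "tr Bm * Cmat g * Bm = k" by (simp add: g_def mat_of_inverse mult.assoc Bm_cancel)
  have "Lambda_H X H Y v g = ?M" unfolding toJ_conj_Bm[symmetric] gk by (rule k(2))
  then have "acts g (Gm A C)" using Lambda_iff_D_SO[OF adm_dims[OF adm]] BF_iff_acts[OF adm_dims[OF adm]] by simp
  then have c: "Cmat g * Cmat X = Cmat X * Cmat g" by (intro Cmat_commute acts_commute(1))
  have "k * Xh = tr Bm * (Cmat g * Cmat X) * Bm" unfolding gk[symmetric] Xh_def by (simp add: mult.assoc Bm_cancel)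
  also have "\<dots> = Xh * k" unfolding c unfolding gk[symmetric] Xh_def by (simp add: mult.assoc Bm_cancel)
  finally show "?M \<in> toJ ` Stab" using k by (intro image_eqI[of _ _ k]) auto
qed

text \<open>The adjoint of k is its inverse and commutes with X as well. \<open>filtered\<close> for
  k excludes components lowering the weight, and \<open>filtered\<close> for the adjoint excludes
  those raising it.\<close>

lemma Stab_commute_E:
  assumes k: "k \<in> Stab" shows "k * us.E c = us.E c * k"
proof -
  have kX: "k * Xh = Xh * k" and kr: "k \<in> SOr" using k by auto
  have ak: "adj k * k = 1" "k * adj k = 1" using kr SOr_D[OF kr] by (simp_all add: SOr_def SO_D)
  have "adj k * Xh = adj k * (Xh * k) * adj k" by (simp add: mult.assoc ak)
  also have "\<dots> = Xh * adj k" unfolding kX[symmetric] by (simp add: mult.assoc[symmetric] ak)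
  finally have aX: "adj k * Xh = Xh * adj k" .
  have z: "us.E j * k * us.E i = 0" if "j \<noteq> i" for i j
  proof (cases "j < i")
    case True
    then show ?thesis by (rule us.filtered[OF kX])
  next
    case False
    then have "us.E i * adj k * us.E j = 0" using that by (intro us.filtered[OF aX]) simp
    then have "adj (us.E i * adj k * us.E j) = adj 0" by simp
    then show ?thesis by (simp add: us.adj_E mult.assoc)
  qed
  show ?thesis
  proof (rule grading_ext[OF us.E_grading])
    fix i j
    have "us.E j * (k * us.E c) * us.E i = (if c = i then us.E j * k * us.E i else 0)"
      by (simp add: mult.assoc us.E_mult)
    also have "\<dots> = (if j = c then us.E j * k * us.E i else 0)" using z[of j i] by auto
    also have "\<dots> = us.E j * (us.E c * k) * us.E i" by (simp add: mult.assoc us.E_mult2)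
    finally show "us.E j * (k * us.E c) * us.E i = us.E j * (us.E c * k) * us.E i" .
  qed
qed

definition Gk :: "'n cmat \<Rightarrow> nat \<Rightarrow> nat \<Rightarrow> nat \<Rightarrow> complex" where
  "Gk k d i j = herm (e d i 0) (k \<rhd> e d j 0)"

text \<open>Preserving weights, k commutes with \<open>N (d, 0)\<close>, so it maps bottoms of
  strings of length d to combinations of such bottoms; commuting with X it has the same matrix on
  all levels.\<close>

lemma Stab_e:
  assumes k: "k \<in> Stab" and d: "d \<in> D" "j \<in> {1..t d}"
  shows "k \<rhd> e d j l = (\<Sum>i\<in>{1..t d}. Gk k d i j *s e d i l)"
proof -
  have kX: "k * Xh = Xh * k" using k by auto
  let ?w = "k \<rhd> e d j 0"
  have N0: "us.N (d, 0) \<rhd> e d j 0 = e d j 0" using us.N_e[OF d, of d 0 0] D_pos(1)[OF d(1)] by simp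
  have Nk: "k * us.N (d, 0) = us.N (d, 0) * k" by (rule us.N_comm[OF kX Stab_commute_E[OF k]])
  have "?w = (k * us.N (d, 0)) \<rhd> e d j 0" by (simp only: app_simps(1) N0)
  also have "\<dots> = us.N (d, 0) \<rhd> ?w" by (simp only: Nk app_simps(1))
  also have "\<dots> = (\<Sum>i\<in>{1..t d}. Gk k d i j *s e d i 0)"
  proof -
    have S: "{x \<in> us.Idx. fst x = d \<and> snd (snd x) = 0} = (\<lambda>i. (d, i, 0)) ` {1..t d}"
      using d(1) D_pos(1)[OF d(1)] by (auto simp: us.Idx_def)
    have "us.N (d, 0) \<rhd> ?w = (\<Sum>x\<in>(\<lambda>i. (d, i, 0)) ` {1..t d}. herm (us.ee x) ?w *s e d (fst (snd x)) 0)"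
      unfolding us.N_def prod.case app_sum_left outer_app S ..
    also have "\<dots> = (\<Sum>i\<in>{1..t d}. herm (us.ee (d, i, 0)) ?w *s e d (fst (snd (d, i, 0::nat))) 0)"
      by (subst sum.reindex) (simp_all only: inj_on_def prod.inject o_def, simp)
    also have "\<dots> = (\<Sum>i\<in>{1..t d}. Gk k d i j *s e d i 0)"
      by (intro sum.cong refl) (simp only: us.ee_def prod.case Gk_def fst_conv snd_conv)
    finally show ?thesis .
  qed
  finally have w: "?w = (\<Sum>i\<in>{1..t d}. Gk k d i j *s e d i 0)" .
  have "k \<rhd> e d j l = (\<Sum>i\<in>{1..t d}. Gk k d i j *s (Xh ^ l \<rhd> e d i 0))"
    unfolding us.commutant_e[OF kX d, of l] by (subst w) (simp only: app_sum_right app_smult)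
  also have "\<dots> = (\<Sum>i\<in>{1..t d}. Gk k d i j *s e d i l)"
    by (intro sum.cong refl) (simp add: us.Xpow_e d(1))
  finally show ?thesis .
qed

lemma Stab_herm:
  assumes k: "k \<in> Stab" and d: "d \<in> D" "i \<in> {1..t d}" "j \<in> {1..t d}" "l < d"
  shows "herm (e d i l) (k \<rhd> e d j l) = Gk k d i j"
proof -
  have "herm (e d i l) (k \<rhd> e d j l) = (\<Sum>m\<in>{1..t d}. if i = m then Gk k d m j else 0)"
    unfolding Stab_e[OF k d(1,3)] herm_linear
    by (intro sum.cong refl) (simp add: us.herm_e[OF d(1,2,4) d(1) _ d(4)])
  then show ?thesis using d(2) by simp
qed

lemma Stab_vcnj: "k \<in> Stab \<Longrightarrow> vcnj (k \<rhd> x) = k \<rhd> vcnj x"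
  using SOr_D(2)[of k] by (simp add: vcnj_app)

text \<open>Conjugation exchanges the bottom of the string j with the top of the string
  \<open>st d j\<close>, up to sign, and k commutes with conjugation and has the same matrix at the
  top as at the bottom.\<close>

lemma realG_Gk: assumes k: "k \<in> Stab" shows "realG (Gk k)"
  unfolding realG_def
proof (intro ballI)
  fix d i j assume d: "d \<in> D" "i \<in> {1..t d}" "j \<in> {1..t d}"
  have d0: "0 < d" "d - 1 < d" using D_pos(1)[OF d(1)] by auto
  have ve: "e d (st d i) (d - 1) = sg d i *\<^sub>R vcnj (e d i 0)" if "i \<in> {1..t d}" for i
    unfolding us.vcnj_e[OF d(1) that d0(1)] by (simp add: s_def sg_sq)
  have "Gk k d (st d i) (st d j) = herm (e d (st d i) (d - 1)) (k \<rhd> e d (st d j) (d - 1))"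
    by (rule Stab_herm[OF k d(1) st_in(1)[OF d(1,2)] st_in(1)[OF d(1,3)] d0(2), symmetric])
  also have "\<dots> = herm (sg d i *\<^sub>R vcnj (e d i 0)) (sg d j *\<^sub>R vcnj (k \<rhd> e d j 0))"
    unfolding ve[OF d(2)] ve[OF d(3)] Stab_vcnj[OF k] scaleR_eq_smult app_smult ..
  also have "\<dots> = complex_of_real (sg d i * sg d j) * cnj (Gk k d i j)"
    unfolding herm_linear herm_cnj(2) Gk_def by simp
  finally show "Gk k d (st d i) (st d j) = complex_of_real (sg d i * sg d j) * cnj (Gk k d i j)" .
qed

lemma Stab_unitary:
  assumes k: "k \<in> Stab" and d: "d \<in> D" "i \<in> {1..t d}" "j \<in> {1..t d}"
  shows "(\<Sum>l\<in>{1..t d}. cnj (Gk k d l i) * Gk k d l j) = (if i = j then 1 else 0)"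
proof -
  have d0: "0 < d" using D_pos(1)[OF d(1)] .
  have "herm (k \<rhd> e d i 0) (k \<rhd> e d j 0) = herm (e d i 0) (e d j 0)"
    using k unfolding herm_bil Stab_vcnj[OF k] bil_app app_simps(1)[symmetric] by (simp add: SO_D SOr_D del: app_simps(1))
  also have "\<dots> = (if i = j then 1 else 0)" using us.herm_e[OF d(1,2) d0 d(1,3) d0] by simp
  finally have 1: "herm (k \<rhd> e d i 0) (k \<rhd> e d j 0) = (if i = j then 1 else 0)" .
  have kj: "k \<rhd> e d j 0 = (\<Sum>l\<in>{1..t d}. Gk k d l j *s e d l 0)" by (rule Stab_e[OF k d(1,3)])
  have "herm (k \<rhd> e d i 0) (k \<rhd> e d j 0) = herm (k \<rhd> e d i 0) (\<Sum>l\<in>{1..t d}. Gk k d l j *s e d l 0)"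
    by (rule arg_cong[OF kj])
  also have "\<dots> = (\<Sum>l\<in>{1..t d}. Gk k d l j * herm (k \<rhd> e d i 0) (e d l 0))"
    by (simp only: herm_linear)
  also have "\<dots> = (\<Sum>l\<in>{1..t d}. cnj (Gk k d l i) * Gk k d l j)"
    by (intro sum.cong refl) (simp add: Gk_def herm_cnj(1) mult.commute)
  finally show ?thesis using 1 by simp
qed

lemma Stab_acts:
  assumes k: "k \<in> Stab" shows "acts (mat_of (Bm * k * tr Bm)) (Gk k)"
  unfolding acts_def
proof (intro ballI allI impI)
  fix d j l assume d: "d \<in> D" "j \<in> {1..t d}"
  have "mat_of (Bm * k * tr Bm) *v b d j l = Bm \<rhd> k \<rhd> e d j l" by (simp add: app.rep_eq[symmetric] e_def)
  also have "\<dots> = (\<Sum>i\<in>{1..t d}. Gk k d i j *s (Bm \<rhd> e d i l))"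
    unfolding Stab_e[OF k d] by (simp only: app_sum_right app_smult)
  also have "\<dots> = (\<Sum>i\<in>{1..t d}. Gk k d i j *s b d i l)" by (simp only: e_def Bm_tr_app)
  finally show "mat_of (Bm * k * tr Bm) *v b d j l = (\<Sum>i\<in>{1..t d}. Gk k d i j *s b d i l)" .
qed

text \<open>Reads off the left half of the matrix of k only; by \<open>realG_Gk\<close> it
  determines the right half (\<open>Gm_AkCk\<close>). The sign in the last coordinate undoes the one
  in \<open>qQ\<close>.\<close>

definition Ak :: "'n cmat \<Rightarrow> nat \<Rightarrow> quat mat" where
  "Ak k d = (let m = t d div 2 in Matrix.mat m m (\<lambda>(i, j).
    let p = Gk k d (Suc i) (Suc j); q = Gk k d (Suc (m + i)) (Suc j) in Quat (Re p) (Im p) (Re q) (- Im q)))"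

definition Ck :: "'n cmat \<Rightarrow> nat \<Rightarrow> real mat" where
  "Ck k d = Matrix.mat (t d) (t d) (\<lambda>(i, j). Re (Gk k d (Suc i) (Suc j)))"

lemma dims_AkCk: "dims (Ak k) (Ck k)" by (simp add: dims_def Ak_def Ck_def Let_def)

lemma Gm_AkCk:
  assumes k: "k \<in> Stab" and d: "d \<in> D" "i \<in> {1..t d}" "j \<in> {1..t d}"
  shows "Gm (Ak k) (Ck k) d i j = Gk k d i j"
proof -
  note st = st_in[OF d(1,2)] st_in[OF d(1,3)]
  have R: "Gk k d i j = complex_of_real (sg d (st d i) * sg d (st d j)) * cnj (Gk k d (st d i) (st d j))"
    using realG_Gk[OF k, unfolded realG_def, rule_format, OF d(1) st(1,3)] unfolding st(2,4) .
  show ?thesis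
  proof (cases "even d")
    case True
    let ?m = "t d div 2"
    have A: "Ak k d \<in> carrier_mat ?m ?m" by (simp add: Ak_def Let_def)
    note w = wp_H_entry[OF A]
    have a: "qP (Ak k d $$ (i', j')) = Gk k d (Suc i') (Suc j')" "qQ (Ak k d $$ (i', j')) = Gk k d (Suc (?m + i')) (Suc j')"
      if "i' < ?m" "j' < ?m" for i' j' using that by (simp_all add: Ak_def Let_def qP_def qQ_def)
    show ?thesis
    proof (rule even_index_cases[OF d(1) True d(2)]; rule even_index_cases[OF d(1) True d(3)])
      fix i' j' assume "i' < ?m" "i = Suc i'" "j' < ?m" "j = Suc j'"
      then show ?thesis by (simp add: Gm_def True w a)
    next
      fix i' j' assume *: "i' < ?m" "i = Suc i'" "st d i = Suc (?m + i')" "j' < ?m" "j = Suc (?m + j')" "st d j = Suc j'"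
      have sg: "sg d (Suc (?m + i')) = -1" "sg d (Suc j') = 1" using * True by (simp_all add: sg_def)
      have "Gm (Ak k) (Ck k) d i j = - cnj (Gk k d (Suc (?m + i')) (Suc j'))" using * by (simp add: Gm_def True w a)
      also have "\<dots> = Gk k d i j" unfolding R unfolding *(3,6) sg by simp
      finally show ?thesis .
    next
      fix i' j' assume "i' < ?m" "i = Suc (?m + i')" "j' < ?m" "j = Suc j'"
      then show ?thesis by (simp add: Gm_def True w a)
    next
      fix i' j' assume *: "i' < ?m" "i = Suc (?m + i')" "st d i = Suc i'" "j' < ?m" "j = Suc (?m + j')" "st d j = Suc j'"
      have sg: "sg d (Suc i') = 1" "sg d (Suc j') = 1" using * True by (simp_all add: sg_def)
      have "Gm (Ak k) (Ck k) d i j = cnj (Gk k d (Suc i') (Suc j'))" using * by (simp add: Gm_def True w a)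
      also have "\<dots> = Gk k d i j" unfolding R unfolding *(3,6) sg by simp
      finally show ?thesis .
    qed
  next
    case False
    then have "Gk k d i j = cnj (Gk k d i j)" using R by (simp add: st_def sg_def)
    then have re: "complex_of_real (Re (Gk k d i j)) = Gk k d i j" by (simp add: complex_eq_iff)
    have "i - 1 < t d" "j - 1 < t d" "Suc (i - 1) = i" "Suc (j - 1) = j" using d by auto
    then have "Ck k d $$ (i - 1, j - 1) = Re (Gk k d i j)" by (simp add: Ck_def del: One_nat_def)
    then show ?thesis using False re by (simp add: Gm_def)
  qed
qed

lemma adm_AkCk: assumes k: "k \<in> Stab" shows "adm (Ak k) (Ck k)"
  unfolding adm_def
proof (intro conjI ballI)
  have un: "(\<Sum>l<t d. cnj (Gm (Ak k) (Ck k) d (Suc l) (Suc i)) * Gm (Ak k) (Ck k) d (Suc l) (Suc j)) = (if i = j then 1 else 0)"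
    if d: "d \<in> D" "i < t d" "j < t d" for d i j
  proof -
    have ij: "Suc i \<in> {1..t d}" "Suc j \<in> {1..t d}" using d by auto
    have "(\<Sum>l<t d. cnj (Gm (Ak k) (Ck k) d (Suc l) (Suc i)) * Gm (Ak k) (Ck k) d (Suc l) (Suc j)) =
        (\<Sum>l\<in>{1..t d}. cnj (Gk k d l (Suc i)) * Gk k d l (Suc j))"
      unfolding sum_Suc_shift by (intro sum.cong refl) (simp add: Gm_AkCk[OF k d(1) _ ij(1)] Gm_AkCk[OF k d(1) _ ij(2)])
    then show ?thesis unfolding Stab_unitary[OF k d(1) ij] by simp
  qed
  show "Ak k \<eta> \<in> Sp (t \<eta> div 2)" if "\<eta> \<in> even_parts X H Y" for \<eta>
  proof -
    note ev = even_partsD[OF that]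
    have t: "2 * (t \<eta> div 2) = t \<eta>" using t_even[OF ev] by simp
    have "unitary_mat (t \<eta>) (wp_H (Ak k \<eta>))"
      using wp_H_dim[where A = "Ak k" and d = \<eta>, OF dims_AkCk ev] un[OF ev(1)] ev(2) by (simp add: unitary_mat_def Gm_def)
    then show ?thesis unfolding Sp_iff t by (simp add: Ak_def Let_def)
  qed
  show "Ck k \<theta> \<in> Orth (t \<theta>)" if "\<theta> \<in> odd_parts X H Y" for \<theta>
    unfolding Orth_iff
  proof (intro conjI allI impI)
    note od = odd_partsD[OF that]
    show "Ck k \<theta> \<in> carrier_mat (t \<theta>) (t \<theta>)" by (simp add: Ck_def)
    fix i j assume ij: "i < t \<theta>" "j < t \<theta>"
    have "complex_of_real (\<Sum>l<t \<theta>. Ck k \<theta> $$ (l, i) * Ck k \<theta> $$ (l, j)) = complex_of_real (if i = j then 1 else 0)"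
      using un[OF od(1) ij] od(2) by (simp add: Gm_def)
    then show "(\<Sum>l<t \<theta>. Ck k \<theta> $$ (l, i) * Ck k \<theta> $$ (l, j)) = (if i = j then 1 else 0)" by (simp only: of_real_eq_iff)
  qed
qed

lemma Stab_sub: "toJ ` Stab \<subseteq> Lambda_H X H Y v ` K_group X H Y v"
proof clarify
  fix k :: "'n cmat" assume "k \<in> SOr" "k * Xh = Xh * k"
  then have k: "k \<in> Stab" by simp
  define g where "g = mat_of (Bm * k * tr Bm)"
  have gk: "tr Bm * Cmat g * Bm = k" by (simp add: g_def mat_of_inverse mult.assoc Bm_cancel)
  have ag: "acts g (Gk k)" unfolding g_def by (rule Stab_acts[OF k])
  have "acts g (Gm (Ak k) (Ck k))" unfolding acts_def
  proof (intro ballI allI impI)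
    fix d j l assume d: "d \<in> D" "j \<in> {1..t d}" "l < d"
    have "g *v b d j l = (\<Sum>i\<in>{1..t d}. Gk k d i j *s b d i l)" using ag d by (simp add: acts_def)
    also have "\<dots> = (\<Sum>i\<in>{1..t d}. Gm (Ak k) (Ck k) d i j *s b d i l)"
      by (intro sum.cong refl) (simp add: Gm_AkCk[OF k d(1) _ d(2)])
    finally show "g *v b d j l = (\<Sum>i\<in>{1..t d}. Gm (Ak k) (Ck k) d i j *s b d i l)" .
  qed
  then have BF: "BF g (bm (Ak k) (Ck k))" using BF_iff_acts[OF dims_AkCk] by simp
  have gSO: "Cmat g \<in> SO" unfolding g_def mat_of_inverse using k by (intro SO_Bm SOr_D(1)) simp
  have Adg: "Ad g A = A" if "\<And>x. g *v (A *v x) = A *v (g *v x)" for A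
  proof -
    have "Cmat (Ad g A) = Cmat A"
      using Cmat_commute[OF that] unfolding Cmat_Ad[OF gSO[folded SO_C_SO]] conj_act_eq_iff[OF gSO] .
    then show ?thesis by (simp add: Cmat_inject)
  qed
  have "g \<in> centralizer X H Y"
    unfolding centralizer_def using gSO Adg acts_commute[OF ag] by (simp add: SO_C_SO)
  then have "g \<in> K_group X H Y v" unfolding K_iff using adm_AkCk[OF k] BF by blast
  moreover have "toJ k = Lambda_H X H Y v g" unfolding toJ_conj_Bm[symmetric] gk ..
  ultimately show "toJ k \<in> Lambda_H X H Y v ` K_group X H Y v" by blast
qed

lemma Lambda_K:
  "Lambda_H X H Y v ` K_group X H Y v = {map_mat complex_of_real (D_SO X H Y g) | g. g \<in> D_domain X H Y}"
  "Lambda_H X H Y v ` K_group X H Y v = toJ ` Stab"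
  using Lambda_K_sub D_SO_sub Stab_sub by auto

lemma orbit_homotopy_equivalent:
  "top_of_set (adjoint_orbit X) homotopy_equivalent_space
    coset_space CARD('n) (SOn CARD('n)) (Lambda_H X H Y v ` K_group X H Y v)"
proof -
  have "top_of_set (adjoint_orbit X) homotopy_equivalent_space top_of_set ((\<lambda>g. conj_act g Xh) ` SO)"
    unfolding Xh_def by (intro homeomorphic_imp_homotopy_equivalent_space adjoint_orbit_homeomorphic tr_Bm)
  also have "top_of_set ((\<lambda>g. conj_act g Xh) ` SO) homotopy_equivalent_space top_of_set ((\<lambda>g. conj_act g Xh) ` SOr)"
    by (rule us.orbit_deformation)
  also have "top_of_set ((\<lambda>g. conj_act g Xh) ` SOr) homotopy_equivalent_space
      coset_space CARD('n) (SOn CARD('n)) (Lambda_H X H Y v ` K_group X H Y v)"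
    unfolding Lambda_K(2) homotopy_equivalent_space_sym[of "top_of_set ((\<lambda>g. conj_act g Xh) ` SOr)"]
    by (intro homeomorphic_imp_homotopy_equivalent_space coset_space_homeomorphic_orbit)
  finally show ?thesis .
qed

end

theorem theorem3p13:
  fixes X H Y :: "complex^'n^'n" and v :: "nat \<Rightarrow> nat \<Rightarrow> complex^'n"
  assumes "CARD('n) \<ge> 5"
    and "X \<in> so_C" and "X \<noteq> 0" and "nilpotent_mat X"
    and "H \<in> so_C" and "Y \<in> so_C" and "sl2_triple X H Y"
    and "adapted_bases X H Y v"
  shows "Lambda_H X H Y v ` K_group X H Y v \<subseteq> SOn CARD('n) \<and>
    Lambda_H X H Y v ` K_group X H Y v =
      {map_mat complex_of_real (D_SO X H Y g) | g. g \<in> D_domain X H Y} \<and>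
    top_of_set (adjoint_orbit X) homotopy_equivalent_space
      coset_space CARD('n) (SOn CARD('n)) (Lambda_H X H Y v ` K_group X H Y v)"
proof -
  interpret adapted X H Y v using assms by unfold_locales
  have "Lambda_H X H Y v ` K_group X H Y v \<subseteq> SOn CARD('n)"
    unfolding Lambda_K(2) toJ_SOr[where 'n = 'n, symmetric] by auto
  then show ?thesis using Lambda_K(1) orbit_homotopy_equivalent by blast
qed

end
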